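(* Let $\rho,EI\in C^4[0,1]$ be strictly positive, let $m,J>0$ and $b>0$. Consider the wind turbine tower model with torque feedback only, $$\rho(x)w_{tt}=-(EI\,w_{xx})_{xx}\ \text{on }(0,1)\times[0,\infty),\quad w(0,t)=w_x(0,t)=0,$$ $$m w_{tt}(1,t)-(EIw_{xx})_x(1,t)=0,\qquad J w_{xtt}(1,t)+EI(1)w_{xx}(1,t)=-b w_{xt}(1,t),$$ formulated as $\dot z=Az$ on $X$ (see context). Then for every $z_0\in X$ the energy $E(t)=\frac12\|T(t)z_0\|_X^2$ satisfies $E(t)\to 0$ as $t\to\infty$, and for every $z_0\in D(A)$ (classical solutions) $E(t)=o(t^{-1})$ as $t\to\infty$.
   Context: $H^2_l(0,1)=\{f\in H^2(0,1): f(0)=f'(0)=0\}$. The state space is $X=H^2_l(0,1)\times L^2(0,1)\times\mathbb{C}^2$ with norm $\|(f,g,\xi,\eta)\|_X^2=\int_0^1[EI|f''|^2+\rho|g|^2]dx+m|\xi|^2+J|\eta|^2$; the state is $z(t)=(w(\cdot,t),w_t(\cdot,t),w_t(1,t),w_{xt}(1,t))$. The operator is $A(f,g,\xi,\eta)=\bigl(g,\,-\tfrac1\rho(EIf'')'',\,\tfrac1m(EIf'')'(1),\,\tfrac1J[-(EIf'')(1)-b\eta]\bigr)$ with $D(A)=\{(f,g,\xi,\eta)\in(H^4(0,1)\cap H^2_l(0,1))\times H^2_l(0,1)\times\mathbb{C}^2:\ \xi=g(1),\ \eta=g'(1)\}$; $A$ generates a $C_0$-semigroup $(T(t))_{t\ge0}$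 on $X$ and solutions are $z(t)=T(t)z_0$; $E(t)$ is the physical energy of the solution. *)

theory Defs
  imports "HOL-Analysis.Analysis" "HOL-Library.Landau_Symbols"
begin

fun Ck_on :: "nat \<Rightarrow> real set \<Rightarrow> (real \<Rightarrow> real) \<Rightarrow> bool" where
  "Ck_on 0 S f \<longleftrightarrow> continuous_on S f"
| "Ck_on (Suc k) S f \<longleftrightarrow> (\<exists>f'. (\<forall>x\<in>S. (f has_real_derivative f' x) (at x within S)) \<and> Ck_on k S f')"

definition sq_int :: "(real \<Rightarrow> complex) \<Rightarrow> bool" where
  "sq_int f \<longleftrightarrow> f measurable_on {0..1} \<and> (\<lambda>x. (cmod (f x))^2) integrable_on {0..1}"

text \<open>f is in H^2(0,1) with (continuous) first derivative f1 and weak second derivative f2 (in L^2).\<close>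
definition H2chain :: "(real \<Rightarrow> complex) \<Rightarrow> (real \<Rightarrow> complex) \<Rightarrow> (real \<Rightarrow> complex) \<Rightarrow> bool" where
  "H2chain f f1 f2 \<longleftrightarrow> sq_int f2 \<and>
     (\<forall>x\<in>{0..1}. f1 x = f1 0 + integral {0..x} f2 \<and> f x = f 0 + integral {0..x} f1)"

definition H4chain :: "(real \<Rightarrow> complex) \<Rightarrow> (real \<Rightarrow> complex) \<Rightarrow> (real \<Rightarrow> complex)
     \<Rightarrow> (real \<Rightarrow> complex) \<Rightarrow> (real \<Rightarrow> complex) \<Rightarrow> bool" where
  "H4chain f f1 f2 f3 f4 \<longleftrightarrow> sq_int f4 \<and>
     (\<forall>x\<in>{0..1}. f3 x = f3 0 + integral {0..x} f4 \<and> f2 x = f2 0 + integral {0..x} f3 \<and>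
                  f1 x = f1 0 + integral {0..x} f2 \<and> f x = f 0 + integral {0..x} f1)"

definition H2l :: "(real \<Rightarrow> complex) \<Rightarrow> bool" where
  "H2l f \<longleftrightarrow> (\<exists>f1 f2. H2chain f f1 f2 \<and> f 0 = 0 \<and> f1 0 = 0)"

text \<open>A (weak) second derivative of an H^2 function (unique a.e.).\<close>
definition D2 :: "(real \<Rightarrow> complex) \<Rightarrow> real \<Rightarrow> complex" where
  "D2 f = (SOME f2. \<exists>f1. H2chain f f1 f2)"

type_synonym state = "(real \<Rightarrow> complex) \<times> (real \<Rightarrow> complex) \<times> complex \<times> complex"

text \<open>The state space X (elements represented by representatives).\<close>
definition Xspace :: "state set" where
  "Xspace = {(f, g, \<xi>, \<eta>). H2l f \<and> sq_int g}"

definition Xnormsq :: "(real \<Rightarrow> real) \<Rightarrow> (real \<Rightarrow> real) \<Rightarrow> real \<Rightarrow> real \<Rightarrow> state \<Rightarrow> real" where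
  "Xnormsq \<rho> EI m J z = (case z of (f, g, \<xi>, \<eta>) \<Rightarrow>
      integral {0..1} (\<lambda>x. EI x * (cmod (D2 f x))^2 + \<rho> x * (cmod (g x))^2)
      + m * (cmod \<xi>)^2 + J * (cmod \<eta>)^2)"

definition xadd :: "state \<Rightarrow> state \<Rightarrow> state" where
  "xadd z w = (case z of (f, g, \<xi>, \<eta>) \<Rightarrow> case w of (f', g', \<xi>', \<eta>') \<Rightarrow>
      ((\<lambda>x. f x + f' x), (\<lambda>x. g x + g' x), \<xi> + \<xi>', \<eta> + \<eta>'))"

definition xscale :: "complex \<Rightarrow> state \<Rightarrow> state" where
  "xscale c z = (case z of (f, g, \<xi>, \<eta>) \<Rightarrow> ((\<lambda>x. c * f x), (\<lambda>x. c * g x), c * \<xi>, c * \<eta>))"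

definition xdiff :: "state \<Rightarrow> state \<Rightarrow> state" where
  "xdiff z w = xadd z (xscale (-1) w)"

text \<open>Equality in X (i.e. of equivalence classes).\<close>
definition xeq :: "(real \<Rightarrow> real) \<Rightarrow> (real \<Rightarrow> real) \<Rightarrow> real \<Rightarrow> real \<Rightarrow> state \<Rightarrow> state \<Rightarrow> bool" where
  "xeq \<rho> EI m J z w \<longleftrightarrow> Xnormsq \<rho> EI m J (xdiff z w) = 0"

text \<open>Graph of the operator A on representatives: Arel z w means z \<in> D(A) and w = A z.\<close>
definition Arel :: "(real \<Rightarrow> real) \<Rightarrow> (real \<Rightarrow> real) \<Rightarrow> real \<Rightarrow> real \<Rightarrow> real \<Rightarrow> state \<Rightarrow> state \<Rightarrow> bool" where
  "Arel \<rho> EI m J b z w \<longleftrightarrow> (case z of (f, g, \<xi>, \<eta>) \<Rightarrow> case w of (u, v, \<alpha>, \<beta>) \<Rightarrow>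
     (\<exists>f1 f2 f3 f4 g1 g2 h1 h2.
        H4chain f f1 f2 f3 f4 \<and> f 0 = 0 \<and> f1 0 = 0 \<and>
        H2chain g g1 g2 \<and> g 0 = 0 \<and> g1 0 = 0 \<and>
        \<xi> = g 1 \<and> \<eta> = g1 1 \<and>
        H2chain (\<lambda>x. complex_of_real (EI x) * f2 x) h1 h2 \<and>
        u = g \<and>
        (\<forall>x\<in>{0..1}. v x = - h2 x / complex_of_real (\<rho> x)) \<and>
        \<alpha> = h1 1 / complex_of_real m \<and>
        \<beta> = (- (complex_of_real (EI 1) * f2 1) - complex_of_real b * \<eta>) / complex_of_real J))"

definition DA :: "(real \<Rightarrow> real) \<Rightarrow> (real \<Rightarrow> real) \<Rightarrow> real \<Rightarrow> real \<Rightarrow> real \<Rightarrow> state set" where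
  "DA \<rho> EI m J b = {z. \<exists>w. Arel \<rho> EI m J b z w}"

definition Agraph :: "(real \<Rightarrow> real) \<Rightarrow> (real \<Rightarrow> real) \<Rightarrow> real \<Rightarrow> real \<Rightarrow> real \<Rightarrow> state \<Rightarrow> state \<Rightarrow> bool" where
  "Agraph \<rho> EI m J b z w \<longleftrightarrow>
     (\<exists>z' w'. xeq \<rho> EI m J z z' \<and> xeq \<rho> EI m J w w' \<and> Arel \<rho> EI m J b z' w')"

text \<open>T is a C_0-semigroup on X (acting on representatives, well defined on classes).\<close>
definition C0_semigroup :: "(real \<Rightarrow> real) \<Rightarrow> (real \<Rightarrow> real) \<Rightarrow> real \<Rightarrow> real \<Rightarrow> (real \<Rightarrow> state \<Rightarrow> state) \<Rightarrow> bool" where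
  "C0_semigroup \<rho> EI m J T \<longleftrightarrow>
     (\<forall>t\<ge>0. \<forall>z\<in>Xspace. T t z \<in> Xspace) \<and>
     (\<forall>t\<ge>0. \<forall>z\<in>Xspace. \<forall>z'\<in>Xspace. \<forall>a c.
        xeq \<rho> EI m J (T t (xadd (xscale a z) (xscale c z'))) (xadd (xscale a (T t z)) (xscale c (T t z')))) \<and>
     (\<forall>t\<ge>0. \<exists>C. \<forall>z\<in>Xspace. Xnormsq \<rho> EI m J (T t z) \<le> C * Xnormsq \<rho> EI m J z) \<and>
     (\<forall>z\<in>Xspace. xeq \<rho> EI m J (T 0 z) z) \<and>
     (\<forall>t\<ge>0. \<forall>s\<ge>0. \<forall>z\<in>Xspace. xeq \<rho> EI m J (T (t + s) z) (T t (T s z))) \<and>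
     (\<forall>z\<in>Xspace. ((\<lambda>t. Xnormsq \<rho> EI m J (xdiff (T t z) z)) \<longlongrightarrow> 0) (at_right 0))"

definition generated_by_A :: "(real \<Rightarrow> real) \<Rightarrow> (real \<Rightarrow> real) \<Rightarrow> real \<Rightarrow> real \<Rightarrow> real \<Rightarrow> (real \<Rightarrow> state \<Rightarrow> state) \<Rightarrow> bool" where
  "generated_by_A \<rho> EI m J b T \<longleftrightarrow> C0_semigroup \<rho> EI m J T \<and>
     (\<forall>z\<in>Xspace. \<forall>w\<in>Xspace.
        ((\<lambda>h. Xnormsq \<rho> EI m J (xdiff (xscale (complex_of_real (1 / h)) (xdiff (T h z) z)) w)) \<longlongrightarrow> 0) (at_right 0)
        \<longleftrightarrow> Agraph \<rho> EI m J b z w)"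

definition energy :: "(real \<Rightarrow> real) \<Rightarrow> (real \<Rightarrow> real) \<Rightarrow> real \<Rightarrow> real \<Rightarrow> (real \<Rightarrow> state \<Rightarrow> state) \<Rightarrow> state \<Rightarrow> real \<Rightarrow> real" where
  "energy \<rho> EI m J T z0 t = Xnormsq \<rho> EI m J (T t z0) / 2"

end

theory Submission
  imports Defs "HOL-Library.Function_Algebras"
begin

text \<open>
  For a classical solution the energy \<open>e\<close> is nonincreasing, so it suffices to show that its integral
  over the half line is finite. Call \<open>p\<close> negligible if for every \<open>\<epsilon> > 0\<close> its integral over \<open>{0..t}\<close> is
  at most \<open>\<epsilon>\<close> times that of \<open>e\<close> plus a constant. Dissipation makes \<open>\<eta>\<close>, its derivative, and hence the
  moment \<open>M\<close> at the tip negligible, and a test function multiplier gives the same for the slope \<open>a\<close> at the tip.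

  The tip displacement \<open>c\<close> is recovered without spectral theory. With \<open>y\<^sub>n\<close> the solution of
  \<open>(EI y\<^sub>n'')'' = \<theta>\<^sub>n\<close> with zero data at \<open>0\<close> and \<open>\<theta>\<^sub>n\<^sub>+\<^sub>1 = \<rho> y\<^sub>n\<close>, the moments \<open>r\<^sub>n\<close> of \<open>w\<close> against
  \<open>\<theta>\<^sub>n\<close> satisfy \<open>r\<^sub>n + r\<^sub>n\<^sub>+\<^sub>1'' = k\<^sub>n + s\<^sub>n c - \<mu>\<^sub>n c''\<close> with \<open>k\<^sub>n\<close> negligible and \<open>s\<^sub>n, \<mu>\<^sub>n \<ge> 0\<close>.
  Applying a moving average sufficiently often turns each time derivative into a difference quotient and
  makes the remainder of the iterated recursion small, because \<open>\<theta>\<^sub>n\<close> decays like \<open>L^n / (4n)!\<close>; by the signs of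
  \<open>s\<^sub>n\<close> and \<open>\<mu>\<^sub>n\<close> the starting value \<open>r\<^sub>0 = 0\<close>, \<open>s\<^sub>0 = 1\<close> forces \<open>c\<close> to be negligible, and then so is every
  moment of \<open>w\<close>. All the boundary terms of the classical multiplier \<open>(exp (l x) - 1) w\<^sub>x\<close> are then
  negligible, which bounds the integral of \<open>e\<close>. Density of \<open>D(A)\<close> and contractivity extend the decay to all states.
\<close>

section \<open>The space of square integrable functions on the unit interval\<close>

text \<open>What drives the scheme is a count of orders. A classical trajectory is only C^1 in X, so
  eliminating the moments recursively would call for time derivatives that need not exist; pairs of
  derivatives are therefore replaced by difference quotients of averaged signals. With a total
  averaging time \<tau> and 2N averages the step is \<open>\<tau> / (2 * N)\<close>, and N steps of
  the recursion cost a factor of order \<open>(N / \<tau>)^(2 * N)\<close> up to geometric factors.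
  Each step also integrates four times in space, which gains about \<open>1 / (4 * N)!\<close> in
  all and wins for every fixed \<tau>: the beam is of order four in space but two in time. Hence
  \<tau> is chosen from the accuracy first and N afterwards. A second obstacle is the moment at the
  tip. It contains the derivative of \<eta>, the last component of \<open>T t (A z)\<close>, and for
  z in D(A) the state A z is merely in X. So the square integrability of the observation has to be
  known for all mild solutions, before any decay.\<close>

abbreviation I01 :: "real measure" where "I01 \<equiv> lebesgue_on {0..1}"

definition l2sq :: "(real \<Rightarrow> complex) \<Rightarrow> real" where
  "l2sq f = (LINT x|I01. (cmod (f x))^2)"

lemma sets_I01 [simp]: "{0..1::real} \<in> sets lebesgue"
  by simp

lemma measure_I01 [simp]: "measure I01 {0..1} = 1"
  by (simp add: measure_restrict_space)

lemma measurable_I01_cont: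
  fixes f :: "real \<Rightarrow> 'a::real_normed_vector"
  shows "continuous_on {0..1} f \<Longrightarrow> f \<in> borel_measurable I01"
  by (rule continuous_imp_measurable_on_sets_lebesgue) auto

lemma integrable_I01_cont:
  fixes f :: "real \<Rightarrow> 'a::euclidean_space"
  shows "continuous_on {0..1} f \<Longrightarrow> integrable I01 f"
  by (rule continuous_imp_integrable_real)

text \<open>For nonnegative integrands Henstock-Kurzweil and absolute integrability coincide, so the
  gauge-integral definition can be exchanged for the Bochner one, where dominated convergence and
  almost-everywhere arguments are at hand.\<close>

lemma sq_int_iff:
  "sq_int f \<longleftrightarrow> f \<in> borel_measurable I01 \<and> integrable I01 (\<lambda>x. (cmod (f x))^2)"
proof -
  have "integrable I01 (\<lambda>x. (cmod (f x))^2) \<longleftrightarrow> (\<lambda>x. (cmod (f x))^2) integrable_on {0..1}"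
    using integrable_on_lebesgue_on[of "{0..1}" "\<lambda>x. (cmod (f x))^2"]
      nonnegative_absolutely_integrable_1[of "\<lambda>x. (cmod (f x))^2" "{0..1}"]
      absolutely_integrable_imp_integrable[of "{0..1}" "\<lambda>x. (cmod (f x))^2"] by auto
  then show ?thesis
    unfolding sq_int_def by (simp add: measurable_on_iff_borel_measurable)
qed

lemma sq_int_meas: "sq_int f \<Longrightarrow> f \<in> borel_measurable I01"
  by (simp add: sq_int_iff)

lemma sq_int_sq: "sq_int f \<Longrightarrow> integrable I01 (\<lambda>x. (cmod (f x))^2)"
  by (simp add: sq_int_iff)

lemma l2sq_HK: "sq_int f \<Longrightarrow> l2sq f = integral {0..1} (\<lambda>x. (cmod (f x))^2)"
  unfolding l2sq_def by (rule lebesgue_integral_eq_integral) (auto simp: sq_int_sq)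

lemma l2sq_nonneg [simp]: "l2sq f \<ge> 0"
  unfolding l2sq_def by (rule integral_nonneg_AE) auto

lemma sq_int_cont: "continuous_on {0..1} f \<Longrightarrow> sq_int f"
  unfolding sq_int_iff by (intro conjI measurable_I01_cont integrable_I01_cont continuous_intros)

lemma sq_int_mult:
  assumes "sq_int f" "sq_int g"
  shows "integrable I01 (\<lambda>x. f x * g x)"
proof (rule Bochner_Integration.integrable_bound)
  show "integrable I01 (\<lambda>x. (cmod (f x))^2 + (cmod (g x))^2)"
    using assms by (simp add: sq_int_sq)
  show "(\<lambda>x. f x * g x) \<in> borel_measurable I01"
    by (intro borel_measurable_times sq_int_meas assms)
  have "cmod (f x * g x) \<le> cmod (f x) ^ 2 + cmod (g x) ^ 2" for x
    using sum_squares_bound[of "cmod (f x)" "cmod (g x)"]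
      mult_nonneg_nonneg[OF norm_ge_zero norm_ge_zero, of "f x" "g x"]
    unfolding norm_mult power2_eq_square by linarith
  then show "AE x in I01. norm (f x * g x) \<le> norm ((cmod (f x))^2 + (cmod (g x))^2)"
    by auto
qed

lemma sq_int_bdd_mult:
  assumes f: "sq_int f" and u: "u \<in> borel_measurable I01"
    and B: "\<And>x. x \<in> {0..1} \<Longrightarrow> cmod (u x) \<le> B"
  shows "sq_int (\<lambda>x. u x * f x)" "l2sq (\<lambda>x. u x * f x) \<le> B^2 * l2sq f"
proof -
  have bd: "(cmod (u x * f x))^2 \<le> B^2 * (cmod (f x))^2" if "x \<in> {0..1}" for x
    unfolding norm_mult power_mult_distrib
    by (intro mult_right_mono power_mono B that) auto
  have i: "integrable I01 (\<lambda>x. (cmod (u x * f x))^2)"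
  proof (rule Bochner_Integration.integrable_bound)
    show "integrable I01 (\<lambda>x. B^2 * (cmod (f x))^2)"
      using f by (simp add: sq_int_sq)
    show "(\<lambda>x. (cmod (u x * f x))^2) \<in> borel_measurable I01"
      using sq_int_meas[OF f] u by measurable
    show "AE x in I01. norm ((cmod (u x * f x))^2) \<le> norm (B^2 * (cmod (f x))^2)"
      using bd by (intro AE_I2) (auto simp del: norm_mult)
  qed
  show "sq_int (\<lambda>x. u x * f x)"
    unfolding sq_int_iff using sq_int_meas[OF f] u i by simp
  have "l2sq (\<lambda>x. u x * f x) \<le> (LINT x|I01. B^2 * (cmod (f x))^2)"
    unfolding l2sq_def using i sq_int_sq[OF f] bd by (intro integral_mono) auto
  then show "l2sq (\<lambda>x. u x * f x) \<le> B^2 * l2sq f"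
    by (simp add: l2sq_def)
qed

lemma sq_int_cmult [intro]: "sq_int f \<Longrightarrow> sq_int (\<lambda>x. c * f x)"
  using sq_int_bdd_mult(1)[of f "\<lambda>_. c" "cmod c"] by simp

lemma sq_int_cont_mult:
  assumes "continuous_on {0..1} u" "sq_int f"
  shows "sq_int (\<lambda>x. u x * f x)"
proof -
  have "bounded (u ` {0..1})"
    by (rule compact_imp_bounded[OF compact_continuous_image[OF assms(1) compact_Icc]])
  then obtain B where "\<forall>x\<in>{0..1}. cmod (u x) \<le> B" by (auto simp: bounded_iff)
  then show ?thesis using sq_int_bdd_mult(1)[OF assms(2) measurable_I01_cont[OF assms(1)]] by blast
qed

lemma sq_int_add [intro]:
  assumes "sq_int f" "sq_int g"
  shows "sq_int (\<lambda>x. f x + g x)"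
  unfolding sq_int_iff
proof
  show m: "(\<lambda>x. f x + g x) \<in> borel_measurable I01"
    by (intro borel_measurable_add sq_int_meas assms)
  show "integrable I01 (\<lambda>x. (cmod (f x + g x))^2)"
  proof (rule Bochner_Integration.integrable_bound)
    show "integrable I01 (\<lambda>x. 2 * (cmod (f x))^2 + 2 * (cmod (g x))^2)"
      using assms by (simp add: sq_int_sq)
    show "(\<lambda>x. (cmod (f x + g x))^2) \<in> borel_measurable I01"
      using m by measurable
    have "(cmod (f x + g x))^2 \<le> 2 * (cmod (f x))^2 + 2 * (cmod (g x))^2" for x
    proof -
      have "(cmod (f x + g x))^2 \<le> (cmod (f x) + cmod (g x))^2"
        by (intro power_mono norm_triangle_ineq) auto
      also have "\<dots> \<le> 2 * (cmod (f x))^2 + 2 * (cmod (g x))^2"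
        using sum_squares_bound[of "cmod (f x)" "cmod (g x)"] by (simp add: power2_sum)
      finally show ?thesis .
    qed
    then show "AE x in I01. norm ((cmod (f x + g x))^2) \<le> norm (2 * (cmod (f x))^2 + 2 * (cmod (g x))^2)"
      by auto
  qed
qed

lemma sq_int_uminus [intro]: "sq_int f \<Longrightarrow> sq_int (\<lambda>x. - f x)"
  using sq_int_cmult[of f "-1"] by simp

lemma sq_int_diff [intro]: "sq_int f \<Longrightarrow> sq_int g \<Longrightarrow> sq_int (\<lambda>x. f x - g x)"
  using sq_int_add[of f "\<lambda>x. - g x"] by auto

lemma sq_int_sum:
  "(\<And>i. i \<in> A \<Longrightarrow> sq_int (f i)) \<Longrightarrow> sq_int (\<lambda>x. \<Sum>i\<in>A. f i x)"
  by (induction A rule: infinite_finite_induct) (auto intro: sq_int_cont)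

lemma sq_int_cnj [intro]: "sq_int f \<Longrightarrow> sq_int (\<lambda>x. cnj (f x))"
  unfolding sq_int_iff
  by (auto intro: borel_measurable_continuous_onI[THEN measurable_compose_rev] continuous_intros)

lemma sq_int_integrable: "sq_int f \<Longrightarrow> integrable I01 f"
  using sq_int_mult[of f "\<lambda>_. 1"] by (simp add: sq_int_cont)

lemma sq_int_cong:
  assumes "\<And>x. x \<in> {0..1} \<Longrightarrow> f x = g x" "sq_int f"
  shows "sq_int g"
proof -
  have "f \<in> borel_measurable I01 \<longleftrightarrow> g \<in> borel_measurable I01"
    using assms by (intro measurable_cong) simp
  moreover have "integrable I01 (\<lambda>x. (cmod (f x))^2) \<longleftrightarrow> integrable I01 (\<lambda>x. (cmod (g x))^2)"
    using assms by (intro Bochner_Integration.integrable_cong) auto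
  ultimately show ?thesis using assms(2) by (simp add: sq_int_iff)
qed

lemma quadratic_nonneg_imp:
  fixes a b c :: real
  assumes "\<And>t. a * t^2 + 2 * b * t + c \<ge> 0" "a \<ge> 0"
  shows "b^2 \<le> a * c"
proof (cases "a = 0")
  case True
  have "b = 0"
  proof (rule ccontr)
    assume "b \<noteq> 0"
    \<comment> \<open>At this t the remaining affine function takes the value -1.\<close>
    then show False using assms(1)[of "-(c+1)/(2*b)"] True by simp
  qed
  then show ?thesis using True by simp
next
  case False
  \<comment> \<open>Evaluation at the minimiser t = -b/a, multiplied by a.\<close>
  have "0 \<le> a * (a * (-b/a)^2 + 2 * b * (-b/a) + c)"
    by (intro mult_nonneg_nonneg assms)
  also have "\<dots> = a * c - b^2" using False by (simp add: field_simps power2_eq_square)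
  finally show ?thesis by simp
qed

section \<open>Cauchy-Schwarz and the triangle inequality in L2\<close>

lemma LINT_cauchy_schwarz:
  assumes f: "sq_int f" and g: "sq_int g"
  shows "(LINT x|I01. cmod (f x) * cmod (g x))^2 \<le> l2sq f * l2sq g"
proof (rule quadratic_nonneg_imp)
  fix t :: real
  have i: "integrable I01 (\<lambda>x. cmod (f x) * cmod (g x))"
    using integrable_norm[OF sq_int_mult[OF f g]] by (simp add: norm_mult)
  have "0 \<le> (LINT x|I01. (t * cmod (f x) + cmod (g x))^2)"
    by (rule integral_nonneg_AE) auto
  also have "\<dots> = (LINT x|I01. t^2 * (cmod (f x))^2 + 2 * t * (cmod (f x) * cmod (g x)) + (cmod (g x))^2)"
    by (intro Bochner_Integration.integral_cong) (auto simp: power2_eq_square algebra_simps)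
  also have "\<dots> = l2sq f * t^2 + 2 * (LINT x|I01. cmod (f x) * cmod (g x)) * t + l2sq g"
    unfolding l2sq_def using i sq_int_sq[OF f] sq_int_sq[OF g] by simp
  finally show "0 \<le> l2sq f * t^2 + 2 * (LINT x|I01. cmod (f x) * cmod (g x)) * t + l2sq g" .
qed simp

lemma LINT_mult_bound:
  assumes f: "sq_int f" and g: "sq_int g"
  shows "cmod (LINT x|I01. f x * g x) \<le> sqrt (l2sq f) * sqrt (l2sq g)"
proof -
  have "cmod (LINT x|I01. f x * g x) \<le> (LINT x|I01. cmod (f x) * cmod (g x))"
    using integral_norm_bound[of I01 "\<lambda>x. f x * g x"] by (simp add: norm_mult)
  also have "\<dots> \<le> sqrt ((LINT x|I01. cmod (f x) * cmod (g x))^2)"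
    by simp
  also have "\<dots> \<le> sqrt (l2sq f * l2sq g)"
    by (intro real_sqrt_le_mono LINT_cauchy_schwarz f g)
  finally show ?thesis by (simp add: real_sqrt_mult)
qed

lemma LINT_norm_bound:
  assumes f: "sq_int f"
  shows "(LINT x|I01. cmod (f x)) \<le> sqrt (l2sq f)"
proof -
  have "(LINT x|I01. cmod (f x) * cmod 1)^2 \<le> l2sq f * l2sq (\<lambda>_. 1)"
    by (rule LINT_cauchy_schwarz[OF f]) (simp add: sq_int_cont)
  then have "(LINT x|I01. cmod (f x))^2 \<le> l2sq f" by (simp add: l2sq_def)
  then show ?thesis by (simp add: real_le_rsqrt)
qed

lemma l2sq_add_le: 
  assumes f: "sq_int f" and g: "sq_int g"
  shows "sqrt (l2sq (\<lambda>x. f x + g x)) \<le> sqrt (l2sq f) + sqrt (l2sq g)"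
proof -
  have i: "integrable I01 (\<lambda>x. cmod (f x) * cmod (g x))"
    using integrable_norm[OF sq_int_mult[OF f g]] by (simp add: norm_mult)
  have "(cmod (f x + g x))^2 \<le> (cmod (f x))^2 + 2 * (cmod (f x) * cmod (g x)) + (cmod (g x))^2" for x
  proof -
    have "(cmod (f x + g x))^2 \<le> (cmod (f x) + cmod (g x))^2"
      by (intro power_mono norm_triangle_ineq) auto
    then show ?thesis by (simp add: power2_sum algebra_simps)
  qed
  then have "l2sq (\<lambda>x. f x + g x) \<le> (LINT x|I01. (cmod (f x))^2 + 2 * (cmod (f x) * cmod (g x)) + (cmod (g x))^2)"
    unfolding l2sq_def using i sq_int_sq[OF f] sq_int_sq[OF g] sq_int_sq[OF sq_int_add[OF f g]]
    by (intro integral_mono) auto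
  also have "\<dots> = l2sq f + 2 * (LINT x|I01. cmod (f x) * cmod (g x)) + l2sq g"
    unfolding l2sq_def using i sq_int_sq[OF f] sq_int_sq[OF g] by simp
  also have "(LINT x|I01. cmod (f x) * cmod (g x)) \<le> sqrt (l2sq f) * sqrt (l2sq g)"
    using real_le_rsqrt[OF LINT_cauchy_schwarz[OF f g]] by (simp add: real_sqrt_mult)
  finally have "l2sq (\<lambda>x. f x + g x) \<le> (sqrt (l2sq f) + sqrt (l2sq g))^2"
    by (simp add: power2_sum algebra_simps)
  then show ?thesis by (simp add: real_le_lsqrt)
qed

lemma l2sq_add_le2:
  assumes f: "sq_int f" and g: "sq_int g"
  shows "l2sq (\<lambda>x. f x + g x) \<le> 2 * l2sq f + 2 * l2sq g"
proof -
  have "(sqrt (l2sq (\<lambda>x. f x + g x)))^2 \<le> (sqrt (l2sq f) + sqrt (l2sq g))^2"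
    by (intro power_mono l2sq_add_le assms) auto
  also have "\<dots> \<le> 2 * l2sq f + 2 * l2sq g"
    using sum_squares_bound[of "sqrt (l2sq f)" "sqrt (l2sq g)"] by (simp add: power2_sum)
  finally show ?thesis by simp
qed

lemma l2sq_scale [simp]: "l2sq (\<lambda>x. c * f x) = (cmod c)^2 * l2sq f"
  unfolding l2sq_def by (simp add: norm_mult power_mult_distrib)

lemma l2sq_uminus [simp]: "l2sq (\<lambda>x. - f x) = l2sq f"
  unfolding l2sq_def by simp

lemma l2sq_cnj [simp]: "l2sq (\<lambda>x. cnj (f x)) = l2sq f"
  unfolding l2sq_def by simp

lemma l2sq_le_const:
  assumes "f \<in> borel_measurable I01" "\<And>x. x \<in> {0..1} \<Longrightarrow> cmod (f x) \<le> B"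
  shows "l2sq f \<le> B^2"
  using sq_int_bdd_mult(2)[of "\<lambda>_. 1" f B] assms by (simp add: sq_int_cont l2sq_def)

lemma l2sq_0_AE: "sq_int f \<Longrightarrow> l2sq f = 0 \<longleftrightarrow> (AE x in I01. f x = 0)"
  unfolding l2sq_def by (subst integral_nonneg_eq_0_iff_AE) (auto simp: sq_int_sq)

lemma l2sq_cong_AE:
  assumes "AE x in I01. f x = g x" "sq_int f" "sq_int g"
  shows "l2sq f = l2sq g"
  unfolding l2sq_def using assms sq_int_sq[of f] sq_int_sq[of g]
  by (intro integral_cong_AE) (auto dest: borel_measurable_integrable)

lemma integral_upto:
  fixes f :: "real \<Rightarrow> 'a::euclidean_space"
  assumes f: "integrable I01 f" and x: "x \<in> {0..1}"
  shows "f integrable_on {0..x}" "integral {0..x} f = (LINT y|I01. indicator {0..x} y *\<^sub>R f y)"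
    "norm (integral {0..x} f) \<le> (LINT y|I01. norm (f y))"
proof -
  have i: "integrable (lebesgue_on {0..x}) f"
    using integrable_subinterval[OF f, of 0 x] x by auto
  show "f integrable_on {0..x}"
    using integrable_on_lebesgue_on[OF i] by simp
  have "integral {0..x} f = (LINT y|lebesgue_on {0..x}. f y)"
    using lebesgue_integral_eq_integral[OF i] by simp
  also have "\<dots> = (LINT y|lebesgue. indicator {0..x} y *\<^sub>R f y)"
    by (rule integral_restrict_space) simp
  also have "\<dots> = (LINT y|lebesgue. indicator {0..1} y *\<^sub>R (indicator {0..x} y *\<^sub>R f y))"
    using x by (intro Bochner_Integration.integral_cong) (auto simp: indicator_def)
  also have "\<dots> = (LINT y|I01. indicator {0..x} y *\<^sub>R f y)"
    by (rule integral_restrict_space[symmetric]) simp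
  finally show eq: "integral {0..x} f = (LINT y|I01. indicator {0..x} y *\<^sub>R f y)" .
  have "norm (integral {0..x} f) \<le> (LINT y|I01. norm (indicator {0..x} y *\<^sub>R f y))"
    unfolding eq by (rule integral_norm_bound)
  also have "\<dots> \<le> (LINT y|I01. norm (f y))"
  proof (rule integral_mono)
    show "integrable I01 (\<lambda>y. norm (f y))" using f by simp
    then show "integrable I01 (\<lambda>y. norm (indicat_real {0..x} y *\<^sub>R f y))"
    proof (rule Bochner_Integration.integrable_bound)
      have "indicat_real {0..x} \<in> borel_measurable I01"
        by (intro borel_measurable_indicator) (use x in \<open>auto simp: sets_restrict_space\<close>)
      then show "(\<lambda>y. norm (indicat_real {0..x} y *\<^sub>R f y)) \<in> borel_measurable I01"
        using borel_measurable_integrable[OF f] by measurable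
    qed (auto simp: indicator_def)
  qed (auto simp: indicator_def)
  finally show "norm (integral {0..x} f) \<le> (LINT y|I01. norm (f y))" .
qed

lemma integral_01_LINT:
  fixes f :: "real \<Rightarrow> 'a::euclidean_space"
  shows "integrable I01 f \<Longrightarrow> integral {0..1} f = (LINT y|I01. f y)"
  by (simp add: lebesgue_integral_eq_integral)

section \<open>Density of continuous functions and polynomials in L2\<close>

lemma AE_I01_negligible:
  assumes "negligible N"
  shows "AE x in I01. x \<notin> N"
proof -
  have "AE x in lebesgue. x \<notin> N"
    using assms by (simp add: AE_not_in negligible_iff_null_sets)
  then show ?thesis
    by (subst AE_restrict_space_iff) (auto elim: eventually_mono)
qed

text \<open>Measurability provides continuous functions that converge almost everywhere, but without
  a common bound. Projecting their values onto the ball of radius B keeps continuity and limits, and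
  makes dominated convergence applicable.\<close>

lemma bounded_cont_dense:
  assumes f: "sq_int f" and B: "\<And>x. cmod (f x) \<le> B" and e: "e > 0"
  obtains g where "continuous_on UNIV g" "l2sq (\<lambda>x. f x - g x) < e"
proof -
  have B0: "B \<ge> 0" using B[of 0] norm_ge_zero[of "f 0"] by (rule order_trans[rotated])
  obtain N g where N: "negligible N" and g: "\<And>n. continuous_on UNIV (g n)"
    and lim: "\<And>x. x \<notin> N \<Longrightarrow> (\<lambda>n. g n x) \<longlonglongrightarrow> (if x \<in> {0..1} then f x else 0)"
    using f unfolding sq_int_def measurable_on_def by blast
  define C where "C = cball (0::complex) B"
  have C: "closed C" "convex C" "C \<noteq> {}" using B0 by (auto simp: C_def)
  define g' where "g' n x = closest_point C (g n x)" for n x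
  have cc: "continuous_on UNIV (closest_point C)"
    by (rule continuous_on_closest_point[OF C(2,1,3)])
  have g'c: "continuous_on UNIV (g' n)" for n
    unfolding g'_def by (rule continuous_on_compose2[OF cc g]) auto
  have g'B: "cmod (g' n x) \<le> B" for n x
    using closest_point_in_set[OF C(1,3), of "g n x"] by (simp add: g'_def C_def)
  have lim': "(\<lambda>n. g' n x) \<longlonglongrightarrow> f x" if "x \<notin> N" "x \<in> {0..1}" for x
  proof -
    have "(\<lambda>n. closest_point C (g n x)) \<longlonglongrightarrow> closest_point C (f x)"
      using lim[OF that(1)] that(2) cc
      by (intro continuous_on_tendsto_compose[OF cc]) auto
    moreover have "closest_point C (f x) = f x"
      using B by (intro closest_point_self) (simp add: C_def)
    ultimately show ?thesis by (simp add: g'_def)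
  qed
  have sd: "sq_int (\<lambda>x. f x - g' n x)" for n
    by (intro sq_int_diff f sq_int_cont continuous_on_subset[OF g'c]) auto
  have "(\<lambda>n. LINT x|I01. (cmod (f x - g' n x))^2) \<longlonglongrightarrow> (LINT x|I01. 0)"
  proof (rule integral_dominated_convergence[where w = "\<lambda>_. (2*B)^2"])
    show "(\<lambda>x. (cmod (f x - g' i x))^2) \<in> borel_measurable I01" for i
      using sq_int_sq[OF sd[of i]] by auto
    show "AE x in I01. (\<lambda>n. (cmod (f x - g' n x))^2) \<longlonglongrightarrow> 0"
      using AE_I01_negligible[OF N] AE_space
    proof eventually_elim
      case (elim x)
      have "(\<lambda>n. (cmod (f x - g' n x))^2) \<longlonglongrightarrow> (cmod (f x - f x))^2"
        using elim by (intro tendsto_intros lim') auto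
      then show ?case by simp
    qed
    show "AE x in I01. norm ((cmod (f x - g' i x))^2) \<le> (2*B)^2" for i
    proof (rule AE_I2)
      fix x
      have "cmod (f x - g' i x) \<le> 2 * B"
        using norm_triangle_ineq4[of "f x" "g' i x"] B[of x] g'B[of i x] by linarith
      then have "(cmod (f x - g' i x))^2 \<le> (2*B)^2" by (intro power_mono) auto
      then show "norm ((cmod (f x - g' i x))^2) \<le> (2*B)^2" by (subst real_norm_def) simp
    qed
  qed auto
  then have "(\<lambda>n. l2sq (\<lambda>x. f x - g' n x)) \<longlonglongrightarrow> 0" by (simp add: l2sq_def)
  then have "eventually (\<lambda>n. l2sq (\<lambda>x. f x - g' n x) < e) sequentially"
    using e by (rule order_tendstoD(2))
  then obtain n where "l2sq (\<lambda>x. f x - g' n x) < e"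
    by (auto simp: eventually_sequentially)
  then show ?thesis using that g'c by blast
qed

lemma truncation_dense:
  assumes f: "sq_int f" and e: "e > 0"
  obtains k :: nat where "l2sq (\<lambda>x. f x - (if cmod (f x) \<le> k then f x else 0)) < e"
    "sq_int (\<lambda>x. if cmod (f x) \<le> k then f x else 0)"
proof -
  define t where "t k x = (if cmod (f x) \<le> real k then f x else 0)" for k x
  have fm: "f \<in> borel_measurable I01" using f by (rule sq_int_meas)
  have tm: "t k \<in> borel_measurable I01" for k
    unfolding t_def using fm by measurable
  have st: "sq_int (t k)" for k
    unfolding sq_int_iff
  proof
    show "integrable I01 (\<lambda>x. (cmod (t k x))^2)"
      by (rule Bochner_Integration.integrable_bound[OF sq_int_sq[OF f]])
         (use tm[of k] in \<open>auto simp: t_def[abs_def]\<close>)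
  qed (rule tm)
  have "(\<lambda>k. LINT x|I01. (cmod (f x - t k x))^2) \<longlonglongrightarrow> (LINT x|I01. 0)"
  proof (rule integral_dominated_convergence[where w = "\<lambda>x. (cmod (f x))^2"])
    show "(\<lambda>x. (cmod (f x - t i x))^2) \<in> borel_measurable I01" for i
      using sq_int_sq[OF sq_int_diff[OF f st[of i]]] by auto
    show "AE x in I01. (\<lambda>k. (cmod (f x - t k x))^2) \<longlonglongrightarrow> 0"
    proof (rule AE_I2)
      fix x
      obtain K :: nat where "cmod (f x) \<le> K" using real_arch_simple by blast
      then have "eventually (\<lambda>k. (cmod (f x - t k x))^2 = 0) sequentially"
        unfolding eventually_sequentially t_def by (intro exI[of _ K]) auto
      then show "(\<lambda>k. (cmod (f x - t k x))^2) \<longlonglongrightarrow> 0"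
        by (rule tendsto_eventually)
    qed
    show "AE x in I01. norm ((cmod (f x - t i x))^2) \<le> (cmod (f x))^2" for i
      by (auto simp: t_def)
  qed (auto simp: sq_int_sq[OF f])
  then have "(\<lambda>k. l2sq (\<lambda>x. f x - t k x)) \<longlonglongrightarrow> 0" by (simp add: l2sq_def)
  then have "eventually (\<lambda>k. l2sq (\<lambda>x. f x - t k x) < e) sequentially"
    using e by (rule order_tendstoD(2))
  then obtain k where "l2sq (\<lambda>x. f x - t k x) < e"
    by (auto simp: eventually_sequentially)
  then show ?thesis using that[of k] st[of k] by (simp add: t_def[abs_def])
qed

lemma continuous_poly_function:
  "polynomial_function p \<Longrightarrow> continuous_on S (p :: real \<Rightarrow> complex)"
  using continuous_on_polymonial_function by blast

lemma sq_int_poly: "polynomial_function p \<Longrightarrow> sq_int p"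
  by (intro sq_int_cont continuous_poly_function)

lemma poly_dense:
  assumes f: "sq_int f" and e: "e > 0"
  obtains p where "polynomial_function p" "l2sq (\<lambda>x. f x - p x) < e"
proof -
  \<comment> \<open>Truncation, a continuous function and Stone-Weierstrass share the error:
    \<open>|u + v|^2 \<le> 2 |u|^2 + 2 |v|^2\<close>, applied twice, adds the shares up to 2/4 +
    4/16 + 4/32 = 7/8 of e.\<close>
  obtain k :: nat where k: "l2sq (\<lambda>x. f x - (if cmod (f x) \<le> k then f x else 0)) < e/4"
    "sq_int (\<lambda>x. if cmod (f x) \<le> k then f x else 0)"
    using truncation_dense[OF f, of "e/4"] e by auto
  define t where "t x = (if cmod (f x) \<le> k then f x else 0)" for x
  have t: "sq_int t" "l2sq (\<lambda>x. f x - t x) < e/4" using k by (simp_all add: t_def[abs_def])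
  have tB: "cmod (t x) \<le> k" for x by (simp add: t_def)
  obtain g where g: "continuous_on UNIV g" "l2sq (\<lambda>x. t x - g x) < e/16"
    using bounded_cont_dense[OF t(1) tB, of "e/16"] e by auto
  obtain p where p: "polynomial_function p" "\<And>x. x \<in> {0..1} \<Longrightarrow> cmod (g x - p x) < sqrt (e/32)"
    using Stone_Weierstrass_polynomial_function[OF compact_Icc continuous_on_subset[OF g(1)], of 0 1 "sqrt (e/32)"] e by auto
  have sg: "sq_int g" by (intro sq_int_cont continuous_on_subset[OF g(1)]) auto
  have sp: "sq_int p" by (rule sq_int_poly[OF p(1)])
  have gp: "l2sq (\<lambda>x. g x - p x) \<le> e/32"
  proof -
    have "l2sq (\<lambda>x. g x - p x) \<le> (sqrt (e/32))^2"
      by (rule l2sq_le_const) (auto intro: sq_int_meas sq_int_diff sg sp intro!: less_imp_le[OF p(2)])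
    then show ?thesis using e by simp
  qed
  have "l2sq (\<lambda>x. t x - p x) \<le> 2 * l2sq (\<lambda>x. t x - g x) + 2 * l2sq (\<lambda>x. g x - p x)"
    using l2sq_add_le2[OF sq_int_diff[OF t(1) sg] sq_int_diff[OF sg sp]] by simp
  moreover have "l2sq (\<lambda>x. f x - p x) \<le> 2 * l2sq (\<lambda>x. f x - t x) + 2 * l2sq (\<lambda>x. t x - p x)"
    using l2sq_add_le2[OF sq_int_diff[OF f t(1)] sq_int_diff[OF t(1) sp]] by simp
  ultimately have "l2sq (\<lambda>x. f x - p x) < e" using t(2) g(2) gp e by linarith
  then show ?thesis using that p(1) by blast
qed

subsection \<open>Integration by parts\<close>

lemma indefinite_continuous:
  assumes "sq_int f" "\<And>x. x \<in> {0..1} \<Longrightarrow> F x = c + integral {0..x} f"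
  shows "continuous_on {0..1} F"
proof -
  have "f integrable_on {0..1}" using integral_upto(1)[OF sq_int_integrable[OF assms(1)], of 1] by simp
  then have "continuous_on {0..1} (\<lambda>x. c + integral {0..x} f)"
    by (intro continuous_intros indefinite_integral_continuous_1)
  then show ?thesis by (rule continuous_on_eq) (simp add: assms(2))
qed

lemma indefinite_derivative:
  assumes "continuous_on {0..1} f" "\<And>x. x \<in> {0..1} \<Longrightarrow> F x = c + integral {0..x} (f :: real \<Rightarrow> complex)" "x \<in> {0..1}"
  shows "(F has_vector_derivative f x) (at x within {0..1})"
proof -
  have "((\<lambda>x. c + integral {0..x} f) has_vector_derivative f x) (at x within {0..1})"
    using integral_has_vector_derivative[OF assms(1,3)]
    by (auto intro: derivative_eq_intros)
  then show ?thesis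
    by (rule has_vector_derivative_transform[OF assms(3), rotated]) (simp add: assms(2))
qed

lemma has_vector_derivative_continuous_on01:
  fixes F :: "real \<Rightarrow> complex"
  assumes "\<And>x. x \<in> {0..1} \<Longrightarrow> (F has_vector_derivative f x) (at x within {0..1})"
  shows "continuous_on {0..1} F"
  unfolding continuous_on_eq_continuous_within
  by (intro ballI has_vector_derivative_continuous[OF assms])

lemma ibp_smooth:
  fixes F G f g :: "real \<Rightarrow> complex"
  assumes F: "\<And>x. x \<in> {0..1} \<Longrightarrow> (F has_vector_derivative f x) (at x within {0..1})"
    and G: "\<And>x. x \<in> {0..1} \<Longrightarrow> (G has_vector_derivative g x) (at x within {0..1})"
    and f: "continuous_on {0..1} f" and g: "continuous_on {0..1} g"
  shows "(LINT x|I01. f x * G x) = F 1 * G 1 - F 0 * G 0 - (LINT x|I01. F x * g x)"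
proof -
  have cF: "continuous_on {0..1} F" by (rule has_vector_derivative_continuous_on01[OF F])
  have cG: "continuous_on {0..1} G" by (rule has_vector_derivative_continuous_on01[OF G])
  have "((\<lambda>x. F x * g x + f x * G x) has_integral (F 1 * G 1 - F 0 * G 0)) {0..1}"
    by (rule fundamental_theorem_of_calculus[where f="\<lambda>x. F x * G x"])
       (auto intro!: has_vector_derivative_mult F G)
  then have "integral {0..1} (\<lambda>x. F x * g x + f x * G x) = F 1 * G 1 - F 0 * G 0"
    by (rule integral_unique)
  also have "integral {0..1} (\<lambda>x. F x * g x + f x * G x) = (LINT x|I01. F x * g x + f x * G x)"
    by (intro integral_01_LINT integrable_I01_cont continuous_intros cF cG f g)
  also have "\<dots> = (LINT x|I01. F x * g x) + (LINT x|I01. f x * G x)"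
    by (intro Bochner_Integration.integral_add integrable_I01_cont continuous_intros cF cG f g)
  finally show ?thesis by (simp add: algebra_simps)
qed

text \<open>F is only an indefinite integral of a square integrable f, so there is no pointwise
  product rule to integrate. Polynomials p close to f in L2 have primitives uniformly close to F,
  and the defect of the formula is bounded by a constant times that distance.\<close>

lemma ibp_L2:
  assumes f: "sq_int f" and F: "\<And>x. x \<in> {0..1} \<Longrightarrow> F x = F 0 + integral {0..x} f"
    and G: "\<And>x. x \<in> {0..1} \<Longrightarrow> (G has_vector_derivative g x) (at x within {0..1})"
    and g: "continuous_on {0..1} g"
  shows "(LINT x|I01. f x * G x) = F 1 * G 1 - F 0 * G 0 - (LINT x|I01. F x * g x)"
proof -
  have cF: "continuous_on {0..1} F" using indefinite_continuous[OF f F] .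
  have cG: "continuous_on {0..1} G" by (rule has_vector_derivative_continuous_on01[OF G])
  have sG: "sq_int G" "sq_int g" "sq_int F" using cG g cF by (auto intro: sq_int_cont)
  define D where "D = (LINT x|I01. f x * G x) - (F 1 * G 1 - F 0 * G 0 - (LINT x|I01. F x * g x))"
  \<comment> \<open>C collects the factors of the two integrals and of the boundary term at 1; the
    boundary term at 0 cancels because P and F agree there.\<close>
  define C where "C = sqrt (l2sq G) + sqrt (l2sq g) + cmod (G 1) + 1"
  have C: "C > 0" unfolding C_def by (simp add: add_nonneg_pos)
  have bd: "cmod D \<le> d * C" if d: "d > 0" for d
  proof -
    obtain p where p: "polynomial_function p" "l2sq (\<lambda>x. f x - p x) < d^2"
      using poly_dense[OF f, of "d^2"] d by auto
    have cp: "continuous_on {0..1} p" by (rule continuous_poly_function[OF p(1)])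
    have sp: "sq_int p" by (rule sq_int_poly[OF p(1)])
    define P where "P x = F 0 + integral {0..x} p" for x
    have Pd: "(P has_vector_derivative p x) (at x within {0..1})" if "x \<in> {0..1}" for x
      by (rule indefinite_derivative[OF cp _ that]) (simp add: P_def)
    have cP: "continuous_on {0..1} P" by (rule has_vector_derivative_continuous_on01[OF Pd])
    have eqP: "(LINT x|I01. p x * G x) = P 1 * G 1 - P 0 * G 0 - (LINT x|I01. P x * g x)"
      by (rule ibp_smooth[OF Pd G cp g])
    define h where "h x = f x - p x" for x
    have sh: "sq_int h" unfolding h_def by (rule sq_int_diff[OF f sp])
    have lh: "sqrt (l2sq h) \<le> d" using p(2) d
      unfolding h_def[abs_def] by (intro real_le_lsqrt) auto
    define H where "H x = F x - P x" for x
    have Hb: "cmod (H x) \<le> d" if "x \<in> {0..1}" for x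
    proof -
      have "H x = integral {0..x} f - integral {0..x} p" using F[OF that] by (simp add: H_def P_def)
      also have "\<dots> = integral {0..x} h" unfolding h_def
        using integral_upto(1)[OF sq_int_integrable[OF f] that] integral_upto(1)[OF sq_int_integrable[OF sp] that]
        by (simp add: Henstock_Kurzweil_Integration.integral_diff)
      finally have "cmod (H x) \<le> (LINT y|I01. cmod (h y))"
        using integral_upto(3)[OF sq_int_integrable[OF sh] that] by simp
      also have "\<dots> \<le> sqrt (l2sq h)" by (rule LINT_norm_bound[OF sh])
      finally show ?thesis using lh by simp
    qed
    have cH: "continuous_on {0..1} H" unfolding H_def by (intro continuous_intros cF cP)
    have sH: "sq_int H" by (rule sq_int_cont[OF cH])
    have lH: "sqrt (l2sq H) \<le> d"
      using l2sq_le_const[OF measurable_I01_cont[OF cH] Hb] d by (simp add: real_le_lsqrt)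
    have P0: "P 0 = F 0" by (simp add: P_def)
    have H1: "H 1 = F 1 - P 1" by (simp add: H_def)
    have e1: "(LINT x|I01. f x * G x) - (LINT x|I01. p x * G x) = (LINT x|I01. h x * G x)"
      using sq_int_mult[OF f sG(1)] sq_int_mult[OF sp sG(1)]
      by (simp add: h_def left_diff_distrib)
    have e2: "(LINT x|I01. F x * g x) - (LINT x|I01. P x * g x) = (LINT x|I01. H x * g x)"
      using sq_int_mult[OF sG(3,2)] sq_int_mult[OF sq_int_cont[OF cP] sG(2)]
      by (simp add: H_def left_diff_distrib)
    have "D = (LINT x|I01. h x * G x) + (LINT x|I01. H x * g x) - H 1 * G 1"
      unfolding D_def e1[symmetric] e2[symmetric] eqP H1 P0 by (simp add: algebra_simps)
    then have "cmod D \<le> cmod (LINT x|I01. h x * G x) + cmod (LINT x|I01. H x * g x) + cmod (H 1 * G 1)"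
      using norm_triangle_ineq4[of "(LINT x|I01. h x * G x) + (LINT x|I01. H x * g x)" "H 1 * G 1"]
        norm_triangle_ineq[of "LINT x|I01. h x * G x" "LINT x|I01. H x * g x"] by simp
    also have "\<dots> \<le> d * sqrt (l2sq G) + d * sqrt (l2sq g) + d * cmod (G 1)"
      unfolding norm_mult
      by (intro add_mono order_trans[OF LINT_mult_bound] mult_right_mono lh lH sh sH sG Hb) auto
    also have "\<dots> \<le> d * C" using d by (simp add: C_def algebra_simps)
    finally show ?thesis .
  qed
  have "cmod D \<le> 0"
  proof (rule field_le_epsilon)
    fix e :: real assume "e > 0"
    then show "cmod D \<le> 0 + e" using bd[of "e / C"] C by simp
  qed
  then show ?thesis by (simp add: D_def)
qed

lemma l2sq_eq_LINT: "sq_int f \<Longrightarrow> complex_of_real (l2sq f) = (LINT x|I01. f x * cnj (f x))"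
  unfolding l2sq_def integral_complex_of_real[symmetric]
  by (intro Bochner_Integration.integral_cong refl complex_norm_square)

text \<open>Integration by parts with F = 0 shows that d is orthogonal to all polynomials, and these
  are dense. This is what makes weak derivatives unique.\<close>

lemma sq_int_zero_primitive:
  assumes d: "sq_int d" and z: "\<And>x. x \<in> {0..1} \<Longrightarrow> integral {0..x} d = 0"
  shows "l2sq d = 0"
proof -
  have bd: "l2sq d \<le> sqrt (l2sq d) * e" if e: "e > 0" for e
  proof -
    obtain p where p: "polynomial_function p" "l2sq (\<lambda>x. d x - p x) < e^2"
      using poly_dense[OF d, of "e^2"] e by auto
    have sp: "sq_int p" by (rule sq_int_poly[OF p(1)])
    obtain p' where p': "polynomial_function p'" "\<And>x. (p has_vector_derivative p' x) (at x)"
      by (rule has_vector_derivative_polynomial_function[OF p(1)]) (rule that)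
    have "(LINT x|I01. d x * cnj (p x)) = 0 * cnj (p 1) - 0 * cnj (p 0) - (LINT x|I01. 0 * cnj (p' x))"
    proof (rule ibp_L2[OF d, where F = "\<lambda>_. 0"])
      show "((\<lambda>x. cnj (p x)) has_vector_derivative cnj (p' x)) (at x within {0..1})" for x
        by (rule has_vector_derivative_cnj[OF has_vector_derivative_at_within[OF p'(2)]])
      show "continuous_on {0..1} (\<lambda>x. cnj (p' x))"
        by (intro continuous_intros continuous_poly_function p')
    qed (simp add: z)
    then have 0: "(LINT x|I01. d x * cnj (p x)) = 0" by simp
    have "complex_of_real (l2sq d) = (LINT x|I01. d x * cnj (d x)) - (LINT x|I01. d x * cnj (p x))"
      by (simp add: 0 l2sq_eq_LINT[OF d])
    also have "\<dots> = (LINT x|I01. d x * cnj (d x - p x))"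
      using sq_int_mult[OF d sq_int_cnj[OF d]] sq_int_mult[OF d sq_int_cnj[OF sp]]
      by (simp add: right_diff_distrib)
    finally have *: "complex_of_real (l2sq d) = (LINT x|I01. d x * cnj (d x - p x))" .
    have "l2sq d = cmod (LINT x|I01. d x * cnj (d x - p x))"
      unfolding *[symmetric] by simp
    also have "\<dots> \<le> sqrt (l2sq d) * sqrt (l2sq (\<lambda>x. d x - p x))"
      using LINT_mult_bound[OF d sq_int_cnj[OF sq_int_diff[OF d sp]]] unfolding l2sq_cnj .
    also have "\<dots> \<le> sqrt (l2sq d) * e"
      using p(2) e by (intro mult_left_mono real_le_lsqrt) auto
    finally show ?thesis .
  qed
  have "l2sq d \<le> 0"
  proof (rule field_le_epsilon)
    fix e :: real assume e: "e > 0"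
    have s: "sqrt (l2sq d) + 1 > 0" by (simp add: add_nonneg_pos)
    have "l2sq d \<le> sqrt (l2sq d) * (e / (sqrt (l2sq d) + 1))" by (intro bd divide_pos_pos e s)
    also have "\<dots> \<le> e" using e s by (simp add: field_simps)
    finally show "l2sq d \<le> 0 + e" by simp
  qed
  then show ?thesis using l2sq_nonneg[of d] by linarith
qed

subsection \<open>Completeness\<close>

lemma l2_series_complete:
  assumes s: "\<And>n. sq_int (G n)" and b: "\<And>n. l2sq (G n) \<le> C * (1/4)^n"
  obtains g where "sq_int g" "(\<lambda>n. l2sq (\<lambda>x. g x - (\<Sum>k<n. G k x))) \<longlonglongrightarrow> 0"
proof -
  \<comment> \<open>The weight 2^k lets Cauchy-Schwarz bound tails of the series pointwise by the
    sum of 2^-k times the sum of 2^k |G k|^2, while the assumed decay 4^-k keeps the weighted series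
    integrable.\<close>
  define u where "u k x = 2^k * (cmod (G k x))^2" for k :: nat and x
  have ui: "integrable I01 (u k)" for k unfolding u_def using sq_int_sq[OF s] by simp
  have u0: "u k x \<ge> 0" for k x by (simp add: u_def)
  have uL: "(LINT x|I01. u k x) \<le> C * (1/2)^k" for k
  proof -
    have "(LINT x|I01. u k x) = 2^k * l2sq (G k)" by (simp add: u_def l2sq_def)
    also have "\<dots> \<le> 2^k * (C * (1/4)^k)" using b by simp
    also have "\<dots> = C * (2 * (1/4))^k" unfolding power_mult_distrib by simp
    also have "\<dots> = C * (1/2)^k" by simp
    finally show ?thesis .
  qed
  have sumL: "summable (\<lambda>k. LINT x|I01. u k x)"
    by (rule summable_comparison_test'[where g="\<lambda>k. C * (1/2)^k" and N=0])
       (use uL in \<open>auto intro!: summable_mult summable_geometric simp: abs_of_nonneg[OF integral_nonneg_AE] u0\<close>)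
  have um: "u k \<in> borel_measurable I01" for k using ui[of k] by auto
  have AEs: "AE x in I01. summable (\<lambda>k. u k x)"
  proof -
    have "(\<integral>\<^sup>+x. (\<Sum>k. ennreal (u k x)) \<partial>I01) = (\<Sum>k. \<integral>\<^sup>+x. ennreal (u k x) \<partial>I01)"
      using um by (intro nn_integral_suminf) auto
    also have "\<dots> = (\<Sum>k. ennreal (LINT x|I01. u k x))"
      using ui u0 by (simp add: nn_integral_eq_integral)
    also have "\<dots> = ennreal (\<Sum>k. LINT x|I01. u k x)"
      using sumL u0 by (intro suminf_ennreal2 integral_nonneg_AE) auto
    finally have "(\<integral>\<^sup>+x. (\<Sum>k. ennreal (u k x)) \<partial>I01) \<noteq> \<infinity>" by simp
    then have "AE x in I01. (\<Sum>k. ennreal (u k x)) \<noteq> \<infinity>"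
      using um by (intro nn_integral_PInf_AE) auto
    then show ?thesis
      by eventually_elim (auto intro!: summable_suminf_not_top u0)
  qed
  define H where "H x = (\<Sum>k. u k x)" for x
  have Hi: "integrable I01 H" unfolding H_def
    using AEs sumL u0 by (intro integrable_suminf ui) auto
  define g where "g x = (\<Sum>k. G k x)" for x
  have Gm: "G k \<in> borel_measurable I01" for k using s by (rule sq_int_meas)
  have gm: "g \<in> borel_measurable I01" unfolding g_def
    using Gm by (rule borel_measurable_suminf)
  have fin: "(\<Sum>k\<in>{n..<m}. cmod (G k x)) ^ 2 \<le> 2 * (1/2)^n * H x"
    if x: "summable (\<lambda>k. u k x)" for x n m
    proof -
      have "(\<Sum>k\<in>{n..<m}. cmod (G k x)) = (\<Sum>k\<in>{n..<m}. sqrt ((1/2)^k) * sqrt (u k x))"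
        by (intro sum.cong) (auto simp: u_def real_sqrt_mult[symmetric] power_mult_distrib[symmetric] simp flip: mult.assoc)
      then have "(\<Sum>k\<in>{n..<m}. cmod (G k x))^2 \<le> (\<Sum>k\<in>{n..<m}. (sqrt ((1/2)^k))^2) * (\<Sum>k\<in>{n..<m}. (sqrt (u k x))^2)"
        using Cauchy_Schwarz_ineq_sum by metis
      also have "\<dots> = (\<Sum>k\<in>{n..<m}. (1/2)^k) * (\<Sum>k\<in>{n..<m}. u k x)"
        using u0 by simp
      also have "\<dots> \<le> (2 * (1/2)^n) * H x"
      proof (intro mult_mono)
        have "(\<Sum>k\<in>{n..<m}. (1/2::real)^k) \<le> (\<Sum>k. (1/2)^(k+n))"
        proof -
          have "(\<Sum>k\<in>{n..<m}. (1/2::real)^k) = (\<Sum>k<m-n. (1/2)^(k+n))"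
            by (rule sum.reindex_bij_witness[where i="\<lambda>k. k+n" and j="\<lambda>k. k-n"]) auto
          also have "\<dots> \<le> (\<Sum>k. (1/2)^(k+n))"
            by (intro sum_le_suminf) (auto simp: power_add intro!: summable_mult2 summable_geometric)
          finally show ?thesis .
        qed
        also have "\<dots> = 2 * (1/2)^n"
          by (simp add: power_add suminf_mult2[symmetric] summable_geometric suminf_geometric)
        finally show "(\<Sum>k\<in>{n..<m}. (1/2::real)^k) \<le> 2 * (1/2)^n" .
        show "(\<Sum>k\<in>{n..<m}. u k x) \<le> H x" unfolding H_def
          by (intro sum_le_suminf x) (auto simp: u0)
      qed (auto intro!: sum_nonneg u0)
      finally show ?thesis .
    qed
  have H0: "H x \<ge> 0" if x: "summable (\<lambda>k. u k x)" for x unfolding H_def by (intro suminf_nonneg x u0)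
  have tail: "(cmod (g x - (\<Sum>k<n. G k x)))^2 \<le> 2 * (1/2)^n * H x"
    if x: "summable (\<lambda>k. u k x)" for x n
  proof -
    have fin': "(\<Sum>k\<in>{n..<m}. cmod (G k x)) \<le> sqrt (2 * (1/2)^n * H x)" for n m
      using fin[OF x] by (rule real_le_rsqrt)
    have sn: "summable (\<lambda>k. cmod (G k x))"
      by (rule summableI_nonneg_bounded[where x="sqrt (2 * H x)"])
         (use fin'[of 0] in \<open>auto simp: lessThan_atLeast0\<close>)
    then have sG: "summable (\<lambda>k. G k x)" by (rule summable_norm_cancel)
    have sn': "summable (\<lambda>k. cmod (G (k + n) x))" using sn by (rule summable_ignore_initial_segment)
    have "g x - (\<Sum>k<n. G k x) = (\<Sum>k. G (k + n) x)"
      unfolding g_def using suminf_minus_initial_segment[OF sG, of n] by simp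
    then have "cmod (g x - (\<Sum>k<n. G k x)) \<le> (\<Sum>k. cmod (G (k + n) x))"
      using summable_norm[OF sn'] by simp
    also have "\<dots> \<le> sqrt (2 * (1/2)^n * H x)"
    proof (rule suminf_le_const[OF sn'])
      fix m
      have "(\<Sum>k<m. cmod (G (k + n) x)) = (\<Sum>k\<in>{n..<m+n}. cmod (G k x))"
        by (rule sum.reindex_bij_witness[where i="\<lambda>k. k-n" and j="\<lambda>k. k+n"]) auto
      then show "(\<Sum>k<m. cmod (G (k + n) x)) \<le> sqrt (2 * (1/2)^n * H x)" using fin' by simp
    qed
    finally have "(cmod (g x - (\<Sum>k<n. G k x)))^2 \<le> (sqrt (2 * (1/2)^n * H x))^2"
      by (intro power_mono) auto
    then show ?thesis using H0[OF x] by simp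
  qed
  have SI: "sq_int (\<lambda>x. \<Sum>k<n. G k x)" for n by (intro sq_int_sum s)
  have dm: "(\<lambda>x. g x - (\<Sum>k<n. G k x)) \<in> borel_measurable I01" for n
    by (intro borel_measurable_diff gm sq_int_meas SI)
  have di: "integrable I01 (\<lambda>x. (cmod (g x - (\<Sum>k<n. G k x)))^2)" for n
  proof (rule Bochner_Integration.integrable_bound[where f="\<lambda>x. 2 * (1/2)^n * H x"])
    show "AE x in I01. norm ((cmod (g x - (\<Sum>k<n. G k x)))^2) \<le> norm (2 * (1/2)^n * H x)"
      using AEs
    proof eventually_elim
      case (elim x)
      show ?case using tail[OF elim, of n] by simp
    qed
    show "(\<lambda>x. (cmod (g x - (\<Sum>k<n. G k x)))^2) \<in> borel_measurable I01"
      using dm[of n] by measurable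
  qed (use Hi in simp)
  have sg: "sq_int g"
    using di[of 0] dm[of 0] by (simp add: sq_int_iff)
  have le: "l2sq (\<lambda>x. g x - (\<Sum>k<n. G k x)) \<le> (1/2)^n * (2 * (LINT x|I01. H x))" for n
  proof -
    have "l2sq (\<lambda>x. g x - (\<Sum>k<n. G k x)) \<le> (LINT x|I01. 2 * (1/2)^n * H x)"
      unfolding l2sq_def
    proof (rule integral_mono_AE[OF di])
      show "AE x in I01. (cmod (g x - (\<Sum>k<n. G k x)))^2 \<le> 2 * (1/2)^n * H x"
        using AEs by eventually_elim (rule tail)
    qed (use Hi in simp)
    then show ?thesis by (simp add: ac_simps)
  qed
  have "(\<lambda>n. l2sq (\<lambda>x. g x - (\<Sum>k<n. G k x))) \<longlonglongrightarrow> 0"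
  proof (rule tendsto_sandwich[OF _ _ tendsto_const])
    show "(\<lambda>n. (1/2)^n * (2 * (LINT x|I01. H x))) \<longlonglongrightarrow> 0"
      by (intro tendsto_mult_left_zero LIMSEQ_realpow_zero) auto
  qed (use le in auto)
  then show ?thesis using that sg by blast
qed

section \<open>The state space\<close>

lemma LINT_cong_AE:
  fixes f g :: "'a \<Rightarrow> 'b::{banach, second_countable_topology}"
  assumes "integrable M f" "integrable M g" "AE x in M. f x = g x"
  shows "(LINT x|M. f x) = (LINT x|M. g x)"
  using assms by (intro integral_cong_AE) auto

section \<open>Weak derivatives and the clamped space H2l\<close>

lemma H2chain_props:
  assumes "H2chain f f1 f2"
  shows "sq_int f2" "continuous_on {0..1} f1" "continuous_on {0..1} f"
    "x \<in> {0..1} \<Longrightarrow> f1 x = f1 0 + integral {0..x} f2"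
    "x \<in> {0..1} \<Longrightarrow> (f has_vector_derivative f1 x) (at x within {0..1})"
proof -
  note a = assms[unfolded H2chain_def]
  show s: "sq_int f2" using a by blast
  show f1: "x \<in> {0..1} \<Longrightarrow> f1 x = f1 0 + integral {0..x} f2" for x using a by blast
  show c1: "continuous_on {0..1} f1" by (rule indefinite_continuous[OF s f1])
  have f: "x \<in> {0..1} \<Longrightarrow> f x = f 0 + integral {0..x} f1" for x using a by blast
  show "continuous_on {0..1} f" by (rule indefinite_continuous[OF sq_int_cont[OF c1] f])
  show "x \<in> {0..1} \<Longrightarrow> (f has_vector_derivative f1 x) (at x within {0..1})"
    by (rule indefinite_derivative[OF c1 f])
qed

lemma H2chainI:
  assumes f: "\<And>x. x \<in> {0..1} \<Longrightarrow> (f has_vector_derivative f1 x) (at x within {0..1})"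
    and f1: "\<And>x. x \<in> {0..1} \<Longrightarrow> (f1 has_vector_derivative f2 x) (at x within {0..1})"
    and f2: "continuous_on {0..1} f2"
  shows "H2chain f f1 f2"
proof -
  have ftc: "F x = F 0 + integral {0..x} F'"
    if "\<And>x. x \<in> {0..1} \<Longrightarrow> (F has_vector_derivative F' x) (at x within {0..1})" "x \<in> {0..1}"
    for F F' :: "real \<Rightarrow> complex" and x
  proof -
    have "(F' has_integral F x - F 0) {0..x}"
      using that(2) by (intro fundamental_theorem_of_calculus)
        (auto intro: has_vector_derivative_within_subset[OF that(1)])
    then show ?thesis by (simp add: integral_unique)
  qed
  show ?thesis unfolding H2chain_def
    using ftc[of f f1] ftc[of f1 f2] f f1 sq_int_cont[OF f2] by blast
qed

text \<open>\<open>D2\<close> picks its derivative by choice and \<open>Arel\<close> quantifies over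
  chains; this makes all of them agree, the continuous derivative everywhere and the second one
  almost everywhere.\<close>

lemma H2chain_unique:
  assumes "H2chain f f1 f2" "H2chain f g1 g2"
  shows "x \<in> {0..1} \<Longrightarrow> f1 x = g1 x" "AE x in I01. f2 x = g2 x"
proof -
  note A = H2chain_props[OF assms(1)] and B = H2chain_props[OF assms(2)]
  show eq: "f1 x = g1 x" if "x \<in> {0..1}" for x
    using vector_derivative_unique_within_closed_interval[of 0 1 x f "f1 x" "g1 x"]
      A(5)[OF that] B(5)[OF that] that by simp
  have sd: "sq_int (\<lambda>x. f2 x - g2 x)" by (rule sq_int_diff[OF A(1) B(1)])
  have "l2sq (\<lambda>x. f2 x - g2 x) = 0"
  proof (rule sq_int_zero_primitive[OF sd])
    fix x :: real assume x: "x \<in> {0..1}"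
    have "integral {0..x} f2 = integral {0..x} g2"
      using A(4)[OF x] B(4)[OF x] eq[OF x] eq[of 0] by simp
    then show "integral {0..x} (\<lambda>x. f2 x - g2 x) = 0"
      using integral_upto(1)[OF sq_int_integrable[OF A(1)] x] integral_upto(1)[OF sq_int_integrable[OF B(1)] x]
      by (simp add: Henstock_Kurzweil_Integration.integral_diff)
  qed
  then show "AE x in I01. f2 x = g2 x" using l2sq_0_AE[OF sd] by simp
qed

lemma D2_chain: "H2chain f f1 f2 \<Longrightarrow> \<exists>g1. H2chain f g1 (D2 f)"
  unfolding D2_def by (rule someI2_ex[where P="\<lambda>f2. \<exists>f1. H2chain f f1 f2"]) auto

text \<open>A primitive depends only on the almost-everywhere class of \<open>D2 f\<close>, so this
  is a pointwise defined derivative of f as soon as f'(0) = 0.\<close>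

definition D1 :: "(real \<Rightarrow> complex) \<Rightarrow> real \<Rightarrow> complex" where
  "D1 f x = integral {0..x} (D2 f)"

lemma D2_AE:
  assumes "H2chain f f1 f2"
  shows "sq_int (D2 f)" "AE x in I01. D2 f x = f2 x"
  using D2_chain[OF assms] H2chain_props(1) H2chain_unique(2)[OF _ assms] by blast+

lemma D1_eq:
  assumes f: "H2chain f f1 f2" and 0: "f1 0 = 0" and x: "x \<in> {0..1}"
  shows "D1 f x = f1 x"
proof -
  obtain g1 where g: "H2chain f g1 (D2 f)" using D2_chain[OF f] by blast
  have "f1 x = g1 x" "f1 0 = g1 0" using H2chain_unique(1)[OF f g] x by auto
  then show ?thesis using H2chain_props(4)[OF g x] 0 by (simp add: D1_def)
qed

lemma H2l_D:
  assumes "H2l f"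
  shows "H2chain f (D1 f) (D2 f)" "f 0 = 0" "D1 f 0 = 0"
proof -
  obtain f1 f2 where f: "H2chain f f1 f2" "f 0 = 0" "f1 0 = 0"
    using assms unfolding H2l_def by blast
  show "f 0 = 0" by fact
  show d0: "D1 f 0 = 0" by (simp add: D1_def)
  have "f x = f 0 + integral {0..x} (D1 f)" if x: "x \<in> {0..1}" for x
  proof -
    have "integral {0..x} (D1 f) = integral {0..x} f1"
      using x by (intro Henstock_Kurzweil_Integration.integral_cong D1_eq[OF f(1,3)]) auto
    moreover have "f x = f 0 + integral {0..x} f1" using f(1) x unfolding H2chain_def by blast
    ultimately show ?thesis by simp
  qed
  then show "H2chain f (D1 f) (D2 f)"
    unfolding H2chain_def using D2_AE(1)[OF f(1)] d0
    by (intro conjI ballI) (simp_all only: D1_def add_0)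
qed

lemma H2l_sq: "H2l f \<Longrightarrow> sq_int (D2 f)"
  using D2_AE(1)[OF H2l_D(1)] .

lemma H2l_cont: "H2l f \<Longrightarrow> continuous_on {0..1} f" "H2l f \<Longrightarrow> continuous_on {0..1} (D1 f)"
  using H2chain_props[OF H2l_D(1)] by blast+

lemma D1_bound:
  assumes f: "H2l f" and x: "x \<in> {0..1}"
  shows "cmod (D1 f x) \<le> sqrt (l2sq (D2 f))"
  unfolding D1_def
  using integral_upto(3)[OF sq_int_integrable[OF H2l_sq[OF f]] x] LINT_norm_bound[OF H2l_sq[OF f]] by simp

text \<open>The slope vanishes at 0, so it is bounded by the L2 norm of the second derivative. The
  Lipschitz constant is thus controlled by the energy norm, which later lets grids and bumps stand
  in for a compact embedding.\<close>

lemma H2l_lipschitz: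
  assumes f: "H2l f" and x: "x \<in> {0..1}" and y: "y \<in> {0..1}"
  shows "cmod (f x - f y) \<le> sqrt (l2sq (D2 f)) * \<bar>x - y\<bar>"
proof -
  have "norm (f x - f y) \<le> sqrt (l2sq (D2 f)) * norm (x - y)"
  proof (rule differentiable_bound[of "{0..1}" f "\<lambda>x h. h *\<^sub>R D1 f x"])
    show "(f has_derivative (\<lambda>h. h *\<^sub>R D1 f x)) (at x within {0..1})" if "x \<in> {0..1}" for x
      using H2chain_props(5)[OF H2l_D(1)[OF f] that] by (simp add: has_vector_derivative_def)
    show "onorm (\<lambda>h. h *\<^sub>R D1 f x) \<le> sqrt (l2sq (D2 f))" if "x \<in> {0..1}" for x
      using D1_bound[OF f that] by (intro onorm_le) (simp add: mult.commute[of "sqrt _"] mult_left_mono)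
  qed (use x y in auto)
  then show ?thesis by simp
qed

lemma H2l_bound:
  assumes f: "H2l f" and x: "x \<in> {0..1}"
  shows "cmod (f x) \<le> sqrt (l2sq (D2 f))"
proof -
  have "cmod (f x) \<le> sqrt (l2sq (D2 f)) * \<bar>x\<bar>"
    using H2l_lipschitz[OF f x, of 0] H2l_D(2)[OF f] by simp
  also have "\<dots> \<le> sqrt (l2sq (D2 f)) * 1" using x by (intro mult_left_mono) auto
  finally show ?thesis by simp
qed

lemma H2chain_add:
  assumes f: "H2chain f f1 f2" and g: "H2chain g g1 g2"
  shows "H2chain (\<lambda>x. f x + g x) (\<lambda>x. f1 x + g1 x) (\<lambda>x. f2 x + g2 x)"
proof -
  note A = H2chain_props[OF f] and B = H2chain_props[OF g]
  have i: "integral {0..x} (\<lambda>x. p x + q x) = integral {0..x} p + integral {0..x} q"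
    if "sq_int p" "sq_int q" "x \<in> {0..1}" for p q x
    using integral_upto(1)[OF sq_int_integrable[OF that(1)] that(3)] integral_upto(1)[OF sq_int_integrable[OF that(2)] that(3)]
    by (rule Henstock_Kurzweil_Integration.integral_add)
  have f': "x \<in> {0..1} \<Longrightarrow> f x = f 0 + integral {0..x} f1" for x using f unfolding H2chain_def by blast
  have g': "x \<in> {0..1} \<Longrightarrow> g x = g 0 + integral {0..x} g1" for x using g unfolding H2chain_def by blast
  show ?thesis unfolding H2chain_def
  proof (intro conjI ballI)
    fix x :: real assume x: "x \<in> {0..1}"
    show "f1 x + g1 x = f1 0 + g1 0 + integral {0..x} (\<lambda>x. f2 x + g2 x)"
      using i[OF A(1) B(1) x] A(4)[OF x] B(4)[OF x] by simp
    show "f x + g x = f 0 + g 0 + integral {0..x} (\<lambda>x. f1 x + g1 x)"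
      using i[OF sq_int_cont[OF A(2)] sq_int_cont[OF B(2)] x] f'[OF x] g'[OF x] by simp
  qed (intro sq_int_add A(1) B(1))
qed

lemma H2chain_scale:
  assumes f: "H2chain f f1 f2"
  shows "H2chain (\<lambda>x. c * f x) (\<lambda>x. c * f1 x) (\<lambda>x. c * f2 x)"
  unfolding H2chain_def
proof (intro conjI ballI)
  fix x :: real assume x: "x \<in> {0..1}"
  have "f1 x = f1 0 + integral {0..x} f2" "f x = f 0 + integral {0..x} f1"
    using f x unfolding H2chain_def by blast+
  then show "c * f1 x = c * f1 0 + integral {0..x} (\<lambda>x. c * f2 x)"
    "c * f x = c * f 0 + integral {0..x} (\<lambda>x. c * f1 x)"
    by (simp_all only: Henstock_Kurzweil_Integration.integral_mult_right distrib_left)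
qed (intro sq_int_cmult H2chain_props(1)[OF f])

lemma H2l_add:
  assumes "H2l f" "H2l g"
  shows "H2l (\<lambda>x. f x + g x)" "AE x in I01. D2 (\<lambda>x. f x + g x) x = D2 f x + D2 g x"
    "x \<in> {0..1} \<Longrightarrow> D1 (\<lambda>x. f x + g x) x = D1 f x + D1 g x"
proof -
  note c = H2chain_add[OF H2l_D(1)[OF assms(1)] H2l_D(1)[OF assms(2)]]
  show "H2l (\<lambda>x. f x + g x)"
    unfolding H2l_def using c H2l_D(2,3)[OF assms(1)] H2l_D(2,3)[OF assms(2)]
    by (intro exI conjI) (rule c, auto)
  show "AE x in I01. D2 (\<lambda>x. f x + g x) x = D2 f x + D2 g x" by (rule D2_AE(2)[OF c])
  show "x \<in> {0..1} \<Longrightarrow> D1 (\<lambda>x. f x + g x) x = D1 f x + D1 g x"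
    by (rule D1_eq[OF c]) (simp add: D1_def)
qed

lemma H2l_scale:
  assumes "H2l f"
  shows "H2l (\<lambda>x. c * f x)" "AE x in I01. D2 (\<lambda>x. c * f x) x = c * D2 f x"
    "x \<in> {0..1} \<Longrightarrow> D1 (\<lambda>x. c * f x) x = c * D1 f x"
proof -
  note c = H2chain_scale[OF H2l_D(1)[OF assms(1)], of c]
  show "H2l (\<lambda>x. c * f x)"
    unfolding H2l_def using c H2l_D(2,3)[OF assms(1)]
    by (intro exI conjI) (rule c, auto)
  show "AE x in I01. D2 (\<lambda>x. c * f x) x = c * D2 f x" by (rule D2_AE(2)[OF c])
  show "x \<in> {0..1} \<Longrightarrow> D1 (\<lambda>x. c * f x) x = c * D1 f x"
    by (rule D1_eq[OF c]) (simp add: D1_def)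
qed

section \<open>States as a vector space of representatives\<close>

abbreviation (input) sg :: "state \<Rightarrow> real \<Rightarrow> complex" where "sg z \<equiv> fst (snd z)"
abbreviation (input) s\<xi> :: "state \<Rightarrow> complex" where "s\<xi> z \<equiv> fst (snd (snd z))"
abbreviation (input) s\<eta> :: "state \<Rightarrow> complex" where "s\<eta> z \<equiv> snd (snd (snd z))"

lemma Xspace_iff: "z \<in> Xspace \<longleftrightarrow> H2l (fst z) \<and> sq_int (sg z)"
  by (cases z) (auto simp: Xspace_def)

text \<open>With pointwise addition of functions the state type is an abelian group, so sums and
  differences of states can be simplified as + and -.\<close>

lemma xadd_eq: "xadd z w = z + w"
  by (cases z; cases w) (simp add: xadd_def plus_fun_def)

lemma xscale_sel [simp]:
  "fst (xscale c z) = (\<lambda>x. c * fst z x)" "fst (snd (xscale c z)) = (\<lambda>x. c * sg z x)"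
  "fst (snd (snd (xscale c z))) = c * s\<xi> z" "snd (snd (snd (xscale c z))) = c * s\<eta> z"
  by (simp_all add: xscale_def split: prod.splits)

lemma xadd_sel:
  "fst (z + w :: state) = (\<lambda>x. fst z x + fst w x)" "fst (snd (z + w :: state)) = (\<lambda>x. sg z x + sg w x)"
  "fst (snd (snd (z + w :: state))) = s\<xi> z + s\<xi> w" "snd (snd (snd (z + w :: state))) = s\<eta> z + s\<eta> w"
  by (simp_all add: plus_fun_def)

lemma state_eqI:
  fixes z w :: state
  assumes "\<And>x. fst z x = fst w x" "\<And>x. sg z x = sg w x" "s\<xi> z = s\<xi> w" "s\<eta> z = s\<eta> w"
  shows "z = w"
  using assms by (cases z; cases w) auto

lemma xscale_m1: "xscale (-1) z = - z"
  by (rule state_eqI) (auto simp: fun_Compl_def)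

lemma xdiff_eq: "xdiff z w = z - w"
  unfolding xdiff_def xadd_eq xscale_m1 by simp

lemma xscale_diff: "xscale c (z - w) = xscale c z - xscale c w"
  by (rule state_eqI) (auto simp: algebra_simps)

lemma xscale_1 [simp]: "xscale 1 z = z"
  by (rule state_eqI) auto

lemma xscale_0 [simp]: "xscale 0 z = 0"
  by (rule state_eqI) auto

lemma xscale_zero [simp]: "xscale c 0 = 0"
  by (rule state_eqI) auto

lemma X_add [intro]: "z \<in> Xspace \<Longrightarrow> w \<in> Xspace \<Longrightarrow> z + w \<in> Xspace"
  unfolding Xspace_iff xadd_sel by (intro conjI H2l_add sq_int_add) auto

lemma X_scale [intro]: "z \<in> Xspace \<Longrightarrow> xscale c z \<in> Xspace"
  unfolding Xspace_iff xscale_sel by (intro conjI H2l_scale sq_int_cmult) auto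

lemma X_uminus [intro]: "z \<in> Xspace \<Longrightarrow> - z \<in> Xspace"
  unfolding xscale_m1[symmetric] by (rule X_scale)

lemma X_diff [intro]: "z \<in> Xspace \<Longrightarrow> w \<in> Xspace \<Longrightarrow> z - w \<in> Xspace"
  using X_add[of z "- w"] X_uminus[of w] by simp

lemma H2l_zero: "H2l (\<lambda>_. 0)"
  unfolding H2l_def H2chain_def by (intro exI[of _ "\<lambda>_. 0"]) (simp add: sq_int_cont)

lemma X_0 [intro, simp]: "0 \<in> Xspace"
  unfolding Xspace_iff by (simp add: zero_fun_def H2l_zero sq_int_cont)

lemma X_sum: "(\<And>i. i \<in> A \<Longrightarrow> f i \<in> Xspace) \<Longrightarrow> sum f A \<in> Xspace"
  by (induction A rule: infinite_finite_induct) auto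

section \<open>The energy norm and its real inner product\<close>

locale tower =
  fixes \<rho> EI :: "real \<Rightarrow> real" and m J b :: real
  assumes \<rho>_C4: "Ck_on 4 {0..1} \<rho>" and EI_C4: "Ck_on 4 {0..1} EI"
    and \<rho>_pos: "x \<in> {0..1} \<Longrightarrow> \<rho> x > 0" and EI_pos: "x \<in> {0..1} \<Longrightarrow> EI x > 0"
    and m_pos: "m > 0" and J_pos: "J > 0" and b_pos: "b > 0"
begin

abbreviation "N2 \<equiv> Xnormsq \<rho> EI m J"
definition "N z = sqrt (N2 z)"

lemma coeff_cont [continuous_intros]: "continuous_on {0..1} \<rho>" "continuous_on {0..1} EI"
proof -
  have "Ck_on (Suc k) {0..1} f \<Longrightarrow> continuous_on {0..1} f" for k f
    by (auto intro: DERIV_continuous_on)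
  then show "continuous_on {0..1} \<rho>" "continuous_on {0..1} EI"
    using \<rho>_C4 EI_C4 by (metis eval_nat_numeral(3) numeral_eq_Suc)+
qed

lemma coeff_bounds:
  obtains lo hi where "lo > 0" "hi > 0" "\<And>x. x \<in> {0..1} \<Longrightarrow> lo \<le> \<rho> x \<and> \<rho> x \<le> hi \<and> lo \<le> EI x \<and> EI x \<le> hi"
proof -
  have ne: "{0..1::real} \<noteq> {}" by simp
  obtain r0 where r0: "r0 \<in> {0..1}" "\<And>x. x \<in> {0..1} \<Longrightarrow> \<rho> r0 \<le> \<rho> x"
    using continuous_attains_inf[OF compact_Icc ne coeff_cont(1)] by blast
  obtain r1 where r1: "\<And>x. x \<in> {0..1} \<Longrightarrow> \<rho> x \<le> \<rho> r1" "r1 \<in> {0..1}"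
    using continuous_attains_sup[OF compact_Icc ne coeff_cont(1)] by blast
  obtain e0 where e0: "e0 \<in> {0..1}" "\<And>x. x \<in> {0..1} \<Longrightarrow> EI e0 \<le> EI x"
    using continuous_attains_inf[OF compact_Icc ne coeff_cont(2)] by blast
  obtain e1 where e1: "\<And>x. x \<in> {0..1} \<Longrightarrow> EI x \<le> EI e1" "e1 \<in> {0..1}"
    using continuous_attains_sup[OF compact_Icc ne coeff_cont(2)] by blast
  show ?thesis
  proof (rule that[of "min (\<rho> r0) (EI e0)" "max (\<rho> r1) (EI e1)"])
    show "min (\<rho> r0) (EI e0) > 0" using \<rho>_pos[OF r0(1)] EI_pos[OF e0(1)] by simp
    show "max (\<rho> r1) (EI e1) > 0" using \<rho>_pos[OF r1(2)] by (simp add: less_max_iff_disj)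
    show "min (\<rho> r0) (EI e0) \<le> \<rho> x \<and> \<rho> x \<le> max (\<rho> r1) (EI e1) \<and>
       min (\<rho> r0) (EI e0) \<le> EI x \<and> EI x \<le> max (\<rho> r1) (EI e1)" if "x \<in> {0..1}" for x
      using r0(2)[OF that] r1(1)[OF that] e0(2)[OF that] e1(1)[OF that]
      by (auto simp: min_def max_def)
  qed
qed

text \<open>The real part of the inner product of X. It suffices because only norms and real
  derivatives of quadratic quantities are formed from it.\<close>

definition rip :: "state \<Rightarrow> state \<Rightarrow> real" where
  "rip z w = (LINT x|I01. EI x * (D2 (fst z) x \<bullet> D2 (fst w) x)) + (LINT x|I01. \<rho> x * (sg z x \<bullet> sg w x))
     + m * (s\<xi> z \<bullet> s\<xi> w) + J * (s\<eta> z \<bullet> s\<eta> w)"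

lemma weighted_inner_integrable:
  assumes u: "continuous_on {0..1} (u :: real \<Rightarrow> real)" and p: "sq_int p" and q: "sq_int q"
  shows "integrable I01 (\<lambda>x. u x * (p x \<bullet> q x))"
proof -
  have c: "continuous_on {0..1} (\<lambda>x. complex_of_real (u x))" by (intro continuous_intros u)
  have "integrable I01 (\<lambda>x. Re ((complex_of_real (u x) * p x) * cnj (q x)))"
    by (intro integrable_Re sq_int_mult sq_int_cont_mult[OF c p] sq_int_cnj q)
  then show ?thesis by (simp add: inner_complex_def algebra_simps)
qed

lemma rip_integrable:
  assumes "z \<in> Xspace" "w \<in> Xspace"
  shows "integrable I01 (\<lambda>x. EI x * (D2 (fst z) x \<bullet> D2 (fst w) x))"
    "integrable I01 (\<lambda>x. \<rho> x * (sg z x \<bullet> sg w x))"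
  using assms by (auto intro!: weighted_inner_integrable coeff_cont H2l_sq simp: Xspace_iff)

lemma rip_commute: "rip z w = rip w z"
  by (simp add: rip_def inner_commute)

lemma rip_add_left:
  assumes z: "z \<in> Xspace" and z': "z' \<in> Xspace" and w: "w \<in> Xspace"
  shows "rip (z + z') w = rip z w + rip z' w"
proof -
  have "AE x in I01. D2 (fst (z+z')) x = D2 (fst z) x + D2 (fst z') x"
    using H2l_add(2)[of "fst z" "fst z'"] z z' by (simp only: Xspace_iff xadd_sel)
  then have "(LINT x|I01. EI x * (D2 (fst (z+z')) x \<bullet> D2 (fst w) x)) =
    (LINT x|I01. EI x * (D2 (fst z) x \<bullet> D2 (fst w) x) + EI x * (D2 (fst z') x \<bullet> D2 (fst w) x))"
    using rip_integrable(1)[OF X_add[OF z z'] w] rip_integrable(1)[OF z w] rip_integrable(1)[OF z' w]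
    by (intro integral_cong_AE) (auto intro!: borel_measurable_integrable simp: inner_add_left distrib_left)
  moreover have "(LINT x|I01. \<rho> x * (sg (z+z') x \<bullet> sg w x)) =
     (LINT x|I01. \<rho> x * (sg z x \<bullet> sg w x) + \<rho> x * (sg z' x \<bullet> sg w x))"
    unfolding xadd_sel by (simp add: inner_add_left distrib_left)
  ultimately show ?thesis
    unfolding rip_def
    using rip_integrable[OF z w] rip_integrable[OF z' w]
    by (simp add: xadd_sel(3,4) inner_add_left distrib_left del: fst_add snd_add)
qed

lemma rip_scale_left:
  assumes z: "z \<in> Xspace" and w: "w \<in> Xspace"
  shows "rip (xscale (complex_of_real r) z) w = r * rip z w"
proof -
  have "AE x in I01. D2 (fst (xscale (complex_of_real r) z)) x = complex_of_real r * D2 (fst z) x"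
    using H2l_scale(2)[of "fst z"] z by (simp add: Xspace_iff)
  then have A: "(LINT x|I01. EI x * (D2 (fst (xscale (complex_of_real r) z)) x \<bullet> D2 (fst w) x)) =
    r * (LINT x|I01. EI x * (D2 (fst z) x \<bullet> D2 (fst w) x))"
    unfolding integral_mult_right_zero[symmetric]
    by (intro LINT_cong_AE integrable_mult_right rip_integrable X_scale z w)
       (auto simp: inner_mult_left)
  have B: "(LINT x|I01. \<rho> x * (sg (xscale (complex_of_real r) z) x \<bullet> sg w x)) =
     r * (LINT x|I01. \<rho> x * (sg z x \<bullet> sg w x))"
    unfolding integral_mult_right_zero[symmetric] xscale_sel inner_mult_left
    by (intro Bochner_Integration.integral_cong) auto
  show ?thesis
    unfolding rip_def A B unfolding xscale_sel inner_mult_left by (simp add: distrib_left)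
qed

lemma N2_eq:
  assumes z: "z \<in> Xspace"
  shows "N2 z = (LINT x|I01. EI x * (cmod (D2 (fst z) x))^2) + (LINT x|I01. \<rho> x * (cmod (sg z x))^2)
     + m * (cmod (s\<xi> z))^2 + J * (cmod (s\<eta> z))^2"
proof -
  have i: "integrable I01 (\<lambda>x. EI x * (cmod (D2 (fst z) x))^2)" "integrable I01 (\<lambda>x. \<rho> x * (cmod (sg z x))^2)"
    using rip_integrable[OF z z] by (simp_all add: power2_norm_eq_inner)
  then have "integral {0..1} (\<lambda>x. EI x * (cmod (D2 (fst z) x))^2 + \<rho> x * (cmod (sg z x))^2) =
     (LINT x|I01. EI x * (cmod (D2 (fst z) x))^2 + \<rho> x * (cmod (sg z x))^2)"
    by (intro integral_01_LINT) auto
  then show ?thesis using i unfolding Xnormsq_def by (cases z) simp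
qed

lemma rip_self: "z \<in> Xspace \<Longrightarrow> rip z z = N2 z"
  unfolding rip_def by (simp add: N2_eq power2_norm_eq_inner)

lemma coeff_nonneg: "x \<in> {0..1} \<Longrightarrow> 0 \<le> EI x" "x \<in> {0..1} \<Longrightarrow> 0 \<le> \<rho> x"
  using EI_pos[of x] \<rho>_pos[of x] by simp_all

lemma N2_nonneg: "z \<in> Xspace \<Longrightarrow> N2 z \<ge> 0"
  using m_pos J_pos unfolding N2_eq
  by (intro add_nonneg_nonneg integral_nonneg_AE AE_I2 mult_nonneg_nonneg) (auto simp: coeff_nonneg)

lemma rip_add_right:
  "z \<in> Xspace \<Longrightarrow> w \<in> Xspace \<Longrightarrow> w' \<in> Xspace \<Longrightarrow> rip z (w + w') = rip z w + rip z w'"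
  by (metis rip_add_left rip_commute)

lemma rip_scale_right:
  "z \<in> Xspace \<Longrightarrow> w \<in> Xspace \<Longrightarrow> rip z (xscale (complex_of_real r) w) = r * rip z w"
  by (metis rip_scale_left rip_commute)

lemma N2_add:
  assumes "z \<in> Xspace" "w \<in> Xspace"
  shows "N2 (z + w) = N2 z + 2 * rip z w + N2 w"
  using assms by (simp add: rip_self[symmetric] X_add rip_add_left rip_add_right rip_commute[of w z])

lemma N2_scale:
  assumes z: "z \<in> Xspace"
  shows "N2 (xscale c z) = (cmod c)^2 * N2 z"
proof -
  have "AE x in I01. D2 (fst (xscale c z)) x = c * D2 (fst z) x"
    using H2l_scale(2)[of "fst z"] z by (simp add: Xspace_iff)
  then have A: "(LINT x|I01. EI x * (cmod (D2 (fst (xscale c z)) x))^2) =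
    (cmod c)^2 * (LINT x|I01. EI x * (cmod (D2 (fst z) x))^2)"
    using rip_integrable(1)[OF X_scale[OF z] X_scale[OF z], of c c] rip_integrable(1)[OF z z]
    unfolding power2_norm_eq_inner[symmetric] integral_mult_right_zero[symmetric]
    by (intro LINT_cong_AE integrable_mult_right) (auto simp: norm_mult power_mult_distrib)
  have B: "(LINT x|I01. \<rho> x * (cmod (sg (xscale c z) x))^2) = (cmod c)^2 * (LINT x|I01. \<rho> x * (cmod (sg z x))^2)"
    unfolding integral_mult_right_zero[symmetric]
    by (intro Bochner_Integration.integral_cong) (auto simp: norm_mult power_mult_distrib)
  show ?thesis unfolding N2_eq[OF z] N2_eq[OF X_scale[OF z]] A B
    by (simp add: norm_mult power_mult_distrib algebra_simps)
qed

lemma N_nonneg [simp]: "z \<in> Xspace \<Longrightarrow> N z \<ge> 0"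
  by (simp add: N_def N2_nonneg)

lemma N_sq: "z \<in> Xspace \<Longrightarrow> (N z)^2 = N2 z"
  by (simp add: N_def N2_nonneg)

lemma rip_le:
  assumes z: "z \<in> Xspace" and w: "w \<in> Xspace"
  shows "\<bar>rip z w\<bar> \<le> N z * N w"
proof -
  have "(rip z w)^2 \<le> N2 z * N2 w"
  proof (rule quadratic_nonneg_imp)
    fix t
    have tz: "xscale (complex_of_real t) z \<in> Xspace" by (rule X_scale[OF z])
    have "0 \<le> N2 (xscale (complex_of_real t) z + w)" by (intro N2_nonneg X_add tz w)
    also have "\<dots> = N2 z * t^2 + 2 * rip z w * t + N2 w"
      using z w tz by (simp add: N2_add N2_scale rip_scale_left)
    finally show "0 \<le> N2 z * t^2 + 2 * rip z w * t + N2 w" .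
  qed (rule N2_nonneg[OF z])
  then have "sqrt ((rip z w)^2) \<le> sqrt (N2 z * N2 w)" by (rule real_sqrt_le_mono)
  then show ?thesis by (simp add: N_def real_sqrt_mult)
qed

lemma N_add:
  assumes z: "z \<in> Xspace" and w: "w \<in> Xspace"
  shows "N (z + w) \<le> N z + N w"
proof -
  have "(N (z + w))^2 \<le> (N z + N w)^2"
    using rip_le[OF z w] z w by (simp add: N_sq X_add N2_add power2_sum abs_le_iff)
  then show ?thesis by (rule power2_le_imp_le) (simp add: z w)
qed

lemma N_scale: "z \<in> Xspace \<Longrightarrow> N (xscale c z) = cmod c * N z"
  by (simp add: N_def N2_scale real_sqrt_mult)

lemma N_0 [simp]: "N 0 = 0"
  using N_scale[OF X_0, of 0] by simp

lemma N_minus: "z \<in> Xspace \<Longrightarrow> N (- z) = N z"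
  using N_scale[of z "-1"] by (simp add: xscale_m1)

lemma N_diff_commute: "z \<in> Xspace \<Longrightarrow> w \<in> Xspace \<Longrightarrow> N (z - w) = N (w - z)"
  using N_minus[of "z - w"] X_diff[of z w] by simp

lemma N_diff: "z \<in> Xspace \<Longrightarrow> w \<in> Xspace \<Longrightarrow> N (z - w) \<le> N z + N w"
  using N_add[of z "- w"] X_uminus[of w] N_minus[of w] by simp

lemma N_triangle: "z \<in> Xspace \<Longrightarrow> w \<in> Xspace \<Longrightarrow> v \<in> Xspace \<Longrightarrow> N (z - w) \<le> N (z - v) + N (v - w)"
  using N_add[of "z - v" "v - w"] X_diff by simp

lemma N_diff_ge: "z \<in> Xspace \<Longrightarrow> w \<in> Xspace \<Longrightarrow> \<bar>N z - N w\<bar> \<le> N (z - w)"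
  using N_add[of "z - w" w] N_add[of "w - z" z] N_diff_commute[of z w] X_diff by (simp add: abs_le_iff)

lemma xeq_iff: "z \<in> Xspace \<Longrightarrow> w \<in> Xspace \<Longrightarrow> xeq \<rho> EI m J z w \<longleftrightarrow> N (z - w) = 0"
  using N2_nonneg[of "z - w"] by (simp add: xeq_def xdiff_eq N_def X_diff)

lemma comp_bounds:
  obtains C where "C > 0"
    "\<And>z. z \<in> Xspace \<Longrightarrow> sqrt (l2sq (D2 (fst z))) \<le> C * N z"
    "\<And>z. z \<in> Xspace \<Longrightarrow> sqrt (l2sq (sg z)) \<le> C * N z"
    "\<And>z. z \<in> Xspace \<Longrightarrow> cmod (s\<xi> z) \<le> C * N z"
    "\<And>z. z \<in> Xspace \<Longrightarrow> cmod (s\<eta> z) \<le> C * N z"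
proof -
  obtain lo hi where lo: "lo > 0" "\<And>x. x \<in> {0..1} \<Longrightarrow> lo \<le> \<rho> x \<and> lo \<le> EI x"
    using coeff_bounds by metis
  \<comment> \<open>The least weight occurring in the four parts of the norm.\<close>
  define k where "k = min lo (min m J)"
  have k: "k > 0" using lo m_pos J_pos by (simp add: k_def)
  have *: "sqrt u \<le> (1 / sqrt k) * N z" if "k * u \<le> N2 z" for u z
  proof -
    have "sqrt k * sqrt u \<le> N z" using that unfolding N_def by (simp flip: real_sqrt_mult)
    then show ?thesis using k by (simp add: field_simps)
  qed
  have main: "k * l2sq (D2 (fst z)) \<le> N2 z \<and> k * l2sq (sg z) \<le> N2 z \<and> k * (cmod (s\<xi> z))^2 \<le> N2 z \<and> k * (cmod (s\<eta> z))^2 \<le> N2 z"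
    if z: "z \<in> Xspace" for z
  proof -
    have s: "sq_int (D2 (fst z))" "sq_int (sg z)" using z H2l_sq by (auto simp: Xspace_iff)
    have i: "integrable I01 (\<lambda>x. EI x * (cmod (D2 (fst z) x))^2)" "integrable I01 (\<lambda>x. \<rho> x * (cmod (sg z x))^2)"
      using rip_integrable[OF z z] by (simp_all add: power2_norm_eq_inner)
    have kl: "k \<le> EI x" "k \<le> \<rho> x" if "x \<in> {0..1}" for x using lo(2)[OF that] by (auto simp: k_def)
    have 1: "k * l2sq (D2 (fst z)) \<le> (LINT x|I01. EI x * (cmod (D2 (fst z) x))^2)"
      unfolding l2sq_def integral_mult_right_zero[symmetric]
      using i sq_int_sq[OF s(1)] kl by (intro integral_mono) (auto intro!: mult_right_mono)
    have 2: "k * l2sq (sg z) \<le> (LINT x|I01. \<rho> x * (cmod (sg z x))^2)"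
      unfolding l2sq_def integral_mult_right_zero[symmetric]
      using i sq_int_sq[OF s(2)] kl by (intro integral_mono) (auto intro!: mult_right_mono)
    have 3: "k * (cmod (s\<xi> z))^2 \<le> m * (cmod (s\<xi> z))^2" "k * (cmod (s\<eta> z))^2 \<le> J * (cmod (s\<eta> z))^2"
      by (auto simp: k_def intro!: mult_right_mono)
    have 4: "k * l2sq (D2 (fst z)) \<ge> 0" "k * l2sq (sg z) \<ge> 0" "k * (cmod (s\<xi> z))^2 \<ge> 0" "k * (cmod (s\<eta> z))^2 \<ge> 0"
      using k by auto
    show ?thesis unfolding N2_eq[OF z] using 1 2 3 4 by linarith
  qed
  show ?thesis
  proof (rule that[of "1 / sqrt k"])
    show "0 < 1 / sqrt k" using k by simp
    show "cmod (s\<xi> z) \<le> 1 / sqrt k * N z" "cmod (s\<eta> z) \<le> 1 / sqrt k * N z" if "z \<in> Xspace" for z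
      using *[of "(cmod (s\<xi> z))^2" z] *[of "(cmod (s\<eta> z))^2" z] main[OF that] by auto
  qed (use * main in blast)+
qed

end

section \<open>Right derivatives\<close>

text \<open>The generator controls only right difference quotients. If H moved away from H 0, there
  would be a last time up to which it stays below a line of small slope, and the vanishing right
  derivative would push that time further to the right.\<close>

lemma right_derivative_zero_imp_const:
  fixes H :: "real \<Rightarrow> 'a::real_normed_vector"
  assumes c: "continuous_on {0..} H"
    and d: "\<And>t. t \<ge> 0 \<Longrightarrow> ((\<lambda>h. (H (t + h) - H t) /\<^sub>R h) \<longlongrightarrow> 0) (at_right 0)"
    and t: "t \<ge> 0"
  shows "H t = H 0"
proof (rule ccontr)
  assume ne: "H t \<noteq> H 0"
  then have t0: "t > 0" using t by (cases "t = 0") auto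
  \<comment> \<open>Half the slope of the chord from 0 to t, so that t itself violates the bound
    defining S.\<close>
  define e where "e = norm (H t - H 0) / (2 * t)"
  have e: "e > 0" using ne t0 by (simp add: e_def)
  define S where "S = {0..t} \<inter> (\<lambda>s. norm (H s - H 0) - e * s) -` {..0}"
  have cc: "continuous_on {0..t} (\<lambda>s. norm (H s - H 0) - e * s)"
    by (intro continuous_intros continuous_on_subset[OF c]) auto
  have "closed S" unfolding S_def
    by (rule continuous_closed_preimage[OF cc closed_atLeastAtMost closed_atMost])
  moreover have "bounded S" by (rule bounded_subset[of "{0..t}"]) (auto simp: S_def)
  ultimately have cpt: "compact S" by (simp add: compact_eq_bounded_closed)
  have "0 \<in> S" using t by (simp add: S_def)
  then have "S \<noteq> {}" by blast
  from compact_attains_sup[OF cpt this] obtain c where cS: "c \<in> S" and cmax: "\<And>s. s \<in> S \<Longrightarrow> s \<le> c"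
    by blast
  have c0: "0 \<le> c" "c \<le> t" "norm (H c - H 0) \<le> e * c" using cS by (auto simp: S_def)
  have "t \<notin> S" using t0 ne by (simp add: S_def e_def)
  then have ct: "c < t" using c0 cS by (cases "c = t") auto
  have "eventually (\<lambda>h. dist ((H (c + h) - H c) /\<^sub>R h) 0 < e) (at_right 0)"
    using d[OF c0(1)] e by (rule tendstoD)
  moreover have "eventually (\<lambda>h. h \<in> {0<..<t-c}) (at_right 0)"
    using ct by (intro eventually_at_right_real) auto
  ultimately have "eventually (\<lambda>h. dist ((H (c + h) - H c) /\<^sub>R h) 0 < e \<and> h \<in> {0<..<t-c}) (at_right 0)"
    by (rule eventually_conj)
  then obtain h where h: "dist ((H (c + h) - H c) /\<^sub>R h) 0 < e" "0 < h" "h < t - c"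
    using eventually_happens'[OF trivial_limit_at_right_real] by (metis (no_types, lifting) greaterThanLessThan_iff)
  have "norm (H (c + h) - H c) < e * h" using h(1,2) by (simp add: divide_simps mult.commute)
  then have "norm (H (c + h) - H 0) \<le> e * c + e * h"
    using norm_triangle_ineq[of "H (c + h) - H c" "H c - H 0"] c0(3) by simp
  then have "c + h \<in> S" using h c0 by (auto simp: S_def algebra_simps)
  then show False using cmax[of "c + h"] h(2) by simp
qed

lemma integral_has_vector_derivative_halfline:
  fixes G :: "real \<Rightarrow> 'a::euclidean_space"
  assumes G: "continuous_on {0..} G" and t: "t \<ge> 0"
  shows "((\<lambda>s. integral {0..s} G) has_vector_derivative G t) (at t within {0..})"
proof -
  have "((\<lambda>s. integral {0..s} G) has_vector_derivative G t) (at t within {0..t+1})"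
    using t by (intro integral_has_vector_derivative continuous_on_subset[OF G]) auto
  moreover have "at t within {0..t+1} = at t within {0..}"
    using t by (intro at_within_nhd[of t "{..<t+1}"]) auto
  ultimately show ?thesis by simp
qed

text \<open>F minus the indefinite integral of its continuous right derivative G has right
  derivative zero, hence is constant.\<close>

lemma right_derivative_imp_derivative:
  fixes F G :: "real \<Rightarrow> 'a::euclidean_space"
  assumes F: "continuous_on {0..} F" and G: "continuous_on {0..} G"
    and d: "\<And>t. t \<ge> 0 \<Longrightarrow> ((\<lambda>h. (F (t + h) - F t) /\<^sub>R h) \<longlongrightarrow> G t) (at_right 0)"
    and t: "t \<ge> 0"
  shows "(F has_vector_derivative G t) (at t within {0..})"
proof -
  define I where "I s = integral {0..s} G" for s
  have Id: "(I has_vector_derivative G s) (at s within {0..})" if "s \<ge> 0" for s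
    unfolding I_def by (rule integral_has_vector_derivative_halfline[OF G that])
  have Ic: "continuous_on {0..} I"
    unfolding continuous_on_eq_continuous_within
    by (intro ballI has_vector_derivative_continuous[OF Id]) auto
  have Ir: "((\<lambda>h. (I (s + h) - I s) /\<^sub>R h) \<longlongrightarrow> G s) (at_right 0)" if s: "s \<ge> 0" for s
  proof -
    have "(I has_vector_derivative G s) (at s within {s<..})"
      by (rule has_vector_derivative_within_subset[OF Id[OF s]]) (use s in auto)
    then have "((\<lambda>y. (1 / norm (y - s)) *\<^sub>R (I y - (I s + (y - s) *\<^sub>R G s))) \<longlongrightarrow> 0) (at_right s)"
      unfolding has_vector_derivative_def has_derivative_within by simp
    then have "((\<lambda>y. (I y - I s) /\<^sub>R (y - s) - G s) \<longlongrightarrow> 0) (at_right s)"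
    proof (rule Lim_transform_eventually)
      have "(1 / norm (y - s)) *\<^sub>R (I y - (I s + (y - s) *\<^sub>R G s)) = (I y - I s) /\<^sub>R (y - s) - G s"
        if "y > s" for y
        using that by (simp add: scaleR_diff_right scaleR_add_right divide_inverse)
      then show "\<forall>\<^sub>F y in at_right s. (1 / norm (y - s)) *\<^sub>R (I y - (I s + (y - s) *\<^sub>R G s)) = (I y - I s) /\<^sub>R (y - s) - G s"
        unfolding eventually_at_filter by (intro always_eventually) simp
    qed
    then have "((\<lambda>y. (I y - I s) /\<^sub>R (y - s)) \<longlongrightarrow> G s) (at_right s)"
      by (simp add: LIM_zero_iff)
    then show ?thesis
      by (subst (asm) filterlim_at_right_to_0) (simp add: add.commute)
  qed
  have FI0: "F s - I s = F 0 - I 0" if s: "s \<ge> 0" for s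
  proof (rule right_derivative_zero_imp_const[where H="\<lambda>s. F s - I s", OF _ _ s])
    show "continuous_on {0..} (\<lambda>s. F s - I s)" by (intro continuous_intros F Ic)
    fix r :: real assume r: "r \<ge> 0"
    have "((\<lambda>h. (F (r + h) - F r) /\<^sub>R h - (I (r + h) - I r) /\<^sub>R h) \<longlongrightarrow> G r - G r) (at_right 0)"
      by (intro tendsto_diff d r Ir)
    then show "((\<lambda>h. (F (r + h) - I (r + h) - (F r - I r)) /\<^sub>R h) \<longlongrightarrow> 0) (at_right 0)"
      by (simp add: algebra_simps)
  qed
  have FI: "I s + (F 0 - I 0) = F s" if "s \<ge> 0" for s
    unfolding FI0[OF that, symmetric] by simp
  have "((\<lambda>s. I s + (F 0 - I 0)) has_vector_derivative G t) (at t within {0..})"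
    using has_vector_derivative_add[OF Id[OF t] has_vector_derivative_const] by simp
  then show ?thesis
    by (rule has_vector_derivative_transform[rotated 2]) (use FI t in \<open>simp_all only: atLeast_iff\<close>)
qed

section \<open>Bounded functionals along trajectories\<close>

context tower
begin

text \<open>The laws are imposed on \<open>Xspace\<close> only: functionals built from
  \<open>D1\<close> or from Bochner integrals are additive there but not on arbitrary
  functions.\<close>

definition linf :: "(state \<Rightarrow> complex) \<Rightarrow> bool" where
  "linf L \<longleftrightarrow> (\<forall>z\<in>Xspace. \<forall>w\<in>Xspace. L (z + w) = L z + L w) \<and> (\<forall>c. \<forall>z\<in>Xspace. L (xscale c z) = c * L z) \<and>
    (\<exists>C. \<forall>z\<in>Xspace. cmod (L z) \<le> C * N z)"

definition bform :: "(state \<Rightarrow> state \<Rightarrow> real) \<Rightarrow> bool" where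
  "bform B \<longleftrightarrow> (\<forall>z\<in>Xspace. \<forall>z'\<in>Xspace. \<forall>w\<in>Xspace. B (z + z') w = B z w + B z' w \<and> B w (z + z') = B w z + B w z') \<and>
    (\<forall>r. \<forall>z\<in>Xspace. \<forall>w\<in>Xspace. B (xscale (complex_of_real r) z) w = r * B z w \<and> B z (xscale (complex_of_real r) w) = r * B z w) \<and>
    (\<exists>C. \<forall>z\<in>Xspace. \<forall>w\<in>Xspace. \<bar>B z w\<bar> \<le> C * (N z * N w))"

lemma linf_diff:
  assumes "linf L" "z \<in> Xspace" "w \<in> Xspace"
  shows "L (z - w) = L z - L w"
proof -
  have "L (z + xscale (-1) w) = L z + (-1) * L w"
    using assms unfolding linf_def by (metis X_scale)
  then show ?thesis by (simp add: xscale_m1)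
qed

lemma bform_add:
  "bform B \<Longrightarrow> z \<in> Xspace \<Longrightarrow> z' \<in> Xspace \<Longrightarrow> w \<in> Xspace \<Longrightarrow> B (z + z') w = B z w + B z' w"
  "bform B \<Longrightarrow> z \<in> Xspace \<Longrightarrow> z' \<in> Xspace \<Longrightarrow> w \<in> Xspace \<Longrightarrow> B w (z + z') = B w z + B w z'"
  unfolding bform_def by blast+

lemma bform_scale:
  "bform B \<Longrightarrow> z \<in> Xspace \<Longrightarrow> w \<in> Xspace \<Longrightarrow> B (xscale (complex_of_real r) z) w = r * B z w"
  "bform B \<Longrightarrow> z \<in> Xspace \<Longrightarrow> w \<in> Xspace \<Longrightarrow> B z (xscale (complex_of_real r) w) = r * B z w"
  unfolding bform_def by blast+

lemma bform_diff:
  assumes B: "bform B" and z: "z \<in> Xspace" "z' \<in> Xspace" "w \<in> Xspace"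
  shows "B (z - z') w = B z w - B z' w" "B w (z - z') = B w z - B w z'"
proof -
  have "xscale (complex_of_real (-1)) z' = - z'" by (simp add: xscale_m1)
  then show "B (z - z') w = B z w - B z' w" "B w (z - z') = B w z - B w z'"
    using bform_add[OF B z(1) X_uminus[OF z(2)] z(3)] bform_scale[OF B z(2,3), of "-1"] bform_scale[OF B z(3,2), of "-1"]
    by simp_all
qed

lemma linf_bound:
  assumes "linf L"
  obtains C where "C > 0" "\<And>z. z \<in> Xspace \<Longrightarrow> cmod (L z) \<le> C * N z"
proof -
  obtain C where C: "\<And>z. z \<in> Xspace \<Longrightarrow> cmod (L z) \<le> C * N z" using assms unfolding linf_def by blast
  have "cmod (L z) \<le> (\<bar>C\<bar> + 1) * N z" if "z \<in> Xspace" for z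
    using C[OF that] mult_right_mono[of C "\<bar>C\<bar> + 1" "N z"] N_nonneg[OF that] by linarith
  then show ?thesis by (intro that[of "\<bar>C\<bar> + 1"]) auto
qed

lemma bform_bound:
  assumes "bform B"
  obtains C where "C > 0" "\<And>z w. z \<in> Xspace \<Longrightarrow> w \<in> Xspace \<Longrightarrow> \<bar>B z w\<bar> \<le> C * (N z * N w)"
proof -
  obtain C where C: "\<And>z w. z \<in> Xspace \<Longrightarrow> w \<in> Xspace \<Longrightarrow> \<bar>B z w\<bar> \<le> C * (N z * N w)"
    using assms unfolding bform_def by blast
  have "\<bar>B z w\<bar> \<le> (\<bar>C\<bar> + 1) * (N z * N w)" if "z \<in> Xspace" "w \<in> Xspace" for z w
    using C[OF that] mult_right_mono[of C "\<bar>C\<bar> + 1" "N z * N w"] N_nonneg[OF that(1)] N_nonneg[OF that(2)]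
    by (meson abs_ge_self add_increasing2 mult_nonneg_nonneg order_trans zero_le_one)
  then show ?thesis by (intro that[of "\<bar>C\<bar> + 1"]) auto
qed

lemma bform_rip: "bform rip"
  unfolding bform_def
  by (intro conjI exI[of _ 1]) (auto simp: rip_add_left rip_add_right rip_scale_left rip_scale_right rip_le)

text \<open>Pairs of representatives for which W = A Z holds literally at each time, so that
  boundary values of derivatives can be read off. The semigroup delivers such an equation only up to
  null states, and in time only a right derivative.\<close>

definition traj :: "(real \<Rightarrow> state) \<Rightarrow> (real \<Rightarrow> state) \<Rightarrow> bool" where
  "traj Z W \<longleftrightarrow> (\<forall>t\<ge>0. Z t \<in> Xspace \<and> W t \<in> Xspace \<and> Arel \<rho> EI m J b (Z t) (W t)) \<and>
    (\<forall>t\<ge>0. ((\<lambda>s. N (Z s - Z t)) \<longlongrightarrow> 0) (at t within {0..})) \<and>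
    (\<forall>t\<ge>0. ((\<lambda>s. N (W s - W t)) \<longlongrightarrow> 0) (at t within {0..})) \<and>
    (\<forall>t\<ge>0. ((\<lambda>h. N (xscale (complex_of_real (1/h)) (Z (t + h) - Z t) - W t)) \<longlongrightarrow> 0) (at_right 0))"

definition contX :: "(real \<Rightarrow> state) \<Rightarrow> bool" where
  "contX Z \<longleftrightarrow> (\<forall>t\<ge>0. Z t \<in> Xspace) \<and> (\<forall>t\<ge>0. ((\<lambda>s. N (Z s - Z t)) \<longlongrightarrow> 0) (at t within {0..}))"

lemma traj_contX: "traj Z W \<Longrightarrow> contX Z" "traj Z W \<Longrightarrow> contX W"
  by (auto simp: traj_def contX_def)

lemma linf_contX:
  assumes L: "linf L" and Z: "contX Z"
  shows "continuous_on {0..} (\<lambda>t. L (Z t))"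
  unfolding continuous_on_def
proof
  fix t :: real assume t: "t \<in> {0..}"
  obtain C where C: "C > 0" "\<And>z. z \<in> Xspace \<Longrightarrow> cmod (L z) \<le> C * N z" using linf_bound[OF L] by blast
  have X: "Z s \<in> Xspace" if "s \<ge> 0" for s using Z that by (auto simp: contX_def)
  have "((\<lambda>s. C * N (Z s - Z t)) \<longlongrightarrow> C * 0) (at t within {0..})"
    using Z t by (intro tendsto_mult tendsto_const) (auto simp: contX_def)
  then have "((\<lambda>s. C * N (Z s - Z t)) \<longlongrightarrow> 0) (at t within {0..})" by simp
  then have "((\<lambda>s. L (Z s) - L (Z t)) \<longlongrightarrow> 0) (at t within {0..})"
  proof (rule Lim_null_comparison[rotated])
    show "\<forall>\<^sub>F s in at t within {0..}. cmod (L (Z s) - L (Z t)) \<le> C * N (Z s - Z t)"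
      unfolding eventually_at_filter
      using C(2)[OF X_diff[OF X X[of t]]] t by (auto simp: linf_diff[OF L] X intro!: always_eventually)
  qed
  then show "((\<lambda>t. L (Z t)) \<longlongrightarrow> L (Z t)) (at t within {0..})" by (simp add: LIM_zero_iff)
qed

lemma N_contX:
  assumes Z: "contX Z"
  shows "continuous_on {0..} (\<lambda>t. N (Z t))"
  unfolding continuous_on_def
proof
  fix t :: real assume t: "t \<in> {0..}"
  have X: "Z s \<in> Xspace" if "s \<ge> 0" for s using Z that by (auto simp: contX_def)
  have "((\<lambda>s. N (Z s - Z t)) \<longlongrightarrow> 0) (at t within {0..})"
    using Z t by (auto simp: contX_def)
  then have "((\<lambda>s. N (Z s) - N (Z t)) \<longlongrightarrow> 0) (at t within {0..})"
  proof (rule Lim_null_comparison[rotated])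
    show "\<forall>\<^sub>F s in at t within {0..}. norm (N (Z s) - N (Z t)) \<le> N (Z s - Z t)"
      unfolding eventually_at_filter
      using N_diff_ge[OF X X[of t]] t by (auto intro!: always_eventually)
  qed
  then show "((\<lambda>t. N (Z t)) \<longlongrightarrow> N (Z t)) (at t within {0..})" by (simp add: LIM_zero_iff)
qed

lemma bform_contX:
  assumes B: "bform B" and Z: "contX Z" and W: "contX W"
  shows "continuous_on {0..} (\<lambda>t. B (Z t) (W t))"
  unfolding continuous_on_def
proof
  fix t :: real assume t: "t \<in> {0..}"
  obtain C where C: "C > 0" "\<And>z w. z \<in> Xspace \<Longrightarrow> w \<in> Xspace \<Longrightarrow> \<bar>B z w\<bar> \<le> C * (N z * N w)"
    using bform_bound[OF B] by blast
  have X: "Z s \<in> Xspace" "W s \<in> Xspace" if "s \<ge> 0" for s using Z W that by (auto simp: contX_def)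
  have "((\<lambda>s. C * (N (Z s - Z t) * N (W s)) + C * (N (Z t) * N (W s - W t))) \<longlongrightarrow> C * (0 * N (W t)) + C * (N (Z t) * 0)) (at t within {0..})"
    using Z W t N_contX[OF W] by (intro tendsto_intros) (auto simp: contX_def continuous_on_def)
  then have "((\<lambda>s. C * (N (Z s - Z t) * N (W s)) + C * (N (Z t) * N (W s - W t))) \<longlongrightarrow> 0) (at t within {0..})" by simp
  then have "((\<lambda>s. B (Z s) (W s) - B (Z t) (W t)) \<longlongrightarrow> 0) (at t within {0..})"
  proof (rule Lim_null_comparison[rotated])
    have "norm (B (Z s) (W s) - B (Z t) (W t)) \<le> C * (N (Z s - Z t) * N (W s)) + C * (N (Z t) * N (W s - W t))" if s: "s \<ge> 0" for s
    proof -
      have "B (Z s) (W s) - B (Z t) (W t) = B (Z s - Z t) (W s) + B (Z t) (W s - W t)"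
        using X[OF s] X[of t] t by (simp add: bform_diff[OF B])
      then show ?thesis
        using C(2)[of "Z s - Z t" "W s"] C(2)[of "Z t" "W s - W t"] X[OF s] X[of t] t X_diff by (simp add: abs_le_iff)
    qed
    then show "\<forall>\<^sub>F s in at t within {0..}. norm (B (Z s) (W s) - B (Z t) (W t)) \<le> C * (N (Z s - Z t) * N (W s)) + C * (N (Z t) * N (W s - W t))"
      unfolding eventually_at_filter by (auto intro!: always_eventually)
  qed
  then show "((\<lambda>t. B (Z t) (W t)) \<longlongrightarrow> B (Z t) (W t)) (at t within {0..})" by (simp add: LIM_zero_iff)
qed

text \<open>Boundedness of L gives the right derivative L (W t); it is continuous in time, which
  upgrades it to a two-sided derivative.\<close>

lemma linf_traj:
  assumes L: "linf L" and T: "traj Z W" and t: "t \<ge> 0"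
  shows "((\<lambda>t. L (Z t)) has_vector_derivative L (W t)) (at t within {0..})"
proof (rule right_derivative_imp_derivative[OF linf_contX[OF L traj_contX(1)[OF T]] linf_contX[OF L traj_contX(2)[OF T]] _ t])
  fix t :: real assume t: "t \<ge> 0"
  obtain C where C: "C > 0" "\<And>z. z \<in> Xspace \<Longrightarrow> cmod (L z) \<le> C * N z" using linf_bound[OF L] by blast
  have X: "Z s \<in> Xspace" "W s \<in> Xspace" if "s \<ge> 0" for s using T that by (auto simp: traj_def)
  have "((\<lambda>h. C * N (xscale (complex_of_real (1/h)) (Z (t + h) - Z t) - W t)) \<longlongrightarrow> C * 0) (at_right 0)"
    using T t by (intro tendsto_mult tendsto_const) (auto simp: traj_def)
  then have "((\<lambda>h. C * N (xscale (complex_of_real (1/h)) (Z (t + h) - Z t) - W t)) \<longlongrightarrow> 0) (at_right 0)" by simp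
  then have "((\<lambda>h. (L (Z (t + h)) - L (Z t)) /\<^sub>R h - L (W t)) \<longlongrightarrow> 0) (at_right 0)"
  proof (rule Lim_null_comparison[rotated])
    have "norm ((L (Z (t + h)) - L (Z t)) /\<^sub>R h - L (W t)) \<le> C * N (xscale (complex_of_real (1/h)) (Z (t + h) - Z t) - W t)"
      if h: "h > 0" for h
    proof -
      have x: "Z (t + h) - Z t \<in> Xspace" using X t h by (intro X_diff) auto
      have "L (xscale (complex_of_real (1/h)) (Z (t + h) - Z t) - W t) = complex_of_real (1/h) * (L (Z (t+h)) - L (Z t)) - L (W t)"
        using linf_diff[OF L X_scale[OF x] X(2)[OF t]] linf_diff[OF L X(1)[of "t+h"] X(1)[OF t]] L x t h
        unfolding linf_def by simp
      then show ?thesis using C(2)[OF X_diff[OF X_scale[OF x] X(2)[OF t]], of "complex_of_real (1/h)"]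
        by (simp add: scaleR_conv_of_real divide_inverse)
    qed
    then show "\<forall>\<^sub>F h in at_right 0. norm ((L (Z (t + h)) - L (Z t)) /\<^sub>R h - L (W t)) \<le> C * N (xscale (complex_of_real (1/h)) (Z (t + h) - Z t) - W t)"
      unfolding eventually_at_filter by (auto intro!: always_eventually)
  qed
  then show "((\<lambda>h. (L (Z (t + h)) - L (Z t)) /\<^sub>R h) \<longlongrightarrow> L (W t)) (at_right 0)" by (simp add: LIM_zero_iff)
qed

text \<open>The product rule for right quotients: with q the difference quotient of Z, the quotient
  of the form is \<open>B q (Z (t + h)) + B (Z t) q\<close>, and q tends to W t in norm.\<close>

lemma bform_traj:
  assumes B: "bform B" and T: "traj Z W" and t: "t \<ge> 0"
  shows "((\<lambda>t. B (Z t) (Z t)) has_vector_derivative (B (W t) (Z t) + B (Z t) (W t))) (at t within {0..})"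
proof -
  note cZ = traj_contX(1)[OF T] and cW = traj_contX(2)[OF T]
  show ?thesis
  proof (rule right_derivative_imp_derivative[OF bform_contX[OF B cZ cZ]
      continuous_on_add[OF bform_contX[OF B cW cZ] bform_contX[OF B cZ cW]] _ t])
  fix t :: real assume t: "t \<ge> 0"
  obtain C where C: "C > 0" "\<And>z w. z \<in> Xspace \<Longrightarrow> w \<in> Xspace \<Longrightarrow> \<bar>B z w\<bar> \<le> C * (N z * N w)"
    using bform_bound[OF B] by blast
  have X: "Z s \<in> Xspace" "W s \<in> Xspace" if "s \<ge> 0" for s using T that by (auto simp: traj_def)
  define q where "q h = xscale (complex_of_real (1/h)) (Z (t + h) - Z t)" for h
  have q: "((\<lambda>h. N (q h - W t)) \<longlongrightarrow> 0) (at_right 0)" using T t by (auto simp: traj_def q_def)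
  have NZ: "((\<lambda>h. N (Z (t + h))) \<longlongrightarrow> N (Z t)) (at_right 0)"
   and BZ: "((\<lambda>h. B (W t) (Z (t + h))) \<longlongrightarrow> B (W t) (Z t)) (at_right 0)"
  proof -
    have *: "((\<lambda>h. f (t + h)) \<longlongrightarrow> f t) (at_right 0)" if "continuous_on {0..} f" for f :: "real \<Rightarrow> real"
    proof -
      have "(f \<longlongrightarrow> f t) (at t within {0..})" using that t by (auto simp: continuous_on_def)
      then have "(f \<longlongrightarrow> f t) (at_right t)" by (rule tendsto_within_subset) (use t in auto)
      then show ?thesis by (subst (asm) filterlim_at_right_to_0) (simp add: add.commute)
    qed
    show "((\<lambda>h. N (Z (t + h))) \<longlongrightarrow> N (Z t)) (at_right 0)" by (rule *[OF N_contX[OF cZ]])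
    have "contX (\<lambda>_. W t)" using X(2)[OF t] by (simp add: contX_def)
    from *[OF bform_contX[OF B this cZ]]
    show "((\<lambda>h. B (W t) (Z (t + h))) \<longlongrightarrow> B (W t) (Z t)) (at_right 0)" .
  qed
  have "((\<lambda>h. C * (N (q h - W t) * N (Z (t + h))) + C * (N (Z t) * N (q h - W t))) \<longlongrightarrow> C * (0 * N (Z t)) + C * (N (Z t) * 0)) (at_right 0)"
    by (intro tendsto_intros q NZ)
  then have "((\<lambda>h. C * (N (q h - W t) * N (Z (t + h))) + C * (N (Z t) * N (q h - W t))) \<longlongrightarrow> 0) (at_right 0)" by simp
  then have "((\<lambda>h. (B (Z (t+h)) (Z (t+h)) - B (Z t) (Z t)) / h - (B (W t) (Z (t+h)) + B (Z t) (W t))) \<longlongrightarrow> 0) (at_right 0)"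
  proof (rule Lim_null_comparison[rotated])
    have "norm ((B (Z (t+h)) (Z (t+h)) - B (Z t) (Z t)) / h - (B (W t) (Z (t+h)) + B (Z t) (W t)))
       \<le> C * (N (q h - W t) * N (Z (t + h))) + C * (N (Z t) * N (q h - W t))"
      if h: "h > 0" for h
    proof -
      have Xh: "Z (t + h) \<in> Xspace" using X t h by auto
      have x: "Z (t + h) - Z t \<in> Xspace" using X t h by (intro X_diff) auto
      have qX: "q h \<in> Xspace" unfolding q_def by (rule X_scale[OF x])
      have e1: "B (q h) (Z (t+h)) = (B (Z (t+h)) (Z (t+h)) - B (Z t) (Z (t+h))) / h"
      proof -
        have "B (q h) (Z (t+h)) = (1/h) * B (Z (t + h) - Z t) (Z (t+h))"
          unfolding q_def by (rule bform_scale(1)[OF B x Xh])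
        then show ?thesis using bform_diff(1)[OF B Xh X(1)[OF t] Xh] by simp
      qed
      have e2: "B (Z t) (q h) = (B (Z t) (Z (t+h)) - B (Z t) (Z t)) / h"
      proof -
        have "B (Z t) (q h) = (1/h) * B (Z t) (Z (t + h) - Z t)"
          unfolding q_def by (rule bform_scale(2)[OF B X(1)[OF t] x])
        then show ?thesis using bform_diff(2)[OF B Xh X(1)[OF t] X(1)[OF t]] by simp
      qed
      have "(B (Z (t+h)) (Z (t+h)) - B (Z t) (Z t)) / h - (B (W t) (Z (t+h)) + B (Z t) (W t))
        = B (q h - W t) (Z (t+h)) + B (Z t) (q h - W t)"
        using bform_diff(1)[OF B qX X(2)[OF t] Xh] bform_diff(2)[OF B qX X(2)[OF t] X(1)[OF t]] e1 e2
        by (simp add: diff_divide_distrib)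
      moreover have "\<bar>B (q h - W t) (Z (t+h))\<bar> \<le> C * (N (q h - W t) * N (Z (t + h)))"
        by (intro C(2) X_diff qX X t Xh)
      moreover have "\<bar>B (Z t) (q h - W t)\<bar> \<le> C * (N (Z t) * N (q h - W t))"
        by (intro C(2) X_diff qX X t Xh)
      ultimately show ?thesis by (simp add: abs_le_iff)
    qed
    then show "\<forall>\<^sub>F h in at_right 0. norm ((B (Z (t+h)) (Z (t+h)) - B (Z t) (Z t)) / h - (B (W t) (Z (t+h)) + B (Z t) (W t)))
       \<le> C * (N (q h - W t) * N (Z (t + h))) + C * (N (Z t) * N (q h - W t))"
      unfolding eventually_at_filter by (auto intro!: always_eventually)
  qed
  then have "((\<lambda>h. ((B (Z (t+h)) (Z (t+h)) - B (Z t) (Z t)) / h - (B (W t) (Z (t+h)) + B (Z t) (W t))) + (B (W t) (Z (t+h)) + B (Z t) (W t))) \<longlongrightarrow> 0 + (B (W t) (Z t) + B (Z t) (W t))) (at_right 0)"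
    by (intro tendsto_add BZ tendsto_const)
  then show "((\<lambda>h. (B (Z (t + h)) (Z (t + h)) - B (Z t) (Z t)) /\<^sub>R h) \<longlongrightarrow> B (W t) (Z t) + B (Z t) (W t)) (at_right 0)"
    by (simp add: divide_inverse mult.commute)
  qed
qed

end

lemma H4chain_props:
  assumes "H4chain f f1 f2 f3 f4"
  shows "H2chain f f1 f2" "continuous_on {0..1} f2" "continuous_on {0..1} f3"
    "x \<in> {0..1} \<Longrightarrow> (f1 has_vector_derivative f2 x) (at x within {0..1})"
    "x \<in> {0..1} \<Longrightarrow> (f2 has_vector_derivative f3 x) (at x within {0..1})"
proof -
  have s: "sq_int f4" and e: "\<And>x. x \<in> {0..1} \<Longrightarrow> f3 x = f3 0 + integral {0..x} f4"
    "\<And>x. x \<in> {0..1} \<Longrightarrow> f2 x = f2 0 + integral {0..x} f3"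
    "\<And>x. x \<in> {0..1} \<Longrightarrow> f1 x = f1 0 + integral {0..x} f2"
    "\<And>x. x \<in> {0..1} \<Longrightarrow> f x = f 0 + integral {0..x} f1"
    using assms unfolding H4chain_def by blast+
  show c3: "continuous_on {0..1} f3" by (rule indefinite_continuous[OF s e(1)])
  show c2: "continuous_on {0..1} f2" by (rule indefinite_continuous[OF sq_int_cont[OF c3] e(2)])
  show "H2chain f f1 f2" unfolding H2chain_def using sq_int_cont[OF c2] e(3,4) by blast
  show "x \<in> {0..1} \<Longrightarrow> (f1 has_vector_derivative f2 x) (at x within {0..1})"
    by (rule indefinite_derivative[OF c2 e(3)])
  show "x \<in> {0..1} \<Longrightarrow> (f2 has_vector_derivative f3 x) (at x within {0..1})"
    by (rule indefinite_derivative[OF c3 e(2)])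
qed

section \<open>Null states and completeness of X\<close>

context tower
begin

lemma Arel_X:
  assumes "Arel \<rho> EI m J b z w"
  shows "z \<in> Xspace" "w \<in> Xspace"
proof -
  obtain f g \<xi> \<eta> u v \<alpha> \<beta> where zw: "z = (f, g, \<xi>, \<eta>)" "w = (u, v, \<alpha>, \<beta>)" by (metis prod_cases4)
  from assms[unfolded Arel_def zw prod.case] obtain f1 f2 f3 f4 g1 g2 h1 h2 where
    f: "H4chain f f1 f2 f3 f4" "f 0 = 0" "f1 0 = 0" and g: "H2chain g g1 g2" "g 0 = 0" "g1 0 = 0"
    and h: "H2chain (\<lambda>x. complex_of_real (EI x) * f2 x) h1 h2" and u: "u = g"
    and v: "\<forall>x\<in>{0..1}. v x = - h2 x / complex_of_real (\<rho> x)" by blast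
  have "H2l f" unfolding H2l_def using H4chain_props(1)[OF f(1)] f by blast
  moreover have "sq_int g" by (rule sq_int_cont[OF H2chain_props(3)[OF g(1)]])
  ultimately show "z \<in> Xspace" by (simp add: zw Xspace_iff)
  have "H2l g" unfolding H2l_def using g by blast
  moreover have "sq_int v"
  proof (rule sq_int_cong)
    have "continuous_on {0..1} (\<lambda>x. - 1 / complex_of_real (\<rho> x))"
      using \<rho>_pos by (intro continuous_intros coeff_cont) (metis less_irrefl of_real_eq_0_iff)
    then show "sq_int (\<lambda>x. (- 1 / complex_of_real (\<rho> x)) * h2 x)"
      by (rule sq_int_cont_mult[OF _ H2chain_props(1)[OF h]])
    show "(- 1 / complex_of_real (\<rho> x)) * h2 x = v x" if "x \<in> {0..1}" for x using v that by simp
  qed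
  ultimately show "w \<in> Xspace" by (simp add: zw u Xspace_iff)
qed

text \<open>X is handled through representatives, so equality in X is a difference of norm zero;
  these substitution rules take the place of a quotient.\<close>

lemma N_eqv:
  assumes "z \<in> Xspace" "w \<in> Xspace" "N (z - w) = 0"
  shows "N z = N w" "v \<in> Xspace \<Longrightarrow> N (z - v) = N (w - v)"
    "v \<in> Xspace \<Longrightarrow> N (v - z) = N (v - w)"
proof -
  show a: "N z = N w" using N_diff_ge[OF assms(1,2)] assms(3) by simp
  assume v: "v \<in> Xspace"
  show "N (z - v) = N (w - v)"
    using N_diff_ge[OF X_diff[OF assms(1) v] X_diff[OF assms(2) v]] assms(3) by simp
  then show "N (v - z) = N (v - w)" using N_diff_commute v assms(1,2) by metis
qed

lemma linf_eqv: "linf L \<Longrightarrow> z \<in> Xspace \<Longrightarrow> w \<in> Xspace \<Longrightarrow> N (z - w) = 0 \<Longrightarrow> L z = L w"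
  using linf_diff[of L z w] linf_bound[of L] X_diff[of z w] by (metis eq_iff_diff_eq_0 mult_zero_right norm_le_zero_iff)

lemma N2_upper:
  obtains K where "K > 0" "\<And>z. z \<in> Xspace \<Longrightarrow> N2 z \<le> K * (l2sq (D2 (fst z)) + l2sq (sg z) + (cmod (s\<xi> z))^2 + (cmod (s\<eta> z))^2)"
proof -
  obtain lo hi where hi: "hi > 0" "\<And>x. x \<in> {0..1} \<Longrightarrow> \<rho> x \<le> hi \<and> EI x \<le> hi"
    using coeff_bounds by metis
  define K where "K = hi + m + J"
  have K: "K > 0" "K \<ge> hi" "K \<ge> m" "K \<ge> J" using hi(1) m_pos J_pos by (auto simp: K_def)
  show ?thesis
  proof (rule that[OF K(1)])
    fix z assume z: "z \<in> Xspace"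
    have s: "sq_int (D2 (fst z))" "sq_int (sg z)" using z H2l_sq by (auto simp: Xspace_iff)
    have i: "integrable I01 (\<lambda>x. EI x * (cmod (D2 (fst z) x))^2)" "integrable I01 (\<lambda>x. \<rho> x * (cmod (sg z x))^2)"
      using rip_integrable[OF z z] by (simp_all add: power2_norm_eq_inner)
    have le: "EI x \<le> K" "\<rho> x \<le> K" if "x \<in> {0..1}" for x using hi(2)[OF that] K by linarith+
    have 1: "(LINT x|I01. EI x * (cmod (D2 (fst z) x))^2) \<le> K * l2sq (D2 (fst z))"
      unfolding l2sq_def integral_mult_right_zero[symmetric]
      using i sq_int_sq[OF s(1)] le by (intro integral_mono) (auto intro!: mult_right_mono)
    have 2: "(LINT x|I01. \<rho> x * (cmod (sg z x))^2) \<le> K * l2sq (sg z)"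
      unfolding l2sq_def integral_mult_right_zero[symmetric]
      using i sq_int_sq[OF s(2)] le by (intro integral_mono) (auto intro!: mult_right_mono)
    have 3: "m * (cmod (s\<xi> z))^2 \<le> K * (cmod (s\<xi> z))^2" "J * (cmod (s\<eta> z))^2 \<le> K * (cmod (s\<eta> z))^2"
      by (auto intro!: mult_right_mono K)
    show "N2 z \<le> K * (l2sq (D2 (fst z)) + l2sq (sg z) + (cmod (s\<xi> z))^2 + (cmod (s\<eta> z))^2)"
      unfolding N2_eq[OF z] using 1 2 3 by (simp add: distrib_left)
  qed
qed

lemma complex_series_tail:
  fixes a :: "nat \<Rightarrow> complex"
  assumes "\<And>n. cmod (a n) \<le> C * (1/2)^n"
  obtains s where "(\<lambda>n. cmod (s - (\<Sum>k<n. a k))) \<longlonglongrightarrow> 0"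
proof -
  have "summable a"
    by (rule summable_comparison_test'[where g="\<lambda>k. C * (1/2)^k" and N=0])
       (use assms in \<open>auto intro!: summable_mult summable_geometric\<close>)
  then have "(\<lambda>n. \<Sum>k<n. a k) \<longlonglongrightarrow> suminf a" by (rule summable_LIMSEQ)
  then have "(\<lambda>n. norm (suminf a - (\<Sum>k<n. a k))) \<longlonglongrightarrow> norm (suminf a - suminf a)"
    by (intro tendsto_intros)
  then show ?thesis by (intro that[of "suminf a"]) simp
qed

text \<open>A geometric rate is all that the gliding hump asks for. The four components converge
  separately; the first is rebuilt by integrating the limit of the second derivatives twice, which
  enforces the clamped conditions at 0.\<close>

lemma X_complete:
  assumes x: "\<And>n. x n \<in> Xspace" and b: "\<And>n. N (x n) \<le> c * (1/2)^n"
  obtains s where "s \<in> Xspace" "(\<lambda>n. N (s - (\<Sum>k<n. x k))) \<longlonglongrightarrow> 0"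
proof -
  obtain C where C: "C > 0"
    "\<And>z. z \<in> Xspace \<Longrightarrow> sqrt (l2sq (D2 (fst z))) \<le> C * N z"
    "\<And>z. z \<in> Xspace \<Longrightarrow> sqrt (l2sq (sg z)) \<le> C * N z"
    "\<And>z. z \<in> Xspace \<Longrightarrow> cmod (s\<xi> z) \<le> C * N z"
    "\<And>z. z \<in> Xspace \<Longrightarrow> cmod (s\<eta> z) \<le> C * N z"
    using comp_bounds by blast
  define c' where "c' = C * c"
  have cc: "C * N (x n) \<le> c' * (1/2)^n" for n
    using mult_left_mono[OF b[of n], of C] C(1) by (simp add: c'_def)
  have sq: "l \<le> c'^2 * (1/4)^n" if "sqrt l \<le> c' * (1/2)^n" "l \<ge> 0" for l n
  proof -
    have "l = (sqrt l)^2" using that by simp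
    also have "\<dots> \<le> (c' * (1/2)^n)^2" by (intro power_mono that) (use that in auto)
    also have "\<dots> = c'^2 * (1/4)^n" by (simp add: power_mult_distrib power2_eq_square flip: power_mult_distrib)
    finally show ?thesis .
  qed
  have H: "H2l (fst (x n))" "sq_int (sg (x n))" for n using x by (auto simp: Xspace_iff)
  obtain p where p: "sq_int p" "(\<lambda>n. l2sq (\<lambda>y. p y - (\<Sum>k<n. D2 (fst (x k)) y))) \<longlonglongrightarrow> 0"
    using l2_series_complete[of "\<lambda>k. D2 (fst (x k))" "c'^2", OF H2l_sq[OF H(1)] sq[OF order_trans[OF C(2)[OF x] cc] l2sq_nonneg]] by blast
  obtain g where g: "sq_int g" "(\<lambda>n. l2sq (\<lambda>y. g y - (\<Sum>k<n. sg (x k) y))) \<longlonglongrightarrow> 0"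
    using l2_series_complete[of "\<lambda>k. sg (x k)" "c'^2", OF H(2) sq[OF order_trans[OF C(3)[OF x] cc] l2sq_nonneg]] by blast
  obtain \<xi> where \<xi>: "(\<lambda>n. cmod (\<xi> - (\<Sum>k<n. s\<xi> (x k)))) \<longlonglongrightarrow> 0"
    using complex_series_tail[of "\<lambda>k. s\<xi> (x k)" c', OF order_trans[OF C(4)[OF x] cc]] by blast
  obtain \<eta> where \<eta>: "(\<lambda>n. cmod (\<eta> - (\<Sum>k<n. s\<eta> (x k)))) \<longlonglongrightarrow> 0"
    using complex_series_tail[of "\<lambda>k. s\<eta> (x k)" c', OF order_trans[OF C(5)[OF x] cc]] by blast
  define f1 where "f1 y = integral {0..y} p" for y
  define f where "f y = integral {0..y} f1" for y
  have fch: "H2chain f f1 p" unfolding H2chain_def using p(1) by (auto simp: f_def f1_def)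
  have f0: "f 0 = 0" "f1 0 = 0" by (auto simp: f_def f1_def)
  define s where "s = (f, g, \<xi>, \<eta>)"
  have sX: "s \<in> Xspace" unfolding Xspace_iff s_def H2l_def using fch f0 g(1) by auto
  define S where "S n = (\<Sum>k<n. x k)" for n
  have SX: "S n \<in> Xspace" for n unfolding S_def by (intro X_sum x)
  have Sg: "sg (S n) y = (\<Sum>k<n. sg (x k) y)" "s\<xi> (S n) = (\<Sum>k<n. s\<xi> (x k))" "s\<eta> (S n) = (\<Sum>k<n. s\<eta> (x k))" for n y
    unfolding S_def by (induction n) (simp_all add: zero_fun_def xadd_sel del: fst_add snd_add)
  have SH: "H2chain (fst (S n)) (\<lambda>y. \<Sum>k<n. D1 (fst (x k)) y) (\<lambda>y. \<Sum>k<n. D2 (fst (x k)) y)" for n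
  proof (induction n)
    case 0
    show ?case by (simp add: S_def zero_fun_def H2chain_def sq_int_cont)
  next
    case (Suc n)
    have "fst (S (Suc n)) = (\<lambda>y. fst (S n) y + fst (x n) y)" by (simp add: S_def xadd_sel del: fst_add)
    then show ?case using H2chain_add[OF Suc H2l_D(1)[OF H(1)[of n]]] by simp
  qed
  obtain K where K: "K > 0" "\<And>z. z \<in> Xspace \<Longrightarrow> N2 z \<le> K * (l2sq (D2 (fst z)) + l2sq (sg z) + (cmod (s\<xi> z))^2 + (cmod (s\<eta> z))^2)"
    using N2_upper by blast
  define r where "r n = K * (l2sq (\<lambda>y. p y - (\<Sum>k<n. D2 (fst (x k)) y)) + l2sq (\<lambda>y. g y - (\<Sum>k<n. sg (x k) y))
     + (cmod (\<xi> - (\<Sum>k<n. s\<xi> (x k))))^2 + (cmod (\<eta> - (\<Sum>k<n. s\<eta> (x k))))^2)" for n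
  have r0: "r \<longlonglongrightarrow> K * (0 + 0 + 0^2 + 0^2)" unfolding r_def by (intro tendsto_intros p g \<xi> \<eta>)
  have sub: "fst (z - w) = (\<lambda>y. fst z y + (-1) * fst w y)" "sg (z - w) = (\<lambda>y. sg z y - sg w y)"
    "s\<xi> (z - w) = s\<xi> z - s\<xi> w" "s\<eta> (z - w) = s\<eta> z - s\<eta> w" for z w :: state
    by (auto simp: fun_diff_def)
  have le: "N2 (s - S n) \<le> r n" for n
  proof -
    have "H2chain (fst (s - S n)) (\<lambda>y. f1 y + (-1) * (\<Sum>k<n. D1 (fst (x k)) y)) (\<lambda>y. p y + (-1) * (\<Sum>k<n. D2 (fst (x k)) y))"
      unfolding sub using H2chain_add[OF fch H2chain_scale[OF SH, of "-1"]] by (simp add: s_def)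
    note ch = D2_AE[OF this]
    have "l2sq (D2 (fst (s - S n))) = l2sq (\<lambda>y. p y - (\<Sum>k<n. D2 (fst (x k)) y))"
    proof (rule l2sq_cong_AE)
      show "AE y in I01. D2 (fst (s - S n)) y = p y - (\<Sum>k<n. D2 (fst (x k)) y)" using ch(2) by simp
    qed (intro ch(1) sq_int_diff p sq_int_sum H2l_sq H)+
    moreover have "l2sq (sg (s - S n)) = l2sq (\<lambda>y. g y - (\<Sum>k<n. sg (x k) y))"
      unfolding sub Sg by (simp add: s_def)
    ultimately show ?thesis
      using K(2)[OF X_diff[OF sX SX[of n]]] unfolding r_def sub(3,4) Sg by (simp add: s_def)
  qed
  have "(\<lambda>n. sqrt (r n)) \<longlonglongrightarrow> sqrt 0" using tendsto_real_sqrt[OF r0] by simp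
  then have lim: "(\<lambda>n. sqrt (r n)) \<longlonglongrightarrow> 0" by simp
  have "(\<lambda>n. N (s - S n)) \<longlonglongrightarrow> 0"
  proof (rule tendsto_sandwich[OF _ _ tendsto_const lim])
    show "\<forall>\<^sub>F n in sequentially. 0 \<le> N (s - S n)"
      by (intro always_eventually allI N_nonneg X_diff sX SX)
    show "\<forall>\<^sub>F n in sequentially. N (s - S n) \<le> sqrt (r n)"
      unfolding N_def by (intro always_eventually allI real_sqrt_le_mono le)
  qed
  then show ?thesis using that[OF sX] by (simp add: S_def)
qed

end

section \<open>The semigroup laws modulo null states\<close>

locale tower_semigroup = tower +
  fixes T :: "real \<Rightarrow> state \<Rightarrow> state"
  assumes gen: "generated_by_A \<rho> EI m J b T"
begin

lemmas C0 = gen[unfolded generated_by_A_def C0_semigroup_def, THEN conjunct1]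

lemma T_X: "t \<ge> 0 \<Longrightarrow> z \<in> Xspace \<Longrightarrow> T t z \<in> Xspace"
  using C0[THEN conjunct1] by blast

lemma T_lin:
  assumes t: "t \<ge> 0" and z: "z \<in> Xspace" "z' \<in> Xspace"
  shows "N (T t (xscale a z + xscale c z') - (xscale a (T t z) + xscale c (T t z'))) = 0"
proof -
  have "xeq \<rho> EI m J (T t (xadd (xscale a z) (xscale c z'))) (xadd (xscale a (T t z)) (xscale c (T t z')))"
    using C0[THEN conjunct2, THEN conjunct1] t z by blast
  then show ?thesis unfolding xadd_eq
    by (subst (asm) xeq_iff) (intro X_add X_scale T_X t z | assumption)+
qed

lemma T_0: "z \<in> Xspace \<Longrightarrow> N (T 0 z - z) = 0"
  using C0[THEN conjunct2, THEN conjunct2, THEN conjunct2, THEN conjunct1] xeq_iff[of "T 0 z" z] T_X[of 0 z]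
  by simp

lemma T_plus: "t \<ge> 0 \<Longrightarrow> s \<ge> 0 \<Longrightarrow> z \<in> Xspace \<Longrightarrow> N (T (t + s) z - T t (T s z)) = 0"
  using C0[THEN conjunct2, THEN conjunct2, THEN conjunct2, THEN conjunct2, THEN conjunct1]
    xeq_iff[of "T (t+s) z" "T t (T s z)"] T_X by simp

lemma T_bdd:
  assumes t: "t \<ge> 0"
  obtains C where "C > 0" "\<And>z. z \<in> Xspace \<Longrightarrow> N (T t z) \<le> C * N z"
proof -
  obtain C where C: "\<And>z. z \<in> Xspace \<Longrightarrow> N2 (T t z) \<le> C * N2 z"
    using C0[THEN conjunct2, THEN conjunct2, THEN conjunct1] t by blast
  have "N (T t z) \<le> sqrt (\<bar>C\<bar> + 1) * N z" if z: "z \<in> Xspace" for z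
  proof -
    have "N2 (T t z) \<le> (\<bar>C\<bar> + 1) * N2 z"
      using C[OF z] N2_nonneg[OF z] mult_right_mono[of C "\<bar>C\<bar> + 1" "N2 z"] by linarith
    then show ?thesis unfolding N_def by (simp flip: real_sqrt_mult)
  qed
  then show ?thesis by (intro that[of "sqrt (\<bar>C\<bar> + 1)"]) (auto simp: add_nonneg_pos)
qed

lemma T_right_cont:
  assumes z: "z \<in> Xspace"
  shows "((\<lambda>h. N (T h z - z)) \<longlongrightarrow> 0) (at_right 0)"
proof -
  have "((\<lambda>h. N2 (xdiff (T h z) z)) \<longlongrightarrow> 0) (at_right 0)"
    using C0[THEN conjunct2, THEN conjunct2, THEN conjunct2, THEN conjunct2, THEN conjunct2] z by blast
  from tendsto_real_sqrt[OF this] show ?thesis by (simp add: N_def xdiff_eq)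
qed

lemma T_diff:
  assumes t: "t \<ge> 0" and z: "z \<in> Xspace" "z' \<in> Xspace"
  shows "N (T t (z - z') - (T t z - T t z')) = 0"
  using T_lin[OF t z, of 1 "-1"] by (simp add: xscale_m1)

lemma T_scale:
  assumes t: "t \<ge> 0" and z: "z \<in> Xspace"
  shows "N (T t (xscale c z) - xscale c (T t z)) = 0"
  using T_lin[OF t z z, of c 0] by simp

lemma N_T_diff:
  assumes t: "t \<ge> 0" and z: "z \<in> Xspace" "z' \<in> Xspace"
  shows "N (T t z - T t z') = N (T t (z - z'))"
  using N_eqv(1)[OF _ _ T_diff[OF t z]] T_X[OF t] z by (simp add: X_diff)

end

section \<open>Uniform boundedness on bounded time intervals and strong continuity\<close>

context tower_semigroup
begin

definition opn :: "real \<Rightarrow> real" where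
  "opn t = (SUP u\<in>{u\<in>Xspace. N u \<le> 1}. N (T t u))"

lemma opn_bdd: "t \<ge> 0 \<Longrightarrow> bdd_above ((\<lambda>u. N (T t u)) ` {u\<in>Xspace. N u \<le> 1})"
proof -
  assume t: "t \<ge> 0"
  obtain C where C: "C > 0" "\<And>z. z \<in> Xspace \<Longrightarrow> N (T t z) \<le> C * N z" using T_bdd[OF t] by blast
  show ?thesis
  proof (rule bdd_aboveI2)
    fix u assume "u \<in> {u\<in>Xspace. N u \<le> 1}"
    then have "N (T t u) \<le> C * N u" "C * N u \<le> C * 1" using C by (auto intro!: mult_left_mono)
    then show "N (T t u) \<le> C" by simp
  qed
qed

lemma opn_upper: "t \<ge> 0 \<Longrightarrow> u \<in> Xspace \<Longrightarrow> N u \<le> 1 \<Longrightarrow> N (T t u) \<le> opn t"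
  unfolding opn_def by (rule cSUP_upper[OF _ opn_bdd]) auto

lemma opn_le:
  assumes t: "t \<ge> 0" and z: "z \<in> Xspace"
  shows "N (T t z) \<le> opn t * N z"
proof (cases "N z = 0")
  case True
  obtain C where C: "C > 0" "\<And>z. z \<in> Xspace \<Longrightarrow> N (T t z) \<le> C * N z" using T_bdd[OF t] by blast
  show ?thesis using C(2)[OF z] True by simp
next
  case False
  then have pos: "N z > 0" using N_nonneg[OF z] by simp
  define u where "u = xscale (complex_of_real (1 / N z)) z"
  have u: "u \<in> Xspace" "N u = 1" using z pos by (auto simp: u_def N_scale norm_divide)
  have "N (T t u) = N (xscale (complex_of_real (1 / N z)) (T t z))"
    unfolding u_def by (rule N_eqv(1)[OF _ _ T_scale[OF t z]]) (intro T_X t X_scale z)+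
  also have "\<dots> = N (T t z) / N z" using pos by (simp add: N_scale T_X t z norm_divide)
  finally have "N (T t z) / N z \<le> opn t" using opn_upper[OF t u(1)] u(2) by simp
  then show ?thesis using pos by (simp add: divide_le_eq)
qed

text \<open>Sokal's gliding-hump proof of the uniform boundedness principle.\<close>

lemma local_bounded:
  obtains d M where "d > 0" "M \<ge> 1" "\<And>t z. 0 \<le> t \<Longrightarrow> t \<le> d \<Longrightarrow> z \<in> Xspace \<Longrightarrow> N (T t z) \<le> M * N z"
proof -
  have "\<exists>d>0. \<exists>M. \<forall>t. 0 \<le> t \<and> t \<le> d \<longrightarrow> opn t \<le> M"
  proof (rule ccontr)
    assume "\<not> ?thesis"
    then have neg: "\<And>d M. d > 0 \<Longrightarrow> \<exists>t. 0 \<le> t \<and> t \<le> d \<and> opn t > M" by (meson not_le_imp_less)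
    \<comment> \<open>The factor 3^n compensates the size 3^-n of the n-th hump; the factor 4 is the
      inverse of the fraction 3/4 - 1/2 that survives the later humps.\<close>
    have "\<exists>t. 0 \<le> t \<and> t \<le> 1 / (real n + 1) \<and> opn t > 4 * 3^n * (real n + 1)" for n :: nat
      by (rule neg) simp
    then obtain \<tau> where \<tau>: "\<And>n. 0 \<le> \<tau> n" "\<And>n. \<tau> n \<le> 1 / (real n + 1)" "\<And>n. opn (\<tau> n) > 4 * 3^n * (real n + 1)"
      by metis
    have op0: "opn (\<tau> n) > 0" for n using \<tau>(3)[of n] by (rule le_less_trans[rotated]) simp
    have "\<exists>u. u \<in> Xspace \<and> N u \<le> 1 \<and> N (T (\<tau> n) u) > 3/4 * opn (\<tau> n)" for n
    proof -
      have "3/4 * opn (\<tau> n) < opn (\<tau> n)" using op0 by simp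
      then have "3/4 * opn (\<tau> n) < (SUP u\<in>{u\<in>Xspace. N u \<le> 1}. N (T (\<tau> n) u))" by (simp only: opn_def)
      moreover have "0 \<in> {u\<in>Xspace. N u \<le> 1}" by simp
      then have "{u\<in>Xspace. N u \<le> 1} \<noteq> {}" by blast
      ultimately have "\<exists>u\<in>{u\<in>Xspace. N u \<le> 1}. 3/4 * opn (\<tau> n) < N (T (\<tau> n) u)"
        using less_cSUP_iff[OF _ opn_bdd[OF \<tau>(1)]] by blast
      then show ?thesis by blast
    qed
    then obtain u where u: "\<And>n. u n \<in> Xspace" "\<And>n. N (u n) \<le> 1" "\<And>n. N (T (\<tau> n) (u n)) > 3/4 * opn (\<tau> n)"
      by metis
    define dl where "dl n = xscale (complex_of_real ((1/3)^n)) (u n)" for n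
    have dX: "dl n \<in> Xspace" for n unfolding dl_def by (rule X_scale[OF u(1)])
    have dN: "N (dl n) \<le> (1/3)^n" for n
      using mult_left_mono[OF u(2)[of n], of "(1/3)^n"] by (simp add: dl_def N_scale[OF u(1)] norm_power norm_divide)
    have dT: "N (T (\<tau> n) (dl n)) \<ge> (1/3)^n * (3/4 * opn (\<tau> n))" for n
    proof -
      have "N (T (\<tau> n) (dl n)) = N (xscale (complex_of_real ((1/3)^n)) (T (\<tau> n) (u n)))"
        unfolding dl_def by (rule N_eqv(1)[OF _ _ T_scale[OF \<tau>(1) u(1)]]) (intro T_X \<tau> X_scale u)+
      also have "\<dots> = (1/3)^n * N (T (\<tau> n) (u n))"
        by (simp add: N_scale T_X \<tau> u norm_power norm_divide)
      finally show ?thesis using mult_left_mono[OF less_imp_le[OF u(3)[of n]], of "(1/3)^n"] by simp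
    qed
    \<comment> \<open>The sign of each hump is chosen so that the image under
      \<open>T (\<tau> n)\<close> is at least as large as that of the hump alone: the hump is half
      the difference of the two candidates, so one of them qualifies.\<close>
    define s where "s = rec_nat 0 (\<lambda>n s. if N (T (\<tau> n) (s + dl n)) \<ge> N (T (\<tau> n) (dl n)) then s + dl n else s - dl n)"
    have s0: "s 0 = 0" by (simp add: s_def)
    have sS: "s (Suc n) = (if N (T (\<tau> n) (s n + dl n)) \<ge> N (T (\<tau> n) (dl n)) then s n + dl n else s n - dl n)" for n
      by (simp add: s_def)
    have sX: "s n \<in> Xspace" for n
      by (induction n) (auto simp: s0 sS intro!: X_add X_diff dX)
    have sT: "N (T (\<tau> n) (s (Suc n))) \<ge> N (T (\<tau> n) (dl n))" for n
    proof (cases "N (T (\<tau> n) (s n + dl n)) \<ge> N (T (\<tau> n) (dl n))")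
      case True then show ?thesis by (simp add: sS)
    next
      case False
      have "2 * N (T (\<tau> n) (dl n)) = N (xscale 2 (T (\<tau> n) (dl n)))"
        by (simp add: N_scale T_X \<tau> dX)
      also have "\<dots> = N (T (\<tau> n) (xscale 2 (dl n)))"
        by (rule N_eqv(1)[OF _ _ T_scale[OF \<tau>(1) dX], symmetric]) (intro T_X \<tau> X_scale dX)+
      also have "xscale 2 (dl n) = (s n + dl n) - (s n - dl n)"
      proof -
        have "xscale 2 (dl n) = dl n + dl n" by (rule state_eqI) auto
        then show ?thesis by simp
      qed
      also have "N (T (\<tau> n) ((s n + dl n) - (s n - dl n))) = N (T (\<tau> n) (s n + dl n) - T (\<tau> n) (s n - dl n))"
        by (rule N_T_diff[symmetric, OF \<tau>(1)]) (intro X_add X_diff sX dX)+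
      also have "\<dots> \<le> N (T (\<tau> n) (s n + dl n)) + N (T (\<tau> n) (s n - dl n))"
        by (intro N_diff T_X \<tau> X_add X_diff sX dX)
      finally show ?thesis using False by (simp add: sS)
    qed
    define x where "x n = s (Suc n) - s n" for n
    have xdl: "x n = dl n \<or> x n = - dl n" for n by (simp add: x_def sS)
    have xX: "x n \<in> Xspace" for n unfolding x_def by (intro X_diff sX)
    have xN: "N (x n) \<le> (1/3)^n" for n using xdl[of n] dN[of n] N_minus[OF dX, of n] by auto
    have xN2: "N (x n) \<le> 1 * (1/2)^n" for n
      using xN[of n] power_mono[of "1/3::real" "1/2" n] by simp
    have sum_x: "(\<Sum>k<n. x k) = s n" for n unfolding x_def by (simp add: sum_lessThan_telescope s0)
    obtain q where q: "q \<in> Xspace" "(\<lambda>n. N (q - s n)) \<longlonglongrightarrow> 0"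
      using X_complete[OF xX xN2] unfolding sum_x by blast
    have geo: "N (s (n + k) - s n) \<le> 3/2 * (1/3)^n * (1 - (1/3)^k)" for n k
    proof (induction k)
      case (Suc k)
      have "N (s (n + Suc k) - s n) \<le> N (x (n + k)) + N (s (n + k) - s n)"
        using N_add[OF xX[of "n+k"] X_diff[OF sX[of "n+k"] sX[of n]]] by (simp add: x_def)
      also have "\<dots> \<le> (1/3)^(n+k) + 3/2 * (1/3)^n * (1 - (1/3)^k)" using xN Suc by (intro add_mono)
      also have "\<dots> = 3/2 * (1/3)^n * (1 - (1/3)^Suc k)" by (simp add: power_add algebra_simps diff_divide_distrib)
      finally show ?case .
    qed simp
    \<comment> \<open>At index \<open>Suc n\<close> this is half of 3^-n, strictly less than the
      fraction 3/4 guaranteed by the n-th hump.\<close>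
    have tail: "N (q - s n) \<le> 3/2 * (1/3)^n" for n
    proof (rule LIMSEQ_le_const)
      have "(\<lambda>k. N (q - s (k + n)) + 3/2 * (1/3)^n) \<longlonglongrightarrow> 0 + 3/2 * (1/3)^n"
        by (intro tendsto_add tendsto_const LIMSEQ_ignore_initial_segment[OF q(2)])
      then show "(\<lambda>k. N (q - s (k + n)) + 3/2 * (1/3)^n) \<longlonglongrightarrow> 3/2 * (1/3)^n" by simp
      show "\<exists>K. \<forall>k\<ge>K. N (q - s n) \<le> N (q - s (k + n)) + 3/2 * (1/3)^n"
      proof (intro exI[of _ 0] allI impI)
        fix k :: nat
        have "3/2 * (1/3)^n * (1 - (1/3)^k) \<le> 3/2 * (1/3)^n * (1::real)" by (intro mult_left_mono) auto
        then show "N (q - s n) \<le> N (q - s (k + n)) + 3/2 * (1/3)^n"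
          using N_triangle[OF q(1) sX[of n] sX[of "k+n"]] geo[of n k, unfolded add.commute[of n k]] by linarith
      qed
    qed
    have big: "N (T (\<tau> n) q) \<ge> real n + 1" for n
    proof -
      have "N (T (\<tau> n) (s (Suc n)) - T (\<tau> n) q) = N (T (\<tau> n) (s (Suc n) - q))"
        by (rule N_T_diff[OF \<tau>(1) sX q(1)])
      also have "\<dots> \<le> opn (\<tau> n) * N (s (Suc n) - q)"
        by (rule opn_le[OF \<tau>(1) X_diff[OF sX q(1)]])
      also have "\<dots> \<le> opn (\<tau> n) * (3/2 * (1/3)^Suc n)"
        using tail[of "Suc n"] op0[of n] by (intro mult_left_mono) (auto simp: N_diff_commute[OF sX q(1)])
      finally have 1: "N (T (\<tau> n) (s (Suc n)) - T (\<tau> n) q) \<le> 1/2 * ((1/3)^n * opn (\<tau> n))" by (simp add: mult.commute)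
      have 2: "N (T (\<tau> n) (s (Suc n))) \<ge> 3/4 * ((1/3)^n * opn (\<tau> n))"
        using dT[of n] sT[of n] by simp
      have 3: "(1/3)^n * opn (\<tau> n) \<ge> (1/3)^n * (4 * 3^n * (real n + 1))"
        by (intro mult_left_mono less_imp_le[OF \<tau>(3)]) auto
      have 4: "(1/3)^n * (4 * 3^n * (real n + 1)) = 4 * (real n + 1)"
        by (simp add: power_one_over)
      have 5: "N (T (\<tau> n) (s (Suc n))) - N (T (\<tau> n) q) \<le> N (T (\<tau> n) (s (Suc n)) - T (\<tau> n) q)"
        using N_diff_ge[OF T_X[OF \<tau>(1)[of n] sX[of "Suc n"]] T_X[OF \<tau>(1)[of n] q(1)]] by simp
      have 6: "4 * (real n + 1) \<le> (1/3)^n * opn (\<tau> n)" using 3 unfolding 4 .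
      have "a \<ge> r" if "d \<le> 1/2 * y" "p \<ge> 3/4 * y" "p - a \<le> d" "4 * r \<le> y" for a d p r y :: real
        using that by linarith
      from this[OF 1 2 5 6] show ?thesis .
    qed
    \<comment> \<open>Strong continuity at 0 bounds the orbit of q for short times, and \<tau> n
      tends to 0; this contradicts \<open>big\<close>.\<close>
    have "eventually (\<lambda>h. dist (N (T h q - q)) 0 < 1) (at_right 0)"
      using T_right_cont[OF q(1)] by (rule tendstoD) simp
    then obtain d where d: "d > 0" "\<And>h. 0 < h \<Longrightarrow> h < d \<Longrightarrow> dist (N (T h q - q)) 0 < 1"
      unfolding eventually_at_right_field by blast
    have bd: "N (T h q) \<le> N q + 1" if "0 \<le> h" "h < d" for h
    proof -
      have "N (T h q - q) \<le> 1"
        using d(2)[of h] T_0[OF q(1)] that by (cases "h = 0") (auto simp: dist_norm)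
      moreover have "N (T h q) - N q \<le> N (T h q - q)"
        using N_diff_ge[OF T_X[OF that(1) q(1)] q(1)] by simp
      ultimately show ?thesis by simp
    qed
    obtain n1 :: nat where n1: "1 / d < real n1" using reals_Archimedean2 by blast
    obtain n2 :: nat where n2: "N q + 1 < real n2" using reals_Archimedean2 by blast
    define n where "n = max n1 n2"
    have "1 / d < real n + 1" using n1 by (simp add: n_def)
    then have "1 / (real n + 1) < d" using d(1) by (simp add: field_simps)
    then have "\<tau> n < d" using \<tau>(2)[of n] by linarith
    then have "N (T (\<tau> n) q) \<le> N q + 1" by (intro bd \<tau>)
    moreover have "real n2 \<le> real n" by (simp add: n_def)
    ultimately show False using big[of n] n2 by linarith
  qed
  then obtain d M where dM: "d > 0" "\<And>t. 0 \<le> t \<Longrightarrow> t \<le> d \<Longrightarrow> opn t \<le> M" by blast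
  show ?thesis
  proof (rule that[of d "max M 1"])
    fix t z assume t: "0 \<le> t" "t \<le> d" and z: "z \<in> Xspace"
    have "N (T t z) \<le> opn t * N z" by (rule opn_le[OF t(1) z])
    also have "\<dots> \<le> max M 1 * N z"
      using dM(2)[OF t] by (intro mult_right_mono N_nonneg z) auto
    finally show "N (T t z) \<le> max M 1 * N z" .
  qed (use dM in auto)
qed

lemma finite_time_bounded:
  obtains M where "M \<ge> 1" "\<And>t z. 0 \<le> t \<Longrightarrow> t \<le> S \<Longrightarrow> z \<in> Xspace \<Longrightarrow> N (T t z) \<le> M * N z"
proof -
  obtain d M where dM: "d > 0" "M \<ge> 1" "\<And>t z. 0 \<le> t \<Longrightarrow> t \<le> d \<Longrightarrow> z \<in> Xspace \<Longrightarrow> N (T t z) \<le> M * N z"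
    using local_bounded by blast
  have k: "N (T t z) \<le> M^k * N z" if "0 \<le> t" "t \<le> real k * d" "z \<in> Xspace" for k t z
    using that
  proof (induction k arbitrary: t z)
    case 0
    then have "t = 0" by simp
    then show ?case using N_eqv(1)[OF _ _ T_0] T_X[of 0 z] 0 by simp
  next
    case (Suc k)
    show ?case
    proof (cases "t \<le> real k * d")
      case True
      have "N (T t z) \<le> M^k * N z" by (rule Suc.IH[OF Suc.prems(1) True Suc.prems(3)])
      also have "\<dots> \<le> M^Suc k * N z"
        using dM(2) by (intro mult_right_mono power_increasing N_nonneg Suc.prems) auto
      finally show ?thesis .
    next
      case False
      have r: "0 \<le> t - real k * d" "t - real k * d \<le> d" using False Suc.prems by (auto simp: algebra_simps)
      have kd: "0 \<le> real k * d" using dM(1) by simp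
      have "N (T t z) = N (T (real k * d) (T (t - real k * d) z))"
        using N_eqv(1)[OF _ _ T_plus[OF kd r(1) Suc.prems(3)]] Suc.prems T_X kd r by simp
      also have "\<dots> \<le> M^k * N (T (t - real k * d) z)"
        by (intro Suc.IH kd order_refl T_X r Suc.prems)
      also have "\<dots> \<le> M^k * (M * N z)"
        using dM(2) by (intro mult_left_mono dM(3) r Suc.prems) auto
      finally show ?thesis by (simp add: mult.assoc mult.left_commute)
    qed
  qed
  obtain n :: nat where n: "S / d < real n" using reals_Archimedean2 by blast
  then have "S \<le> real n * d" using dM(1) by (simp add: field_simps)
  then show ?thesis using k[of _ n] dM(2) by (intro that[of "M^n"]) (auto intro: one_le_power)
qed

text \<open>\<open>T r - T s = T s (T (r - s) - I)\<close> reduces continuity at t, from both sides,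
  to right continuity at 0. From the left this needs a bound on T s that is uniform in s.\<close>

lemma T_contX:
  assumes z: "z \<in> Xspace"
  shows "contX (\<lambda>t. T t z)"
  unfolding contX_def
proof (intro conjI allI impI)
  show "T t z \<in> Xspace" if "0 \<le> t" for t using T_X[OF that z] .
  fix t :: real assume t: "0 \<le> t"
  obtain M where M: "M \<ge> 1" "\<And>s z. 0 \<le> s \<Longrightarrow> s \<le> t + 1 \<Longrightarrow> z \<in> Xspace \<Longrightarrow> N (T s z) \<le> M * N z"
    using finite_time_bounded[of "t+1"] by blast
  have le: "N (T r z - T s z) \<le> M * N (T (r - s) z - z)" if rs: "0 \<le> s" "s \<le> r" "r \<le> t + 1" for r s
  proof -
    have rs': "0 \<le> r - s" "0 \<le> r" using rs by auto
    have "N (T (s + (r - s)) z - T s (T (r - s) z)) = 0" by (rule T_plus[OF rs(1) rs'(1) z])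
    then have "N (T r z - T s z) = N (T s (T (r - s) z) - T s z)"
      using N_eqv(2)[OF T_X[OF rs'(2) z] T_X[OF rs(1) T_X[OF rs'(1) z]] _ T_X[OF rs(1) z]] by simp
    also have "\<dots> = N (T s (T (r - s) z - z))"
      by (rule N_T_diff[OF rs(1) T_X[OF rs'(1) z] z])
    also have "\<dots> \<le> M * N (T (r - s) z - z)"
      using rs by (intro M(2) X_diff T_X z) auto
    finally show ?thesis .
  qed
  show "((\<lambda>s. N (T s z - T t z)) \<longlongrightarrow> 0) (at t within {0..})"
  proof (rule tendstoI)
    fix e :: real assume e: "e > 0"
    have "eventually (\<lambda>h. dist (N (T h z - z)) 0 < e / M) (at_right 0)"
      using M(1) e by (intro tendstoD[OF T_right_cont[OF z]]) simp
    then obtain d where d: "d > 0" "\<And>h. 0 < h \<Longrightarrow> h < d \<Longrightarrow> N (T h z - z) < e / M"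
      unfolding eventually_at_right_field dist_real_def by fastforce
    have small: "M * N (T h z - z) < e" if "0 \<le> h" "h < d" for h
    proof -
      have "N (T h z - z) < e / M"
        using d(2)[of h] T_0[OF z] that e M(1) by (cases "h = 0") auto
      then show ?thesis using M(1) by (simp add: field_simps)
    qed
    show "\<forall>\<^sub>F s in at t within {0..}. dist (N (T s z - T t z)) 0 < e"
      unfolding eventually_at
    proof (intro exI[of _ "min d 1"] conjI ballI impI)
      show "0 < min d 1" using d by simp
      fix s :: real assume s: "s \<in> {0..}" "s \<noteq> t \<and> dist s t < min d 1"
      then have s': "0 \<le> s" "\<bar>s - t\<bar> < d" "\<bar>s - t\<bar> < 1" by (auto simp: dist_real_def)
      have "N (T s z - T t z) < e"
      proof (cases "s \<le> t")
        case True
        have "N (T s z - T t z) = N (T t z - T s z)" by (rule N_diff_commute) (intro T_X z t s')+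
        also have "\<dots> \<le> M * N (T (t - s) z - z)" by (rule le) (use True s' in auto)
        also have "\<dots> < e" by (rule small) (use True s' in auto)
        finally show ?thesis .
      next
        case False
        have "N (T s z - T t z) \<le> M * N (T (s - t) z - z)" by (rule le) (use False s' t in auto)
        also have "\<dots> < e" by (rule small) (use False s' in auto)
        finally show ?thesis .
      qed
      then show "dist (N (T s z - T t z)) 0 < e"
        using N_nonneg[OF X_diff[OF T_X[OF s'(1) z] T_X[OF t z]]] by (simp add: dist_real_def)
    qed
  qed
qed

lemma generator:
  assumes "z \<in> Xspace" "w \<in> Xspace"
  shows "((\<lambda>h. N (xscale (complex_of_real (1 / h)) (T h z - z) - w)) \<longlongrightarrow> 0) (at_right 0) \<longleftrightarrow> Agraph \<rho> EI m J b z w"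
proof -
  have "((\<lambda>h. N2 (xdiff (xscale (complex_of_real (1 / h)) (xdiff (T h z) z)) w)) \<longlongrightarrow> 0) (at_right 0)
        \<longleftrightarrow> Agraph \<rho> EI m J b z w"
    using gen[unfolded generated_by_A_def, THEN conjunct2] assms by blast
  moreover have "((\<lambda>h. N2 (xscale (complex_of_real (1 / h)) (T h z - z) - w)) \<longlongrightarrow> 0) (at_right 0) \<longleftrightarrow>
     ((\<lambda>h. N (xscale (complex_of_real (1 / h)) (T h z - z) - w)) \<longlongrightarrow> 0) (at_right 0)"
  proof
    assume "((\<lambda>h. N2 (xscale (complex_of_real (1 / h)) (T h z - z) - w)) \<longlongrightarrow> 0) (at_right 0)"
    from tendsto_real_sqrt[OF this]
    show "((\<lambda>h. N (xscale (complex_of_real (1 / h)) (T h z - z) - w)) \<longlongrightarrow> 0) (at_right 0)" by (simp add: N_def)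
  next
    assume "((\<lambda>h. N (xscale (complex_of_real (1 / h)) (T h z - z) - w)) \<longlongrightarrow> 0) (at_right 0)"
    from tendsto_power[OF this, of 2]
    have "((\<lambda>h. (N (xscale (complex_of_real (1 / h)) (T h z - z) - w))^2) \<longlongrightarrow> 0) (at_right 0)" by simp
    then show "((\<lambda>h. N2 (xscale (complex_of_real (1 / h)) (T h z - z) - w)) \<longlongrightarrow> 0) (at_right 0)"
    proof (rule Lim_transform_eventually)
      show "\<forall>\<^sub>F h in at_right 0. (N (xscale (complex_of_real (1 / h)) (T h z - z) - w))^2 = N2 (xscale (complex_of_real (1 / h)) (T h z - z) - w)"
        unfolding eventually_at_filter
        by (intro always_eventually allI impI N_sq X_diff X_scale T_X assms) auto
    qed
  qed
  ultimately show ?thesis by (simp only: xdiff_eq)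
qed

text \<open>\<open>T t\<close> maps the difference quotient of z0 to that of the orbit at time t, so
  the generator applies to \<open>T t z0\<close> with value \<open>T t w0\<close>.
  \<open>Agraph\<close> then supplies representatives on which A acts exactly. Since the semigroup
  laws hold modulo null states, most of the work is to carry limits across differences of norm
  zero.\<close>

lemma trajectory_exists:
  assumes A: "Arel \<rho> EI m J b z0 w0"
  obtains Z W where "traj Z W" "\<And>t. t \<ge> 0 \<Longrightarrow> N (T t z0 - Z t) = 0" "\<And>t. t \<ge> 0 \<Longrightarrow> N (T t w0 - W t) = 0"
proof -
  note X0 = Arel_X[OF A]
  have "xeq \<rho> EI m J z z" if "z \<in> Xspace" for z using that by (simp add: xeq_iff)
  then have "Agraph \<rho> EI m J b z0 w0" unfolding Agraph_def using A X0 by blast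
  then have r0: "((\<lambda>h. N (xscale (complex_of_real (1 / h)) (T h z0 - z0) - w0)) \<longlongrightarrow> 0) (at_right 0)"
    using generator[OF X0] by simp
  have q: "N (T t (xscale c (T h z0 - z0) - w0) - (xscale c (T t (T h z0) - T t z0) - T t w0)) = 0"
    if t: "t \<ge> 0" and h: "h \<ge> 0" for t h c
  proof -
    have Th: "T h z0 \<in> Xspace" by (rule T_X[OF h X0(1)])
    note X = T_X[OF t] X_diff X_scale Th X0
    have 1: "N (T t (xscale c (T h z0 - z0) - w0) - (T t (xscale c (T h z0 - z0)) - T t w0)) = 0"
      by (rule T_diff[OF t]) (intro X)+
    have "N ((T t (xscale c (T h z0 - z0)) - T t w0) - (xscale c (T t (T h z0) - T t z0) - T t w0))
      = N (T t (xscale c (T h z0 - z0)) - xscale c (T t (T h z0) - T t z0))" by simp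
    also have "\<dots> \<le> N (T t (xscale c (T h z0 - z0)) - xscale c (T t (T h z0 - z0))) + N (xscale c (T t (T h z0 - z0)) - xscale c (T t (T h z0) - T t z0))"
      by (rule N_triangle) (intro X)+
    also have "N (T t (xscale c (T h z0 - z0)) - xscale c (T t (T h z0 - z0))) = 0"
      by (rule T_scale[OF t]) (intro X)+
    also have "N (xscale c (T t (T h z0 - z0)) - xscale c (T t (T h z0) - T t z0)) = cmod c * N (T t (T h z0 - z0) - (T t (T h z0) - T t z0))"
      unfolding xscale_diff[symmetric] by (rule N_scale) (intro X)+
    also have "N (T t (T h z0 - z0) - (T t (T h z0) - T t z0)) = 0"
      by (rule T_diff[OF t]) (intro X)+
    finally have 2: "N ((T t (xscale c (T h z0 - z0)) - T t w0) - (xscale c (T t (T h z0) - T t z0) - T t w0)) \<le> 0" by simp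
    have "N (T t (xscale c (T h z0 - z0) - w0) - (xscale c (T t (T h z0) - T t z0) - T t w0)) \<le>
      N (T t (xscale c (T h z0 - z0) - w0) - (T t (xscale c (T h z0 - z0)) - T t w0)) + N ((T t (xscale c (T h z0 - z0)) - T t w0) - (xscale c (T t (T h z0) - T t z0) - T t w0))"
      by (rule N_triangle) (intro X)+
    then have "N (T t (xscale c (T h z0 - z0) - w0) - (xscale c (T t (T h z0) - T t z0) - T t w0)) \<le> 0"
      using 1 2 by linarith
    moreover have "N (T t (xscale c (T h z0 - z0) - w0) - (xscale c (T t (T h z0) - T t z0) - T t w0)) \<ge> 0"
      by (rule N_nonneg) (intro X)+
    ultimately show ?thesis by linarith
  qed
  \<comment> \<open>Boundedness of the single operator T t carries the limit at time 0 to time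
    t.\<close>
  have rt: "((\<lambda>h. N (xscale (complex_of_real (1 / h)) (T t (T h z0) - T t z0) - T t w0)) \<longlongrightarrow> 0) (at_right 0)"
    if t: "t \<ge> 0" for t
  proof -
    obtain C where C: "C > 0" "\<And>z. z \<in> Xspace \<Longrightarrow> N (T t z) \<le> C * N z" using T_bdd[OF t] by blast
    have lim: "((\<lambda>h. C * N (xscale (complex_of_real (1 / h)) (T h z0 - z0) - w0)) \<longlongrightarrow> 0) (at_right 0)"
      using tendsto_mult[OF tendsto_const r0, of C] by simp
    have le: "norm (N (xscale (complex_of_real (1 / h)) (T t (T h z0) - T t z0) - T t w0)) \<le> C * N (xscale (complex_of_real (1 / h)) (T h z0 - z0) - w0)"
      if h: "h > 0" for h
    proof -
      have h0: "h \<ge> 0" using h by simp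
      have Th: "T h z0 \<in> Xspace" by (rule T_X[OF h0 X0(1)])
      note X = T_X[OF t] X_diff X_scale Th X0
      have "N (xscale (complex_of_real (1 / h)) (T t (T h z0) - T t z0) - T t w0) = N (T t (xscale (complex_of_real (1 / h)) (T h z0 - z0) - w0))"
        by (rule N_eqv(1)[OF _ _ q[OF t h0], symmetric]) (intro X)+
      also have "\<dots> \<le> C * N (xscale (complex_of_real (1 / h)) (T h z0 - z0) - w0)"
        by (rule C(2)) (intro X)+
      finally show ?thesis using N_nonneg[of "xscale (complex_of_real (1 / h)) (T t (T h z0) - T t z0) - T t w0"] X by simp
    qed
    show ?thesis
      by (rule Lim_null_comparison[OF _ lim]) (use le in \<open>auto simp: eventually_at_filter intro!: always_eventually\<close>)
  qed
  \<comment> \<open>Commuting T t with T h turns the quotient into the one that the generator sees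
    at \<open>T t z0\<close>.\<close>
  have "\<exists>z w. N (T t z0 - z) = 0 \<and> N (T t w0 - w) = 0 \<and> Arel \<rho> EI m J b z w" if t: "t \<ge> 0" for t
  proof -
    have "((\<lambda>h. N (xscale (complex_of_real (1 / h)) (T h (T t z0) - T t z0) - T t w0)) \<longlongrightarrow> 0) (at_right 0)"
    proof (rule Lim_transform_eventually[OF rt[OF t]])
      have "N (xscale (complex_of_real (1 / h)) (T t (T h z0) - T t z0) - T t w0) = N (xscale (complex_of_real (1 / h)) (T h (T t z0) - T t z0) - T t w0)"
        if h: "h > 0" for h
      proof -
        have h0: "h \<ge> 0" "h + t \<ge> 0" using h t by auto
        note X = T_X[OF t] T_X[OF h0(1)] T_X[OF h0(2)] X_diff X_scale X0
        have "N (T t (T h z0) - T h (T t z0)) \<le> N (T t (T h z0) - T (h + t) z0) + N (T (h + t) z0 - T h (T t z0))"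
          by (rule N_triangle) (intro X)+
        also have "\<dots> = 0"
          using T_plus[OF h0(1) t X0(1)] T_plus[OF t h0(1) X0(1)] N_diff_commute[of "T t (T h z0)" "T (h + t) z0"] X
          by (simp add: add.commute)
        finally have 0: "N (T t (T h z0) - T h (T t z0)) = 0"
          using N_nonneg[OF X_diff[OF T_X[OF t T_X[OF h0(1) X0(1)]] T_X[OF h0(1) T_X[OF t X0(1)]]]] by linarith
        have "N ((xscale (complex_of_real (1 / h)) (T t (T h z0) - T t z0) - T t w0) - (xscale (complex_of_real (1 / h)) (T h (T t z0) - T t z0) - T t w0))
          = N (xscale (complex_of_real (1 / h)) (T t (T h z0) - T h (T t z0)))"
          by (simp add: xscale_diff)
        also have "\<dots> = 0" using 0 X by (subst N_scale) auto
        finally show ?thesis by (intro N_eqv(1)) (intro X | assumption)+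
      qed
      then show "\<forall>\<^sub>F h in at_right 0. N (xscale (complex_of_real (1 / h)) (T t (T h z0) - T t z0) - T t w0) = N (xscale (complex_of_real (1 / h)) (T h (T t z0) - T t z0) - T t w0)"
        unfolding eventually_at_filter by (intro always_eventually) simp
    qed
    then have "Agraph \<rho> EI m J b (T t z0) (T t w0)"
      using generator[OF T_X[OF t X0(1)] T_X[OF t X0(2)]] by simp
    then obtain z w where zw: "xeq \<rho> EI m J (T t z0) z" "xeq \<rho> EI m J (T t w0) w" "Arel \<rho> EI m J b z w"
      unfolding Agraph_def by blast
    then show ?thesis
      using xeq_iff T_X[OF t X0(1)] T_X[OF t X0(2)] Arel_X[OF zw(3)] by blast
  qed
  then obtain Z W where ZW: "\<And>t. t \<ge> 0 \<Longrightarrow> N (T t z0 - Z t) = 0" "\<And>t. t \<ge> 0 \<Longrightarrow> N (T t w0 - W t) = 0"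
     "\<And>t. t \<ge> 0 \<Longrightarrow> Arel \<rho> EI m J b (Z t) (W t)" by metis
  have X: "Z t \<in> Xspace" "W t \<in> Xspace" "T t z0 \<in> Xspace" "T t w0 \<in> Xspace" if "t \<ge> 0" for t
    using Arel_X[OF ZW(3)[OF that]] T_X[OF that] X0 by auto
  have conv: "((\<lambda>s. N (V s - V t)) \<longlongrightarrow> 0) (at t within {0..})"
    if t: "t \<ge> 0" and V: "\<And>t. t \<ge> 0 \<Longrightarrow> N (T t v - V t) = 0" "\<And>t. t \<ge> 0 \<Longrightarrow> V t \<in> Xspace" and v: "v \<in> Xspace" for t V v
  proof (rule Lim_transform_eventually)
    show "((\<lambda>s. N (T s v - T t v)) \<longlongrightarrow> 0) (at t within {0..})"
      using T_contX[OF v] t by (simp add: contX_def)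
    have "N (T s v - T t v) = N (V s - V t)" if s: "s \<ge> 0" for s
      using N_eqv(2)[OF T_X[OF s v] V(2)[OF s] V(1)[OF s] T_X[OF t v]]
        N_eqv(3)[OF T_X[OF t v] V(2)[OF t] V(1)[OF t] V(2)[OF s]] by simp
    then show "\<forall>\<^sub>F s in at t within {0..}. N (T s v - T t v) = N (V s - V t)"
      unfolding eventually_at_filter by (intro always_eventually) simp
  qed
  have "((\<lambda>h. N (xscale (complex_of_real (1/h)) (Z (t + h) - Z t) - W t)) \<longlongrightarrow> 0) (at_right 0)" if t: "t \<ge> 0" for t
  proof (rule Lim_transform_eventually[OF rt[OF t]])
    have "N (xscale (complex_of_real (1 / h)) (T t (T h z0) - T t z0) - T t w0) = N (xscale (complex_of_real (1/h)) (Z (t + h) - Z t) - W t)"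
      if h: "h > 0" for h
    proof -
      have h0: "h \<ge> 0" "t + h \<ge> 0" using h t by auto
      note XX = T_X[OF t] T_X[OF h0(1)] T_X[OF h0(2)] X_diff X_scale X0 X(1,2)[OF t] X(1)[OF h0(2)] X_add
      have "N (T t (T h z0) - Z (t + h)) \<le> N (T t (T h z0) - T (t + h) z0) + N (T (t + h) z0 - Z (t + h))"
        by (rule N_triangle) (intro XX)+
      also have "\<dots> = 0"
        using ZW(1)[OF h0(2)] T_plus[OF t h0(1) X0(1)] N_diff_commute[of "T t (T h z0)" "T (t + h) z0"] XX by simp
      finally have 1: "N (T t (T h z0) - Z (t + h)) \<le> 0" .
      define c where "c = complex_of_real (1/h)"
      have "(xscale c (T t (T h z0) - T t z0) - T t w0) - (xscale c (Z (t + h) - Z t) - W t)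
        = (xscale c (T t (T h z0) - Z (t + h)) - xscale c (T t z0 - Z t)) - (T t w0 - W t)"
        by (simp add: xscale_diff algebra_simps)
      also have "N \<dots> \<le> N (xscale c (T t (T h z0) - Z (t + h)) - xscale c (T t z0 - Z t)) + N (T t w0 - W t)"
        by (rule N_diff) (intro XX)+
      also have "N (xscale c (T t (T h z0) - Z (t + h)) - xscale c (T t z0 - Z t)) \<le> N (xscale c (T t (T h z0) - Z (t + h))) + N (xscale c (T t z0 - Z t))"
        by (rule N_diff) (intro XX)+
      also have "N (xscale c (T t (T h z0) - Z (t + h))) = cmod c * N (T t (T h z0) - Z (t + h))"
        by (rule N_scale) (intro XX)+
      also have "N (xscale c (T t z0 - Z t)) = cmod c * N (T t z0 - Z t)"
        by (rule N_scale) (intro XX)+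
      also have "cmod c * N (T t (T h z0) - Z (t + h)) \<le> cmod c * 0" by (rule mult_left_mono[OF 1]) simp
      finally have "N ((xscale c (T t (T h z0) - T t z0) - T t w0) - (xscale c (Z (t + h) - Z t) - W t)) \<le> 0"
        using ZW(1,2)[OF t] by simp
      moreover have "N ((xscale c (T t (T h z0) - T t z0) - T t w0) - (xscale c (Z (t + h) - Z t) - W t)) \<ge> 0"
        by (rule N_nonneg) (intro XX)+
      ultimately have "N ((xscale c (T t (T h z0) - T t z0) - T t w0) - (xscale c (Z (t + h) - Z t) - W t)) = 0" by linarith
      then show ?thesis unfolding c_def by (intro N_eqv(1)) (intro XX | assumption)+
    qed
    then show "\<forall>\<^sub>F h in at_right 0. N (xscale (complex_of_real (1 / h)) (T t (T h z0) - T t z0) - T t w0) = N (xscale (complex_of_real (1/h)) (Z (t + h) - Z t) - W t)"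
      unfolding eventually_at_filter by (intro always_eventually) simp
  qed
  then have "traj Z W"
    unfolding traj_def
    by (intro conjI allI impI X(1) X(2) ZW(3) conv[OF _ ZW(1) X(1) X0(1)] conv[OF _ ZW(2) X(2) X0(2)]) auto
  then show ?thesis using that ZW(1,2) by blast
qed

end

section \<open>Identities on the domain of the operator\<close>

lemma Re_LINT: "integrable M f \<Longrightarrow> Re (LINT x|M. f x) = (LINT x|M. Re (f x))"
  by (rule integral_Re[symmetric])

lemma LINT_inner_eq:
  assumes p: "sq_int p" and q: "sq_int q"
  shows "(LINT x|I01. p x \<bullet> q x) = Re (LINT x|I01. p x * cnj (q x))"
  using Re_LINT[OF sq_int_mult[OF p sq_int_cnj[OF q]]]
  by (simp add: inner_complex_def complex_mult_cnj)

lemma LINT_weighted_inner_eq: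
  assumes u: "continuous_on {0..1} (u :: real \<Rightarrow> real)" and p: "sq_int p" and q: "sq_int q"
  shows "(LINT x|I01. u x * (p x \<bullet> q x)) = Re (LINT x|I01. complex_of_real (u x) * p x * cnj (q x))"
proof -
  have "sq_int (\<lambda>x. complex_of_real (u x) * p x)"
    by (intro sq_int_cont_mult continuous_intros u p)
  from LINT_inner_eq[OF this q] show ?thesis
    by (simp add: inner_complex_def algebra_simps)
qed

context tower
begin

section \<open>Bounded functionals and bilinear forms built from the components\<close>

lemma linf_add: "linf L \<Longrightarrow> linf L' \<Longrightarrow> linf (\<lambda>z. L z + L' z)"
  unfolding linf_def
proof (elim conjE exE, intro conjI)
  fix C C' assume C: "\<forall>z\<in>Xspace. cmod (L z) \<le> C * N z" "\<forall>z\<in>Xspace. cmod (L' z) \<le> C' * N z"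
  have "cmod (L z + L' z) \<le> (C + C') * N z" if "z \<in> Xspace" for z
    using norm_triangle_ineq[of "L z" "L' z"] C that by (simp add: distrib_right) (smt (verit))
  then show "\<exists>C. \<forall>z\<in>Xspace. cmod (L z + L' z) \<le> C * N z" by blast
qed (auto simp: algebra_simps)

lemma linf_cmult: "linf L \<Longrightarrow> linf (\<lambda>z. c * L z)"
  unfolding linf_def
proof (elim conjE exE, intro conjI)
  fix C assume C: "\<forall>z\<in>Xspace. cmod (L z) \<le> C * N z"
  have "cmod (c * L z) \<le> (cmod c * C) * N z" if "z \<in> Xspace" for z
    using mult_left_mono[of "cmod (L z)" "C * N z" "cmod c"] C that by (simp add: norm_mult mult.assoc)
  then show "\<exists>C. \<forall>z\<in>Xspace. cmod (c * L z) \<le> C * N z" by blast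
qed (auto simp: algebra_simps)

lemma linf_basic:
  "linf (\<lambda>z. s\<xi> z)" "linf (\<lambda>z. s\<eta> z)"
  "x \<in> {0..1} \<Longrightarrow> linf (\<lambda>z. fst z x)" "x \<in> {0..1} \<Longrightarrow> linf (\<lambda>z. D1 (fst z) x)"
  "sq_int \<theta> \<Longrightarrow> linf (\<lambda>z. LINT x|I01. \<theta> x * fst z x)"
  "sq_int \<theta> \<Longrightarrow> linf (\<lambda>z. LINT x|I01. \<theta> x * sg z x)"
proof -
  obtain C where C: "C > 0"
    "\<And>z. z \<in> Xspace \<Longrightarrow> sqrt (l2sq (D2 (fst z))) \<le> C * N z"
    "\<And>z. z \<in> Xspace \<Longrightarrow> sqrt (l2sq (sg z)) \<le> C * N z"
    "\<And>z. z \<in> Xspace \<Longrightarrow> cmod (s\<xi> z) \<le> C * N z"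
    "\<And>z. z \<in> Xspace \<Longrightarrow> cmod (s\<eta> z) \<le> C * N z" using comp_bounds by blast
  show "linf (\<lambda>z. s\<xi> z)" "linf (\<lambda>z. s\<eta> z)"
    unfolding linf_def xadd_sel xscale_sel using C(4,5) by blast+
  have H: "H2l (fst z)" "sq_int (sg z)" if "z \<in> Xspace" for z using that by (auto simp: Xspace_iff)
  show "linf (\<lambda>z. fst z x)" if "x \<in> {0..1}"
    unfolding linf_def xadd_sel xscale_sel using order_trans[OF H2l_bound[OF H(1) that] C(2)] by blast
  show "linf (\<lambda>z. D1 (fst z) x)" if x: "x \<in> {0..1}"
    unfolding linf_def xadd_sel xscale_sel
    using order_trans[OF D1_bound[OF H(1) x] C(2)] H2l_add(3)[OF H(1) H(1) x] H2l_scale(3)[OF H(1) x] by blast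
  have b: "sqrt (l2sq \<theta>) * l \<le> sqrt (l2sq \<theta>) * C * n" if "l \<le> C * n" for l n
    using mult_left_mono[OF that, of "sqrt (l2sq \<theta>)"] by (simp add: mult.assoc)
  have fs: "sq_int (fst z)" if "z \<in> Xspace" for z by (rule sq_int_cont[OF H2l_cont(1)[OF H(1)[OF that]]])
  have fb: "sqrt (l2sq (fst z)) \<le> C * N z" if z: "z \<in> Xspace" for z
  proof -
    have "l2sq (fst z) \<le> (sqrt (l2sq (D2 (fst z))))^2"
      by (rule l2sq_le_const[OF sq_int_meas[OF fs[OF z]] H2l_bound[OF H(1)[OF z]]])
    then have "sqrt (l2sq (fst z)) \<le> sqrt (l2sq (D2 (fst z)))" by simp
    then show ?thesis using C(2)[OF z] by linarith
  qed
  show "linf (\<lambda>z. LINT x|I01. \<theta> x * fst z x)" if th: "sq_int \<theta>"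
    unfolding linf_def
  proof (intro conjI allI ballI exI)
    fix z w :: state assume z: "z \<in> Xspace" and w: "w \<in> Xspace"
    show "(LINT x|I01. \<theta> x * fst (z + w) x) = (LINT x|I01. \<theta> x * fst z x) + (LINT x|I01. \<theta> x * fst w x)"
      unfolding xadd_sel using sq_int_mult[OF th fs[OF z]] sq_int_mult[OF th fs[OF w]] by (simp add: distrib_left)
  next
    fix c and z :: state assume z: "z \<in> Xspace"
    show "(LINT x|I01. \<theta> x * fst (xscale c z) x) = c * (LINT x|I01. \<theta> x * fst z x)"
      unfolding xscale_sel by (simp add: mult.left_commute[of _ c])
    show "cmod (LINT x|I01. \<theta> x * fst z x) \<le> sqrt (l2sq \<theta>) * C * N z"
      by (rule order_trans[OF LINT_mult_bound[OF th fs[OF z]] b[OF fb[OF z]]])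
  qed
  show "linf (\<lambda>z. LINT x|I01. \<theta> x * sg z x)" if th: "sq_int \<theta>"
    unfolding linf_def
  proof (intro conjI allI ballI exI)
    fix z w :: state assume z: "z \<in> Xspace" and w: "w \<in> Xspace"
    show "(LINT x|I01. \<theta> x * sg (z + w) x) = (LINT x|I01. \<theta> x * sg z x) + (LINT x|I01. \<theta> x * sg w x)"
      unfolding xadd_sel using sq_int_mult[OF th H(2)[OF z]] sq_int_mult[OF th H(2)[OF w]] by (simp add: distrib_left)
  next
    fix c and z :: state assume z: "z \<in> Xspace"
    show "(LINT x|I01. \<theta> x * sg (xscale c z) x) = c * (LINT x|I01. \<theta> x * sg z x)"
      unfolding xscale_sel by (simp add: mult.left_commute[of _ c])
    show "cmod (LINT x|I01. \<theta> x * sg z x) \<le> sqrt (l2sq \<theta>) * C * N z"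
      by (rule order_trans[OF LINT_mult_bound[OF th H(2)[OF z]] b[OF C(3)[OF z]]])
  qed
qed

lemma bform_add2: "bform B \<Longrightarrow> bform B' \<Longrightarrow> bform (\<lambda>z w. B z w + B' z w)"
  unfolding bform_def
proof (elim conjE exE, intro conjI)
  fix C C' assume C: "\<forall>z\<in>Xspace. \<forall>w\<in>Xspace. \<bar>B z w\<bar> \<le> C * (N z * N w)" "\<forall>z\<in>Xspace. \<forall>w\<in>Xspace. \<bar>B' z w\<bar> \<le> C' * (N z * N w)"
  have "\<bar>B z w + B' z w\<bar> \<le> (C + C') * (N z * N w)" if "z \<in> Xspace" "w \<in> Xspace" for z w
  proof -
    have "\<bar>B z w\<bar> \<le> C * (N z * N w)" "\<bar>B' z w\<bar> \<le> C' * (N z * N w)" using C that by blast+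
    then show ?thesis unfolding distrib_right by linarith
  qed
  then show "\<exists>C. \<forall>z\<in>Xspace. \<forall>w\<in>Xspace. \<bar>B z w + B' z w\<bar> \<le> C * (N z * N w)" by blast
qed (auto simp: algebra_simps)

lemma bform_linf:
  assumes L: "linf L" and L': "linf L'"
  shows "bform (\<lambda>z w. c * (L z \<bullet> L' w))"
proof -
  obtain C where C: "C > 0" "\<And>z. z \<in> Xspace \<Longrightarrow> cmod (L z) \<le> C * N z" using linf_bound[OF L] by blast
  obtain C' where C': "C' > 0" "\<And>z. z \<in> Xspace \<Longrightarrow> cmod (L' z) \<le> C' * N z" using linf_bound[OF L'] by blast
  have add: "L (z + w) = L z + L w" "L' (z + w) = L' z + L' w" if "z \<in> Xspace" "w \<in> Xspace" for z w
    using L L' that unfolding linf_def by blast+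
  have sc: "L (xscale d z) = d * L z" "L' (xscale d z) = d * L' z" if "z \<in> Xspace" for z d
    using L L' that unfolding linf_def by blast+
  have inr: "p \<bullet> (complex_of_real r * q) = r * (p \<bullet> q)" for p q r
    using inner_mult_left[of r q p] by (simp add: inner_commute)
  show ?thesis unfolding bform_def
  proof (intro conjI ballI allI exI)
    fix z w :: state assume z: "z \<in> Xspace" and w: "w \<in> Xspace"
    have "\<bar>L z \<bullet> L' w\<bar> \<le> cmod (L z) * cmod (L' w)" by (rule Cauchy_Schwarz_ineq2)
    also have "\<dots> \<le> (C * N z) * (C' * N w)" by (intro mult_mono C C' z w) (use C(1) in \<open>auto simp: z\<close>)
    finally have "\<bar>c\<bar> * \<bar>L z \<bullet> L' w\<bar> \<le> \<bar>c\<bar> * ((C * N z) * (C' * N w))" by (rule mult_left_mono) simp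
    then show "\<bar>c * (L z \<bullet> L' w)\<bar> \<le> \<bar>c\<bar> * C * C' * (N z * N w)" by (simp add: abs_mult mult.assoc mult.left_commute)
  qed (simp_all add: add sc inner_add_left inner_add_right inner_mult_left inr distrib_left mult.left_commute[of c])
qed

text \<open>Velocity paired with slope: the distributed part of the multiplier functional.\<close>

lemma bform_weighted:
  assumes u: "continuous_on {0..1} u"
  shows "bform (\<lambda>z w. LINT x|I01. u x * (sg z x \<bullet> D1 (fst w) x))"
proof -
  obtain C where C: "C > 0"
    "\<And>z. z \<in> Xspace \<Longrightarrow> sqrt (l2sq (D2 (fst z))) \<le> C * N z"
    "\<And>z. z \<in> Xspace \<Longrightarrow> sqrt (l2sq (sg z)) \<le> C * N z"
    using comp_bounds by metis
  have "bounded (u ` {0..1})"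
    by (rule compact_imp_bounded[OF compact_continuous_image[OF u compact_Icc]])
  then obtain K where "\<forall>y\<in>u ` {0..1}. norm y \<le> K" unfolding bounded_iff by blast
  then have K: "\<bar>u x\<bar> \<le> K" if "x \<in> {0..1}" for x using that by simp
  have K0: "K \<ge> 0" using K[of 0] by simp
  have H: "H2l (fst z)" "sq_int (sg z)" "sq_int (D1 (fst z))" if "z \<in> Xspace" for z
    using that H2l_cont(2)[of "fst z"] by (auto simp: Xspace_iff intro: sq_int_cont)
  have i: "integrable I01 (\<lambda>x. u x * (sg z x \<bullet> D1 (fst w) x))" if "z \<in> Xspace" "w \<in> Xspace" for z w
    by (intro weighted_inner_integrable u H that)
  have dadd: "(LINT x|I01. u x * (sg z x \<bullet> D1 (fst (w + w')) x)) = (LINT x|I01. u x * (sg z x \<bullet> D1 (fst w) x) + u x * (sg z x \<bullet> D1 (fst w') x))"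
    if "w \<in> Xspace" "w' \<in> Xspace" for z w w'
    using H2l_add(3)[OF H(1)[OF that(1)] H(1)[OF that(2)]]
    by (intro Bochner_Integration.integral_cong refl) (auto simp: xadd_sel inner_add_right distrib_left simp del: fst_add)
  have inr: "p \<bullet> (complex_of_real r * q) = r * (p \<bullet> q)" for p q r
    using inner_mult_left[of r q p] by (simp add: inner_commute)
  have dsc: "(LINT x|I01. u x * (sg z x \<bullet> D1 (fst (xscale (complex_of_real r) w)) x)) = (LINT x|I01. r * (u x * (sg z x \<bullet> D1 (fst w) x)))"
    if "w \<in> Xspace" for z w r
    using H2l_scale(3)[OF H(1)[OF that]]
    by (intro Bochner_Integration.integral_cong refl) (auto simp: inr)
  show ?thesis unfolding bform_def
  proof (intro conjI ballI allI exI)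
    fix z w :: state assume z: "z \<in> Xspace" and w: "w \<in> Xspace"
    have cK: "continuous_on {0..1} (\<lambda>x. complex_of_real (u x))" by (intro continuous_intros u)
    have s: "sq_int (\<lambda>x. complex_of_real (u x) * sg z x)" by (rule sq_int_cont_mult[OF cK H(2)[OF z]])
    have "\<bar>LINT x|I01. u x * (sg z x \<bullet> D1 (fst w) x)\<bar> \<le> cmod (LINT x|I01. complex_of_real (u x) * sg z x * cnj (D1 (fst w) x))"
      unfolding LINT_weighted_inner_eq[OF u H(2)[OF z] H(3)[OF w]] by (rule abs_Re_le_cmod)
    also have "\<dots> \<le> sqrt (l2sq (\<lambda>x. complex_of_real (u x) * sg z x)) * sqrt (l2sq (\<lambda>x. cnj (D1 (fst w) x)))"
      by (rule LINT_mult_bound[OF s sq_int_cnj[OF H(3)[OF w]]])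
    also have "\<dots> \<le> (K * (C * N z)) * (C * N w)"
    proof (intro mult_mono)
      have "l2sq (\<lambda>x. complex_of_real (u x) * sg z x) \<le> K^2 * l2sq (sg z)"
        by (rule sq_int_bdd_mult(2)[OF H(2)[OF z] measurable_I01_cont[OF cK]]) (simp add: K)
      then have "sqrt (l2sq (\<lambda>x. complex_of_real (u x) * sg z x)) \<le> sqrt (K^2 * l2sq (sg z))" by (rule real_sqrt_le_mono)
      also have "\<dots> = K * sqrt (l2sq (sg z))" using K0 by (simp add: real_sqrt_mult)
      also have "\<dots> \<le> K * (C * N z)" by (intro mult_left_mono C z K0)
      finally show "sqrt (l2sq (\<lambda>x. complex_of_real (u x) * sg z x)) \<le> K * (C * N z)" .
      have "l2sq (D1 (fst w)) \<le> (sqrt (l2sq (D2 (fst w))))^2"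
        by (rule l2sq_le_const[OF sq_int_meas[OF H(3)[OF w]] D1_bound[OF H(1)[OF w]]])
      then have "sqrt (l2sq (D1 (fst w))) \<le> sqrt (l2sq (D2 (fst w)))" by simp
      then show "sqrt (l2sq (\<lambda>x. cnj (D1 (fst w) x))) \<le> C * N w"
        unfolding l2sq_cnj using C(2)[OF w] by (rule order_trans)
    qed (use K0 C(1) z in auto)
    finally show "\<bar>LINT x|I01. u x * (sg z x \<bullet> D1 (fst w) x)\<bar> \<le> K * C * C * (N z * N w)"
      by (simp add: algebra_simps)
  next
    fix z z' w :: state assume a: "z \<in> Xspace" "z' \<in> Xspace" "w \<in> Xspace"
    show "(LINT x|I01. u x * (sg (z + z') x \<bullet> D1 (fst w) x)) = (LINT x|I01. u x * (sg z x \<bullet> D1 (fst w) x)) + (LINT x|I01. u x * (sg z' x \<bullet> D1 (fst w) x))"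
      unfolding xadd_sel using i[OF a(1,3)] i[OF a(2,3)] by (simp add: inner_add_left distrib_left)
    show "(LINT x|I01. u x * (sg w x \<bullet> D1 (fst (z + z')) x)) = (LINT x|I01. u x * (sg w x \<bullet> D1 (fst z) x)) + (LINT x|I01. u x * (sg w x \<bullet> D1 (fst z') x))"
      unfolding dadd[OF a(1,2)] using i[OF a(3,1)] i[OF a(3,2)] by simp
  next
    fix r and z w :: state assume a: "z \<in> Xspace" "w \<in> Xspace"
    show "(LINT x|I01. u x * (sg (xscale (complex_of_real r) z) x \<bullet> D1 (fst w) x)) = r * (LINT x|I01. u x * (sg z x \<bullet> D1 (fst w) x))"
      unfolding xscale_sel inner_mult_left by (simp add: mult.left_commute[of _ r])
    show "(LINT x|I01. u x * (sg z x \<bullet> D1 (fst (xscale (complex_of_real r) w)) x)) = r * (LINT x|I01. u x * (sg z x \<bullet> D1 (fst w) x))"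
      unfolding dsc[OF a(2)] by simp
  qed
qed

text \<open>By the boundary condition for the rotation at the tip this is the bending moment EI(1)
  w_xx(1). Written through \<eta> and its time derivative, it inherits their integrability in
  time.\<close>

definition Mom :: "state \<Rightarrow> state \<Rightarrow> complex" where
  "Mom z w = - (complex_of_real b * s\<eta> z + complex_of_real J * s\<eta> w)"

section \<open>Integration by parts on the domain: weak form, dissipation, multiplier\<close>

lemma Arel_facts:
  assumes A: "Arel \<rho> EI m J b z w"
  obtains f2 f3 h1 h2 where
    "\<forall>x\<in>{0..1}. (D1 (fst z) has_vector_derivative f2 x) (at x within {0..1})"
    "\<forall>x\<in>{0..1}. (f2 has_vector_derivative f3 x) (at x within {0..1})"
    "continuous_on {0..1} f2" "continuous_on {0..1} f3"
    "AE x in I01. D2 (fst z) x = f2 x"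
    "H2chain (\<lambda>x. complex_of_real (EI x) * f2 x) h1 h2"
    "\<forall>x\<in>{0..1}. complex_of_real (\<rho> x) * sg w x = - h2 x"
    "complex_of_real m * s\<xi> w = h1 1" "complex_of_real (EI 1) * f2 1 = Mom z w"
proof -
  obtain f g \<xi> \<eta> u v \<alpha> \<beta> where zw: "z = (f, g, \<xi>, \<eta>)" "w = (u, v, \<alpha>, \<beta>)" by (metis prod_cases4)
  from A[unfolded Arel_def zw prod.case] obtain f1 f2 f3 f4 g1 g2 h1 h2 where
    f: "H4chain f f1 f2 f3 f4" "f 0 = 0" "f1 0 = 0" and g: "H2chain g g1 g2" "g 0 = 0" "g1 0 = 0"
    and bd: "\<xi> = g 1" "\<eta> = g1 1"
    and h: "H2chain (\<lambda>x. complex_of_real (EI x) * f2 x) h1 h2" and u: "u = g"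
    and v: "\<forall>x\<in>{0..1}. v x = - h2 x / complex_of_real (\<rho> x)"
    and \<alpha>: "\<alpha> = h1 1 / complex_of_real m"
    and \<beta>: "\<beta> = (- (complex_of_real (EI 1) * f2 1) - complex_of_real b * \<eta>) / complex_of_real J" by blast
  note F = H4chain_props[OF f(1)]
  have d1: "D1 f x = f1 x" if "x \<in> {0..1}" for x by (rule D1_eq[OF F(1) f(3) that])
  show ?thesis
  proof (rule that[of f2 f3 h1 h2])
    show "\<forall>x\<in>{0..1}. (D1 (fst z) has_vector_derivative f2 x) (at x within {0..1})"
    proof
      fix x :: real assume x: "x \<in> {0..1}"
      show "(D1 (fst z) has_vector_derivative f2 x) (at x within {0..1})"
        unfolding zw fst_conv by (rule has_vector_derivative_transform[OF x d1 F(4)[OF x]])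
    qed
    show "\<forall>x\<in>{0..1}. (f2 has_vector_derivative f3 x) (at x within {0..1})" using F(5) by blast
    show "AE x in I01. D2 (fst z) x = f2 x" unfolding zw fst_conv by (rule D2_AE(2)[OF F(1)])
    show "\<forall>x\<in>{0..1}. complex_of_real (\<rho> x) * sg w x = - h2 x"
    proof
      fix x :: real assume x: "x \<in> {0..1}"
      show "complex_of_real (\<rho> x) * sg w x = - h2 x" using v \<rho>_pos[OF x] x by (simp add: zw)
    qed
    show "complex_of_real m * s\<xi> w = h1 1" using m_pos by (simp add: zw \<alpha>)
    show "complex_of_real (EI 1) * f2 1 = Mom z w" using J_pos by (simp add: zw Mom_def \<beta>)
  qed (use F(2,3) h in auto)
qed

lemma Arel_simple:
  assumes A: "Arel \<rho> EI m J b z w"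
  shows "H2l (fst z)" "H2l (sg z)" "fst w = sg z" "s\<xi> z = sg z 1" "s\<eta> z = D1 (sg z) 1"
proof -
  obtain f g \<xi> \<eta> u v \<alpha> \<beta> where zw: "z = (f, g, \<xi>, \<eta>)" "w = (u, v, \<alpha>, \<beta>)" by (metis prod_cases4)
  from A[unfolded Arel_def zw prod.case] obtain g1 g2 where
    g: "H2chain g g1 g2" "g 0 = 0" "g1 0 = 0" and bd: "\<xi> = g 1" "\<eta> = g1 1" and u: "u = g" by blast
  show "H2l (fst z)" using Arel_X(1)[OF A] by (simp add: Xspace_iff)
  show "H2l (sg z)" using g unfolding zw H2l_def by auto
  show "fst w = sg z" "s\<xi> z = sg z 1" by (simp_all add: zw u bd)
  show "s\<eta> z = D1 (sg z) 1" using D1_eq[OF g(1,3), of 1] by (simp add: zw bd)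
qed

text \<open>The weak form of the equation. The relation \<open>\<rho> v = -(EI f'')''\<close> is
  multiplied by a test function clamped at 0 and integrated by parts twice; the boundary terms at 1
  are the shear force, which equals m times the acceleration of the tip, and the moment. The pairing
  carries no conjugation, so conjugates are placed in the test function.\<close>

lemma test_identity:
  assumes A: "Arel \<rho> EI m J b z w" and \<phi>: "H2chain \<phi> \<phi>1 \<phi>2" "\<phi> 0 = 0" "\<phi>1 0 = 0"
  shows "(LINT x|I01. complex_of_real (\<rho> x) * \<phi> x * sg w x) + complex_of_real m * \<phi> 1 * s\<xi> w
    = \<phi>1 1 * Mom z w - (LINT x|I01. complex_of_real (EI x) * D2 (fst z) x * \<phi>2 x)"
proof -
  obtain f2 f3 h1 h2 where F: "\<forall>x\<in>{0..1}. (D1 (fst z) has_vector_derivative f2 x) (at x within {0..1})"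
    "\<forall>x\<in>{0..1}. (f2 has_vector_derivative f3 x) (at x within {0..1})"
    "continuous_on {0..1} f2" "continuous_on {0..1} f3"
    "AE x in I01. D2 (fst z) x = f2 x"
    "H2chain (\<lambda>x. complex_of_real (EI x) * f2 x) h1 h2"
    "\<forall>x\<in>{0..1}. complex_of_real (\<rho> x) * sg w x = - h2 x"
    "complex_of_real m * s\<xi> w = h1 1" "complex_of_real (EI 1) * f2 1 = Mom z w"
    by (rule Arel_facts[OF A]) (rule that)
  note c2 = F(3) and D2f = F(5) and h = F(6) and v = F(7)[rule_format] and \<alpha> = F(8) and M = F(9) and H = Arel_simple(1)[OF A]
  note P = H2chain_props[OF \<phi>(1)] and Q = H2chain_props[OF h]
  have 1: "(LINT x|I01. h2 x * \<phi> x) = h1 1 * \<phi> 1 - h1 0 * \<phi> 0 - (LINT x|I01. h1 x * \<phi>1 x)"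
    by (rule ibp_L2[OF Q(1) Q(4) P(5) P(2)])
  have 2: "(LINT x|I01. \<phi>2 x * (complex_of_real (EI x) * f2 x)) = \<phi>1 1 * (complex_of_real (EI 1) * f2 1)
      - \<phi>1 0 * (complex_of_real (EI 0) * f2 0) - (LINT x|I01. \<phi>1 x * h1 x)"
    by (rule ibp_L2[OF P(1) P(4) Q(5) Q(2)])
  have 3: "(LINT x|I01. complex_of_real (\<rho> x) * \<phi> x * sg w x) = - (LINT x|I01. h2 x * \<phi> x)"
    unfolding integral_minus[symmetric]
  proof (rule Bochner_Integration.integral_cong[OF refl])
    fix x assume "x \<in> space I01"
    then have x: "x \<in> {0..1}" by simp
    have "complex_of_real (\<rho> x) * \<phi> x * sg w x = (complex_of_real (\<rho> x) * sg w x) * \<phi> x" by simp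
    then show "complex_of_real (\<rho> x) * \<phi> x * sg w x = - (h2 x * \<phi> x)" unfolding v[OF x] by simp
  qed
  have ce: "continuous_on {0..1} (\<lambda>x. complex_of_real (EI x))" by (intro continuous_intros coeff_cont)
  have 4: "(LINT x|I01. complex_of_real (EI x) * D2 (fst z) x * \<phi>2 x) = (LINT x|I01. \<phi>2 x * (complex_of_real (EI x) * f2 x))"
  proof (rule LINT_cong_AE)
    show "integrable I01 (\<lambda>x. complex_of_real (EI x) * D2 (fst z) x * \<phi>2 x)"
      by (intro sq_int_mult sq_int_cont_mult ce H2l_sq H P)
    show "integrable I01 (\<lambda>x. \<phi>2 x * (complex_of_real (EI x) * f2 x))"
      by (intro sq_int_mult sq_int_cont_mult ce sq_int_cont[OF c2] P)
    show "AE x in I01. complex_of_real (EI x) * D2 (fst z) x * \<phi>2 x = \<phi>2 x * (complex_of_real (EI x) * f2 x)"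
      using D2f by eventually_elim simp
  qed
  have 5: "complex_of_real m * \<phi> 1 * s\<xi> w = h1 1 * \<phi> 1" unfolding \<alpha>[symmetric] by simp
  show ?thesis unfolding 3 4 5 1 2 M \<phi> by (simp add: mult.commute)
qed

text \<open>The test function is the conjugate velocity. Elastic and kinetic terms cancel in the
  real part, the moment combines with the rotational inertia, and only the damping remains.\<close>

lemma energy_identity:
  assumes A: "Arel \<rho> EI m J b z w"
  shows "rip w z = - b * (cmod (s\<eta> z))^2"
proof -
  note X = Arel_X[OF A]
  note H = Arel_simple[OF A]
  have c: "H2chain (\<lambda>x. cnj (sg z x)) (\<lambda>x. cnj (D1 (sg z) x)) (\<lambda>x. cnj (D2 (sg z) x))"
  proof -
    have i: "integral {0..x} (\<lambda>x. cnj (p x)) = cnj (integral {0..x} p)" for p x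
      using integral_cnj[of "{0..x}" p] by simp
    have "H2chain (sg z) (D1 (sg z)) (D2 (sg z))" by (rule H2l_D(1)[OF H(2)])
    then show ?thesis unfolding H2chain_def i by (metis complex_cnj_add sq_int_cnj)
  qed
  have s: "sq_int (D2 (sg z))" "sq_int (D2 (fst z))" "sq_int (sg z)" "sq_int (sg w)"
    using H2l_sq H X by (auto simp: Xspace_iff)
  have id: "(LINT x|I01. complex_of_real (\<rho> x) * cnj (sg z x) * sg w x) + complex_of_real m * cnj (s\<xi> z) * s\<xi> w
    = cnj (s\<eta> z) * Mom z w - (LINT x|I01. complex_of_real (EI x) * D2 (fst z) x * cnj (D2 (sg z) x))"
    using test_identity[OF A c] H H2l_D(2,3)[OF H(2)] by simp
  have a: "(LINT x|I01. \<rho> x * (sg w x \<bullet> sg z x)) = Re (LINT x|I01. complex_of_real (\<rho> x) * cnj (sg z x) * sg w x)"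
    unfolding LINT_weighted_inner_eq[OF coeff_cont(1) s(4,3)] by (simp add: ac_simps)
  have bb: "(LINT x|I01. EI x * (D2 (fst w) x \<bullet> D2 (fst z) x)) = Re (LINT x|I01. complex_of_real (EI x) * D2 (fst z) x * cnj (D2 (sg z) x))"
    unfolding H(3) LINT_weighted_inner_eq[OF coeff_cont(2) s(2,1), symmetric] by (simp add: inner_commute)
  have "rip w z = Re (cnj (s\<eta> z) * Mom z w) + J * (s\<eta> w \<bullet> s\<eta> z)"
    unfolding rip_def a bb using arg_cong[OF id, of Re] by (simp add: inner_complex_def algebra_simps)
  also have "\<dots> = - b * (cmod (s\<eta> z))^2"
    unfolding cmod_power2 unfolding power2_eq_square by (simp add: Mom_def inner_complex_def algebra_simps)
  finally show ?thesis .
qed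

text \<open>Interpolation by parts: the slope is controlled by the uniform size of f and boundary
  values, with the second derivative entering only to the first power. This makes the slope term of
  the multiplier estimate lower order.\<close>

lemma D1_l2_bound:
  assumes f: "H2l f" and B: "\<And>x. x \<in> {0..1} \<Longrightarrow> cmod (f x) \<le> B"
  shows "l2sq (D1 f) \<le> cmod (D1 f 1) * cmod (f 1) + sqrt (l2sq (D2 f)) * B"
proof -
  note P = H2chain_props[OF H2l_D(1)[OF f]]
  have sD: "sq_int (D1 f)" "sq_int f" by (rule sq_int_cont[OF P(2)], rule sq_int_cont[OF P(3)])
  have B0: "B \<ge> 0" using order_trans[OF norm_ge_zero B[of 0]] by simp
  have "(LINT x|I01. D2 f x * cnj (f x)) = D1 f 1 * cnj (f 1) - D1 f 0 * cnj (f 0) - (LINT x|I01. D1 f x * cnj (D1 f x))"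
    by (rule ibp_L2[OF P(1) P(4) has_vector_derivative_cnj[OF P(5)]])
       (use P(2) in \<open>auto intro: continuous_intros\<close>)
  then have "complex_of_real (l2sq (D1 f)) = D1 f 1 * cnj (f 1) - (LINT x|I01. D2 f x * cnj (f x))"
    unfolding l2sq_eq_LINT[OF sD(1)] using H2l_D(3)[OF f] by simp
  then have "l2sq (D1 f) = cmod (D1 f 1 * cnj (f 1) - (LINT x|I01. D2 f x * cnj (f x)))"
    using l2sq_nonneg[of "D1 f"] by (metis abs_of_nonneg norm_of_real)
  also have "\<dots> \<le> cmod (D1 f 1) * cmod (f 1) + cmod (LINT x|I01. D2 f x * cnj (f x))"
    using norm_triangle_ineq4[of "D1 f 1 * cnj (f 1)"] by (simp add: norm_mult)
  also have "cmod (LINT x|I01. D2 f x * cnj (f x)) \<le> sqrt (l2sq (D2 f)) * sqrt (l2sq (\<lambda>x. cnj (f x)))"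
    by (rule LINT_mult_bound[OF P(1) sq_int_cnj[OF sD(2)]])
  also have "sqrt (l2sq (\<lambda>x. cnj (f x))) \<le> B"
    using l2sq_le_const[OF sq_int_meas[OF sD(2)] B] B0 by (simp add: real_le_lsqrt)
  finally show ?thesis by (simp add: mult_left_mono)
qed

end

lemma Ck_on_4_derivs:
  assumes "Ck_on 4 S f"
  obtains f' f'' where "\<And>x. x \<in> S \<Longrightarrow> (f has_real_derivative f' x) (at x within S)"
    "\<And>x. x \<in> S \<Longrightarrow> (f' has_real_derivative f'' x) (at x within S)" "continuous_on S f'" "continuous_on S f''"
proof -
  have "Ck_on (Suc (Suc (Suc (Suc 0)))) S f" using assms by (simp add: numeral_eq_Suc)
  then obtain f' f'' f3 where d: "\<forall>x\<in>S. (f has_real_derivative f' x) (at x within S)"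
    "\<forall>x\<in>S. (f' has_real_derivative f'' x) (at x within S)"
    "\<forall>x\<in>S. (f'' has_real_derivative f3 x) (at x within S)"
    unfolding Ck_on.simps by blast
  have c: "continuous_on S f'" "continuous_on S f''"
    by (rule DERIV_continuous_on, use d in blast)+
  show ?thesis by (rule that[OF _ _ c]) (use d in blast)+
qed

lemma LINT_weighted_square_derivative:
  fixes p :: "real \<Rightarrow> complex" and U :: "real \<Rightarrow> real"
  assumes U: "\<And>x. x \<in> {0..1} \<Longrightarrow> (U has_real_derivative U' x) (at x within {0..1})" "continuous_on {0..1} U'"
    and p: "\<And>x. x \<in> {0..1} \<Longrightarrow> (p has_vector_derivative p' x) (at x within {0..1})" "continuous_on {0..1} p'"
  shows "(LINT x|I01. U' x * (cmod (p x))^2) + 2 * (LINT x|I01. U x * (p x \<bullet> p' x)) = U 1 * (cmod (p 1))^2 - U 0 * (cmod (p 0))^2"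
proof -
  have cU: "continuous_on {0..1} U" by (rule DERIV_continuous_on[OF U(1)])
  have cp: "continuous_on {0..1} p" by (rule has_vector_derivative_continuous_on01[OF p(1)])
  have "((\<lambda>x. U' x * (cmod (p x))^2 + 2 * (U x * (p x \<bullet> p' x))) has_integral (U 1 * (p 1 \<bullet> p 1) - U 0 * (p 0 \<bullet> p 0))) {0..1}"
  proof (rule fundamental_theorem_of_calculus)
    fix x :: real assume x: "x \<in> {0..1}"
    have "((\<lambda>x. p x \<bullet> p x) has_vector_derivative (p x \<bullet> p' x + p' x \<bullet> p x)) (at x within {0..1})"
      by (rule bounded_bilinear.has_vector_derivative[OF bounded_bilinear_inner p(1)[OF x] p(1)[OF x]])
    then have "((\<lambda>x. p x \<bullet> p x) has_real_derivative (2 * (p x \<bullet> p' x))) (at x within {0..1})"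
      by (simp add: has_real_derivative_iff_has_vector_derivative inner_commute[of "p' x"])
    from DERIV_mult[OF U(1)[OF x] this]
    show "((\<lambda>x. U x * (p x \<bullet> p x)) has_vector_derivative (U' x * (cmod (p x))^2 + 2 * (U x * (p x \<bullet> p' x)))) (at x within {0..1})"
      by (simp add: has_real_derivative_iff_has_vector_derivative power2_norm_eq_inner algebra_simps)
  qed simp
  then have "integral {0..1} (\<lambda>x. U' x * (cmod (p x))^2 + 2 * (U x * (p x \<bullet> p' x))) = U 1 * (p 1 \<bullet> p 1) - U 0 * (p 0 \<bullet> p 0)"
    by (rule integral_unique)
  moreover have "integral {0..1} (\<lambda>x. U' x * (cmod (p x))^2 + 2 * (U x * (p x \<bullet> p' x))) = (LINT x|I01. U' x * (cmod (p x))^2 + 2 * (U x * (p x \<bullet> p' x)))"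
    by (intro integral_01_LINT integrable_I01_cont continuous_intros cU cp U p)
  moreover have "\<dots> = (LINT x|I01. U' x * (cmod (p x))^2) + (LINT x|I01. 2 * (U x * (p x \<bullet> p' x)))"
    by (intro Bochner_Integration.integral_add integrable_I01_cont continuous_intros cU cp U p)
  ultimately show ?thesis by (simp add: power2_norm_eq_inner)
qed

context tower
begin

text \<open>The functional of the multiplier h w_x. The tip term is the contribution of the
  concentrated mass to the weak form with test function h times the conjugate slope.\<close>

definition Bmul :: "(real \<Rightarrow> real) \<Rightarrow> state \<Rightarrow> state \<Rightarrow> real" where
  "Bmul h z w = (LINT x|I01. (h x * \<rho> x) * (sg z x \<bullet> D1 (fst w) x)) + (m * h 1) * (s\<xi> z \<bullet> D1 (fst w) 1)"

lemma bform_Bmul: "continuous_on {0..1} h \<Longrightarrow> bform (Bmul h)"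
  unfolding Bmul_def
  by (intro bform_add2 bform_weighted bform_linf linf_basic continuous_intros) auto

text \<open>\<open>Bmul h w z\<close> is the weak form tested with h times the conjugate slope;
  \<open>Bmul h z w\<close> pairs the velocity with its own space derivative. In both, a function
  times its derivative is half the derivative of a square, and h 0 = 0 removes the boundary terms at
  0.\<close>

lemma multiplier_identity:
  assumes A: "Arel \<rho> EI m J b z w"
    and \<rho>': "\<And>x. x \<in> {0..1} \<Longrightarrow> (\<rho> has_real_derivative \<rho>' x) (at x within {0..1})" "continuous_on {0..1} \<rho>'"
    and EI': "\<And>x. x \<in> {0..1} \<Longrightarrow> (EI has_real_derivative EI' x) (at x within {0..1})" "continuous_on {0..1} EI'"
    and h: "\<And>x. x \<in> {0..1} \<Longrightarrow> (h has_real_derivative h' x) (at x within {0..1})"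
      "\<And>x. x \<in> {0..1} \<Longrightarrow> (h' has_real_derivative h'' x) (at x within {0..1})"
      "continuous_on {0..1} h''" "h 0 = 0"
  shows "Bmul h w z + Bmul h z w = 1/2 * \<rho> 1 * h 1 * (cmod (s\<xi> z))^2 + m * h 1 * (s\<xi> z \<bullet> s\<eta> z)
     + h' 1 * (D1 (fst z) 1 \<bullet> Mom z w) + h 1 * (cmod (Mom z w))^2 / (2 * EI 1)
     - 1/2 * (LINT x|I01. (\<rho>' x * h x + \<rho> x * h' x) * (cmod (sg z x))^2)
     - (LINT x|I01. (3/2 * EI x * h' x - 1/2 * EI' x * h x) * (cmod (D2 (fst z) x))^2)
     - (LINT x|I01. (EI x * h'' x) * (D2 (fst z) x \<bullet> D1 (fst z) x))"
proof -
  obtain f2 f3 h1 h2 where F: "\<forall>x\<in>{0..1}. (D1 (fst z) has_vector_derivative f2 x) (at x within {0..1})"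
    "\<forall>x\<in>{0..1}. (f2 has_vector_derivative f3 x) (at x within {0..1})"
    "continuous_on {0..1} f2" "continuous_on {0..1} f3"
    "AE x in I01. D2 (fst z) x = f2 x"
    "H2chain (\<lambda>x. complex_of_real (EI x) * f2 x) h1 h2"
    "\<forall>x\<in>{0..1}. complex_of_real (\<rho> x) * sg w x = - h2 x"
    "complex_of_real m * s\<xi> w = h1 1" "complex_of_real (EI 1) * f2 1 = Mom z w"
    by (rule Arel_facts[OF A]) (rule that)
  note S = Arel_simple[OF A] and X = Arel_X[OF A]
  define f1 where "f1 = D1 (fst z)"
  define g where "g = sg z"
  define M where "M = Mom z w"
  have ch: "continuous_on {0..1} h" "continuous_on {0..1} h'"
    by (rule DERIV_continuous_on, erule h)+
  have c1: "continuous_on {0..1} f1" unfolding f1_def by (rule H2l_cont(2)[OF S(1)])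
  have G: "H2chain g (D1 g) (D2 g)" "D1 g 0 = 0" "g 0 = 0" unfolding g_def using H2l_D[OF S(2)] by auto
  note Gp = H2chain_props[OF G(1)]
  note cts = ch h(3) c1 F(3,4) Gp(2,3) coeff_cont \<rho>'(2) EI'(2)
  note cI = integrable_I01_cont continuous_intros cts
  have sv: "sq_int (sg w)" using X by (auto simp: Xspace_iff)
  have oh: "((\<lambda>x. complex_of_real (u x)) has_vector_derivative complex_of_real (u' x)) (at x within {0..1})"
    if "(u has_real_derivative u' x) (at x within {0..1})" for u u' x
    using that by (auto intro!: has_vector_derivative_of_real simp: has_real_derivative_iff_has_vector_derivative)
  define \<phi> where "\<phi> x = complex_of_real (h x) * cnj (f1 x)" for x
  define \<phi>1 where "\<phi>1 x = complex_of_real (h x) * cnj (f2 x) + complex_of_real (h' x) * cnj (f1 x)" for x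
  define \<phi>2 where "\<phi>2 x = (complex_of_real (h x) * cnj (f3 x) + complex_of_real (h' x) * cnj (f2 x)) + (complex_of_real (h' x) * cnj (f2 x) + complex_of_real (h'' x) * cnj (f1 x))" for x
  have chain: "H2chain \<phi> \<phi>1 \<phi>2"
  proof (rule H2chainI)
    fix x :: real assume x: "x \<in> {0..1}"
    show "(\<phi> has_vector_derivative \<phi>1 x) (at x within {0..1})"
      unfolding \<phi>_def \<phi>1_def f1_def
      by (intro has_vector_derivative_mult oh h(1)[OF x] has_vector_derivative_cnj F(1)[rule_format, OF x])
    show "(\<phi>1 has_vector_derivative \<phi>2 x) (at x within {0..1})"
      unfolding \<phi>2_def \<phi>1_def f1_def
      by (intro has_vector_derivative_mult has_vector_derivative_add oh h(1)[OF x] h(2)[OF x] has_vector_derivative_cnj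
          F(1,2)[rule_format, OF x])
  next
    show "continuous_on {0..1} \<phi>2" unfolding \<phi>2_def by (intro continuous_intros cts)
  qed
  have \<phi>0: "\<phi> 0 = 0" "\<phi>1 0 = 0" using h(4) by (auto simp: \<phi>_def \<phi>1_def f1_def D1_def)
  note id = test_identity[OF A chain \<phi>0]
  have i: "Re (LINT x|I01. complex_of_real (\<rho> x) * \<phi> x * sg w x) = (LINT x|I01. (h x * \<rho> x) * (sg w x \<bullet> f1 x))"
    by (subst LINT_weighted_inner_eq[OF _ sv sq_int_cont[OF c1]]) (auto intro!: continuous_intros cts simp: \<phi>_def ac_simps)
  have ii: "Re (complex_of_real m * \<phi> 1 * s\<xi> w) = (m * h 1) * (s\<xi> w \<bullet> f1 1)"
    by (simp add: \<phi>_def inner_complex_def algebra_simps)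
  have f21: "f2 1 = M / complex_of_real (EI 1)"
    using F(9) EI_pos[of 1] by (simp add: M_def field_simps)
  have iii: "Re (\<phi>1 1 * M) = h' 1 * (f1 1 \<bullet> M) + h 1 * (cmod M)^2 / EI 1"
    unfolding cmod_power2 \<phi>1_def f21 using EI_pos[of 1]
    by (simp add: inner_complex_def field_simps power2_eq_square)
  have iv: "Re (LINT x|I01. complex_of_real (EI x) * D2 (fst z) x * \<phi>2 x) =
     (LINT x|I01. (EI x * h'' x) * (f2 x \<bullet> f1 x)) + 2 * (LINT x|I01. EI x * h' x * (cmod (f2 x))^2) + (LINT x|I01. EI x * h x * (f2 x \<bullet> f3 x))"
  proof -
    have "(LINT x|I01. complex_of_real (EI x) * D2 (fst z) x * \<phi>2 x) = (LINT x|I01. complex_of_real (EI x) * f2 x * \<phi>2 x)"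
    proof (rule LINT_cong_AE)
      show "integrable I01 (\<lambda>x. complex_of_real (EI x) * D2 (fst z) x * \<phi>2 x)"
        by (intro sq_int_mult sq_int_cont_mult continuous_intros cts H2l_sq S(1) H2chain_props(1)[OF chain])
      show "integrable I01 (\<lambda>x. complex_of_real (EI x) * f2 x * \<phi>2 x)"
        unfolding \<phi>2_def by (intro cI)
      show "AE x in I01. complex_of_real (EI x) * D2 (fst z) x * \<phi>2 x = complex_of_real (EI x) * f2 x * \<phi>2 x"
        using F(5) by eventually_elim simp
    qed
    also have "Re \<dots> = (LINT x|I01. Re (complex_of_real (EI x) * f2 x * \<phi>2 x))"
      unfolding \<phi>2_def by (intro Re_LINT cI)
    also have "\<dots> = (LINT x|I01. (EI x * h'' x) * (f2 x \<bullet> f1 x) + 2 * (EI x * h' x * (cmod (f2 x))^2) + EI x * h x * (f2 x \<bullet> f3 x))"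
      unfolding cmod_power2 \<phi>2_def by (intro Bochner_Integration.integral_cong refl) (simp add: inner_complex_def power2_eq_square algebra_simps)
    also have "\<dots> = (LINT x|I01. (EI x * h'' x) * (f2 x \<bullet> f1 x) + 2 * (EI x * h' x * (cmod (f2 x))^2)) + (LINT x|I01. EI x * h x * (f2 x \<bullet> f3 x))"
      by (intro Bochner_Integration.integral_add cI)
    also have "(LINT x|I01. (EI x * h'' x) * (f2 x \<bullet> f1 x) + 2 * (EI x * h' x * (cmod (f2 x))^2)) = (LINT x|I01. (EI x * h'' x) * (f2 x \<bullet> f1 x)) + (LINT x|I01. 2 * (EI x * h' x * (cmod (f2 x))^2))"
      by (intro Bochner_Integration.integral_add cI)
    finally show ?thesis by simp
  qed
  have Uh: "((\<lambda>x. u x * h x) has_real_derivative (u' x * h x + u x * h' x)) (at x within {0..1})"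
    if "x \<in> {0..1}" "(u has_real_derivative u' x) (at x within {0..1})" for u u' x
    using DERIV_mult[OF that(2) h(1)[OF that(1)]] by (simp add: algebra_simps)
  have UE: "((\<lambda>x. EI x * h x) has_real_derivative (EI' x * h x + EI x * h' x)) (at x within {0..1})" if "x \<in> {0..1}" for x
    by (rule Uh[of x EI EI', OF that EI'(1)[OF that]])
  have UR: "((\<lambda>x. \<rho> x * h x) has_real_derivative (\<rho>' x * h x + \<rho> x * h' x)) (at x within {0..1})" if "x \<in> {0..1}" for x
    by (rule Uh[of x \<rho> \<rho>', OF that \<rho>'(1)[OF that]])
  have cuE: "continuous_on {0..1} (\<lambda>x. EI' x * h x + EI x * h' x)"
    and cuR: "continuous_on {0..1} (\<lambda>x. \<rho>' x * h x + \<rho> x * h' x)" by (intro continuous_intros cts)+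
  have v: "(LINT x|I01. (EI' x * h x + EI x * h' x) * (cmod (f2 x))^2) + 2 * (LINT x|I01. (EI x * h x) * (f2 x \<bullet> f3 x)) = EI 1 * h 1 * (cmod (f2 1))^2"
    using LINT_weighted_square_derivative[of "\<lambda>x. EI x * h x" "\<lambda>x. EI' x * h x + EI x * h' x" f2 f3]
      UE cuE F(2,4) h(4) by auto
  have vi: "(LINT x|I01. (\<rho>' x * h x + \<rho> x * h' x) * (cmod (g x))^2) + 2 * (LINT x|I01. (\<rho> x * h x) * (g x \<bullet> D1 g x)) = \<rho> 1 * h 1 * (cmod (g 1))^2"
    using LINT_weighted_square_derivative[of "\<lambda>x. \<rho> x * h x" "\<lambda>x. \<rho>' x * h x + \<rho> x * h' x" g "D1 g"]
      UR cuR Gp(2,5) h(4) by auto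
  have f21sq: "EI 1 * h 1 * (cmod (f2 1))^2 = h 1 * (cmod M)^2 / EI 1"
    unfolding f21 using EI_pos[of 1] by (simp add: norm_divide power_divide power2_eq_square)
  \<comment> \<open>The second derivative of the test function gives 2 EI h', and the square gives
    minus half of (EI h)'; together 3/2 EI h' - 1/2 EI' h.\<close>
  have c1': "(LINT x|I01. (3/2 * EI x * h' x - 1/2 * EI' x * h x) * (cmod (D2 (fst z) x))^2) = 2 * (LINT x|I01. EI x * h' x * (cmod (f2 x))^2) - 1/2 * (LINT x|I01. (EI' x * h x + EI x * h' x) * (cmod (f2 x))^2)"
  proof -
    have "(LINT x|I01. (3/2 * EI x * h' x - 1/2 * EI' x * h x) * (cmod (D2 (fst z) x))^2) = (LINT x|I01. 2 * (EI x * h' x * (cmod (f2 x))^2) - 1/2 * ((EI' x * h x + EI x * h' x) * (cmod (f2 x))^2))"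
    proof (rule LINT_cong_AE)
      show "integrable I01 (\<lambda>x. (3/2 * EI x * h' x - 1/2 * EI' x * h x) * (cmod (D2 (fst z) x))^2)"
        unfolding power2_norm_eq_inner
        by (intro weighted_inner_integrable H2l_sq S(1) continuous_intros cts)
      show "integrable I01 (\<lambda>x. 2 * (EI x * h' x * (cmod (f2 x))^2) - 1/2 * ((EI' x * h x + EI x * h' x) * (cmod (f2 x))^2))"
        by (intro cI)
      show "AE x in I01. (3/2 * EI x * h' x - 1/2 * EI' x * h x) * (cmod (D2 (fst z) x))^2 = 2 * (EI x * h' x * (cmod (f2 x))^2) - 1/2 * ((EI' x * h x + EI x * h' x) * (cmod (f2 x))^2)"
        using F(5) by eventually_elim (simp add: algebra_simps)
    qed
    also have "\<dots> = (LINT x|I01. 2 * (EI x * h' x * (cmod (f2 x))^2)) - (LINT x|I01. 1/2 * ((EI' x * h x + EI x * h' x) * (cmod (f2 x))^2))"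
      by (intro Bochner_Integration.integral_diff cI)
    finally show ?thesis by simp
  qed
  have c2': "(LINT x|I01. (EI x * h'' x) * (D2 (fst z) x \<bullet> f1 x)) = (LINT x|I01. (EI x * h'' x) * (f2 x \<bullet> f1 x))"
  proof (rule LINT_cong_AE)
    show "integrable I01 (\<lambda>x. (EI x * h'' x) * (D2 (fst z) x \<bullet> f1 x))"
      by (intro weighted_inner_integrable H2l_sq S(1) continuous_intros cts sq_int_cont[OF c1])
    show "integrable I01 (\<lambda>x. (EI x * h'' x) * (f2 x \<bullet> f1 x))" by (intro cI)
    show "AE x in I01. (EI x * h'' x) * (D2 (fst z) x \<bullet> f1 x) = (EI x * h'' x) * (f2 x \<bullet> f1 x)"
      using F(5) by eventually_elim simp
  qed
  have Bz: "Bmul h z w = (LINT x|I01. (\<rho> x * h x) * (g x \<bullet> D1 g x)) + m * h 1 * (s\<xi> z \<bullet> s\<eta> z)"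
    unfolding Bmul_def S(3) S(5)[symmetric] g_def by (simp add: ac_simps)
  have Bw: "Bmul h w z = h' 1 * (f1 1 \<bullet> M) + h 1 * (cmod M)^2 / EI 1 - ((LINT x|I01. (EI x * h'' x) * (f2 x \<bullet> f1 x)) + 2 * (LINT x|I01. EI x * h' x * (cmod (f2 x))^2) + (LINT x|I01. EI x * h x * (f2 x \<bullet> f3 x)))"
    using arg_cong[OF id, of Re] unfolding Bmul_def f1_def[symmetric] plus_complex.sel minus_complex.sel i ii iv M_def[symmetric] iii .
  have g1: "s\<xi> z = g 1" by (simp add: S(4) g_def)
  have MM: "h 1 * (cmod M)^2 / (2 * EI 1) = 1/2 * (h 1 * (cmod M)^2 / EI 1)" by simp
  show ?thesis
    unfolding c1' Bz Bw M_def[symmetric] f1_def[symmetric] g_def[symmetric] c2' MM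
    using v vi unfolding f21sq g1 by (simp add: algebra_simps)
qed

end

section \<open>Low-pass filters on the half line\<close>

lemma half_integrable:
  fixes f :: "real \<Rightarrow> 'a::euclidean_space"
  shows "continuous_on {0..} f \<Longrightarrow> 0 \<le> a \<Longrightarrow> f integrable_on {a..b}"
  by (rule integrable_continuous_real, rule continuous_on_subset[of "{0..}" f]) auto

lemma integral_shift_half:
  fixes f :: "real \<Rightarrow> 'a::euclidean_space"
  assumes f: "continuous_on {0..} f" and "0 \<le> a" "0 \<le> h"
  shows "integral {a..b} (\<lambda>t. f (t + h)) = integral {a+h..b+h} f"
proof -
  have "continuous_on {a+h..b+h} f" by (rule continuous_on_subset[OF f]) (use assms in auto)
  from integral_shift[OF this] show ?thesis by (simp add: o_def)
qed

lemma integral_split_half: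
  fixes f :: "real \<Rightarrow> 'a::euclidean_space"
  assumes f: "continuous_on {0..} f" and "0 \<le> a" "a \<le> b" "b \<le> c"
  shows "integral {a..b} f + integral {b..c} f = integral {a..c} f"
  using assms by (intro Henstock_Kurzweil_Integration.integral_combine half_integrable f) auto

lemma integral_nonneg_half:
  fixes p :: "real \<Rightarrow> real"
  assumes "continuous_on {0..} p" "0 \<le> a" "\<And>t. t \<ge> 0 \<Longrightarrow> p t \<ge> 0"
  shows "integral {a..b} p \<ge> 0"
  using assms by (intro Henstock_Kurzweil_Integration.integral_nonneg half_integrable) auto

lemma integral_mono_half:
  fixes p q :: "real \<Rightarrow> real"
  assumes "continuous_on {0..} p" "continuous_on {0..} q" "0 \<le> a" "\<And>t. t \<ge> 0 \<Longrightarrow> p t \<le> q t"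
  shows "integral {a..b} p \<le> integral {a..b} q"
  using assms by (intro integral_le half_integrable) auto

lemma integral_mono_upper:
  fixes p :: "real \<Rightarrow> real"
  assumes "continuous_on {0..} p" "\<And>t. t \<ge> 0 \<Longrightarrow> p t \<ge> 0" "0 \<le> S" "S \<le> T"
  shows "integral {0..S} p \<le> integral {0..T} p"
  using integral_split_half[of p 0 S T] integral_nonneg_half[of p S T] assms by simp

lemma continuous_shift:
  fixes f :: "real \<Rightarrow> 'a::topological_space"
  shows "continuous_on {0..} f \<Longrightarrow> 0 \<le> h \<Longrightarrow> continuous_on {0..} (\<lambda>t. f (t + h))"
  by (rule continuous_on_compose2[where g=f and t="{0..}"]) (auto intro!: continuous_intros)

lemma shift_derivative:
  fixes g :: "real \<Rightarrow> 'a::real_normed_vector"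
  assumes g: "\<And>s. s \<ge> 0 \<Longrightarrow> (g has_vector_derivative g' s) (at s within {0..})" and h: "h \<ge> 0" and t: "t \<ge> 0"
  shows "((\<lambda>t. g (t + h)) has_vector_derivative g' (t + h)) (at t within {0..})"
proof -
  have "((\<lambda>t. t + h) has_vector_derivative 1) (at t within {0..})"
    by (auto intro!: derivative_eq_intros)
  moreover have "(g has_vector_derivative g' (t + h)) (at (t + h) within (\<lambda>t. t + h) ` {0..})"
    using g[of "t+h"] t h by (auto intro: has_vector_derivative_within_subset)
  ultimately show ?thesis
    using vector_diff_chain_within[of "\<lambda>t. t + h" 1 t "{0..}" g "g' (t + h)"] by (simp add: o_def)
qed

lemma FTC_half:
  fixes q :: "real \<Rightarrow> 'a::euclidean_space"
  assumes "\<And>s. s \<ge> 0 \<Longrightarrow> (q has_vector_derivative q' s) (at s within {0..})" "0 \<le> a" "a \<le> b"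
  shows "integral {a..b} q' = q b - q a"
proof -
  have "(q' has_integral q b - q a) {a..b}"
  proof (rule fundamental_theorem_of_calculus[OF assms(3)])
    fix x assume "x \<in> {a..b}"
    then show "(q has_vector_derivative q' x) (at x within {a..b})"
      using assms(2) by (intro has_vector_derivative_within_subset[OF assms(1)]) auto
  qed
  then show ?thesis by (rule integral_unique)
qed

lemma derivative_imp_continuous_half:
  fixes q :: "real \<Rightarrow> 'a::real_normed_vector"
  assumes "\<And>s. s \<ge> 0 \<Longrightarrow> (q has_vector_derivative q' s) (at s within {0..})"
  shows "continuous_on {0..} q"
  unfolding continuous_on_eq_continuous_within
  using has_vector_derivative_continuous[OF assms] by auto

section \<open>Square integrals over [0, T]\<close>

definition J2 :: "(real \<Rightarrow> complex) \<Rightarrow> real \<Rightarrow> real" where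
  "J2 f T = integral {0..T} (\<lambda>t. (cmod (f t))^2)"

lemma sq_cont: "continuous_on {0..} f \<Longrightarrow> continuous_on {0..} (\<lambda>t. (cmod (f t))^2)"
  by (intro continuous_intros)

lemma J2_mono: "continuous_on {0..} f \<Longrightarrow> 0 \<le> S \<Longrightarrow> S \<le> T \<Longrightarrow> J2 f S \<le> J2 f T"
  unfolding J2_def by (rule integral_mono_upper[OF sq_cont]) auto

text \<open>In \<open>W_diff_J2\<close> the free weight k keeps the constant exactly quadratic in
  the number of averages.\<close>

lemma sq_add_weighted:
  fixes a b :: complex
  assumes k: "k > 0"
  shows "(cmod (a + b))^2 \<le> (1 + k) * (cmod a)^2 + (1 + 1/k) * (cmod b)^2"
proof -
  have "(cmod (a + b))^2 \<le> (cmod a + cmod b)^2" by (intro power_mono norm_triangle_ineq) auto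
  also have "\<dots> = (cmod a)^2 + 2 * cmod a * cmod b + (cmod b)^2" by (simp add: power2_sum)
  also have "2 * cmod a * cmod b \<le> k * (cmod a)^2 + 1/k * (cmod b)^2"
  proof -
    have "0 \<le> (k * cmod a - cmod b)^2" by simp
    then have "0 \<le> (k * (k * (cmod a)^2 + 1/k * (cmod b)^2 - 2 * cmod a * cmod b))"
      using k by (simp add: power2_diff algebra_simps power2_eq_square)
    then show ?thesis using k by (simp add: zero_le_mult_iff)
  qed
  finally show ?thesis by (simp add: algebra_simps)
qed

lemma J2_add_weighted:
  assumes f: "continuous_on {0..} f" and g: "continuous_on {0..} g" and k: "k > 0"
  shows "J2 (\<lambda>t. f t + g t) T \<le> (1 + k) * J2 f T + (1 + 1/k) * J2 g T"
proof -
  have "J2 (\<lambda>t. f t + g t) T \<le> integral {0..T} (\<lambda>t. (1 + k) * (cmod (f t))^2 + (1 + 1/k) * (cmod (g t))^2)"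
    unfolding J2_def by (intro integral_mono_half continuous_intros f g sq_add_weighted k) auto
  also have "\<dots> = integral {0..T} (\<lambda>t. (1 + k) * (cmod (f t))^2) + integral {0..T} (\<lambda>t. (1 + 1/k) * (cmod (g t))^2)"
    by (intro Henstock_Kurzweil_Integration.integral_add half_integrable continuous_intros f g) auto
  finally show ?thesis by (simp add: J2_def)
qed

lemma J2_add:
  assumes f: "continuous_on {0..} f" and g: "continuous_on {0..} g"
  shows "J2 (\<lambda>t. f t + g t) T \<le> 2 * J2 f T + 2 * J2 g T"
  using J2_add_weighted[OF f g, of 1] by simp

lemma J2_scale: "J2 (\<lambda>t. c * f t) T = (cmod c)^2 * J2 f T"
  unfolding J2_def by (simp add: norm_mult power_mult_distrib)

lemma J2_cong: "(\<And>t. t \<ge> 0 \<Longrightarrow> f t = g t) \<Longrightarrow> J2 f T = J2 g T"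
  unfolding J2_def by (intro Henstock_Kurzweil_Integration.integral_cong) auto

lemma J2_mono_fun:
  assumes f: "continuous_on {0..} f" and p: "continuous_on {0..} p"
    and le: "\<And>t. t \<ge> 0 \<Longrightarrow> (cmod (f t))^2 \<le> p t"
  shows "J2 f T \<le> integral {0..T} p"
  unfolding J2_def by (intro integral_mono_half sq_cont f p le) auto

text \<open>The window lies ahead of t, so functions on the half line are mapped to such functions;
  the price is that bounds on [0, T] involve the signal up to T + h.\<close>

definition av :: "real \<Rightarrow> (real \<Rightarrow> complex) \<Rightarrow> real \<Rightarrow> complex" where
  "av h q t = integral {t..t+h} q /\<^sub>R h"

definition dq :: "real \<Rightarrow> (real \<Rightarrow> complex) \<Rightarrow> real \<Rightarrow> complex" where
  "dq h q t = (q (t + h) - q t) /\<^sub>R h"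

lemma dq_cont: "h > 0 \<Longrightarrow> continuous_on {0..} q \<Longrightarrow> continuous_on {0..} (dq h q)"
  unfolding dq_def[abs_def] by (intro continuous_intros continuous_shift) auto

lemma av_derivative:
  assumes h: "h > 0" and q: "continuous_on {0..} q" and t: "t \<ge> 0"
  shows "(av h q has_vector_derivative dq h q t) (at t within {0..})"
proof -
  define P where "P s = integral {0..s} q" for s
  have P: "(P has_vector_derivative q s) (at s within {0..})" if "s \<ge> 0" for s
    unfolding P_def by (rule integral_has_vector_derivative_halfline[OF q that])
  have "((\<lambda>s. (P (s + h) - P s) /\<^sub>R h) has_vector_derivative dq h q t) (at t within {0..})"
    unfolding dq_def using has_vector_derivative_diff[OF shift_derivative[OF P _ t, of h] P[OF t]] h
    by (intro has_vector_derivative_scaleR[where f="\<lambda>_. inverse h" and f'=0, simplified]) auto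
  then show ?thesis
  proof (rule has_vector_derivative_transform[rotated 2])
    show "t \<in> {0..}" using t by simp
    fix s :: real assume "s \<in> {0..}"
    then have "P (s + h) - P s = integral {s..s+h} q"
      using integral_split_half[OF q, of 0 s "s+h"] h unfolding P_def by (metis add_diff_cancel_left' atLeast_iff le_add_same_cancel1 less_imp_le order_refl)
    then show "av h q s = (P (s + h) - P s) /\<^sub>R h" by (simp add: av_def)
  qed
qed

lemma av_cont: "h > 0 \<Longrightarrow> continuous_on {0..} q \<Longrightarrow> continuous_on {0..} (av h q)"
  by (rule derivative_imp_continuous_half[OF av_derivative])

lemma av_of_derivative:
  assumes h: "h > 0" and q: "\<And>s. s \<ge> 0 \<Longrightarrow> (q has_vector_derivative q' s) (at s within {0..})" and t: "t \<ge> 0"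
  shows "av h q' t = dq h q t"
  using FTC_half[OF q, of t "t+h"] h t by (simp add: av_def dq_def)

lemma av_dq:
  assumes h: "h > 0" and q: "continuous_on {0..} q" and t: "t \<ge> 0"
  shows "av h (dq h q) t = dq h (av h q) t"
proof -
  have qs: "continuous_on {0..} (\<lambda>s. q (s + h))" using q h by (intro continuous_shift) auto
  have "integral {t..t+h} (dq h q) = (integral {t..t+h} (\<lambda>s. q (s + h)) - integral {t..t+h} q) /\<^sub>R h"
    unfolding dq_def[abs_def] using half_integrable[OF q t] half_integrable[OF qs t]
    by (simp add: Henstock_Kurzweil_Integration.integral_diff)
  also have "integral {t..t+h} (\<lambda>s. q (s + h)) = integral {t+h..t+h+h} q"
    using integral_shift_half[OF q t, of h "t+h"] h by simp
  finally have I: "integral {t..t+h} (dq h q) = (integral {t+h..t+h+h} q - integral {t..t+h} q) /\<^sub>R h" .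
  show ?thesis unfolding av_def[of h "dq h q"] I unfolding dq_def av_def by (simp add: scaleR_diff_right)
qed

lemma av_add:
  assumes "continuous_on {0..} f" "continuous_on {0..} g" "t \<ge> 0"
  shows "av h (\<lambda>s. f s + g s) t = av h f t + av h g t"
  using assms by (simp add: av_def Henstock_Kurzweil_Integration.integral_add half_integrable scaleR_add_right)

lemma av_cmult: "av h (\<lambda>s. c * f s) t = c * av h f t"
  by (simp add: av_def)

lemma av_cong: "(\<And>s. s \<ge> 0 \<Longrightarrow> f s = g s) \<Longrightarrow> t \<ge> 0 \<Longrightarrow> av h f t = av h g t"
  unfolding av_def by (intro arg_cong[where f="\<lambda>x. x /\<^sub>R h"] Henstock_Kurzweil_Integration.integral_cong) auto

lemma dq_add: "dq h (\<lambda>s. f s + g s) t = dq h f t + dq h g t"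
  by (simp add: dq_def algebra_simps)

lemma dq_cmult: "dq h (\<lambda>s. c * f s) t = c * dq h f t"
  by (simp add: dq_def algebra_simps)

lemma dq_cong: "(\<And>s. s \<ge> 0 \<Longrightarrow> f s = g s) \<Longrightarrow> t \<ge> 0 \<Longrightarrow> h > 0 \<Longrightarrow> dq h f t = dq h g t"
  by (simp add: dq_def)

lemma integral_norm_sq:
  assumes q: "continuous_on {0..} q" and t: "t \<ge> 0" and h: "h > 0"
  shows "(cmod (integral {t..t+h} q))^2 \<le> h * integral {t..t+h} (\<lambda>s. (cmod (q s))^2)"
proof -
  define a where "a = integral {t..t+h} (\<lambda>s. cmod (q s))"
  have i1: "(\<lambda>s. cmod (q s)) integrable_on {t..t+h}" using t q by (intro half_integrable continuous_intros) auto
  have i2: "(\<lambda>s. (cmod (q s))^2) integrable_on {t..t+h}" using t q by (intro half_integrable continuous_intros) auto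
  have i3: "(\<lambda>s. 2 * (a/h) * cmod (q s)) integrable_on {t..t+h}" using t q by (intro half_integrable continuous_intros) auto
  have "cmod (integral {t..t+h} q) \<le> a" unfolding a_def
    by (intro integral_norm_bound_integral half_integrable[OF q t] i1) auto
  then have "(cmod (integral {t..t+h} q))^2 \<le> a^2" by (intro power_mono) auto
  also have "a^2 \<le> h * integral {t..t+h} (\<lambda>s. (cmod (q s))^2)"
  proof -
    \<comment> \<open>The variance of |q| about a/h, which bounds its mean in the square-integral
      sense.\<close>
    have "0 \<le> integral {t..t+h} (\<lambda>s. (cmod (q s) - a/h)^2)"
      using t q by (intro integral_nonneg_half continuous_intros) auto
    also have "\<dots> = integral {t..t+h} (\<lambda>s. ((cmod (q s))^2 - 2 * (a/h) * cmod (q s)) + (a/h)^2)"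
      by (intro Henstock_Kurzweil_Integration.integral_cong) (simp add: power2_diff algebra_simps)
    also have "\<dots> = integral {t..t+h} (\<lambda>s. (cmod (q s))^2 - 2 * (a/h) * cmod (q s)) + integral {t..t+h} (\<lambda>s. (a/h)^2)"
      by (intro Henstock_Kurzweil_Integration.integral_add integrable_diff i2 i3 integrable_const_ivl)
    also have "integral {t..t+h} (\<lambda>s. (cmod (q s))^2 - 2 * (a/h) * cmod (q s)) = integral {t..t+h} (\<lambda>s. (cmod (q s))^2) - integral {t..t+h} (\<lambda>s. 2 * (a/h) * cmod (q s))"
      by (intro Henstock_Kurzweil_Integration.integral_diff i2 i3)
    also have "integral {t..t+h} (\<lambda>s. 2 * (a/h) * cmod (q s)) = 2 * (a/h) * a" by (simp add: a_def)
    also have "integral {t..t+h} (\<lambda>s. (a/h)^2) = h * (a/h)^2" using h by simp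
    finally have "0 \<le> integral {t..t+h} (\<lambda>s. (cmod (q s))^2) - a^2/h"
      using h by (simp add: power2_eq_square field_simps)
    then show ?thesis using h by (simp add: field_simps)
  qed
  finally show ?thesis .
qed

text \<open>With P a primitive of p, the inner integral is P (t + h) - P t, and its integral
  telescopes to P over the last window minus P over the first one. This stands in for an exchange of
  integrals.\<close>

lemma sliding_integral_bound:
  fixes p :: "real \<Rightarrow> real"
  assumes p: "continuous_on {0..} p" and p0: "\<And>t. t \<ge> 0 \<Longrightarrow> p t \<ge> 0" and h: "h > 0" and T: "T \<ge> 0"
  shows "continuous_on {0..} (\<lambda>t. integral {t..t+h} p)"
    "integral {0..T} (\<lambda>t. integral {t..t+h} p) \<le> h * integral {0..T+h} p"
proof -
  define P where "P s = integral {0..s} p" for s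
  have Pc: "continuous_on {0..} P"
    unfolding P_def by (rule derivative_imp_continuous_half[OF integral_has_vector_derivative_halfline[OF p]])
  have P0: "P s \<ge> 0" for s unfolding P_def by (rule integral_nonneg_half[OF p _ p0]) auto
  have eq: "integral {t..t+h} p = P (t + h) - P t" if "t \<ge> 0" for t
    using integral_split_half[OF p, of 0 t "t+h"] h that by (simp add: P_def)
  have Ps: "continuous_on {0..} (\<lambda>t. P (t + h))" using h by (intro continuous_shift Pc) auto
  have "continuous_on {0..} (\<lambda>t. P (t + h) - P t)" by (intro continuous_intros Pc Ps)
  then show "continuous_on {0..} (\<lambda>t. integral {t..t+h} p)"
    by (rule continuous_on_eq) (simp add: eq)
  have "integral {0..T} (\<lambda>t. integral {t..t+h} p) = integral {0..T} (\<lambda>t. P (t + h) - P t)"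
    by (intro Henstock_Kurzweil_Integration.integral_cong) (simp add: eq)
  also have "\<dots> = integral {0..T} (\<lambda>t. P (t + h)) - integral {0..T} P"
    by (intro Henstock_Kurzweil_Integration.integral_diff half_integrable Pc Ps) auto
  also have "integral {0..T} (\<lambda>t. P (t + h)) = integral {h..T+h} P"
    using integral_shift_half[OF Pc, of 0 h T] h by simp
  also have "integral {h..T+h} P - integral {0..T} P = integral {T..T+h} P - integral {0..h} P"
    using integral_split_half[OF Pc, of 0 h "T+h"] integral_split_half[OF Pc, of 0 T "T+h"] h T by simp
  also have "\<dots> \<le> integral {T..T+h} P"
    using integral_nonneg_half[OF Pc, of 0 h] P0 by simp
  also have "\<dots> \<le> integral {T..T+h} (\<lambda>_. P (T + h))"
  proof (rule integral_le)
    show "P s \<le> P (T + h)" if "s \<in> {T..T+h}" for s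
      unfolding P_def using that T by (intro integral_mono_upper p p0) auto
  qed (use T in \<open>auto intro: half_integrable[OF Pc]\<close>)
  also have "\<dots> = h * P (T + h)" using h by simp
  finally show "integral {0..T} (\<lambda>t. integral {t..t+h} p) \<le> h * integral {0..T+h} p" by (simp add: P_def)
qed

lemma av_J2:
  assumes h: "h > 0" and q: "continuous_on {0..} q" and T: "T \<ge> 0"
  shows "J2 (av h q) T \<le> J2 q (T + h)"
proof -
  note s = sliding_integral_bound[OF sq_cont[OF q] _ h T]
  have "J2 (av h q) T \<le> integral {0..T} (\<lambda>t. (1/h) * integral {t..t+h} (\<lambda>s. (cmod (q s))^2))"
  proof (rule J2_mono_fun[OF av_cont[OF h q]])
    show "continuous_on {0..} (\<lambda>t. (1/h) * integral {t..t+h} (\<lambda>s. (cmod (q s))^2))"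
      by (intro continuous_intros s(1)) auto
    fix t :: real assume t: "t \<ge> 0"
    have "(cmod (av h q t))^2 = (1/h)^2 * (cmod (integral {t..t+h} q))^2"
      using h by (simp add: av_def power_mult_distrib divide_inverse)
    also have "\<dots> \<le> (1/h)^2 * (h * integral {t..t+h} (\<lambda>s. (cmod (q s))^2))"
      by (intro mult_left_mono integral_norm_sq q t h) auto
    also have "\<dots> = (1/h) * integral {t..t+h} (\<lambda>s. (cmod (q s))^2)" using h by (simp add: power2_eq_square)
    finally show "(cmod (av h q t))^2 \<le> (1/h) * integral {t..t+h} (\<lambda>s. (cmod (q s))^2)" .
  qed
  also have "\<dots> = (1/h) * integral {0..T} (\<lambda>t. integral {t..t+h} (\<lambda>s. (cmod (q s))^2))" by simp
  also have "\<dots> \<le> (1/h) * (h * integral {0..T+h} (\<lambda>s. (cmod (q s))^2))"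
    using h by (intro mult_left_mono s(2)) auto
  also have "\<dots> = J2 q (T + h)" using h by (simp add: J2_def)
  finally show ?thesis .
qed

lemma shift_J2:
  assumes h: "h \<ge> 0" and q: "continuous_on {0..} q" and T: "T \<ge> 0"
  shows "J2 (\<lambda>t. q (t + h)) T \<le> J2 q (T + h)"
  unfolding J2_def
  using integral_shift_half[OF sq_cont[OF q], of 0 h T] h T
    integral_split_half[OF sq_cont[OF q], of 0 h "T+h"] integral_nonneg_half[OF sq_cont[OF q], of 0 h] by simp

lemma dq_J2:
  assumes h: "h > 0" and q: "continuous_on {0..} q" and T: "T \<ge> 0"
  shows "J2 (dq h q) T \<le> (4/h^2) * J2 q (T + h)"
proof -
  have eq: "dq h q = (\<lambda>t. complex_of_real (1/h) * (q (t + h) + (-1) * q t))"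
    by (rule ext) (simp add: dq_def scaleR_conv_of_real divide_inverse)
  have c: "continuous_on {0..} (\<lambda>t. q (t + h))" "continuous_on {0..} (\<lambda>t. (-1) * q t)"
    using h q by (auto intro!: continuous_shift continuous_intros)
  have "J2 (dq h q) T = (1/h)^2 * J2 (\<lambda>t. q (t + h) + (-1) * q t) T"
    unfolding eq J2_scale by (simp add: norm_divide power_divide)
  also have "\<dots> \<le> (1/h)^2 * (2 * J2 (\<lambda>t. q (t + h)) T + 2 * J2 (\<lambda>t. (-1) * q t) T)"
    by (intro mult_left_mono J2_add c) auto
  also have "\<dots> \<le> (1/h)^2 * (2 * J2 q (T + h) + 2 * J2 q (T + h))"
    unfolding J2_scale using h T by (intro mult_left_mono add_mono shift_J2 q) (auto intro: J2_mono q)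
  finally show ?thesis by (simp add: power_divide)
qed

text \<open>By Cauchy-Schwarz the signal on a window of length h differs from its value at the left
  end by at most the square root of h times the local integral of |q'|^2; the sliding integral
  contributes the second factor h.\<close>

lemma av_diff_J2:
  assumes h: "h > 0" and q: "\<And>s. s \<ge> 0 \<Longrightarrow> (q has_vector_derivative q' s) (at s within {0..})"
    and q': "continuous_on {0..} q'" and T: "T \<ge> 0"
  shows "J2 (\<lambda>t. q t - av h q t) T \<le> h^2 * J2 q' (T + h)"
proof -
  have qc: "continuous_on {0..} q" by (rule derivative_imp_continuous_half[OF q])
  note s = sliding_integral_bound[OF sq_cont[OF q'] _ h T]
  have "J2 (\<lambda>t. q t - av h q t) T \<le> integral {0..T} (\<lambda>t. h * integral {t..t+h} (\<lambda>s. (cmod (q' s))^2))"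
  proof (rule J2_mono_fun)
    show "continuous_on {0..} (\<lambda>t. q t - av h q t)" by (intro continuous_intros qc av_cont h)
    show "continuous_on {0..} (\<lambda>t. h * integral {t..t+h} (\<lambda>s. (cmod (q' s))^2))"
      by (intro continuous_intros s(1)) auto
    fix t :: real assume t: "t \<ge> 0"
    define B where "B = integral {t..t+h} (\<lambda>s. (cmod (q' s))^2)"
    have B0: "B \<ge> 0" unfolding B_def by (rule integral_nonneg_half[OF sq_cont[OF q'] t]) auto
    have b: "cmod (q t - q s) \<le> sqrt (h * B)" if s: "s \<in> {t..t+h}" for s
    proof (cases "s = t")
      case True then show ?thesis using h B0 by simp
    next
      case False
      then have st: "s - t > 0" using s by simp
      have "q s - q t = integral {t..t + (s - t)} q'" using FTC_half[OF q t, of s] s by simp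
      then have "(cmod (q t - q s))^2 \<le> (s - t) * integral {t..t + (s - t)} (\<lambda>s. (cmod (q' s))^2)"
        using integral_norm_sq[OF q' t st] by (simp add: norm_minus_commute)
      also have "\<dots> \<le> h * B"
      proof (intro mult_mono)
        show "integral {t..t + (s - t)} (\<lambda>s. (cmod (q' s))^2) \<le> B" unfolding B_def
          using integral_split_half[OF sq_cont[OF q'] t, of s "t+h"] integral_nonneg_half[OF sq_cont[OF q'], of s "t+h"] s t by simp
      qed (use s h integral_nonneg_half[OF sq_cont[OF q'] t] in auto)
      finally show ?thesis by (rule real_le_rsqrt)
    qed
    have eq: "q t - av h q t = integral {t..t+h} (\<lambda>s. q t - q s) /\<^sub>R h"
    proof -
      have "integral {t..t+h} (\<lambda>s. q t - q s) = integral {t..t+h} (\<lambda>s. q t) - integral {t..t+h} q"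
        by (rule Henstock_Kurzweil_Integration.integral_diff[OF integrable_const_ivl half_integrable[OF qc t]])
      also have "integral {t..t+h} (\<lambda>s. q t) = h *\<^sub>R q t" using h by (simp add: integral_const_real)
      finally show ?thesis using h by (simp add: av_def scaleR_diff_right)
    qed
    have "cmod (integral {t..t+h} (\<lambda>s. q t - q s)) \<le> sqrt (h * B) * (t + h - t)"
      using b h t by (intro integral_bound continuous_intros continuous_on_subset[OF qc]) auto
    then have "cmod (q t - av h q t) \<le> sqrt (h * B)"
      unfolding eq using h by (simp add: field_simps)
    then have "(cmod (q t - av h q t))^2 \<le> (sqrt (h * B))^2" by (intro power_mono) auto
    then show "(cmod (q t - av h q t))^2 \<le> h * integral {t..t+h} (\<lambda>s. (cmod (q' s))^2)"
      using h B0 by (simp add: B_def)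
  qed
  also have "\<dots> = h * integral {0..T} (\<lambda>t. integral {t..t+h} (\<lambda>s. (cmod (q' s))^2))" by simp
  also have "\<dots> \<le> h * (h * integral {0..T+h} (\<lambda>s. (cmod (q' s))^2))"
    using h by (intro mult_left_mono s(2)) auto
  finally show ?thesis by (simp add: J2_def power2_eq_square mult.assoc)
qed

text \<open>i averages followed by j difference quotients. The two kinds commute on continuous
  signals, and a time derivative trades one average for one difference quotient
  (\<open>W_derivative\<close>); derivatives are counted in this way throughout.\<close>

definition W :: "real \<Rightarrow> nat \<Rightarrow> nat \<Rightarrow> (real \<Rightarrow> complex) \<Rightarrow> real \<Rightarrow> complex" where
  "W h i j f = (dq h ^^ j) ((av h ^^ i) f)"

lemma W_0 [simp]: "W h 0 0 f = f"
  by (simp add: W_def)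

lemma W_dq: "dq h (W h i j f) = W h i (Suc j) f"
  by (simp add: W_def)

lemma W_av0: "av h (W h i 0 f) = W h (Suc i) 0 f"
  by (simp add: W_def)

lemma W_cont:
  assumes h: "h > 0" and f: "continuous_on {0..} f"
  shows "continuous_on {0..} (W h i j f)"
proof (induction j)
  case 0
  show ?case by (induction i) (use f in \<open>auto simp: W_av0[symmetric] intro: av_cont h\<close>)
next
  case (Suc j)
  then show ?case unfolding W_dq[symmetric] by (rule dq_cont[OF h])
qed

lemma W_av:
  assumes h: "h > 0" and f: "continuous_on {0..} f" and t: "t \<ge> 0"
  shows "av h (W h i j f) t = W h (Suc i) j f t"
  using t
proof (induction j arbitrary: t)
  case 0
  then show ?case by (simp add: W_av0)
next
  case (Suc j)
  have "av h (W h i (Suc j) f) t = dq h (av h (W h i j f)) t"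
    unfolding W_dq[symmetric] by (rule av_dq[OF h W_cont[OF h f] Suc.prems])
  also have "\<dots> = dq h (W h (Suc i) j f) t"
    by (rule dq_cong[OF Suc.IH Suc.prems h])
  finally show ?case by (simp add: W_dq)
qed

lemma W_derivative:
  assumes h: "h > 0" and f: "continuous_on {0..} f" and t: "t \<ge> 0"
  shows "(W h (Suc i) j f has_vector_derivative W h i (Suc j) f t) (at t within {0..})"
  using t
proof (induction j arbitrary: t)
  case 0
  show ?case unfolding W_av0[symmetric] W_dq[symmetric] by (rule av_derivative[OF h W_cont[OF h f] 0])
next
  case (Suc j)
  have "((\<lambda>t. (W h (Suc i) j f (t + h) - W h (Suc i) j f t) /\<^sub>R h) has_vector_derivative
     (W h i (Suc j) f (t + h) - W h i (Suc j) f t) /\<^sub>R h) (at t within {0..})"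
    using has_vector_derivative_diff[OF shift_derivative[OF Suc.IH _ Suc.prems, of h] Suc.IH[OF Suc.prems]] h
    by (intro has_vector_derivative_scaleR[where f="\<lambda>_. inverse h" and f'=0, simplified]) auto
  then show ?case unfolding W_dq[symmetric, of h "Suc i" j] W_dq[symmetric, of h i "Suc j"] dq_def[abs_def] .
qed

text \<open>The pointwise bound feeds the boundary terms of \<open>even_derivative_pairing\<close>;
  square integrals are covered by \<open>W_J2\<close>.\<close>

lemma W_bound:
  assumes h: "h > 0" and f: "continuous_on {0..} f" and B: "\<And>t. t \<ge> 0 \<Longrightarrow> cmod (f t) \<le> B" and t: "t \<ge> 0"
  shows "cmod (W h i j f t) \<le> (2/h)^j * B"
  using t
proof (induction j arbitrary: t)
  case 0
  then show ?case
  proof (induction i arbitrary: t)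
    case 0 then show ?case using B by simp
  next
    case (Suc i)
    have "cmod (integral {t..t+h} (W h i 0 f)) \<le> B * (t + h - t)"
      using Suc h by (intro integral_bound continuous_on_subset[OF W_cont[OF h f]]) auto
    then show ?case unfolding W_av0[symmetric] av_def using h by (simp add: field_simps)
  qed
next
  case (Suc j)
  have "cmod (W h i j f (t + h) - W h i j f t) \<le> (2/h)^j * B + (2/h)^j * B"
    using Suc h by (intro order_trans[OF norm_triangle_ineq4] add_mono) auto
  then have le: "cmod (W h i j f (t + h) - W h i j f t) / h \<le> ((2/h)^j * B + (2/h)^j * B) / h"
    using h by (intro divide_right_mono) auto
  have "cmod (W h i (Suc j) f t) = cmod (W h i j f (t + h) - W h i j f t) / h"
    unfolding W_dq[symmetric] dq_def norm_scaleR using h by (simp add: divide_inverse mult.commute)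
  also note le
  also have "((2/h)^j * B + (2/h)^j * B) / h = (2/h)^Suc j * B" using h by (simp add: field_simps)
  finally show ?case .
qed

lemma W_J2:
  assumes h: "h > 0" and f: "continuous_on {0..} f" and T: "T \<ge> 0"
  shows "J2 (W h i j f) T \<le> (4/h^2)^j * J2 f (T + real (i + j) * h)"
  using T
proof (induction j arbitrary: T)
  case 0
  then show ?case
  proof (induction i arbitrary: T)
    case (Suc i)
    have "J2 (W h (Suc i) 0 f) T \<le> J2 (W h i 0 f) (T + h)"
      unfolding W_av0[symmetric] by (rule av_J2[OF h W_cont[OF h f] Suc.prems])
    also have "\<dots> \<le> J2 f (T + h + real i * h)" using Suc.IH[of "T+h"] Suc.prems h by simp
    finally show ?case by (simp add: algebra_simps)
  qed simp
next
  case (Suc j)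
  have "J2 (W h i (Suc j) f) T \<le> (4/h^2) * J2 (W h i j f) (T + h)"
    unfolding W_dq[symmetric] by (rule dq_J2[OF h W_cont[OF h f] Suc.prems])
  also have "\<dots> \<le> (4/h^2) * ((4/h^2)^j * J2 f (T + h + real (i + j) * h))"
    using Suc.prems h by (intro mult_left_mono Suc.IH) auto
  finally show ?case by (simp add: algebra_simps)
qed

lemma W_diff_J2:
  assumes h: "h > 0" and q: "\<And>s. s \<ge> 0 \<Longrightarrow> (q has_vector_derivative q' s) (at s within {0..})"
    and q': "continuous_on {0..} q'" and T: "T \<ge> 0"
  shows "J2 (\<lambda>t. q t - W h k 0 q t) T \<le> (real k * h)^2 * J2 q' (T + real k * h)"
  using T
proof (induction k arbitrary: T)
  case 0 then show ?case by (simp add: J2_def)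
next
  case (Suc k)
  have qc: "continuous_on {0..} q" by (rule derivative_imp_continuous_half[OF q])
  define V where "V = J2 q' (T + real (Suc k) * h)"
  have kh: "T + h \<le> T + real (Suc k) * h" "T + h + real k * h = T + real (Suc k) * h"
    using h by (auto simp: algebra_simps)
  have b1: "J2 (\<lambda>t. q t - av h q t) T \<le> h^2 * V"
  proof -
    have "J2 (\<lambda>t. q t - av h q t) T \<le> h^2 * J2 q' (T + h)" by (rule av_diff_J2[OF h q q' Suc.prems])
    also have "\<dots> \<le> h^2 * V" unfolding V_def using kh Suc.prems h by (intro mult_left_mono J2_mono q') auto
    finally show ?thesis .
  qed
  show ?case
  proof (cases "k = 0")
    case True then show ?thesis using b1 by (simp add: W_av0[symmetric] V_def)
  next
    case False
    then have k: "real k > 0" by simp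
    define d where "d t = q t - W h k 0 q t" for t
    have dc: "continuous_on {0..} d" unfolding d_def by (intro continuous_intros qc W_cont h)
    have b2: "J2 (av h d) T \<le> (real k * h)^2 * V"
    proof -
      have "J2 (av h d) T \<le> J2 d (T + h)" by (rule av_J2[OF h dc Suc.prems])
      also have "\<dots> \<le> (real k * h)^2 * V"
        using Suc.IH[of "T + h"] Suc.prems h unfolding d_def V_def kh by simp
      finally show ?thesis .
    qed
    have eq: "q t - W h (Suc k) 0 q t = (q t - av h q t) + av h d t" if "t \<ge> 0" for t
    proof -
      have "av h d t = av h (\<lambda>s. q s + (-1) * W h k 0 q s) t" by (simp add: d_def[abs_def])
      also have "\<dots> = av h q t + (-1) * av h (W h k 0 q) t"
        by (subst av_add) (auto simp: av_cmult[where c="-1", simplified] intro!: qc continuous_intros W_cont h that)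
      finally show ?thesis by (simp add: W_av0)
    qed
    have "J2 (\<lambda>t. q t - W h (Suc k) 0 q t) T = J2 (\<lambda>t. (q t - av h q t) + av h d t) T"
      by (rule J2_cong) (simp add: eq)
    \<comment> \<open>The weight k is the one for which
      \<open>(1 + k) + (1 + 1 / k) * k^2 = (k + 1)^2\<close>, so that k averages cost no more than
      the total delay k h.\<close>
    also have "\<dots> \<le> (1 + real k) * J2 (\<lambda>t. q t - av h q t) T + (1 + 1/real k) * J2 (av h d) T"
      by (intro J2_add_weighted continuous_intros qc av_cont h dc k)
    also have "\<dots> \<le> (1 + real k) * (h^2 * V) + (1 + 1/real k) * ((real k * h)^2 * V)"
      using k by (intro add_mono mult_left_mono b1 b2) auto
    also have "\<dots> = (real (Suc k) * h)^2 * V"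
      using k by (simp add: power2_eq_square field_simps)
    finally show ?thesis by (simp add: V_def)
  qed
qed

lemma W_cong:
  assumes "\<And>t. t \<ge> 0 \<Longrightarrow> f t = g t" "h > 0" "t \<ge> 0"
  shows "W h i j f t = W h i j g t"
  using assms(3)
proof (induction j arbitrary: t)
  case 0
  then show ?case
  proof (induction i arbitrary: t)
    case 0 then show ?case using assms(1) by simp
  next
    case (Suc i)
    show ?case unfolding W_av0[symmetric] by (rule av_cong[OF Suc.IH Suc.prems])
  qed
next
  case (Suc j)
  show ?case unfolding W_dq[symmetric] by (rule dq_cong[OF Suc.IH Suc.prems assms(2)])
qed

lemma W_add:
  assumes h: "h > 0" and f: "continuous_on {0..} f" and g: "continuous_on {0..} g" and t: "t \<ge> 0"
  shows "W h i j (\<lambda>s. f s + g s) t = W h i j f t + W h i j g t"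
  using t
proof (induction j arbitrary: t)
  case 0
  then show ?case
  proof (induction i arbitrary: t)
    case 0 then show ?case by simp
  next
    case (Suc i)
    have "W h (Suc i) 0 (\<lambda>s. f s + g s) t = av h (\<lambda>s. W h i 0 f s + W h i 0 g s) t"
      unfolding W_av0[symmetric] by (rule av_cong[OF Suc.IH Suc.prems])
    then show ?case by (simp add: av_add W_cont h f g Suc.prems W_av0)
  qed
next
  case (Suc j)
  have "W h i (Suc j) (\<lambda>s. f s + g s) t = dq h (\<lambda>s. W h i j f s + W h i j g s) t"
    unfolding W_dq[symmetric] by (rule dq_cong[OF Suc.IH Suc.prems h])
  then show ?case by (simp add: dq_add W_dq)
qed

lemma W_cmult:
  assumes h: "h > 0" and t: "t \<ge> 0"
  shows "W h i j (\<lambda>s. c * f s) t = c * W h i j f t"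
  using t
proof (induction j arbitrary: t)
  case 0
  then show ?case
  proof (induction i arbitrary: t)
    case 0 then show ?case by simp
  next
    case (Suc i)
    have "W h (Suc i) 0 (\<lambda>s. c * f s) t = av h (\<lambda>s. c * W h i 0 f s) t"
      unfolding W_av0[symmetric] by (rule av_cong[OF Suc.IH Suc.prems])
    then show ?case by (simp add: av_cmult W_av0)
  qed
next
  case (Suc j)
  have "W h i (Suc j) (\<lambda>s. c * f s) t = dq h (\<lambda>s. c * W h i j f s) t"
    unfolding W_dq[symmetric] by (rule dq_cong[OF Suc.IH Suc.prems h])
  then show ?case by (simp add: dq_cmult W_dq)
qed

lemma W_dq_inner: "W h 0 j (dq h f) = W h 0 (Suc j) f"
  by (simp add: W_def funpow_swap1)

lemma W_split: "W h 2 j f = W h 0 j (av h (av h f))"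
  by (simp add: W_def numeral_2_eq_2)

lemma av2_second_derivative:
  assumes h: "h > 0" and q: "\<And>t. t \<ge> 0 \<Longrightarrow> (q has_vector_derivative q1 t) (at t within {0..})"
    and q1: "\<And>t. t \<ge> 0 \<Longrightarrow> (q1 has_vector_derivative q2 t) (at t within {0..})" and t: "t \<ge> 0"
  shows "av h (av h q2) t = dq h (dq h q) t"
proof -
  have "av h (av h q2) t = av h (dq h q1) t"
    by (rule av_cong[OF av_of_derivative[OF h q1] t])
  also have "\<dots> = dq h (av h q1) t"
    by (rule av_dq[OF h derivative_imp_continuous_half[OF q1] t])
  also have "\<dots> = dq h (dq h q) t"
    by (rule dq_cong[OF av_of_derivative[OF h q] t h])
  finally show ?thesis .
qed

lemma integral_by_parts_inner:
  fixes p q :: "real \<Rightarrow> complex"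
  assumes p: "\<And>t. t \<ge> 0 \<Longrightarrow> (p has_vector_derivative p' t) (at t within {0..})" "continuous_on {0..} p'"
    and q: "\<And>t. t \<ge> 0 \<Longrightarrow> (q has_vector_derivative q' t) (at t within {0..})" "continuous_on {0..} q'"
    and T: "T \<ge> 0"
  shows "integral {0..T} (\<lambda>t. p' t \<bullet> q t) + integral {0..T} (\<lambda>t. p t \<bullet> q' t) = p T \<bullet> q T - p 0 \<bullet> q 0"
proof -
  have c: "continuous_on {0..} p" "continuous_on {0..} q"
    by (rule derivative_imp_continuous_half, fact)+
  have "integral {0..T} (\<lambda>t. p t \<bullet> q' t + p' t \<bullet> q t) = p T \<bullet> q T - p 0 \<bullet> q 0"
  proof (rule FTC_half[of "\<lambda>t. p t \<bullet> q t"])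
    show "((\<lambda>t. p t \<bullet> q t) has_vector_derivative (p s \<bullet> q' s + p' s \<bullet> q s)) (at s within {0..})" if "s \<ge> 0" for s
      by (rule bounded_bilinear.has_vector_derivative[OF bounded_bilinear_inner p(1)[OF that] q(1)[OF that]])
  qed (use T in auto)
  moreover have "integral {0..T} (\<lambda>t. p t \<bullet> q' t + p' t \<bullet> q t) = integral {0..T} (\<lambda>t. p t \<bullet> q' t) + integral {0..T} (\<lambda>t. p' t \<bullet> q t)"
    by (intro Henstock_Kurzweil_Integration.integral_add half_integrable continuous_intros c p q) auto
  ultimately show ?thesis by simp
qed

text \<open>Moving j of the 2j derivatives across by parts leaves (-1)^j times a square integral.
  Each step produces boundary terms at 0 and T of at most B^2 each, uniformly in T.\<close>

lemma even_derivative_pairing: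
  fixes u :: "nat \<Rightarrow> real \<Rightarrow> complex"
  assumes d: "\<And>i t. i < 2 * j \<Longrightarrow> t \<ge> 0 \<Longrightarrow> (u i has_vector_derivative u (Suc i) t) (at t within {0..})"
    and c: "\<And>i. continuous_on {0..} (u i)"
    and B: "\<And>i t. i \<le> 2 * j \<Longrightarrow> t \<ge> 0 \<Longrightarrow> cmod (u i t) \<le> B" and T: "T \<ge> 0"
  shows "(-1)^j * integral {0..T} (\<lambda>t. u (2 * j) t \<bullet> u 0 t) \<ge> - (2 * real j * B^2)"
proof -
  have B0: "B \<ge> 0" using B[of 0 0] norm_ge_zero[of "u 0 0"] by (metis le0 order_refl order_trans)
  have bd: "\<bar>u i t \<bullet> u k t\<bar> \<le> B^2" if "i \<le> 2*j" "k \<le> 2*j" "t \<ge> 0" for i k t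
  proof -
    have "\<bar>u i t \<bullet> u k t\<bar> \<le> cmod (u i t) * cmod (u k t)" by (rule Cauchy_Schwarz_ineq2)
    also have "\<dots> \<le> B * B" using that B0 by (intro mult_mono B) auto
    finally show ?thesis by (simp add: power2_eq_square)
  qed
  have step: "\<bar>integral {0..T} (\<lambda>t. u (2 * j) t \<bullet> u 0 t) - (-1)^k * integral {0..T} (\<lambda>t. u (2 * j - k) t \<bullet> u k t)\<bar> \<le> 2 * real k * B^2"
    if "k \<le> j" for k
    using that
  proof (induction k)
    case (Suc k)
    define I where "I = integral {0..T} (\<lambda>t. u (2 * j - k) t \<bullet> u k t)"
    define I' where "I' = integral {0..T} (\<lambda>t. u (2 * j - Suc k) t \<bullet> u (Suc k) t)"
    have s: "Suc (2 * j - Suc k) = 2 * j - k" using Suc.prems by simp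
    have "integral {0..T} (\<lambda>t. u (Suc (2 * j - Suc k)) t \<bullet> u k t) + I' = u (2*j - Suc k) T \<bullet> u k T - u (2*j - Suc k) 0 \<bullet> u k 0"
      unfolding I'_def by (rule integral_by_parts_inner) (use Suc.prems T in \<open>auto intro!: d c\<close>)
    then have "I + I' = u (2*j - Suc k) T \<bullet> u k T - u (2*j - Suc k) 0 \<bullet> u k 0" unfolding s I_def .
    moreover have "\<bar>u (2*j - Suc k) T \<bullet> u k T\<bar> \<le> B^2" "\<bar>u (2*j - Suc k) 0 \<bullet> u k 0\<bar> \<le> B^2"
      using Suc.prems T by (auto intro!: bd)
    ultimately have "\<bar>I + I'\<bar> \<le> 2 * B^2" by linarith
    then have "\<bar>(-1)^k * I - (-1)^Suc k * I'\<bar> \<le> 2 * B^2" by (simp add: abs_mult flip: distrib_left)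
    moreover have "\<bar>integral {0..T} (\<lambda>t. u (2 * j) t \<bullet> u 0 t) - (-1)^k * I\<bar> \<le> 2 * real k * B^2"
      unfolding I_def using Suc by simp
    ultimately show ?case unfolding I'_def[symmetric] by (simp add: algebra_simps)
  qed simp
  have "2 * j - j = j" by simp
  then have "\<bar>integral {0..T} (\<lambda>t. u (2 * j) t \<bullet> u 0 t) - (-1)^j * integral {0..T} (\<lambda>t. u j t \<bullet> u j t)\<bar> \<le> 2 * real j * B^2"
    using step[of j] by simp
  then have "\<bar>(-1)^j * (integral {0..T} (\<lambda>t. u (2 * j) t \<bullet> u 0 t) - (-1)^j * integral {0..T} (\<lambda>t. u j t \<bullet> u j t))\<bar> \<le> 2 * real j * B^2"
    by (simp add: abs_mult)
  moreover have "(-1)^j * (integral {0..T} (\<lambda>t. u (2 * j) t \<bullet> u 0 t) - (-1)^j * integral {0..T} (\<lambda>t. u j t \<bullet> u j t))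
    = (-1)^j * integral {0..T} (\<lambda>t. u (2 * j) t \<bullet> u 0 t) - integral {0..T} (\<lambda>t. u j t \<bullet> u j t)"
    by (simp add: right_diff_distrib flip: mult.assoc power_add)
  moreover have "integral {0..T} (\<lambda>t. u j t \<bullet> u j t) \<ge> 0"
    by (intro integral_nonneg_half continuous_intros c) auto
  ultimately show ?thesis by linarith
qed

section \<open>Negligible quantities\<close>

locale energy_weight =
  fixes e :: "real \<Rightarrow> real" and E0 :: real
  assumes e_cont: "continuous_on {0..} e" and e_nonneg: "\<And>t. t \<ge> 0 \<Longrightarrow> e t \<ge> 0" and e_le: "\<And>t. t \<ge> 0 \<Longrightarrow> e t \<le> E0"
begin

definition Ie :: "real \<Rightarrow> real" where "Ie T = integral {0..T} e"

lemma E0_nonneg: "E0 \<ge> 0"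
  using e_nonneg[of 0] e_le[of 0] by simp

lemma Ie_nonneg: "Ie T \<ge> 0"
  unfolding Ie_def by (rule integral_nonneg_half[OF e_cont _ e_nonneg]) auto

text \<open>The filters look ahead; since the energy is bounded by E0, this costs only a
  constant.\<close>

lemma Ie_shift:
  assumes "T \<ge> 0" "h \<ge> 0"
  shows "Ie (T + h) \<le> Ie T + h * E0"
proof -
  have "integral {T..T+h} e \<le> integral {T..T+h} (\<lambda>_. E0)"
    using assms by (intro integral_le half_integrable e_cont) (auto intro: e_le)
  then show ?thesis
    using integral_split_half[OF e_cont, of 0 T "T+h"] assms by (simp add: Ie_def)
qed

definition negl :: "(real \<Rightarrow> real) \<Rightarrow> bool" where
  "negl p \<longleftrightarrow> continuous_on {0..} p \<and> (\<forall>t\<ge>0. 0 \<le> p t) \<and> (\<forall>\<epsilon>>0. \<exists>C. \<forall>T\<ge>0. integral {0..T} p \<le> \<epsilon> * Ie T + C)"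

definition Negl :: "(real \<Rightarrow> complex) \<Rightarrow> bool" where
  "Negl f \<longleftrightarrow> continuous_on {0..} f \<and> (\<forall>\<epsilon>>0. \<exists>C. \<forall>T\<ge>0. J2 f T \<le> \<epsilon> * Ie T + C)"

lemma Negl_negl: "Negl f \<Longrightarrow> negl (\<lambda>t. (cmod (f t))^2)"
  unfolding Negl_def negl_def J2_def by (auto intro: sq_cont)

lemma neglD:
  assumes "negl p" "\<epsilon> > 0"
  obtains C where "\<And>T. T \<ge> 0 \<Longrightarrow> integral {0..T} p \<le> \<epsilon> * Ie T + C"
  using assms unfolding negl_def by blast

lemma negl_add:
  assumes "negl p" "negl q"
  shows "negl (\<lambda>t. p t + q t)"
  unfolding negl_def
proof (intro conjI allI impI)
  have c: "continuous_on {0..} p" "continuous_on {0..} q" using assms by (auto simp: negl_def)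
  show "continuous_on {0..} (\<lambda>t. p t + q t)" by (intro continuous_intros c)
  show "0 \<le> p t + q t" if "0 \<le> t" for t using assms that by (auto simp: negl_def)
  fix \<epsilon> :: real assume "\<epsilon> > 0"
  then have e2: "\<epsilon>/2 > 0" by simp
  obtain C where C: "\<And>T. T \<ge> 0 \<Longrightarrow> integral {0..T} p \<le> \<epsilon>/2 * Ie T + C" using neglD[OF assms(1) e2] by blast
  obtain C' where C': "\<And>T. T \<ge> 0 \<Longrightarrow> integral {0..T} q \<le> \<epsilon>/2 * Ie T + C'" using neglD[OF assms(2) e2] by blast
  have "integral {0..T} (\<lambda>t. p t + q t) \<le> \<epsilon> * Ie T + (C + C')" if "T \<ge> 0" for T
  proof -
    have "integral {0..T} (\<lambda>t. p t + q t) = integral {0..T} p + integral {0..T} q"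
      by (intro Henstock_Kurzweil_Integration.integral_add half_integrable c) auto
    then show ?thesis using C[OF that] C'[OF that] by simp
  qed
  then show "\<exists>C. \<forall>T\<ge>0. integral {0..T} (\<lambda>t. p t + q t) \<le> \<epsilon> * Ie T + C" by blast
qed

lemma negl_scale:
  assumes "negl p" "k \<ge> 0"
  shows "negl (\<lambda>t. k * p t)"
  unfolding negl_def
proof (intro conjI allI impI)
  show "continuous_on {0..} (\<lambda>t. k * p t)" using assms by (auto simp: negl_def intro!: continuous_intros)
  show "0 \<le> k * p t" if "0 \<le> t" for t using assms that by (auto simp: negl_def)
  fix \<epsilon> :: real assume "\<epsilon> > 0"
  then have e2: "\<epsilon>/(k+1) > 0" using assms by simp
  obtain C where C: "\<And>T. T \<ge> 0 \<Longrightarrow> integral {0..T} p \<le> \<epsilon>/(k+1) * Ie T + C" using neglD[OF assms(1) e2] by blast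
  have "integral {0..T} (\<lambda>t. k * p t) \<le> \<epsilon> * Ie T + k * C" if "T \<ge> 0" for T
  proof -
    have "integral {0..T} (\<lambda>t. k * p t) \<le> k * (\<epsilon>/(k+1) * Ie T + C)"
      using mult_left_mono[OF C[OF that] assms(2)] by simp
    also have "\<dots> = k/(k+1) * (\<epsilon> * Ie T) + k * C" by (simp add: algebra_simps)
    also have "\<dots> \<le> 1 * (\<epsilon> * Ie T) + k * C"
      using assms \<open>\<epsilon> > 0\<close> Ie_nonneg[of T] by (intro add_right_mono mult_right_mono) auto
    finally show ?thesis by simp
  qed
  then show "\<exists>C. \<forall>T\<ge>0. integral {0..T} (\<lambda>t. k * p t) \<le> \<epsilon> * Ie T + C" by blast
qed

text \<open>A pointwise error \<epsilon> e integrates to \<epsilon> times Ie and is therefore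
  tolerated; this is how approximations of test functions enter.\<close>

lemma negl_approx:
  assumes p: "continuous_on {0..} p" "\<And>t. t \<ge> 0 \<Longrightarrow> 0 \<le> p t"
    and a: "\<And>\<epsilon>. \<epsilon> > 0 \<Longrightarrow> \<exists>q. negl q \<and> (\<forall>t\<ge>0. p t \<le> \<epsilon> * e t + q t)"
  shows "negl p"
  unfolding negl_def
proof (intro conjI allI impI p)
  fix \<epsilon> :: real assume "\<epsilon> > 0"
  then have e2: "\<epsilon>/2 > 0" by simp
  obtain q where q: "negl q" "\<And>t. t \<ge> 0 \<Longrightarrow> p t \<le> \<epsilon>/2 * e t + q t" using a[OF e2] by blast
  have cq: "continuous_on {0..} q" using q(1) by (simp add: negl_def)
  obtain C where C: "\<And>T. T \<ge> 0 \<Longrightarrow> integral {0..T} q \<le> \<epsilon>/2 * Ie T + C" using neglD[OF q(1) e2] by blast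
  have "integral {0..T} p \<le> \<epsilon> * Ie T + C" if "T \<ge> 0" for T
  proof -
    have "integral {0..T} p \<le> integral {0..T} (\<lambda>t. \<epsilon>/2 * e t + q t)"
      by (intro integral_mono_half p continuous_intros e_cont cq q(2)) auto
    also have "\<dots> = integral {0..T} (\<lambda>t. \<epsilon>/2 * e t) + integral {0..T} q"
      by (intro Henstock_Kurzweil_Integration.integral_add half_integrable continuous_intros e_cont cq) auto
    also have "\<dots> \<le> \<epsilon>/2 * Ie T + (\<epsilon>/2 * Ie T + C)" using C[OF that] by (simp add: Ie_def)
    finally show ?thesis by (simp add: algebra_simps)
  qed
  then show "\<exists>C. \<forall>T\<ge>0. integral {0..T} p \<le> \<epsilon> * Ie T + C" by blast
qed

lemma negl_mono:
  assumes "negl q" "continuous_on {0..} p" "\<And>t. t \<ge> 0 \<Longrightarrow> 0 \<le> p t" "\<And>t. t \<ge> 0 \<Longrightarrow> p t \<le> q t"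
  shows "negl p"
proof (rule negl_approx[OF assms(2,3)])
  fix \<epsilon> :: real assume "\<epsilon> > 0"
  then have "p t \<le> \<epsilon> * e t + q t" if "t \<ge> 0" for t
    using assms(4)[OF that] e_nonneg[OF that] by (simp add: add_increasing)
  then show "\<exists>q. negl q \<and> (\<forall>t\<ge>0. p t \<le> \<epsilon> * e t + q t)" using assms(1) by blast
qed auto

lemma negl_bounded_integral:
  assumes "continuous_on {0..} p" "\<And>t. t \<ge> 0 \<Longrightarrow> 0 \<le> p t" "\<And>T. T \<ge> 0 \<Longrightarrow> integral {0..T} p \<le> C"
  shows "negl p"
  unfolding negl_def
proof (intro conjI allI impI assms)
  fix \<epsilon> :: real assume "\<epsilon> > 0"
  then have "integral {0..T} p \<le> \<epsilon> * Ie T + C" if "T \<ge> 0" for T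
    using assms(3)[OF that] Ie_nonneg[of T] by (simp add: add_increasing)
  then show "\<exists>C. \<forall>T\<ge>0. integral {0..T} p \<le> \<epsilon> * Ie T + C" by blast
qed auto

lemma Negl_iff: "Negl f \<longleftrightarrow> continuous_on {0..} f \<and> negl (\<lambda>t. (cmod (f t))^2)"
  unfolding Negl_def negl_def J2_def by (auto intro: sq_cont)

lemma Negl_add: "Negl f \<Longrightarrow> Negl g \<Longrightarrow> Negl (\<lambda>t. f t + g t)"
  unfolding Negl_iff
proof (elim conjE, intro conjI)
  assume c: "continuous_on {0..} f" "continuous_on {0..} g" and n: "negl (\<lambda>t. (cmod (f t))^2)" "negl (\<lambda>t. (cmod (g t))^2)"
  show c': "continuous_on {0..} (\<lambda>t. f t + g t)" by (intro continuous_intros c)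
  show "negl (\<lambda>t. (cmod (f t + g t))^2)"
  proof (rule negl_mono[OF negl_add[OF negl_scale[OF n(1)] negl_scale[OF n(2)]]])
    show "(cmod (f t + g t))^2 \<le> 2 * (cmod (f t))^2 + 2 * (cmod (g t))^2" for t
      using sq_add_weighted[of 1 "f t" "g t"] by simp
  qed (auto intro: sq_cont c')
qed

lemma Negl_cmult: "Negl f \<Longrightarrow> Negl (\<lambda>t. c * f t)"
  unfolding Negl_iff norm_mult power_mult_distrib by (intro conjI continuous_intros negl_scale) auto

lemma Negl_cong: "Negl f \<Longrightarrow> (\<And>t. t \<ge> 0 \<Longrightarrow> f t = g t) \<Longrightarrow> Negl g"
  unfolding Negl_def using J2_cong[of f g] by (auto intro: continuous_on_eq)

lemma Negl_0: "Negl (\<lambda>_. 0)"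
  unfolding Negl_iff by (auto intro!: negl_bounded_integral[where C=0])

lemma Negl_sum: "(\<And>i. i \<in> A \<Longrightarrow> Negl (f i)) \<Longrightarrow> Negl (\<lambda>t. \<Sum>i\<in>A. f i t)"
  by (induction A rule: infinite_finite_induct) (auto intro: Negl_add Negl_0)

text \<open>The gain K of the filter is absorbed by using the accuracy \<epsilon> / K, its delay s
  by \<open>Ie_shift\<close>.\<close>

lemma Negl_W:
  assumes f: "Negl f" and h: "h > 0"
  shows "Negl (W h i j f)"
  unfolding Negl_def
proof (intro conjI allI impI)
  have c: "continuous_on {0..} f" using f by (simp add: Negl_def)
  show "continuous_on {0..} (W h i j f)" by (rule W_cont[OF h c])
  fix \<epsilon> :: real assume e: "\<epsilon> > 0"
  define K where "K = (4/h^2)^j"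
  have K: "K > 0" using h by (simp add: K_def)
  obtain C where C: "\<And>T. T \<ge> 0 \<Longrightarrow> J2 f T \<le> \<epsilon>/K * Ie T + C"
    using f e K unfolding Negl_def by (meson divide_pos_pos)
  define s where "s = real (i + j) * h"
  have s: "s \<ge> 0" using h by (simp add: s_def)
  have "J2 (W h i j f) T \<le> \<epsilon> * Ie T + (\<epsilon> * (s * E0) + K * C)" if T: "T \<ge> 0" for T
  proof -
    have "J2 (W h i j f) T \<le> K * J2 f (T + s)" unfolding K_def s_def by (rule W_J2[OF h c T])
    also have "\<dots> \<le> K * (\<epsilon>/K * Ie (T + s) + C)" using K C[of "T+s"] T s by (intro mult_left_mono) auto
    also have "\<dots> = \<epsilon> * Ie (T + s) + K * C" using K by (simp add: algebra_simps)
    also have "\<dots> \<le> \<epsilon> * (Ie T + s * E0) + K * C" using e Ie_shift[OF T s] by (intro add_right_mono mult_left_mono) auto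
    finally show ?thesis by (simp add: algebra_simps)
  qed
  then show "\<exists>C. \<forall>T\<ge>0. J2 (W h i j f) T \<le> \<epsilon> * Ie T + C" by blast
qed

text \<open>The order of the choices is the point. The total delay \<tau> of the 2N averages is
  fixed by the accuracy, which bounds q minus its filtered version independently of N. Only then is
  N taken so large that \<open>decay\<close> beats the gain \<open>(4 / h^2)^(2 * N)\<close> of the
  2N difference quotients with step h = \<tau> / (2N).\<close>

lemma lowpass_final:
  assumes q: "\<And>t. t \<ge> 0 \<Longrightarrow> (q has_vector_derivative q' t) (at t within {0..})" "continuous_on {0..} q'"
    and G: "G \<ge> 0" "\<And>t. t \<ge> 0 \<Longrightarrow> (cmod (q' t))^2 \<le> G * e t"
    and r: "\<And>n. continuous_on {0..} (r n)" "\<And>n t. t \<ge> 0 \<Longrightarrow> (cmod (r n t))^2 \<le> (\<gamma> n)^2 * e t"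
    and decay: "\<And>x. (\<lambda>n. (x * real n)^(2*n) * \<gamma> n) \<longlonglongrightarrow> 0"
    and main: "\<And>h N. h > 0 \<Longrightarrow> N \<ge> 1 \<Longrightarrow> \<exists>\<nu> C. negl \<nu> \<and> (\<forall>T\<ge>0. J2 (W h (2*N) 0 q) T \<le> 2 * integral {0..T} \<nu> + 2 * J2 (W h 0 (2*N) (r N)) T + C)"
  shows "Negl q"
  unfolding Negl_def
proof (intro conjI allI impI)
  show qc: "continuous_on {0..} q" by (rule derivative_imp_continuous_half[OF q(1)])
  fix \<epsilon> :: real assume e: "\<epsilon> > 0"
  \<comment> \<open>Makes twice the squared delay times G at most \<epsilon>/3.\<close>
  define \<tau> where "\<tau> = sqrt (\<epsilon> / (6 * (G + 1)))"
  have \<tau>: "\<tau> > 0" using e G by (simp add: \<tau>_def)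
  have \<tau>G: "2 * \<tau>^2 * G \<le> \<epsilon>/3"
  proof -
    have "2 * \<tau>^2 * G = \<epsilon>/3 * (G / (G + 1))" using e G by (simp add: \<tau>_def field_simps)
    also have "\<dots> \<le> \<epsilon>/3 * 1" using e G by (intro mult_left_mono) auto
    finally show ?thesis by simp
  qed
  \<comment> \<open>The number 4n/\<tau> is the square root of 4/h^2 for the step h = \<tau> /
    (2n).\<close>
  have "(\<lambda>n. 4 * ((4/\<tau> * real n)^(2*n) * \<gamma> n)^2) \<longlonglongrightarrow> 4 * 0^2" by (intro tendsto_intros decay)
  then have "eventually (\<lambda>n. 4 * ((4/\<tau> * real n)^(2*n) * \<gamma> n)^2 < \<epsilon>/3) sequentially"
    using e by (intro order_tendstoD(2)[where y="4*0^2"]) auto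
  then obtain N0 where N0: "\<And>n. n \<ge> N0 \<Longrightarrow> 4 * ((4/\<tau> * real n)^(2*n) * \<gamma> n)^2 < \<epsilon>/3"
    by (auto simp: eventually_sequentially)
  define N where "N = max N0 1"
  have N: "N \<ge> 1" "4 * ((4/\<tau> * real N)^(2*N) * \<gamma> N)^2 \<le> \<epsilon>/3" using N0[of N] by (auto simp: N_def)
  define h where "h = \<tau> / (2 * real N)"
  have h: "h > 0" using \<tau> N by (simp add: h_def)
  have Nh: "real (2*N) * h = \<tau>" using N by (simp add: h_def)
  obtain \<nu> C where \<nu>: "negl \<nu>" and C: "\<And>T. T \<ge> 0 \<Longrightarrow> J2 (W h (2*N) 0 q) T \<le> 2 * integral {0..T} \<nu> + 2 * J2 (W h 0 (2*N) (r N)) T + C"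
    using main[OF h N(1)] by blast
  \<comment> \<open>The hypothesis \<open>main\<close> doubles the integral of \<nu> and the
    splitting of q doubles it again, so this share costs \<epsilon>/3.\<close>
  have e12: "\<epsilon>/12 > 0" using e by simp
  obtain C' where C': "\<And>T. T \<ge> 0 \<Longrightarrow> integral {0..T} \<nu> \<le> \<epsilon>/12 * Ie T + C'" using neglD[OF \<nu> e12] by blast
  have "J2 q T \<le> \<epsilon> * Ie T + (2 * \<epsilon>/3 * (\<tau> * E0) + (2 * C + 4 * C'))" if T: "T \<ge> 0" for T
  proof -
    define I where "I = Ie T + \<tau> * E0"
    have I: "Ie (T + \<tau>) \<le> I" "I \<ge> 0" using Ie_shift[OF T, of \<tau>] \<tau> Ie_nonneg[of "T+\<tau>"] by (auto simp: I_def)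
    have Je: "J2 f (T + \<tau>) \<le> K * I" if "continuous_on {0..} f" "K \<ge> 0" "\<And>t. t \<ge> 0 \<Longrightarrow> (cmod (f t))^2 \<le> K * e t" for f K
    proof -
      have "J2 f (T + \<tau>) \<le> integral {0..T+\<tau>} (\<lambda>t. K * e t)"
        by (intro J2_mono_fun that continuous_intros e_cont)
      also have "\<dots> = K * Ie (T + \<tau>)" by (simp add: Ie_def)
      also have "\<dots> \<le> K * I" by (intro mult_left_mono I that)
      finally show ?thesis .
    qed
    have a1: "2 * J2 (\<lambda>t. q t - W h (2*N) 0 q t) T \<le> \<epsilon>/3 * I"
    proof -
      have "2 * J2 (\<lambda>t. q t - W h (2*N) 0 q t) T \<le> 2 * (\<tau>^2 * J2 q' (T + \<tau>))"
        using W_diff_J2[OF h q T, of "2*N"] unfolding Nh by simp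
      also have "\<dots> \<le> 2 * (\<tau>^2 * (G * I))" by (intro mult_left_mono Je q G) auto
      also have "\<dots> = (2 * \<tau>^2 * G) * I" by simp
      also have "\<dots> \<le> \<epsilon>/3 * I" by (intro mult_right_mono \<tau>G I)
      finally show ?thesis .
    qed
    have a2: "4 * J2 (W h 0 (2*N) (r N)) T \<le> \<epsilon>/3 * I"
    proof -
      have hh: "4/h^2 = (4/\<tau> * real N)^2" using \<tau> N by (simp add: h_def power_divide power_mult_distrib)
      have "4 * J2 (W h 0 (2*N) (r N)) T \<le> 4 * ((4/h^2)^(2*N) * J2 (r N) (T + \<tau>))"
        using W_J2[OF h r(1) T, of 0 "2*N" N] Nh by simp
      also have "\<dots> \<le> 4 * ((4/h^2)^(2*N) * ((\<gamma> N)^2 * I))" by (intro mult_left_mono Je r) auto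
      also have "\<dots> = 4 * ((4/\<tau> * real N)^(2*N) * \<gamma> N)^2 * I"
        unfolding hh by (simp add: power_mult_distrib power_mult[symmetric] mult.commute[of 2] ac_simps)
      also have "\<dots> \<le> \<epsilon>/3 * I" by (intro mult_right_mono N I)
      finally show ?thesis .
    qed
    have a3: "4 * integral {0..T} \<nu> \<le> \<epsilon>/3 * Ie T + 4 * C'" using C'[OF T] by simp
    have "J2 q T = J2 (\<lambda>t. (q t - W h (2*N) 0 q t) + W h (2*N) 0 q t) T" by simp
    also have "\<dots> \<le> 2 * J2 (\<lambda>t. q t - W h (2*N) 0 q t) T + 2 * J2 (W h (2*N) 0 q) T"
      by (intro J2_add continuous_intros qc W_cont h)
    also have "\<dots> \<le> 2 * J2 (\<lambda>t. q t - W h (2*N) 0 q t) T + 2 * (2 * integral {0..T} \<nu> + 2 * J2 (W h 0 (2*N) (r N)) T + C)"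
      using C[OF T] by simp
    also have "\<dots> \<le> \<epsilon>/3 * I + \<epsilon>/3 * I + (\<epsilon>/3 * Ie T + 4 * C') + 2 * C"
    proof -
      have "2 * x + 2 * (2 * y + 2 * w + z) \<le> X + X + Y + 2 * z"
        if "2 * x \<le> X" "4 * w \<le> X" "4 * y \<le> Y" for x y w z X Y :: real
        using that by (simp add: algebra_simps)
      from this[OF a1 a2 a3] show ?thesis .
    qed
    finally show ?thesis by (simp add: I_def algebra_simps)
  qed
  then show "\<exists>C. \<forall>T\<ge>0. J2 q T \<le> \<epsilon> * Ie T + C" by blast
qed

end

text \<open>The recursion between moments, detached from the beam: c, \<xi>, \<alpha> are
  displacement, velocity and acceleration of the tip, \<open>r1\<close> and \<open>r2\<close> the
  time derivatives of the moments \<open>r n\<close>, and \<gamma> their size relative to the energy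
  norm. One instance bounds c itself, the other an arbitrary moment once c is known.\<close>

locale moment_chain = energy_weight +
  fixes c \<xi> \<alpha> :: "real \<Rightarrow> complex" and r r1 r2 \<kappa> :: "nat \<Rightarrow> real \<Rightarrow> complex" and s \<mu> \<gamma> :: "nat \<Rightarrow> real" and G :: real
  assumes c': "\<And>t. t \<ge> 0 \<Longrightarrow> (c has_vector_derivative \<xi> t) (at t within {0..})"
    and \<xi>': "\<And>t. t \<ge> 0 \<Longrightarrow> (\<xi> has_vector_derivative \<alpha> t) (at t within {0..})"
    and \<alpha>c: "continuous_on {0..} \<alpha>"
    and r': "\<And>n t. t \<ge> 0 \<Longrightarrow> (r n has_vector_derivative r1 n t) (at t within {0..})"
    and r1': "\<And>n t. t \<ge> 0 \<Longrightarrow> (r1 n has_vector_derivative r2 n t) (at t within {0..})"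
    and r2c: "\<And>n. continuous_on {0..} (r2 n)"
    and \<kappa>: "\<And>n. Negl (\<kappa> n)"
    and rel: "\<And>n t. t \<ge> 0 \<Longrightarrow> r n t + r2 (Suc n) t = \<kappa> n t + complex_of_real (s n) * c t - complex_of_real (\<mu> n) * \<alpha> t"
    and r_le: "\<And>n t. t \<ge> 0 \<Longrightarrow> (cmod (r n t))^2 \<le> (\<gamma> n)^2 * e t"
    and decay: "\<And>x. (\<lambda>n. (x * real n)^(2*n) * \<gamma> n) \<longlonglongrightarrow> 0"
    and G: "G \<ge> 0" "\<And>t. t \<ge> 0 \<Longrightarrow> (cmod (\<xi> t))^2 \<le> G * e t" "\<And>t. t \<ge> 0 \<Longrightarrow> (cmod (c t))^2 \<le> G * e t"
      "\<And>t. t \<ge> 0 \<Longrightarrow> (cmod (r1 0 t))^2 \<le> G * e t"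
begin

lemma cc: "continuous_on {0..} c" "continuous_on {0..} \<xi>" "continuous_on {0..} (r n)" "continuous_on {0..} (r1 n)" "continuous_on {0..} (\<kappa> n)"
  using derivative_imp_continuous_half[OF c'] derivative_imp_continuous_half[OF \<xi>'] derivative_imp_continuous_half[OF r']
    derivative_imp_continuous_half[OF r1'] \<kappa> by (auto simp: Negl_def)

text \<open>The filtered version of the sum of (-1)^j (s j c^(2j) - \<mu> j c^(2j+2)) over j < n.
  Each term carries 2n operators in all: one difference quotient per derivative, and averages for
  the rest.\<close>

definition Sn :: "real \<Rightarrow> nat \<Rightarrow> real \<Rightarrow> complex" where
  "Sn h n t = (\<Sum>j<n. (-1)^j * (complex_of_real (s j) * W h (2*n - 2*j) (2*j) c t
     - complex_of_real (\<mu> j) * W h (2*n - 2*j - 2) (2*j + 2) c t))"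

lemma Sn_cont: "h > 0 \<Longrightarrow> continuous_on {0..} (Sn h n)"
  unfolding Sn_def[abs_def] by (intro continuous_intros W_cont cc)

lemma W_rn:
  assumes h: "h > 0" and t: "t \<ge> 0"
  shows "W h 2 (2*n) (r n) t = W h 2 (2*n) (\<kappa> n) t + complex_of_real (s n) * W h 2 (2*n) c t
    - complex_of_real (\<mu> n) * W h 0 (2*n + 2) c t - W h 0 (2*n + 2) (r (Suc n)) t"
proof -
  have "W h 2 (2*n) (r n) t = W h 2 (2*n) (\<lambda>t. (\<kappa> n t + complex_of_real (s n) * c t) + (complex_of_real (- \<mu> n) * \<alpha> t + (-1) * r2 (Suc n) t)) t"
  proof (rule W_cong[OF _ h t])
    fix t :: real assume "t \<ge> 0"
    from rel[OF this, of n] show "r n t = (\<kappa> n t + complex_of_real (s n) * c t) + (complex_of_real (- \<mu> n) * \<alpha> t + (-1) * r2 (Suc n) t)"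
      by (simp add: algebra_simps eq_diff_eq)
  qed
  also have "\<dots> = (W h 2 (2*n) (\<kappa> n) t + W h 2 (2*n) (\<lambda>t. complex_of_real (s n) * c t) t) + (W h 2 (2*n) (\<lambda>t. complex_of_real (- \<mu> n) * \<alpha> t) t + W h 2 (2*n) (\<lambda>t. (-1) * r2 (Suc n) t) t)"
    by (subst W_add[OF h _ _ t], (intro continuous_intros cc \<alpha>c r2c)+)+ simp
  also have "\<dots> = (W h 2 (2*n) (\<kappa> n) t + complex_of_real (s n) * W h 2 (2*n) c t) + (complex_of_real (- \<mu> n) * W h 2 (2*n) \<alpha> t + (-1) * W h 2 (2*n) (r2 (Suc n)) t)"
    by (simp only: W_cmult[OF h t])
  also have "W h 2 (2*n) \<alpha> t = W h 0 (2*n + 2) c t"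
  proof -
    have "W h 2 (2*n) \<alpha> t = W h 0 (2*n) (dq h (dq h c)) t"
      unfolding W_split by (rule W_cong[OF av2_second_derivative[OF h c' \<xi>'] h t])
    then show ?thesis by (simp add: W_dq_inner)
  qed
  also have "W h 2 (2*n) (r2 (Suc n)) t = W h 0 (2*n + 2) (r (Suc n)) t"
  proof -
    have "W h 2 (2*n) (r2 (Suc n)) t = W h 0 (2*n) (dq h (dq h (r (Suc n)))) t"
      unfolding W_split by (rule W_cong[OF av2_second_derivative[OF h r' r1'] h t])
    then show ?thesis by (simp add: W_dq_inner)
  qed
  finally show ?thesis by simp
qed

text \<open>Two further averages are applied to the previous error. In its last term they turn
  \<open>r2\<close> and \<alpha>, which enter through \<open>rel\<close>, into second difference
  quotients of \<open>r (Suc n)\<close> and c. The new error is the old one averaged twice, plus a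
  filtered \<open>\<kappa> n\<close>.\<close>

lemma chain_negl:
  assumes h: "h > 0"
  shows "Negl (\<lambda>t. W h (2*n) 0 (r 0) t - Sn h n t - (-1)^n * W h 0 (2*n) (r n) t)"
proof (induction n)
  case 0
  show ?case by (simp add: Sn_def Negl_0)
next
  case (Suc n)
  define F where "F t = W h (2*n) 0 (r 0) t - Sn h n t - (-1)^n * W h 0 (2*n) (r n) t" for t
  have FN: "Negl F" using Suc by (simp add: F_def[abs_def])
  define P where "P t = W h (2*n) 0 (r 0) t" for t
  define Q where "Q j t = (-1)^j * (complex_of_real (s j) * W h (2*n - 2*j) (2*j) c t
     - complex_of_real (\<mu> j) * W h (2*n - 2*j - 2) (2*j + 2) c t)" for j t
  have av2: "W h 2 0 (W h i j f) t = W h (Suc (Suc i)) j f t" if "continuous_on {0..} f" "t \<ge> 0" for i j f t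
  proof -
    have "W h 2 0 (W h i j f) t = av h (av h (W h i j f)) t" by (simp add: W_split)
    also have "\<dots> = av h (W h (Suc i) j f) t" by (rule av_cong[OF W_av[OF h that(1)] that(2)])
    finally show ?thesis using W_av[OF h that] by simp
  qed
  have Qc: "continuous_on {0..} (Q j)" for j unfolding Q_def[abs_def] by (intro continuous_intros W_cont h cc)
  have WQ: "W h 2 0 (Q j) t = (-1)^j * (complex_of_real (s j) * W h (2*Suc n - 2*j) (2*j) c t
     - complex_of_real (\<mu> j) * W h (2*Suc n - 2*j - 2) (2*j + 2) c t)" if j: "j < n" and t: "t \<ge> 0" for j t
  proof -
    have "Q j = (\<lambda>t. (-1)^j * (complex_of_real (s j) * W h (2*n - 2*j) (2*j) c t + complex_of_real (- \<mu> j) * W h (2*n - 2*j - 2) (2*j + 2) c t))"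
      by (simp add: Q_def fun_eq_iff)
    then have "W h 2 0 (Q j) t = (-1)^j * W h 2 0 (\<lambda>t. complex_of_real (s j) * W h (2*n - 2*j) (2*j) c t + complex_of_real (- \<mu> j) * W h (2*n - 2*j - 2) (2*j + 2) c t) t"
      by (simp only: W_cmult[OF h t])
    also have "W h 2 0 (\<lambda>t. complex_of_real (s j) * W h (2*n - 2*j) (2*j) c t + complex_of_real (- \<mu> j) * W h (2*n - 2*j - 2) (2*j + 2) c t) t
      = W h 2 0 (\<lambda>t. complex_of_real (s j) * W h (2*n - 2*j) (2*j) c t) t + W h 2 0 (\<lambda>t. complex_of_real (- \<mu> j) * W h (2*n - 2*j - 2) (2*j + 2) c t) t"
      by (rule W_add[OF h _ _ t]) (intro continuous_intros W_cont h cc)+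
    also have "\<dots> = complex_of_real (s j) * W h (Suc (Suc (2*n - 2*j))) (2*j) c t + complex_of_real (- \<mu> j) * W h (Suc (Suc (2*n - 2*j - 2))) (2*j + 2) c t"
      by (simp only: W_cmult[OF h t] av2[OF cc(1) t])
    also have "Suc (Suc (2*n - 2*j)) = 2*Suc n - 2*j" using j by simp
    also have "Suc (Suc (2*n - 2*j - 2)) = 2*Suc n - 2*j - 2" using j by simp
    finally show ?thesis by simp
  qed
  have Wsum: "W h 2 0 (\<lambda>t. \<Sum>j<k. Q j t) t = (\<Sum>j<k. W h 2 0 (Q j) t)" if t: "t \<ge> 0" for k t
  proof (induction k)
    case 0
    show ?case using W_cmult[OF h t, of 2 0 0 "\<lambda>_. 0"] by simp
  next
    case (Suc k)
    have "W h 2 0 (\<lambda>t. (\<Sum>j<k. Q j t) + Q k t) t = W h 2 0 (\<lambda>t. \<Sum>j<k. Q j t) t + W h 2 0 (Q k) t"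
      by (rule W_add[OF h _ Qc t]) (intro continuous_intros Qc)
    then show ?case using Suc by simp
  qed
  have "W h 2 0 F t + (-1)^n * W h 2 (2*n) (\<kappa> n) t = W h (2*Suc n) 0 (r 0) t - Sn h (Suc n) t - (-1)^Suc n * W h 0 (2*Suc n) (r (Suc n)) t"
    if t: "t \<ge> 0" for t
  proof -
    have "F = (\<lambda>t. W h (2*n) 0 (r 0) t + ((-1) * (\<Sum>j<n. Q j t) + (- ((-1)^n)) * W h 0 (2*n) (r n) t))"
      by (simp add: F_def Sn_def Q_def fun_eq_iff)
    then have "W h 2 0 F t = W h 2 0 (\<lambda>t. W h (2*n) 0 (r 0) t + ((-1) * (\<Sum>j<n. Q j t) + (- ((-1)^n)) * W h 0 (2*n) (r n) t)) t"
      by (rule arg_cong)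
    also have "\<dots> = W h 2 0 (W h (2*n) 0 (r 0)) t + W h 2 0 (\<lambda>t. (-1) * (\<Sum>j<n. Q j t) + (- ((-1)^n)) * W h 0 (2*n) (r n) t) t"
      by (rule W_add[OF h W_cont[OF h cc(3)] _ t]) (intro continuous_intros Qc W_cont h cc)
    also have "W h 2 0 (\<lambda>t. (-1) * (\<Sum>j<n. Q j t) + (- ((-1)^n)) * W h 0 (2*n) (r n) t) t = W h 2 0 (\<lambda>t. (-1) * (\<Sum>j<n. Q j t)) t + W h 2 0 (\<lambda>t. (- ((-1)^n)) * W h 0 (2*n) (r n) t) t"
      by (rule W_add[OF h _ _ t]) (intro continuous_intros Qc W_cont h cc)+
    also have "\<dots> = (-1) * (\<Sum>j<n. W h 2 0 (Q j) t) + (- ((-1)^n)) * W h 2 (2*n) (r n) t"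
      by (simp only: W_cmult[OF h t] Wsum[OF t] av2[OF cc(3) t] numeral_2_eq_2[symmetric] One_nat_def[symmetric] Suc_1)
    also have "W h 2 0 (W h (2*n) 0 (r 0)) t = W h (2*Suc n) 0 (r 0) t" using av2[OF cc(3) t, of "2*n" 0 0] by simp
    finally have WF: "W h 2 0 F t = W h (2*Suc n) 0 (r 0) t + ((-1) * (\<Sum>j<n. W h 2 0 (Q j) t) + (- ((-1)^n)) * W h 2 (2*n) (r n) t)" .
    have S: "Sn h (Suc n) t = (\<Sum>j<n. W h 2 0 (Q j) t) + (-1)^n * (complex_of_real (s n) * W h 2 (2*n) c t - complex_of_real (\<mu> n) * W h 0 (2*n + 2) c t)"
      unfolding Sn_def using WQ[OF _ t] by simp
    show ?thesis unfolding WF S W_rn[OF h t] by (simp add: algebra_simps)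
  qed
  then show ?case
    by (rule Negl_cong[OF Negl_add[OF Negl_W[OF FN h] Negl_cmult[OF Negl_W[OF \<kappa> h]]]])
qed

text \<open>With c negligible so is all of \<open>Sn\<close>, and the chain leaves only the
  remainder that \<open>lowpass_final\<close> admits.\<close>

lemma moment_negl:
  assumes "Negl c"
  shows "Negl (r 0)"
proof (rule lowpass_final[OF r' cc(4) G(1,4) cc(3) r_le decay])
  fix h :: real and N :: nat assume h: "h > 0" and N: "N \<ge> 1"
  define F where "F t = W h (2*N) 0 (r 0) t - Sn h N t - (-1)^N * W h 0 (2*N) (r N) t" for t
  have F: "Negl F" unfolding F_def by (rule chain_negl[OF h])
  have S: "Negl (Sn h N)"
  proof -
    have "Negl (\<lambda>t. \<Sum>j<N. (-1)^j * (complex_of_real (s j) * W h (2*N - 2*j) (2*j) c t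
     + complex_of_real (- \<mu> j) * W h (2*N - 2*j - 2) (2*j + 2) c t))"
      by (intro Negl_sum Negl_cmult Negl_add Negl_W assms h)
    then show ?thesis by (simp add: Sn_def[abs_def])
  qed
  define \<nu> where "\<nu> t = (cmod (F t + Sn h N t))^2" for t
  have \<nu>: "negl \<nu>" unfolding \<nu>_def by (rule Negl_negl[OF Negl_add[OF F S]])
  have cF: "continuous_on {0..} F" using F by (simp add: Negl_def)
  have "J2 (W h (2*N) 0 (r 0)) T \<le> 2 * integral {0..T} \<nu> + 2 * J2 (W h 0 (2*N) (r N)) T + 0" if "T \<ge> 0" for T
  proof -
    have "J2 (W h (2*N) 0 (r 0)) T = J2 (\<lambda>t. (F t + Sn h N t) + (-1)^N * W h 0 (2*N) (r N) t) T" by (simp add: F_def)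
    also have "\<dots> \<le> 2 * J2 (\<lambda>t. F t + Sn h N t) T + 2 * J2 (\<lambda>t. (-1)^N * W h 0 (2*N) (r N) t) T"
      by (intro J2_add continuous_intros cF Sn_cont h W_cont cc)
    also have "J2 (\<lambda>t. (-1)^N * W h 0 (2*N) (r N) t) T = J2 (W h 0 (2*N) (r N)) T"
      unfolding J2_scale by (simp add: norm_power)
    finally show ?thesis by (simp add: J2_def \<nu>_def[abs_def])
  qed
  then show "\<exists>\<nu> C. negl \<nu> \<and> (\<forall>T\<ge>0. J2 (W h (2*N) 0 (r 0)) T \<le> 2 * integral {0..T} \<nu> + 2 * J2 (W h 0 (2*N) (r N)) T + C)"
    using \<nu> by blast
qed

text \<open>If the zeroth moment vanishes, the chain is an equation with an elliptic symbol for \<open>c\<close> alone: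
  all coefficients of the even derivatives of the filtered \<open>c\<close> carry the sign that makes the
  pairing with the filtered \<open>c\<close> coercive.\<close>

lemma observed_negl:
  assumes r0: "\<And>t. r 0 t = 0" and s0: "s 0 = 1" and s: "\<And>n. s n \<ge> 0" and \<mu>: "\<And>n. \<mu> n \<ge> 0"
  shows "Negl c"
proof (rule lowpass_final[OF c' cc(2) G(1,2) cc(3) r_le decay])
  fix h :: real and N :: nat assume h: "h > 0" and N: "N \<ge> 1"
  define F where "F t = W h (2*N) 0 (r 0) t - Sn h N t - (-1)^N * W h 0 (2*N) (r N) t" for t
  have F: "Negl F" unfolding F_def by (rule chain_negl[OF h])
  have cF: "continuous_on {0..} F" using F by (simp add: Negl_def)
  have F_eq: "Sn h N t = (-1) * F t + (- ((-1)^N)) * W h 0 (2*N) (r N) t" if t: "t \<ge> 0" for t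
  proof -
    have "W h (2*N) 0 (r 0) t = W h (2*N) 0 (\<lambda>t. 0 * c t) t" by (rule W_cong[OF _ h t]) (simp add: r0)
    also have "\<dots> = 0 * W h (2*N) 0 c t" by (rule W_cmult[OF h t])
    also have "\<dots> = 0" by simp
    finally show ?thesis by (simp add: F_def)
  qed
  \<comment> \<open>Up to order 2N, \<open>u j\<close> is exactly the j-th time derivative of the
    2N-fold average of c, so the terms of \<open>Sn\<close> are \<open>u\<close> at even
    orders.\<close>
  define u where "u j = W h (2*N - j) j c" for j
  have uc: "continuous_on {0..} (u j)" for j unfolding u_def by (rule W_cont[OF h cc(1)])
  have ud: "(u i has_vector_derivative u (Suc i) t) (at t within {0..})" if "i < 2*N" "t \<ge> 0" for i t
  proof -
    have "2*N - i = Suc (2*N - Suc i)" using that by simp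
    then show ?thesis unfolding u_def using W_derivative[OF h cc(1) that(2), of "2*N - Suc i" i] by simp
  qed
  \<comment> \<open>A common bound for the derivatives up to order 2N; the maximum with 1 makes the
    powers increase with the order.\<close>
  define B where "B = (max 1 (2/h))^(2*N) * sqrt (G * E0)"
  have cB: "cmod (c t) \<le> sqrt (G * E0)" if "t \<ge> 0" for t
  proof (rule real_le_rsqrt)
    have "(cmod (c t))^2 \<le> G * e t" by (rule G(3)[OF that])
    also have "\<dots> \<le> G * E0" by (intro mult_left_mono e_le that G)
    finally show "(cmod (c t))^2 \<le> G * E0" .
  qed
  have uB: "cmod (u i t) \<le> B" if "i \<le> 2*N" "t \<ge> 0" for i t
  proof -
    have "cmod (u i t) \<le> (2/h)^i * sqrt (G * E0)" unfolding u_def by (rule W_bound[OF h cc(1) cB that(2)])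
    also have "(2/h)^i \<le> (max 1 (2/h))^i" using h by (intro power_mono) auto
    also have "\<dots> \<le> (max 1 (2/h))^(2*N)" by (intro power_increasing that) auto
    finally show ?thesis using G E0_nonneg by (simp add: B_def mult_right_mono)
  qed
  define I where "I T k = integral {0..T} (\<lambda>t. u k t \<bullet> u 0 t)" for T k
  have I0: "I T 0 = J2 (u 0) T" for T by (simp add: I_def J2_def power2_norm_eq_inner)
  have pair: "(-1)^j * I T (2*j) \<ge> - (2 * real j * B^2)" if "j \<le> N" "T \<ge> 0" for j T
    unfolding I_def
  proof (rule even_derivative_pairing[where u=u and j=j, OF _ uc _ that(2)])
    show "(u i has_vector_derivative u (Suc i) t) (at t within {0..})" if "i < 2*j" "t \<ge> 0" for i t
      using that \<open>j \<le> N\<close> by (intro ud) auto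
    show "cmod (u i t) \<le> B" if "i \<le> 2*j" "t \<ge> 0" for i t
      using that \<open>j \<le> N\<close> by (intro uB) auto
  qed
  define C where "C = (\<Sum>j<N. s j * (2 * real j * B^2) + \<mu> j * (2 * real (Suc j) * B^2))"
  have low: "integral {0..T} (\<lambda>t. Sn h N t \<bullet> u 0 t) \<ge> I T 0 - C" if T: "T \<ge> 0" for T
  proof -
    have Sn: "Sn h N t \<bullet> u 0 t = (\<Sum>j<N. s j * (-1)^j * (u (2*j) t \<bullet> u 0 t) + \<mu> j * (-1)^Suc j * (u (2*Suc j) t \<bullet> u 0 t))" for t
    proof -
      have neg: "((-1)^j * z) \<bullet> w = (-1)^j * (z \<bullet> w)" for z w :: complex and j :: nat
        using inner_mult_left[of "(-1)^j" z w] by simp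
      show ?thesis unfolding Sn_def inner_sum_left
        by (intro sum.cong refl) (simp add: neg inner_diff_left inner_mult_left u_def algebra_simps)
    qed
    have "integral {0..T} (\<lambda>t. Sn h N t \<bullet> u 0 t) = (\<Sum>j<N. integral {0..T} (\<lambda>t. s j * (-1)^j * (u (2*j) t \<bullet> u 0 t) + \<mu> j * (-1)^Suc j * (u (2*Suc j) t \<bullet> u 0 t)))"
      unfolding Sn by (intro Henstock_Kurzweil_Integration.integral_sum half_integrable continuous_intros uc) auto
    also have "\<dots> = (\<Sum>j<N. s j * ((-1)^j * I T (2*j)) + \<mu> j * ((-1)^Suc j * I T (2*Suc j)))"
    proof (intro sum.cong refl)
      fix j
      have "integral {0..T} (\<lambda>t. s j * (-1)^j * (u (2*j) t \<bullet> u 0 t) + \<mu> j * (-1)^Suc j * (u (2*Suc j) t \<bullet> u 0 t))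
        = integral {0..T} (\<lambda>t. s j * (-1)^j * (u (2*j) t \<bullet> u 0 t)) + integral {0..T} (\<lambda>t. \<mu> j * (-1)^Suc j * (u (2*Suc j) t \<bullet> u 0 t))"
        by (intro Henstock_Kurzweil_Integration.integral_add half_integrable continuous_intros uc) auto
      then show "integral {0..T} (\<lambda>t. s j * (-1)^j * (u (2*j) t \<bullet> u 0 t) + \<mu> j * (-1)^Suc j * (u (2*Suc j) t \<bullet> u 0 t))
        = s j * ((-1)^j * I T (2*j)) + \<mu> j * ((-1)^Suc j * I T (2*Suc j))"
        unfolding I_def by (simp only: integral_mult_right mult.assoc)
    qed
    \<comment> \<open>Only the s-term with j = 0 is kept, where s 0 = 1 yields the square integral
      of \<open>u 0\<close>; all other pairings are nonnegative up to boundary terms independent of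
      T.\<close>
    also have "\<dots> \<ge> (\<Sum>j<N. (if j = 0 then I T 0 else 0) + (- (s j * (2 * real j * B^2)) - \<mu> j * (2 * real (Suc j) * B^2)))"
    proof (rule sum_mono)
      fix j assume "j \<in> {..<N}"
      then have j: "j \<le> N" "Suc j \<le> N" by auto
      have 1: "\<mu> j * ((-1)^Suc j * I T (2*Suc j)) \<ge> \<mu> j * (- (2 * real (Suc j) * B^2))"
        by (rule mult_left_mono[OF pair[OF j(2) T] \<mu>])
      have 2: "s j * ((-1)^j * I T (2*j)) \<ge> s j * (- (2 * real j * B^2))"
        by (rule mult_left_mono[OF pair[OF j(1) T] s])
      show "(if j = 0 then I T 0 else 0) + (- (s j * (2 * real j * B^2)) - \<mu> j * (2 * real (Suc j) * B^2)) \<le> s j * ((-1)^j * I T (2*j)) + \<mu> j * ((-1)^Suc j * I T (2*Suc j))"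
        using 1 2 s0 by (cases "j = 0") auto
    qed
    also have "(\<Sum>j<N. (if j = 0 then I T 0 else 0) + (- (s j * (2 * real j * B^2)) - \<mu> j * (2 * real (Suc j) * B^2))) = I T 0 - C"
      using N by (simp add: sum.distrib sum_subtractf sum_negf C_def sum.delta)
    finally show ?thesis .
  qed
  \<comment> \<open>Half of the square integral of \<open>u 0\<close> is absorbed by the lower
    bound; what is left is \<open>Sn\<close>, hence the error and the remainder.\<close>
  have up: "integral {0..T} (\<lambda>t. Sn h N t \<bullet> u 0 t) \<le> 1/2 * J2 (Sn h N) T + 1/2 * J2 (u 0) T" for T
  proof -
    have "integral {0..T} (\<lambda>t. Sn h N t \<bullet> u 0 t) \<le> integral {0..T} (\<lambda>t. 1/2 * (cmod (Sn h N t))^2 + 1/2 * (cmod (u 0 t))^2)"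
    proof (rule integral_mono_half)
      show "Sn h N t \<bullet> u 0 t \<le> 1/2 * (cmod (Sn h N t))^2 + 1/2 * (cmod (u 0 t))^2" for t
        using inner_ge_zero[of "Sn h N t - u 0 t"] by (simp add: power2_norm_eq_inner inner_diff_left inner_diff_right inner_commute)
    qed (intro continuous_intros Sn_cont h uc | simp)+
    also have "\<dots> = integral {0..T} (\<lambda>t. 1/2 * (cmod (Sn h N t))^2) + integral {0..T} (\<lambda>t. 1/2 * (cmod (u 0 t))^2)"
      by (intro Henstock_Kurzweil_Integration.integral_add half_integrable continuous_intros Sn_cont h uc) auto
    finally show ?thesis by (simp only: J2_def integral_mult_right)
  qed
  have SJ: "J2 (Sn h N) T \<le> 2 * J2 F T + 2 * J2 (W h 0 (2*N) (r N)) T" for T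
  proof -
    have "J2 (Sn h N) T = J2 (\<lambda>t. (-1) * F t + (- ((-1)^N)) * W h 0 (2*N) (r N) t) T"
      by (rule J2_cong) (rule F_eq)
    also have "\<dots> \<le> 2 * J2 (\<lambda>t. (-1) * F t) T + 2 * J2 (\<lambda>t. (- ((-1)^N)) * W h 0 (2*N) (r N) t) T"
      by (intro J2_add continuous_intros cF W_cont h cc)
    finally show ?thesis unfolding J2_scale by (simp add: norm_power)
  qed
  have "J2 (W h (2*N) 0 c) T \<le> 2 * integral {0..T} (\<lambda>t. (cmod (F t))^2) + 2 * J2 (W h 0 (2*N) (r N)) T + 2 * C" if T: "T \<ge> 0" for T
  proof -
    have "W h (2*N) 0 c = u 0" by (simp add: u_def)
    then show ?thesis using low[OF T] up[of T] SJ[of T] I0[of T] by (simp add: J2_def[symmetric])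
  qed
  then show "\<exists>\<nu> C. negl \<nu> \<and> (\<forall>T\<ge>0. J2 (W h (2*N) 0 c) T \<le> 2 * integral {0..T} \<nu> + 2 * J2 (W h 0 (2*N) (r N)) T + C)"
    using Negl_negl[OF F] by blast
qed

end

section \<open>Test functions\<close>

definition prim :: "(real \<Rightarrow> real) \<Rightarrow> real \<Rightarrow> real" where
  "prim u x = integral {0..x} u"

lemma prim_0 [simp]: "prim u 0 = 0"
  by (simp add: prim_def)

lemma prim_deriv:
  "continuous_on {0..1} u \<Longrightarrow> x \<in> {0..1} \<Longrightarrow> (prim u has_real_derivative u x) (at x within {0..1})"
  unfolding prim_def[abs_def] by (rule integral_has_real_derivative)

lemma prim_cont: "continuous_on {0..1} u \<Longrightarrow> continuous_on {0..1} (prim u)"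
  by (rule DERIV_continuous_on[OF prim_deriv])

lemma prim_nonneg:
  "continuous_on {0..1} u \<Longrightarrow> (\<And>x. x \<in> {0..1} \<Longrightarrow> u x \<ge> 0) \<Longrightarrow> x \<in> {0..1} \<Longrightarrow> prim u x \<ge> 0"
  unfolding prim_def by (rule Henstock_Kurzweil_Integration.integral_nonneg)
    (auto intro!: integrable_continuous_real intro: continuous_on_subset)

text \<open>Each primitive raises the power and the factorial by one; four of them per step of the
  recursion produce the factor \<open>1 / (4 * n)!\<close>.\<close>

lemma prim_le_power:
  assumes u: "continuous_on {0..1} u" and le: "\<And>x. x \<in> {0..1} \<Longrightarrow> u x \<le> B * x^p / fact p" and x: "x \<in> {0..1}"
  shows "prim u x \<le> B * x^Suc p / fact (Suc p)"
proof -
  have "((\<lambda>x. B * x^p / fact p) has_integral (B * x^Suc p / fact (Suc p) - B * 0^Suc p / fact (Suc p))) {0..x}"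
  proof (rule fundamental_theorem_of_calculus)
    fix y :: real
    have "((\<lambda>x. B * x^Suc p / fact (Suc p)) has_real_derivative (B * (real (Suc p) * y^p) / fact (Suc p))) (at y within {0..x})"
      using DERIV_cdivide[OF DERIV_cmult[OF DERIV_pow[of "Suc p" y "{0..x}"], of B], of "fact (Suc p)"] by simp
    also have "B * (real (Suc p) * y^p) / fact (Suc p) = B * y^p / fact p"
      by (simp add: field_simps del: of_nat_Suc)
    finally show "((\<lambda>x. B * x^Suc p / fact (Suc p)) has_vector_derivative (B * y^p / fact p)) (at y within {0..x})"
      by (simp add: has_real_derivative_iff_has_vector_derivative)
  qed (use x in auto)
  then have hi: "((\<lambda>x. B * x^p / fact p) has_integral (B * x^Suc p / fact (Suc p))) {0..x}" by simp
  have i: "(\<lambda>x. B * x^p / fact p) integrable_on {0..x}" "integral {0..x} (\<lambda>x. B * x^p / fact p) = B * x^Suc p / fact (Suc p)"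
    by (rule has_integral_integrable[OF hi], rule integral_unique[OF hi])
  have "prim u x \<le> integral {0..x} (\<lambda>x. B * x^p / fact p)"
    unfolding prim_def using x
    by (intro integral_le i integrable_continuous_real continuous_on_subset[OF u]) (auto intro!: le)
  then show ?thesis unfolding i(2) .
qed

lemma real_chain_H2chain:
  assumes "\<And>x. x \<in> {0..1} \<Longrightarrow> (y has_real_derivative y1 x) (at x within {0..1})"
    "\<And>x. x \<in> {0..1} \<Longrightarrow> (y1 has_real_derivative y2 x) (at x within {0..1})" "continuous_on {0..1} y2"
  shows "H2chain (\<lambda>x. complex_of_real (y x)) (\<lambda>x. complex_of_real (y1 x)) (\<lambda>x. complex_of_real (y2 x))"
proof (rule H2chainI)
  have oh: "((\<lambda>x. complex_of_real (u x)) has_vector_derivative complex_of_real (u' x)) (at x within {0..1})"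
    if "(u has_real_derivative u' x) (at x within {0..1})" for u u' x
    using that by (auto intro!: has_vector_derivative_of_real simp: has_real_derivative_iff_has_vector_derivative)
  fix x :: real assume x: "x \<in> {0..1}"
  show "((\<lambda>x. complex_of_real (y x)) has_vector_derivative complex_of_real (y1 x)) (at x within {0..1})"
    by (intro oh assms(1) x)
  show "((\<lambda>x. complex_of_real (y1 x)) has_vector_derivative complex_of_real (y2 x)) (at x within {0..1})"
    by (intro oh assms(2) x)
qed (intro continuous_intros assms)

text \<open>Put n = j + 1. Since \<open>(4 * j)!\<close> is at least
  \<open>(2 * j)^(2 * j) * (2 * j)!\<close>, the first factor absorbs the growth n^(2n), and a term
  of a convergent exponential series is left.\<close>

lemma exp_ratio_decay:
  fixes x L K :: real
  assumes L: "L \<ge> 0"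
  shows "(\<lambda>n. (x * real n)^(2*n) * (K * L^n / fact (4*(n-1)))) \<longlonglongrightarrow> 0"
proof -
  \<comment> \<open>Collects |x|, the square root of L, which is raised to the power 2j, and the 2
    lost in comparing (j + 1)^(2j + 2) with (2j)^(2j).\<close>
  define y where "y = 2 * \<bar>x\<bar> * sqrt L"
  have fact_ge: "fact (4*j) \<ge> (2 * real j)^(2*j) * fact (2*j)" for j :: nat
  proof -
    have "(2 * real j)^(2*j) * fact (2*j) \<le> (fact (2*j + 2*j) :: real)"
    proof -
      have g: "(real a)^k * fact a \<le> (fact (a + k) :: real)" for a k :: nat
      proof (induction k)
        case (Suc k)
        have "(real a)^Suc k * fact a = real a * ((real a)^k * fact a)" by simp
        also have "\<dots> \<le> real (Suc (a + k)) * fact (a + k)" by (intro mult_mono Suc) auto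
        finally show ?case by simp
      qed simp
      show ?thesis using g[of "2*j" "2*j"] by simp
    qed
    then show ?thesis by (simp add: mult_2[symmetric] flip: mult.assoc)
  qed
  have main: "\<bar>(x * real (Suc j))^(2*Suc j) * (K * L^Suc j / fact (4*j))\<bar> \<le> (\<bar>K\<bar> * x^2 * L) * (y^(2*j) / fact (2*j))" if j: "j \<ge> 1" for j
  proof -
    have a: "(real (Suc j))^(2*Suc j) \<le> (2 * real j)^(2*j) * 2^(2*j)"
    proof -
      have "(real (Suc j))^(2*j) \<le> (2 * real j)^(2*j)" using j by (intro power_mono) auto
      moreover have "real (Suc j) \<le> 2^j" by (induction j) auto
      then have "(real (Suc j))^2 \<le> (2^j)^2" by (intro power_mono) auto
      then have "(real (Suc j))^2 \<le> 2^(2*j)" by (simp add: power_mult[symmetric] mult.commute)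
      ultimately have "(real (Suc j))^(2*j) * (real (Suc j))^2 \<le> (2 * real j)^(2*j) * 2^(2*j)"
        by (intro mult_mono) auto
      then show ?thesis by (simp add: power_add[symmetric] del: power_Suc)
    qed
    have "\<bar>(x * real (Suc j))^(2*Suc j) * (K * L^Suc j / fact (4*j))\<bar> = (\<bar>K\<bar> * \<bar>x\<bar>^(2*Suc j) * L^Suc j) * ((real (Suc j))^(2*Suc j) / fact (4*j))"
      using L by (simp add: abs_mult power_mult_distrib power_abs del: power_Suc of_nat_Suc)
    also have "\<dots> \<le> (\<bar>K\<bar> * \<bar>x\<bar>^(2*Suc j) * L^Suc j) * (2^(2*j) / fact (2*j))"
    proof (intro mult_left_mono)
      have "(real (Suc j))^(2*Suc j) / fact (4*j) \<le> ((2 * real j)^(2*j) * 2^(2*j)) / ((2 * real j)^(2*j) * fact (2*j))"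
        using j by (intro frac_le a fact_ge) auto
      also have "\<dots> = 2^(2*j) / fact (2*j)" using j by simp
      finally show "(real (Suc j))^(2*Suc j) / fact (4*j) \<le> 2^(2*j) / fact (2*j)" .
    qed (use L in auto)
    also have "\<dots> = (\<bar>K\<bar> * x^2 * L) * (y^(2*j) / fact (2*j))"
    proof -
      have "\<bar>x\<bar>^(2*Suc j) = x^2 * \<bar>x\<bar>^(2*j)" by (simp add: power2_eq_square mult.assoc[symmetric])
      moreover have "L^Suc j = L * sqrt L^(2*j)" using L by (simp add: power_mult)
      moreover have "y^(2*j) = 2^(2*j) * \<bar>x\<bar>^(2*j) * sqrt L^(2*j)" by (simp only: y_def power_mult_distrib)
      ultimately show ?thesis by (simp only: times_divide_eq_right mult.assoc mult.left_commute mult.commute)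
    qed
    finally show ?thesis .
  qed
  have "summable (\<lambda>n. y^n / fact n)" using summable_exp[of y] by (simp add: divide_inverse mult.commute)
  then have "(\<lambda>n. y^n / fact n) \<longlonglongrightarrow> 0" by (rule summable_LIMSEQ_zero)
  then have "(\<lambda>j. y^(2*j) / fact (2*j)) \<longlonglongrightarrow> 0"
    using LIMSEQ_subseq_LIMSEQ[of _ _ "\<lambda>j. 2*j"] by (force simp: strict_mono_def o_def)
  then have "(\<lambda>j. (\<bar>K\<bar> * x^2 * L) * (y^(2*j) / fact (2*j))) \<longlonglongrightarrow> 0" by (rule tendsto_mult_right_zero)
  then have "(\<lambda>j. (x * real (Suc j))^(2*Suc j) * (K * L^Suc j / fact (4*j))) \<longlonglongrightarrow> 0"
    by (rule Lim_null_comparison[rotated]) (use main in \<open>auto simp: eventually_sequentially intro!: exI[of _ 1]\<close>)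
  then show ?thesis by (subst filterlim_sequentially_Suc[symmetric]) simp
qed

section \<open>Moments of the displacement and the iterated test functions\<close>

context tower
begin

lemma div_EI_cont: "continuous_on {0..1} u \<Longrightarrow> continuous_on {0..1} (\<lambda>x. u x / EI x)"
proof -
  assume u: "continuous_on {0..1} u"
  have "EI x \<noteq> 0" if "x \<in> {0..1}" for x using EI_pos[OF that] by simp
  then show ?thesis by (intro continuous_on_divide u coeff_cont) blast
qed

text \<open>The test function y satisfies \<open>EI y'' = Y\<close>, hence
  \<open>(EI y'')'' = \<theta>\<close>, with y(0) = y'(0) = 0. Two further integrations by parts
  move the remaining derivatives from the displacement to Y; the elastic term becomes a moment of
  the displacement plus boundary values at 1.\<close>

lemma moment_identity:
  assumes A: "Arel \<rho> EI m J b z w"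
    and Y: "\<And>x. x \<in> {0..1} \<Longrightarrow> (Y has_real_derivative Y1 x) (at x within {0..1})"
      "\<And>x. x \<in> {0..1} \<Longrightarrow> (Y1 has_real_derivative \<theta> x) (at x within {0..1})" "continuous_on {0..1} \<theta>"
    and y: "y = prim (prim (\<lambda>x. Y x / EI x))"
  shows "(LINT x|I01. complex_of_real (\<theta> x) * fst z x) + (LINT x|I01. complex_of_real (\<rho> x * y x) * sg w x)
    = complex_of_real (prim (\<lambda>x. Y x / EI x) 1) * Mom z w - complex_of_real (Y 1) * D1 (fst z) 1
      + complex_of_real (Y1 1) * fst z 1 - complex_of_real (m * y 1) * s\<xi> w"
proof -
  have cY: "continuous_on {0..1} Y" "continuous_on {0..1} Y1" by (rule DERIV_continuous_on, erule Y)+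
  have cE: "continuous_on {0..1} (\<lambda>x. Y x / EI x)" by (rule div_EI_cont[OF cY(1)])
  have ch: "H2chain (\<lambda>x. complex_of_real (y x)) (\<lambda>x. complex_of_real (prim (\<lambda>x. Y x / EI x) x)) (\<lambda>x. complex_of_real (Y x / EI x))"
    unfolding y by (rule real_chain_H2chain) (auto intro!: prim_deriv prim_cont cE)
  have H: "H2l (fst z)" by (rule Arel_simple(1)[OF A])
  note P = H2chain_props[OF H2l_D(1)[OF H]]
  have oh: "((\<lambda>x. complex_of_real (u x)) has_vector_derivative complex_of_real (u' x)) (at x within {0..1})"
    if "(u has_real_derivative u' x) (at x within {0..1})" for u u' x
    using that by (auto intro!: has_vector_derivative_of_real simp: has_real_derivative_iff_has_vector_derivative)
  have id: "(LINT x|I01. complex_of_real (\<rho> x) * complex_of_real (y x) * sg w x) + complex_of_real m * complex_of_real (y 1) * s\<xi> w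
    = complex_of_real (prim (\<lambda>x. Y x / EI x) 1) * Mom z w - (LINT x|I01. complex_of_real (EI x) * D2 (fst z) x * complex_of_real (Y x / EI x))"
    by (rule test_identity[OF A ch]) (simp_all add: y)
  have 1: "(LINT x|I01. complex_of_real (EI x) * D2 (fst z) x * complex_of_real (Y x / EI x)) = (LINT x|I01. D2 (fst z) x * complex_of_real (Y x))"
  proof (intro Bochner_Integration.integral_cong refl)
    fix x assume "x \<in> space I01"
    then show "complex_of_real (EI x) * D2 (fst z) x * complex_of_real (Y x / EI x) = D2 (fst z) x * complex_of_real (Y x)"
      using EI_pos[of x] by simp
  qed
  have 2: "(LINT x|I01. D2 (fst z) x * complex_of_real (Y x)) = D1 (fst z) 1 * complex_of_real (Y 1) - D1 (fst z) 0 * complex_of_real (Y 0)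
     - (LINT x|I01. D1 (fst z) x * complex_of_real (Y1 x))"
    by (rule ibp_L2[OF P(1) P(4) oh[where u=Y and u'=Y1, OF Y(1)]]) (auto intro!: continuous_intros cY)
  have 3: "(LINT x|I01. D1 (fst z) x * complex_of_real (Y1 x)) = fst z 1 * complex_of_real (Y1 1) - fst z 0 * complex_of_real (Y1 0)
     - (LINT x|I01. fst z x * complex_of_real (\<theta> x))"
    by (rule ibp_smooth[OF P(5) oh[where u=Y1 and u'=\<theta>, OF Y(2)] P(2)]) (auto intro!: continuous_intros Y(3))
  show ?thesis using id unfolding 1 2 3 H2l_D(2,3)[OF H] by (simp add: algebra_simps)
qed

text \<open>The next weight is \<rho> times the solution of \<open>(EI y'')'' = th n\<close> with
  zero data at 0, except that in the first step the shear \<open>(EI y'')'\<close> starts from k.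
  The choice \<theta> = 0, k = 1 makes the zeroth moment vanish while the coefficient of c is 1; an
  arbitrary \<theta> with k = 0 gives the chain for the moment against \<theta>.\<close>

primrec th :: "real \<Rightarrow> (real \<Rightarrow> real) \<Rightarrow> nat \<Rightarrow> real \<Rightarrow> real" where
  "th k \<theta> 0 = \<theta>"
| "th k \<theta> (Suc n) = (\<lambda>x. \<rho> x * prim (prim (\<lambda>s. prim (\<lambda>q. (if n = 0 then k else 0) + prim (th k \<theta> n) q) s / EI s)) x)"

definition Y1n :: "real \<Rightarrow> (real \<Rightarrow> real) \<Rightarrow> nat \<Rightarrow> real \<Rightarrow> real" where
  "Y1n k \<theta> n q = (if n = 0 then k else 0) + prim (th k \<theta> n) q"

definition Yn :: "real \<Rightarrow> (real \<Rightarrow> real) \<Rightarrow> nat \<Rightarrow> real \<Rightarrow> real" where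
  "Yn k \<theta> n = prim (Y1n k \<theta> n)"

definition yn :: "real \<Rightarrow> (real \<Rightarrow> real) \<Rightarrow> nat \<Rightarrow> real \<Rightarrow> real" where
  "yn k \<theta> n = prim (prim (\<lambda>s. Yn k \<theta> n s / EI s))"

lemma th_Suc: "th k \<theta> (Suc n) x = \<rho> x * yn k \<theta> n x"
  by (simp add: yn_def Yn_def Y1n_def[abs_def])

declare th.simps(2) [simp del]

lemma th_cont:
  assumes "continuous_on {0..1} \<theta>"
  shows "continuous_on {0..1} (th k \<theta> n)" "continuous_on {0..1} (Y1n k \<theta> n)" "continuous_on {0..1} (Yn k \<theta> n)" "continuous_on {0..1} (yn k \<theta> n)"
proof -
  have t: "continuous_on {0..1} (th k \<theta> n)" for n
  proof (induction n)
    case 0 then show ?case using assms by simp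
  next
    case (Suc n)
    have "continuous_on {0..1} (\<lambda>x. \<rho> x * yn k \<theta> n x)"
      unfolding yn_def Yn_def Y1n_def[abs_def] by (intro continuous_intros coeff_cont prim_cont div_EI_cont Suc)
    then show ?case by (simp add: th_Suc[abs_def])
  qed
  show "continuous_on {0..1} (th k \<theta> n)" by (rule t)
  show "continuous_on {0..1} (Y1n k \<theta> n)" "continuous_on {0..1} (Yn k \<theta> n)" "continuous_on {0..1} (yn k \<theta> n)"
    unfolding yn_def Yn_def Y1n_def[abs_def] by (intro continuous_intros coeff_cont prim_cont div_EI_cont t)+
qed

text \<open>The values at 1 of \<open>Y1n\<close> and \<open>yn\<close> become the coefficients of c
  and, up to m, of its second derivative; these are the signs that make the symbol coercive.\<close>

lemma th_nonneg:
  assumes c: "continuous_on {0..1} \<theta>" and p: "\<And>x. x \<in> {0..1} \<Longrightarrow> \<theta> x \<ge> 0" and k: "k \<ge> 0" and x: "x \<in> {0..1}"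
  shows "th k \<theta> n x \<ge> 0" "Y1n k \<theta> n x \<ge> 0" "Yn k \<theta> n x \<ge> 0" "yn k \<theta> n x \<ge> 0"
proof -
  have Y1: "Y1n k \<theta> n x \<ge> 0" if "\<And>x. x \<in> {0..1} \<Longrightarrow> th k \<theta> n x \<ge> 0" "x \<in> {0..1}" for n x
    using prim_nonneg[OF th_cont(1)[OF c] that] k by (simp add: Y1n_def)
  have Yn: "Yn k \<theta> n x \<ge> 0" if "\<And>x. x \<in> {0..1} \<Longrightarrow> th k \<theta> n x \<ge> 0" "x \<in> {0..1}" for n x
    unfolding Yn_def by (rule prim_nonneg[OF th_cont(2)[OF c] Y1[OF that(1)] that(2)])
  have q: "Yn k \<theta> n x / EI x \<ge> 0" if "\<And>x. x \<in> {0..1} \<Longrightarrow> th k \<theta> n x \<ge> 0" "x \<in> {0..1}" for n x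
    using Yn[OF that] coeff_nonneg[OF that(2)] by simp
  have yn: "yn k \<theta> n x \<ge> 0" if "\<And>x. x \<in> {0..1} \<Longrightarrow> th k \<theta> n x \<ge> 0" "x \<in> {0..1}" for n x
    unfolding yn_def by (rule prim_nonneg[OF prim_cont[OF div_EI_cont[OF th_cont(3)[OF c]]] prim_nonneg[OF div_EI_cont[OF th_cont(3)[OF c]] q[OF that(1)]] that(2)])
  have t: "x \<in> {0..1} \<Longrightarrow> th k \<theta> n x \<ge> 0" for n x
  proof (induction n arbitrary: x)
    case 0 then show ?case using p by simp
  next
    case (Suc n)
    then show ?case unfolding th_Suc using yn[of n x] coeff_nonneg[of x] by simp
  qed
  show "th k \<theta> n x \<ge> 0" "Y1n k \<theta> n x \<ge> 0" "Yn k \<theta> n x \<ge> 0" "yn k \<theta> n x \<ge> 0"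
    using t[OF x] Y1[OF t x] Yn[OF t x] yn[OF t x] by auto
qed

lemma th_bound:
  assumes c: "continuous_on {0..1} \<theta>" and p: "\<And>x. x \<in> {0..1} \<Longrightarrow> \<theta> x \<ge> 0" and k: "k \<ge> 0"
  obtains K L where "K \<ge> 0" "L \<ge> 0" "\<And>n x. x \<in> {0..1} \<Longrightarrow> th k \<theta> n x \<le> K * L^n / fact (4*(n-1))"
proof -
  obtain lo hi where lo: "lo > 0" "hi > 0" "\<And>x. x \<in> {0..1} \<Longrightarrow> lo \<le> \<rho> x \<and> \<rho> x \<le> hi \<and> lo \<le> EI x \<and> EI x \<le> hi"
    using coeff_bounds by blast
  have bdd: "\<exists>B. \<forall>x\<in>{0..1}. u x \<le> B" if "continuous_on {0..1} u" for u :: "real \<Rightarrow> real"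
    using continuous_attains_sup[OF compact_Icc _ that] by auto
  obtain B0 where B0: "\<And>x. x \<in> {0..1} \<Longrightarrow> \<theta> x \<le> B0" using bdd[OF c] by blast
  obtain B1 where B1: "\<And>x. x \<in> {0..1} \<Longrightarrow> th k \<theta> 1 x \<le> B1" using bdd[OF th_cont(1)[OF c]] by blast
  \<comment> \<open>The factorial gain starts at index 1, from where on k no longer enters the
    recursion. The suprema of the first two weights are put into K, whence the shift n - 1 in the
    bound.\<close>
  define K where "K = max (max B0 B1) 0"
  \<comment> \<open>At least 1, so that L^(n - 1) may be enlarged to L^n.\<close>
  define L where "L = max (hi / lo) 1"
  have KL: "K \<ge> 0" "L \<ge> 1" "L \<ge> hi/lo" by (auto simp: K_def L_def)
  have step: "th k \<theta> (Suc n) x \<le> (A * L) * x^(p+4) / fact (p+4)"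
    if n: "n \<ge> 1" and A: "A \<ge> 0" "\<And>x. x \<in> {0..1} \<Longrightarrow> th k \<theta> n x \<le> A * x^p / fact p" and x: "x \<in> {0..1}" for n p A x
  proof -
    note cc = th_cont[OF c]
    have nn: "yn k \<theta> n x \<ge> 0" by (rule th_nonneg(4)[OF c p k x])
    have 1: "Y1n k \<theta> n x \<le> A * x^Suc p / fact (Suc p)" if "x \<in> {0..1}" for x
      using prim_le_power[OF cc(1) A(2) that] n by (simp add: Y1n_def)
    have 2: "Yn k \<theta> n x \<le> A * x^Suc (Suc p) / fact (Suc (Suc p))" if "x \<in> {0..1}" for x
      unfolding Yn_def by (rule prim_le_power[OF cc(2) 1 that])
    have 3: "Yn k \<theta> n x / EI x \<le> (A / lo) * x^Suc (Suc p) / fact (Suc (Suc p))" if "x \<in> {0..1}" for x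
    proof -
      have "Yn k \<theta> n x / EI x \<le> (A * x^Suc (Suc p) / fact (Suc (Suc p))) / lo"
        using that lo A by (intro frac_le 2) auto
      then show ?thesis by (simp add: field_simps)
    qed
    have 4: "prim (\<lambda>s. Yn k \<theta> n s / EI s) x \<le> (A / lo) * x^Suc (Suc (Suc p)) / fact (Suc (Suc (Suc p)))" if "x \<in> {0..1}" for x
      by (rule prim_le_power[OF div_EI_cont[OF cc(3)] 3 that])
    have 5: "yn k \<theta> n x \<le> (A / lo) * x^Suc (Suc (Suc (Suc p))) / fact (Suc (Suc (Suc (Suc p))))"
      unfolding yn_def by (rule prim_le_power[OF prim_cont[OF div_EI_cont[OF cc(3)]] 4 x])
    have p4: "Suc (Suc (Suc (Suc p))) = p + 4" by simp
    have "th k \<theta> (Suc n) x \<le> hi * ((A / lo) * x^(p+4) / fact (p+4))"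
      unfolding th_Suc using 5 lo(3)[OF x] lo(2) nn unfolding p4 by (intro mult_mono) auto
    also have "\<dots> = (A * (hi/lo)) * (x^(p+4) / fact (p+4))" by simp
    also have "\<dots> \<le> (A * L) * (x^(p+4) / fact (p+4))"
      using KL A x by (intro mult_right_mono mult_left_mono) auto
    finally show ?thesis by simp
  qed
  have b: "th k \<theta> (Suc n) x \<le> (K * L^n) * x^(4*n) / fact (4*n)" if "x \<in> {0..1}" for n x
    using that
  proof (induction n arbitrary: x)
    case 0 then show ?case using B1 by (simp add: K_def le_max_iff_disj)
  next
    case (Suc n)
    have e: "4 * n + 4 = 4 * Suc n" by simp
    have "th k \<theta> (Suc (Suc n)) x \<le> ((K * L^n) * L) * x^(4*n+4) / fact (4*n+4)"
      by (rule step[OF _ _ Suc.IH Suc.prems]) (use KL in auto)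
    then show ?case unfolding e by (simp only: power_Suc2 mult.assoc)
  qed
  show ?thesis
  proof (rule that[of K L])
    fix n x assume x: "x \<in> {0..1::real}"
    show "th k \<theta> n x \<le> K * L^n / fact (4*(n-1))"
    proof (cases n)
      case 0 then show ?thesis using B0[OF x] by (simp add: K_def le_max_iff_disj)
    next
      case (Suc j)
      have "th k \<theta> n x \<le> (K * L^j) * x^(4*j) / fact (4*j)" unfolding Suc by (rule b[OF x])
      also have "\<dots> \<le> (K * L^n) * 1 / fact (4*j)"
        using x KL Suc by (intro divide_right_mono mult_mono power_le_one power_increasing mult_left_mono) auto
      finally show ?thesis using Suc by simp
    qed
  qed (use KL in auto)
qed

lemma th_identity:
  assumes A: "Arel \<rho> EI m J b z w" and c: "continuous_on {0..1} \<theta>"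
  shows "(LINT x|I01. complex_of_real (th k \<theta> n x) * fst z x) + (LINT x|I01. complex_of_real (th k \<theta> (Suc n) x) * sg w x)
    = (complex_of_real (prim (\<lambda>x. Yn k \<theta> n x / EI x) 1) * Mom z w - complex_of_real (Yn k \<theta> n 1) * D1 (fst z) 1)
      + complex_of_real (Y1n k \<theta> n 1) * fst z 1 - complex_of_real (m * yn k \<theta> n 1) * s\<xi> w"
proof -
  have "(Y1n k \<theta> n has_real_derivative th k \<theta> n x) (at x within {0..1})" if "x \<in> {0..1}" for x
    unfolding Y1n_def[abs_def] using DERIV_add[OF DERIV_const prim_deriv[OF th_cont(1)[OF c] that]] by simp
  moreover have "(Yn k \<theta> n has_real_derivative Y1n k \<theta> n x) (at x within {0..1})" if "x \<in> {0..1}" for x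
    unfolding Yn_def by (rule prim_deriv[OF th_cont(2)[OF c] that])
  ultimately show ?thesis
    using moment_identity[OF A, of "Yn k \<theta> n" "Y1n k \<theta> n" "th k \<theta> n" "yn k \<theta> n"] th_cont(1)[OF c]
    unfolding th_Suc yn_def by blast
qed

text \<open>For the test function with \<open>EI y'' = 1\<close> the displacement drops out of
  \<open>moment_identity\<close>, and the boundary term at 1 is exactly the slope.\<close>

lemma slope_test:
  obtains \<Lambda> k where "linf \<Lambda>" "\<And>z w. Arel \<rho> EI m J b z w \<Longrightarrow> \<Lambda> w = complex_of_real k * Mom z w - D1 (fst z) 1"
proof -
  define y where "y = prim (prim (\<lambda>x. 1 / EI x))"
  have c1: "continuous_on {0..1} (\<lambda>_. 1::real)" "continuous_on {0..1} (\<lambda>_. 0::real)" by (intro continuous_intros)+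
  have cy: "continuous_on {0..1} y" unfolding y_def by (intro prim_cont div_EI_cont c1)
  define \<Lambda> where "\<Lambda> z = (LINT x|I01. complex_of_real (\<rho> x * y x) * sg z x) + complex_of_real (m * y 1) * s\<xi> z" for z :: state
  have "linf \<Lambda>" unfolding \<Lambda>_def
    by (intro linf_add linf_cmult linf_basic sq_int_cont continuous_intros coeff_cont cy)
  moreover have "\<Lambda> w = complex_of_real (prim (\<lambda>x. 1 / EI x) 1) * Mom z w - D1 (fst z) 1" if "Arel \<rho> EI m J b z w" for z w
    using moment_identity[OF that, of "\<lambda>_. 1" "\<lambda>_. 0" "\<lambda>_. 0" y] unfolding \<Lambda>_def y_def by (simp add: algebra_simps)
  ultimately show ?thesis using that by blast
qed

lemma power_l2sq: "l2sq (\<lambda>x. complex_of_real (x^k)) = 1 / (2 * real k + 1)"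
proof -
  have "((\<lambda>x::real. x^(2*k)) has_integral (1^Suc (2*k) / real (Suc (2*k)) - 0^Suc (2*k) / real (Suc (2*k)))) {0..1}"
  proof (rule fundamental_theorem_of_calculus)
    fix y :: real
    have "((\<lambda>x. x^Suc (2*k) / real (Suc (2*k))) has_real_derivative (real (Suc (2*k)) * y^(2*k) / real (Suc (2*k)))) (at y within {0..1})"
      using DERIV_cdivide[OF DERIV_pow[of "Suc (2*k)" y "{0..1}"], of "real (Suc (2*k))"] by simp
    also have "real (Suc (2*k)) * y^(2*k) / real (Suc (2*k)) = y^(2*k)" by (simp del: of_nat_Suc)
    finally show "((\<lambda>x. x^Suc (2*k) / real (Suc (2*k))) has_vector_derivative y^(2*k)) (at y within {0..1})"
      by (simp add: has_real_derivative_iff_has_vector_derivative)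
  qed simp
  then have "integral {0..1} (\<lambda>x::real. x^(2*k)) = 1 / (2 * real k + 1)" by (simp add: integral_unique add.commute)
  moreover have "(cmod (complex_of_real (x^k)))^2 = x^(2*k)" for x :: real
    unfolding norm_of_real power2_abs by (simp add: power_mult[symmetric] mult.commute)
  moreover have "sq_int (\<lambda>x. complex_of_real (x^k))" by (intro sq_int_cont continuous_intros)
  ultimately show ?thesis by (simp only: l2sq_HK)
qed

text \<open>Testing with \<open>x^k\<close> for large \<open>k\<close> isolates the motion of the tip mass.\<close>

lemma tip_test:
  assumes e: "\<epsilon> > 0"
  obtains \<Lambda> K where "linf \<Lambda>" "K > 0"
    "\<And>z. z \<in> Xspace \<Longrightarrow> cmod (\<Lambda> z - complex_of_real m * s\<xi> z) \<le> \<epsilon> * N z"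
    "\<And>z w. Arel \<rho> EI m J b z w \<Longrightarrow> cmod (\<Lambda> w) \<le> K * (cmod (Mom z w) + N z)"
proof -
  obtain C where C: "C > 0"
    "\<And>z. z \<in> Xspace \<Longrightarrow> sqrt (l2sq (D2 (fst z))) \<le> C * N z"
    "\<And>z. z \<in> Xspace \<Longrightarrow> sqrt (l2sq (sg z)) \<le> C * N z"
    using comp_bounds by metis
  obtain lo hi where lo: "hi > 0" "\<And>x. x \<in> {0..1} \<Longrightarrow> \<rho> x \<le> hi \<and> EI x \<le> hi"
    using coeff_bounds by metis
  \<comment> \<open>The L2 norm of x^k is \<open>1 / sqrt (2 * k + 1)\<close>, which n makes small
    enough; the shift k = n + 2 makes x^k vanish at 0 together with its derivative.\<close>
  obtain n :: nat where n: "(hi * C / \<epsilon>)^2 < real n" using reals_Archimedean2 by blast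
  define k where "k = n + 2"
  have k: "k \<ge> 2" "hi * (1 / sqrt (2 * real k + 1)) * C \<le> \<epsilon>"
  proof -
    have "(hi * C / \<epsilon>)^2 \<le> 2 * real k + 1" using n by (simp add: k_def)
    then have "hi * C / \<epsilon> \<le> sqrt (2 * real k + 1)" by (rule real_le_rsqrt)
    then have "hi * C \<le> \<epsilon> * sqrt (2 * real k + 1)" using e by (simp add: field_simps)
    moreover have "sqrt (2 * real k + 1) > 0" by simp
    ultimately show "hi * (1 / sqrt (2 * real k + 1)) * C \<le> \<epsilon>" by (simp add: pos_divide_le_eq)
  qed (simp add: k_def)
  define y where "y x = (x::real)^k" for x
  define y1 where "y1 x = real k * x^(k-1)" for x :: real
  define y2 where "y2 x = real k * (real (k-1) * x^(k-1-1))" for x :: real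
  have d: "(y has_real_derivative y1 x) (at x within {0..1})" "(y1 has_real_derivative y2 x) (at x within {0..1})" for x
    unfolding y_def[abs_def] y1_def[abs_def] y2_def by (auto intro!: derivative_eq_intros)
  have cy: "continuous_on {0..1} y" "continuous_on {0..1} y2" unfolding y_def[abs_def] y2_def[abs_def] by (intro continuous_intros)+
  have ch: "H2chain (\<lambda>x. complex_of_real (y x)) (\<lambda>x. complex_of_real (y1 x)) (\<lambda>x. complex_of_real (y2 x))"
    by (rule real_chain_H2chain[OF d cy(2)])
  define P where "P z = (LINT x|I01. complex_of_real (\<rho> x * y x) * sg z x)" for z :: state
  define \<Lambda> where "\<Lambda> z = P z + complex_of_real m * s\<xi> z" for z :: state
  have L: "linf \<Lambda>" unfolding \<Lambda>_def P_def
    by (intro linf_add linf_cmult linf_basic sq_int_cont continuous_intros coeff_cont cy)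
  have small: "cmod (P z) \<le> \<epsilon> * N z" if z: "z \<in> Xspace" for z
  proof -
    have c\<rho>: "continuous_on {0..1} (\<lambda>x. complex_of_real (\<rho> x))" by (intro continuous_intros coeff_cont)
    have sy: "sq_int (\<lambda>x. complex_of_real (x^k))" by (intro sq_int_cont continuous_intros)
    have "l2sq (\<lambda>x. complex_of_real (\<rho> x) * complex_of_real (x^k)) \<le> hi^2 * l2sq (\<lambda>x. complex_of_real (x^k))"
      using lo(2) coeff_nonneg by (intro sq_int_bdd_mult(2)[OF sy measurable_I01_cont[OF c\<rho>]]) auto
    then have "sqrt (l2sq (\<lambda>x. complex_of_real (\<rho> x * y x))) \<le> sqrt (hi^2 * (1 / (2 * real k + 1)))"
      unfolding power_l2sq y_def by simp
    also have "\<dots> = hi * (1 / sqrt (2 * real k + 1))" using lo(1) by (simp add: real_sqrt_mult real_sqrt_divide)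
    finally have s: "sqrt (l2sq (\<lambda>x. complex_of_real (\<rho> x * y x))) \<le> hi * (1 / sqrt (2 * real k + 1))" .
    have "cmod (P z) \<le> sqrt (l2sq (\<lambda>x. complex_of_real (\<rho> x * y x))) * sqrt (l2sq (sg z))"
      unfolding P_def by (rule LINT_mult_bound) (use z in \<open>auto simp: Xspace_iff intro!: sq_int_cont continuous_intros coeff_cont cy simp del: of_real_mult\<close>)
    also have "\<dots> \<le> (hi * (1 / sqrt (2 * real k + 1))) * (C * N z)"
      using lo(1) by (intro mult_mono s C(3) z) auto
    also have "\<dots> \<le> \<epsilon> * N z" using mult_right_mono[OF k(2) N_nonneg[OF z]] by (simp add: mult.assoc)
    finally show ?thesis .
  qed
  define K0 where "K0 = sqrt (l2sq (\<lambda>x. complex_of_real (EI x * y2 x))) * C"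
  define K where "K = real k + K0 + 1"
  have K0: "K0 \<ge> 0" using C(1) by (simp add: K0_def)
  show ?thesis
  proof (rule that[OF L, of K])
    show "K > 0" using K0 by (simp add: K_def)
    show "cmod (\<Lambda> z - complex_of_real m * s\<xi> z) \<le> \<epsilon> * N z" if "z \<in> Xspace" for z
      using small[OF that] by (simp add: \<Lambda>_def)
    fix z w assume A: "Arel \<rho> EI m J b z w"
    have z: "z \<in> Xspace" by (rule Arel_X(1)[OF A])
    have yy: "y 0 = 0" "y1 0 = 0" "y 1 = 1" "y1 1 = real k" using k by (auto simp: y_def y1_def)
    have "\<Lambda> w = complex_of_real (real k) * Mom z w - (LINT x|I01. complex_of_real (EI x) * D2 (fst z) x * complex_of_real (y2 x))"
      using test_identity[OF A ch] yy by (simp add: \<Lambda>_def P_def)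
    also have "(LINT x|I01. complex_of_real (EI x) * D2 (fst z) x * complex_of_real (y2 x)) = (LINT x|I01. complex_of_real (EI x * y2 x) * D2 (fst z) x)"
      by (simp add: ac_simps)
    finally have "cmod (\<Lambda> w) \<le> real k * cmod (Mom z w) + cmod (LINT x|I01. complex_of_real (EI x * y2 x) * D2 (fst z) x)"
      using norm_triangle_ineq4 by (metis norm_mult norm_of_nat of_real_of_nat_eq)
    also have "cmod (LINT x|I01. complex_of_real (EI x * y2 x) * D2 (fst z) x) \<le> sqrt (l2sq (\<lambda>x. complex_of_real (EI x * y2 x))) * sqrt (l2sq (D2 (fst z)))"
      by (rule LINT_mult_bound) (use z in \<open>auto simp: Xspace_iff intro!: sq_int_cont continuous_intros coeff_cont cy H2l_sq simp del: of_real_mult\<close>)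
    also have "\<dots> \<le> K0 * N z" unfolding K0_def mult.assoc by (intro mult_left_mono C z) auto
    also have "real k * cmod (Mom z w) + K0 * N z \<le> K * cmod (Mom z w) + K * N z"
      using K0 z by (intro add_mono mult_right_mono) (auto simp: K_def)
    finally show "cmod (\<Lambda> w) \<le> K * (cmod (Mom z w) + N z)" by (simp add: distrib_left)
  qed
qed

end

section \<open>The multiplier inequality\<close>

lemma weighted_amgm:
  fixes p q K l :: real
  assumes "l > 0"
  shows "K * (p * q) \<le> l * p^2 + K^2 / (4 * l) * q^2"
proof -
  have "0 \<le> (2 * l * p - K * q)^2" by simp
  then have "4 * l * (K * (p * q)) \<le> 4 * l * (l * p^2 + K^2 / (4 * l) * q^2)"
    using assms by (simp add: power2_eq_square algebra_simps)
  then show ?thesis using assms by simp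
qed

lemma inner_le_sq: "\<bar>p \<bullet> q\<bar> \<le> (cmod p)^2 + (cmod q)^2" for p q :: complex
proof -
  have "\<bar>p \<bullet> q\<bar> \<le> cmod p * cmod q" by (rule Cauchy_Schwarz_ineq2)
  also have "\<dots> \<le> (cmod p)^2 + (cmod q)^2"
    using sum_squares_bound[of "cmod p" "cmod q"] mult_nonneg_nonneg[OF norm_ge_zero norm_ge_zero, of p q] by linarith
  finally show ?thesis .
qed

lemma continuous_bounded01:
  fixes u :: "real \<Rightarrow> real"
  assumes "continuous_on {0..1} u"
  obtains K where "K \<ge> 0" "\<And>x. x \<in> {0..1} \<Longrightarrow> \<bar>u x\<bar> \<le> K"
proof -
  have "bounded (u ` {0..1})"
    by (rule compact_imp_bounded[OF compact_continuous_image[OF assms compact_Icc]])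
  then obtain K where "\<forall>y\<in>u ` {0..1}. norm y \<le> K" unfolding bounded_iff by blast
  then have K: "\<bar>u x\<bar> \<le> K" if "x \<in> {0..1}" for x using that by simp
  moreover have "K \<ge> 0" using K[of 0] by simp
  ultimately show ?thesis using that by blast
qed

context tower
begin

text \<open>For h = exp (l x) - 1 the terms with h' carry an additional factor l compared with those
  containing derivatives of the coefficients. A large l thus makes both quadratic terms coercive
  without any monotonicity of \<rho> or EI.\<close>

lemma multiplier_inequality:
  obtains B c C where "bform B" "c > 0" "C > 0"
    "\<And>z w. Arel \<rho> EI m J b z w \<Longrightarrow> B w z + B z w \<le> - c * N2 z
      + C * ((cmod (s\<xi> z))^2 + (cmod (s\<eta> z))^2 + (cmod (D1 (fst z) 1))^2 + (cmod (Mom z w))^2 + l2sq (D1 (fst z)))"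
proof -
  obtain lo hi where lo: "lo > 0" "hi > 0" "\<And>x. x \<in> {0..1} \<Longrightarrow> lo \<le> \<rho> x \<and> \<rho> x \<le> hi \<and> lo \<le> EI x \<and> EI x \<le> hi"
    using coeff_bounds by blast
  obtain \<rho>' \<rho>'' where \<rho>': "\<And>x. x \<in> {0..1} \<Longrightarrow> (\<rho> has_real_derivative \<rho>' x) (at x within {0..1})" "continuous_on {0..1} \<rho>'"
    using Ck_on_4_derivs[OF \<rho>_C4] by metis
  obtain EI' EI'' where EI': "\<And>x. x \<in> {0..1} \<Longrightarrow> (EI has_real_derivative EI' x) (at x within {0..1})" "continuous_on {0..1} EI'"
    using Ck_on_4_derivs[OF EI_C4] by metis
  obtain R1 where R1: "R1 \<ge> 0" "\<And>x. x \<in> {0..1} \<Longrightarrow> \<bar>\<rho>' x\<bar> \<le> R1" using continuous_bounded01[OF \<rho>'(2)] by blast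
  obtain R2 where R2: "R2 \<ge> 0" "\<And>x. x \<in> {0..1} \<Longrightarrow> \<bar>EI' x\<bar> \<le> R2" using continuous_bounded01[OF EI'(2)] by blast
  define R where "R = R1 + R2"
  have R: "R \<ge> 0" "\<And>x. x \<in> {0..1} \<Longrightarrow> \<bar>\<rho>' x\<bar> \<le> R" "\<And>x. x \<in> {0..1} \<Longrightarrow> \<bar>EI' x\<bar> \<le> R"
    using R1 R2 by (force simp: R_def)+
  \<comment> \<open>Then \<open>lo * l\<close> pays for the bound R on \<rho>' and EI' and leaves
    lo, because h x \<le> exp (l x).\<close>
  define l where "l = (R + lo) / lo"
  have l: "l > 0" "lo * l = R + lo" using lo(1) R(1) by (auto simp: l_def)
  define h where "h x = exp (l * x) - 1" for x :: real
  define h' where "h' x = l * exp (l * x)" for x :: real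
  define h'' where "h'' x = l * (l * exp (l * x))" for x :: real
  have dh: "(h has_real_derivative h' x) (at x within {0..1})" "(h' has_real_derivative h'' x) (at x within {0..1})" for x
    unfolding h_def[abs_def] h'_def[abs_def] h''_def by (auto intro!: derivative_eq_intros)
  have ch: "continuous_on {0..1} h" "continuous_on {0..1} h'" "continuous_on {0..1} h''"
    unfolding h_def[abs_def] h'_def[abs_def] h''_def[abs_def] by (intro continuous_intros)+
  have h0: "h 0 = 0" "h 1 \<ge> 0" "h' 1 \<ge> 0" using l by (auto simp: h_def h'_def)
  have hE: "0 \<le> h x" "h x \<le> exp (l * x)" "1 \<le> exp (l * x)" if "x \<in> {0..1}" for x using l that by (auto simp: h_def)
  have low: "lo \<le> \<rho>' x * h x + \<rho> x * h' x" "lo \<le> 3/2 * EI x * h' x - 1/2 * EI' x * h x" if x: "x \<in> {0..1}" for x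
  proof -
    define E where "E = exp (l * x)"
    have E: "E \<ge> 1" "0 \<le> h x" "h x \<le> E" using hE[OF x] by (auto simp: E_def)
    have a: "\<bar>\<rho>' x * h x\<bar> \<le> R * E" "\<bar>EI' x * h x\<bar> \<le> R * E"
      unfolding abs_mult using E R(2,3)[OF x] R(1) by (auto intro!: mult_mono)
    have b1: "\<rho> x * h' x \<ge> (R + lo) * E"
    proof -
      have "lo * (l * E) \<le> \<rho> x * (l * E)" using lo(3)[OF x] l E by (intro mult_right_mono) auto
      then show ?thesis unfolding l(2)[symmetric] h'_def E_def by (simp add: mult.assoc)
    qed
    have b2: "EI x * h' x \<ge> (R + lo) * E"
    proof -
      have "lo * (l * E) \<le> EI x * (l * E)" using lo(3)[OF x] l E by (intro mult_right_mono) auto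
      then show ?thesis unfolding l(2)[symmetric] h'_def E_def by (simp add: mult.assoc)
    qed
    have RE: "R * E \<ge> 0" "lo * E \<ge> lo" using R E lo(1) by auto
    show "lo \<le> \<rho>' x * h x + \<rho> x * h' x" using a b1 RE by (simp add: distrib_right abs_le_iff)
    show "lo \<le> 3/2 * EI x * h' x - 1/2 * EI' x * h x"
    proof -
      have lin: "3/2 * u - 1/2 * v \<ge> k" if "\<bar>v\<bar> \<le> r" "u \<ge> r + q" "r \<ge> 0" "q \<ge> k" "k > 0" for u v r q k :: real
        using that by (simp add: abs_le_iff)
      have "3/2 * (EI x * h' x) - 1/2 * (EI' x * h x) \<ge> lo"
        by (rule lin[OF a(2) b2[unfolded distrib_right] RE lo(1)])
      then show ?thesis by (simp add: mult.assoc)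
    qed
  qed
  obtain K7 where K7: "K7 \<ge> 0" "\<And>x. x \<in> {0..1} \<Longrightarrow> \<bar>EI x * h'' x\<bar> \<le> K7"
    using continuous_bounded01[of "\<lambda>x. EI x * h'' x"] coeff_cont ch by (metis continuous_on_mult)
  obtain K where K: "K > 0" "\<And>z. z \<in> Xspace \<Longrightarrow> N2 z \<le> K * (l2sq (D2 (fst z)) + l2sq (sg z) + (cmod (s\<xi> z))^2 + (cmod (s\<eta> z))^2)"
    using N2_upper by blast
  define k1 where "k1 = 1/2 * \<rho> 1 * h 1"
  define k2 where "k2 = m * h 1"
  define k3 where "k3 = h' 1"
  define k4 where "k4 = h 1 / (2 * EI 1)"
  define k7 where "k7 = K7^2 / (2 * lo)"
  have k0: "k1 \<ge> 0" "k2 \<ge> 0" "k3 \<ge> 0" "k4 \<ge> 0" "k7 \<ge> 0"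
    using h0 m_pos coeff_nonneg[of 1] lo(1) by (auto simp: k1_def k2_def k3_def k4_def k7_def)
  define C where "C = k1 + k2 + k3 + k4 + k7 + lo"
  \<comment> \<open>Half of the coercivity constant, divided by the constant that bounds N2 by its
    unweighted components.\<close>
  define c where "c = lo / (2 * K)"
  have Bf: "bform (Bmul h)" by (rule bform_Bmul[OF ch(1)])
  have main: "Bmul h w z + Bmul h z w \<le> - c * N2 z
      + C * ((cmod (s\<xi> z))^2 + (cmod (s\<eta> z))^2 + (cmod (D1 (fst z) 1))^2 + (cmod (Mom z w))^2 + l2sq (D1 (fst z)))"
    if A: "Arel \<rho> EI m J b z w" for z w
  proof -
    note X = Arel_X[OF A]
    have H: "H2l (fst z)" "sq_int (sg z)" using X by (auto simp: Xspace_iff)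
    have s: "sq_int (D2 (fst z))" "sq_int (D1 (fst z))" by (rule H2l_sq[OF H(1)], rule sq_int_cont[OF H2l_cont(2)[OF H(1)]])
    define P where "P = l2sq (D2 (fst z))"
    define Gg where "Gg = l2sq (sg z)"
    define Q where "Q = l2sq (D1 (fst z))"
    define xx where "xx = (cmod (s\<xi> z))^2"
    define ee where "ee = (cmod (s\<eta> z))^2"
    define aa where "aa = (cmod (D1 (fst z) 1))^2"
    define MM where "MM = (cmod (Mom z w))^2"
    have nn: "P \<ge> 0" "Gg \<ge> 0" "Q \<ge> 0" "xx \<ge> 0" "ee \<ge> 0" "aa \<ge> 0" "MM \<ge> 0"
      by (auto simp: P_def Gg_def Q_def xx_def ee_def aa_def MM_def)
    have t5: "lo * Gg \<le> (LINT x|I01. (\<rho>' x * h x + \<rho> x * h' x) * (cmod (sg z x))^2)"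
      unfolding Gg_def l2sq_def integral_mult_right_zero[symmetric]
    proof (rule integral_mono)
      show "integrable I01 (\<lambda>x. lo * (cmod (sg z x))^2)" using sq_int_sq[OF H(2)] by simp
      show "integrable I01 (\<lambda>x. (\<rho>' x * h x + \<rho> x * h' x) * (cmod (sg z x))^2)"
        unfolding power2_norm_eq_inner by (intro weighted_inner_integrable H continuous_intros coeff_cont ch \<rho>')
    qed (auto intro!: mult_right_mono low)
    have t6: "lo * P \<le> (LINT x|I01. (3/2 * EI x * h' x - 1/2 * EI' x * h x) * (cmod (D2 (fst z) x))^2)"
      unfolding P_def l2sq_def integral_mult_right_zero[symmetric]
    proof (rule integral_mono)
      show "integrable I01 (\<lambda>x. lo * (cmod (D2 (fst z) x))^2)" using sq_int_sq[OF s(1)] by simp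
      show "integrable I01 (\<lambda>x. (3/2 * EI x * h' x - 1/2 * EI' x * h x) * (cmod (D2 (fst z) x))^2)"
        unfolding power2_norm_eq_inner by (intro weighted_inner_integrable s continuous_intros coeff_cont ch EI')
    qed (use low(2) in \<open>auto intro!: mult_right_mono\<close>)
    \<comment> \<open>Half of the coercive term \<open>lo * P\<close> absorbs the part with h''; the
      rest is the lower-order slope integral.\<close>
    have t7: "\<bar>LINT x|I01. (EI x * h'' x) * (D2 (fst z) x \<bullet> D1 (fst z) x)\<bar> \<le> lo/2 * P + k7 * Q"
    proof -
      have cu: "continuous_on {0..1} (\<lambda>x. EI x * h'' x)" by (intro continuous_intros coeff_cont ch)
      have cuc: "continuous_on {0..1} (\<lambda>x. complex_of_real (EI x * h'' x))" by (intro continuous_intros coeff_cont ch)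
      have "\<bar>LINT x|I01. (EI x * h'' x) * (D2 (fst z) x \<bullet> D1 (fst z) x)\<bar> \<le> cmod (LINT x|I01. complex_of_real (EI x * h'' x) * D2 (fst z) x * cnj (D1 (fst z) x))"
        unfolding LINT_weighted_inner_eq[OF cu s] by (rule abs_Re_le_cmod)
      also have "\<dots> \<le> sqrt (l2sq (\<lambda>x. complex_of_real (EI x * h'' x) * D2 (fst z) x)) * sqrt (l2sq (\<lambda>x. cnj (D1 (fst z) x)))"
        by (rule LINT_mult_bound[OF sq_int_cont_mult[OF cuc s(1)] sq_int_cnj[OF s(2)]])
      also have "\<dots> \<le> sqrt (K7^2 * P) * sqrt Q"
      proof (intro mult_mono real_sqrt_le_mono)
        show "l2sq (\<lambda>x. complex_of_real (EI x * h'' x) * D2 (fst z) x) \<le> K7^2 * P"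
          unfolding P_def by (rule sq_int_bdd_mult(2)[OF s(1) measurable_I01_cont[OF cuc]]) (use K7(2) in \<open>simp add: norm_of_real del: of_real_mult\<close>)
      qed (auto simp: Q_def P_def)
      also have "\<dots> = K7 * (sqrt P * sqrt Q)" using K7(1) by (simp add: real_sqrt_mult)
      also have "\<dots> \<le> (lo/2) * (sqrt P)^2 + K7^2 / (4 * (lo/2)) * (sqrt Q)^2" by (rule weighted_amgm) (use lo in simp)
      also have "\<dots> = lo/2 * P + k7 * Q" using nn by (simp add: k7_def)
      finally show ?thesis .
    qed
    have t2: "k2 * (s\<xi> z \<bullet> s\<eta> z) \<le> k2 * (xx + ee)"
      using inner_le_sq[of "s\<xi> z" "s\<eta> z"] unfolding xx_def ee_def by (intro mult_left_mono k0) auto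
    have t3: "k3 * (D1 (fst z) 1 \<bullet> Mom z w) \<le> k3 * (aa + MM)"
      using inner_le_sq[of "D1 (fst z) 1" "Mom z w"] unfolding aa_def MM_def by (intro mult_left_mono k0) auto
    have id: "Bmul h w z + Bmul h z w = k1 * xx + k2 * (s\<xi> z \<bullet> s\<eta> z) + k3 * (D1 (fst z) 1 \<bullet> Mom z w) + k4 * MM
       - 1/2 * (LINT x|I01. (\<rho>' x * h x + \<rho> x * h' x) * (cmod (sg z x))^2)
       - (LINT x|I01. (3/2 * EI x * h' x - 1/2 * EI' x * h x) * (cmod (D2 (fst z) x))^2)
       - (LINT x|I01. (EI x * h'' x) * (D2 (fst z) x \<bullet> D1 (fst z) x))"
      using multiplier_identity[OF A \<rho>' EI' dh ch(3) h0(1)] unfolding k1_def k2_def k3_def k4_def xx_def MM_def by simp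
    have N: "c * N2 z \<le> lo/2 * (P + Gg + xx + ee)"
    proof -
      have "c * N2 z \<le> c * (K * (P + Gg + xx + ee))"
        using K(2)[OF X(1)] K(1) lo(1) unfolding P_def Gg_def xx_def ee_def by (intro mult_left_mono) (auto simp: c_def)
      also have "\<dots> = lo/2 * (P + Gg + xx + ee)" using K(1) by (simp add: c_def)
      finally show ?thesis .
    qed
    have kC: "(k1 + k2 + lo/2) * xx \<le> C * xx" "(k2 + lo/2) * ee \<le> C * ee" "k3 * aa \<le> C * aa" "(k3 + k4) * MM \<le> C * MM" "k7 * Q \<le> C * Q"
      using k0 lo(1) nn by (auto intro!: mult_right_mono simp: C_def)
    have fin: "B \<le> - cN + (Cx + Ce + Ca + CM + CQ)"
      if "B = k1x + i2 + i3 + k4M - 1/2 * I5 - I6 - I7" "i2 \<le> k2x + k2e" "i3 \<le> k3a + k3M"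
        "loG \<le> I5" "loP \<le> I6" "\<bar>I7\<bar> \<le> loP/2 + k7Q" "cN \<le> loP/2 + loG/2 + lox/2 + loe/2"
        "k1x + k2x + lox/2 \<le> Cx" "k2e + loe/2 \<le> Ce" "k3a \<le> Ca" "k3M + k4M \<le> CM" "k7Q \<le> CQ"
      for B cN Cx Ce Ca CM CQ k1x i2 i3 k4M I5 I6 I7 k2x k2e k3a k3M loG loP k7Q lox loe :: real
      using that by (simp add: abs_le_iff)
    have "Bmul h w z + Bmul h z w \<le> - (c * N2 z) + (C * xx + C * ee + C * aa + C * MM + C * Q)"
      by (rule fin[OF id t2[unfolded distrib_left] t3[unfolded distrib_left] t5 t6]) 
         (use t7 N kC in \<open>simp_all add: algebra_simps add_divide_distrib\<close>)
    then show ?thesis unfolding xx_def ee_def aa_def MM_def Q_def by (simp add: distrib_left)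
  qed
  have "c > 0" "C > 0" using lo(1) K(1) k0 by (auto simp: c_def C_def intro!: add_nonneg_pos)
  then show ?thesis using that[OF Bf _ _ main] by blast
qed

lemma linf_sq:
  assumes "linf L"
  obtains C where "C > 0" "\<And>z. z \<in> Xspace \<Longrightarrow> (cmod (L z))^2 \<le> C * N2 z"
proof -
  obtain C where C: "C > 0" "\<And>z. z \<in> Xspace \<Longrightarrow> cmod (L z) \<le> C * N z" using linf_bound[OF assms] by blast
  have "(cmod (L z))^2 \<le> C^2 * N2 z" if "z \<in> Xspace" for z
    using power_mono[OF C(2)[OF that], of 2] by (simp add: power_mult_distrib N_sq that)
  then show ?thesis using C(1) by (intro that[of "C^2"]) auto
qed

end

context energy_weight
begin

text \<open>The derivative of a bounded V contributes at most 2B to the integral, uniformly in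
  T.\<close>

lemma negl_lyapunov:
  assumes p: "continuous_on {0..} p" "\<And>t. t \<ge> 0 \<Longrightarrow> 0 \<le> p t"
    and a: "\<And>\<epsilon>. \<epsilon> > 0 \<Longrightarrow> \<exists>V V' q B. (\<forall>t\<ge>0. (V has_vector_derivative V' t) (at t within {0..})) \<and> continuous_on {0..} V' \<and>
      (\<forall>t\<ge>0. \<bar>V t\<bar> \<le> B) \<and> negl q \<and> (\<forall>t\<ge>0. p t \<le> V' t + \<epsilon> * e t + q t)"
  shows "negl p"
  unfolding negl_def
proof (intro conjI allI impI p)
  fix \<epsilon> :: real assume "\<epsilon> > 0"
  then have e2: "\<epsilon>/2 > 0" by simp
  from a[OF e2] obtain V V' q B where V: "\<And>t. t \<ge> 0 \<Longrightarrow> (V has_vector_derivative V' t) (at t within {0..})"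
    "continuous_on {0..} V'" "\<And>t. t \<ge> 0 \<Longrightarrow> \<bar>V t\<bar> \<le> (B::real)" and q: "negl q" and le: "\<And>t. t \<ge> 0 \<Longrightarrow> p t \<le> V' t + \<epsilon>/2 * e t + q t"
    by blast
  have cq: "continuous_on {0..} q" using q(1) by (simp add: negl_def)
  obtain C where C: "\<And>T. T \<ge> 0 \<Longrightarrow> integral {0..T} q \<le> \<epsilon>/2 * Ie T + C" using neglD[OF q e2] by blast
  have "integral {0..T} p \<le> \<epsilon> * Ie T + (2 * B + C)" if T: "T \<ge> 0" for T
  proof -
    have "integral {0..T} p \<le> integral {0..T} (\<lambda>t. V' t + \<epsilon>/2 * e t + q t)"
      by (intro integral_mono_half p continuous_intros e_cont cq V(2) le) auto
    also have "\<dots> = integral {0..T} (\<lambda>t. V' t + \<epsilon>/2 * e t) + integral {0..T} q"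
      by (intro Henstock_Kurzweil_Integration.integral_add half_integrable continuous_intros e_cont cq V(2)) auto
    also have "integral {0..T} (\<lambda>t. V' t + \<epsilon>/2 * e t) = integral {0..T} V' + integral {0..T} (\<lambda>t. \<epsilon>/2 * e t)"
      by (intro Henstock_Kurzweil_Integration.integral_add half_integrable continuous_intros e_cont V(2)) auto
    also have "integral {0..T} V' = V T - V 0" by (rule FTC_half[OF V(1)]) (use T in auto)
    also have "integral {0..T} (\<lambda>t. \<epsilon>/2 * e t) = \<epsilon>/2 * Ie T" by (simp only: integral_mult_right Ie_def)
    finally show ?thesis using C[OF T] V(3)[OF T] V(3)[of 0] by (simp add: abs_le_iff)
  qed
  then show "\<exists>C. \<forall>T\<ge>0. integral {0..T} p \<le> \<epsilon> * Ie T + C" by blast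
qed

end

section \<open>Dissipation along classical trajectories\<close>

locale tower_solution = tower +
  fixes Z W' :: "real \<Rightarrow> state"
  assumes tr: "traj Z W'"
begin

lemma trD: 
  assumes "t \<ge> 0"
  shows "Z t \<in> Xspace" "W' t \<in> Xspace" "Arel \<rho> EI m J b (Z t) (W' t)"
  using tr assms by (auto simp: traj_def)

definition e where "e t = N2 (Z t)"

lemma e_deriv: "t \<ge> 0 \<Longrightarrow> (e has_vector_derivative (- 2 * b * (cmod (s\<eta> (Z t)))^2)) (at t within {0..})"
proof -
  assume t: "t \<ge> 0"
  have "((\<lambda>t. rip (Z t) (Z t)) has_vector_derivative (- 2 * b * (cmod (s\<eta> (Z t)))^2)) (at t within {0..})"
    using bform_traj[OF bform_rip tr t] rip_commute[of "Z t" "W' t"] energy_identity[OF trD(3)[OF t]] by (simp add: mult.assoc)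
  then show ?thesis
    by (rule has_vector_derivative_transform[rotated 2]) (use t in \<open>auto simp: e_def rip_self trD\<close>)
qed

lemma sig_cont: "linf L \<Longrightarrow> continuous_on {0..} (\<lambda>t. L (Z t))" "linf L \<Longrightarrow> continuous_on {0..} (\<lambda>t. L (W' t))"
  using linf_contX traj_contX[OF tr] by blast+

lemma eta_integral:
  assumes T: "T \<ge> 0"
  shows "2 * b * integral {0..T} (\<lambda>t. (cmod (s\<eta> (Z t)))^2) = e 0 - e T"
proof -
  have "integral {0..T} (\<lambda>t. - 2 * b * (cmod (s\<eta> (Z t)))^2) = e T - e 0"
    by (rule FTC_half[OF e_deriv]) (use T in auto)
  then show ?thesis by (simp only: integral_mult_right)
qed

lemma e_antimono:
  assumes "0 \<le> s" "s \<le> t"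
  shows "e t \<le> e s"
proof -
  have c: "continuous_on {0..} (\<lambda>t. (cmod (s\<eta> (Z t)))^2)" by (rule sq_cont[OF sig_cont(1)[OF linf_basic(2)]])
  have "integral {0..s} (\<lambda>t. (cmod (s\<eta> (Z t)))^2) \<le> integral {0..t} (\<lambda>t. (cmod (s\<eta> (Z t)))^2)"
    by (rule integral_mono_upper[OF c _ assms]) auto
  then have "2 * b * integral {0..s} (\<lambda>t. (cmod (s\<eta> (Z t)))^2) \<le> 2 * b * integral {0..t} (\<lambda>t. (cmod (s\<eta> (Z t)))^2)"
    using b_pos by (intro mult_left_mono) auto
  then show ?thesis using eta_integral[of s] eta_integral[of t] assms by simp
qed

end

text \<open>The additional assumption says that the rotational acceleration of the tip is square
  integrable in time. It is the dissipation bound for the orbit of A z, obtained for every state of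
  X in \<open>observation_bounded\<close>.\<close>

locale tower_traj = tower_solution +
  assumes \<beta>_bound: "\<exists>C. \<forall>T\<ge>0. integral {0..T} (\<lambda>t. (cmod (s\<eta> (W' t)))^2) \<le> C"
begin

sublocale energy_weight e "e 0"
proof
  show "continuous_on {0..} e" by (rule derivative_imp_continuous_half[OF e_deriv])
  show "e t \<ge> 0" if "t \<ge> 0" for t using N2_nonneg trD(1)[OF that] by (simp add: e_def)
  show "e t \<le> e 0" if "t \<ge> 0" for t by (rule e_antimono[OF _ that]) simp
qed

lemma sig_bound:
  assumes "linf L"
  obtains C where "C > 0" "\<And>t. t \<ge> 0 \<Longrightarrow> (cmod (L (Z t)))^2 \<le> C * e t" "\<And>t. t \<ge> 0 \<Longrightarrow> cmod (L (Z t)) \<le> C"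
proof -
  obtain C where C: "C > 0" "\<And>z. z \<in> Xspace \<Longrightarrow> (cmod (L z))^2 \<le> C * N2 z" using linf_sq[OF assms] by blast
  define D where "D = C + sqrt (C * e 0)"
  have D: "D \<ge> C" "D \<ge> sqrt (C * e 0)" using C(1) E0_nonneg by (auto simp: D_def)
  show ?thesis
  proof (rule that[of D])
    show "D > 0" using C(1) D by simp
    fix t :: real assume t: "t \<ge> 0"
    have 1: "(cmod (L (Z t)))^2 \<le> C * e t" using C(2)[OF trD(1)[OF t]] by (simp add: e_def)
    also have "\<dots> \<le> D * e t" using D e_nonneg[OF t] by (intro mult_right_mono) auto
    finally show "(cmod (L (Z t)))^2 \<le> D * e t" .
    have "C * e t \<le> C * e 0" using e_le[OF t] C(1) by (intro mult_left_mono) auto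
    then have "(cmod (L (Z t)))^2 \<le> C * e 0" using 1 by linarith
    then have "cmod (L (Z t)) \<le> sqrt (C * e 0)" by (rule real_le_rsqrt)
    then show "cmod (L (Z t)) \<le> D" using D by simp
  qed
qed

definition c where "c t = fst (Z t) 1"
definition \<xi> where "\<xi> t = s\<xi> (Z t)"
definition \<eta> where "\<eta> t = s\<eta> (Z t)"
definition \<alpha> where "\<alpha> t = s\<xi> (W' t)"
definition a where "a t = D1 (fst (Z t)) 1"
definition M where "M t = Mom (Z t) (W' t)"

lemma sig_derivs:
  assumes t: "t \<ge> 0"
  shows "(c has_vector_derivative \<xi> t) (at t within {0..})" "(\<xi> has_vector_derivative \<alpha> t) (at t within {0..})"
    "(a has_vector_derivative \<eta> t) (at t within {0..})"
proof -
  note S = Arel_simple[OF trD(3)[OF t]]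
  show "(c has_vector_derivative \<xi> t) (at t within {0..})"
    using linf_traj[OF linf_basic(3) tr t, of 1] unfolding c_def[abs_def] \<xi>_def S(3,4) by simp
  show "(\<xi> has_vector_derivative \<alpha> t) (at t within {0..})"
    using linf_traj[OF linf_basic(1) tr t] unfolding \<xi>_def[abs_def] \<alpha>_def by simp
  show "(a has_vector_derivative \<eta> t) (at t within {0..})"
    using linf_traj[OF linf_basic(4) tr t, of 1] unfolding a_def[abs_def] \<eta>_def S(3,5) by simp
qed

lemma sig_conts: "continuous_on {0..} c" "continuous_on {0..} \<xi>" "continuous_on {0..} \<eta>" "continuous_on {0..} \<alpha>"
    "continuous_on {0..} a" "continuous_on {0..} M"
proof -
  show "continuous_on {0..} c" "continuous_on {0..} a" unfolding c_def[abs_def] a_def[abs_def] by (intro sig_cont linf_basic; simp)+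
  show "continuous_on {0..} \<xi>" "continuous_on {0..} \<alpha>" "continuous_on {0..} \<eta>"
    unfolding \<xi>_def[abs_def] \<alpha>_def[abs_def] \<eta>_def[abs_def] by (intro sig_cont linf_basic)+
  show "continuous_on {0..} M"
    unfolding M_def[abs_def] Mom_def by (intro continuous_intros sig_cont linf_basic)
qed

lemma Negl_eta: "Negl \<eta>"
  unfolding Negl_iff
proof
  show "negl (\<lambda>t. (cmod (\<eta> t))^2)"
  proof (rule negl_bounded_integral[where C="e 0 / (2 * b)"])
    fix T :: real assume T: "T \<ge> 0"
    show "integral {0..T} (\<lambda>t. (cmod (\<eta> t))^2) \<le> e 0 / (2 * b)"
      using eta_integral[OF T] e_nonneg[OF T] b_pos by (simp add: \<eta>_def field_simps)
  qed (auto intro: sq_cont sig_conts)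
qed (rule sig_conts)

lemma Negl_M: "Negl M"
proof -
  obtain C where C: "\<And>T. T \<ge> 0 \<Longrightarrow> integral {0..T} (\<lambda>t. (cmod (s\<eta> (W' t)))^2) \<le> C" using \<beta>_bound by blast
  have "Negl (\<lambda>t. s\<eta> (W' t))" unfolding Negl_iff
    by (intro conjI negl_bounded_integral[where C=C] sig_cont linf_basic sq_cont C) auto
  from Negl_add[OF Negl_cmult[OF Negl_eta, of "- complex_of_real b"] Negl_cmult[OF this, of "- complex_of_real J"]]
  show ?thesis by (rule Negl_cong) (simp add: M_def Mom_def \<eta>_def)
qed

text \<open>The functional from \<open>slope_test\<close> has time derivative k M - a. Paired with a
  it yields -|a|^2 up to a term with M, while the derivative of a is \<eta>; both M and \<eta> are
  negligible.\<close>

lemma Negl_a: "Negl a"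
  unfolding Negl_iff
proof
  show "negl (\<lambda>t. (cmod (a t))^2)"
  proof (rule negl_lyapunov[OF sq_cont[OF sig_conts(5)]])
    fix \<epsilon> :: real assume e: "\<epsilon> > 0"
    obtain \<Lambda> k where L: "linf \<Lambda>" "\<And>z w. Arel \<rho> EI m J b z w \<Longrightarrow> \<Lambda> w = complex_of_real k * Mom z w - D1 (fst z) 1"
      using slope_test by blast
    obtain C where C: "C > 0" "\<And>t. t \<ge> 0 \<Longrightarrow> (cmod (\<Lambda> (Z t)))^2 \<le> C * e t" "\<And>t. t \<ge> 0 \<Longrightarrow> cmod (\<Lambda> (Z t)) \<le> C" using sig_bound[OF L(1)] by blast
    obtain C' where C': "C' > 0" "\<And>t. t \<ge> 0 \<Longrightarrow> cmod (a t) \<le> C'"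
      using sig_bound[OF linf_basic(4), of 1] unfolding a_def by (metis atLeastAtMost_iff order_refl zero_le_one)
    define V where "V t = 2 * (a t \<bullet> \<Lambda> (Z t))" for t
    define V' where "V' t = 2 * (a t \<bullet> \<Lambda> (W' t) + \<eta> t \<bullet> \<Lambda> (Z t))" for t
    have dV: "(V has_vector_derivative V' t) (at t within {0..})" if t: "t \<ge> 0" for t
      unfolding V_def[abs_def] V'_def
      using bounded_bilinear.has_vector_derivative[OF bounded_bilinear_inner sig_derivs(3)[OF t] linf_traj[OF L(1) tr t]]
      by (intro has_vector_derivative_mult_right) auto
    have cV: "continuous_on {0..} V'" unfolding V'_def[abs_def] by (intro continuous_intros sig_conts sig_cont L)
    have bV: "\<bar>V t\<bar> \<le> 2 * (C' * C)" if t: "t \<ge> 0" for t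
    proof -
      have "\<bar>a t \<bullet> \<Lambda> (Z t)\<bar> \<le> cmod (a t) * cmod (\<Lambda> (Z t))" by (rule Cauchy_Schwarz_ineq2)
      also have "\<dots> \<le> C' * C" using C' C t by (intro mult_mono) auto
      finally show ?thesis by (simp add: V_def)
    qed
    \<comment> \<open>With this weight in Young's inequality the term l |\<Lambda> (Z t)|^2 is at
      most \<epsilon> e.\<close>
    define l where "l = \<epsilon> / C"
    have l: "l > 0" using e C(1) by (simp add: l_def)
    define q where "q t = 4 / (4 * l) * (cmod (\<eta> t))^2 + k^2 * (cmod (M t))^2" for t
    have nq: "negl q" unfolding q_def[abs_def]
      using l by (intro negl_add negl_scale Negl_negl Negl_eta Negl_M) auto
    have le: "(cmod (a t))^2 \<le> - V' t + \<epsilon> * e t + q t" if t: "t \<ge> 0" for t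
    proof -
      have "a t \<bullet> \<Lambda> (W' t) = k * (a t \<bullet> M t) - (cmod (a t))^2"
        unfolding L(2)[OF trD(3)[OF t]] M_def[symmetric] a_def[symmetric]
        using inner_mult_left[of k "M t" "a t"] by (simp add: inner_diff_right power2_norm_eq_inner inner_commute)
      then have 1: "- V' t = 2 * (cmod (a t))^2 - 2 * (k * (a t \<bullet> M t)) - 2 * (\<eta> t \<bullet> \<Lambda> (Z t))"
        by (simp add: V'_def)
      have 2: "2 * (k * (a t \<bullet> M t)) \<le> (cmod (a t))^2 + k^2 * (cmod (M t))^2"
      proof -
        have "0 \<le> (a t - k *\<^sub>R M t) \<bullet> (a t - k *\<^sub>R M t)" by simp
        also have "\<dots> = (cmod (a t))^2 - 2 * (k * (a t \<bullet> M t)) + k^2 * (cmod (M t))^2"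
          by (simp add: power2_norm_eq_inner inner_diff_left inner_diff_right inner_commute power2_eq_square[of k] algebra_simps)
        finally show ?thesis by simp
      qed
      have 3: "2 * (\<eta> t \<bullet> \<Lambda> (Z t)) \<le> \<epsilon> * e t + 4 / (4 * l) * (cmod (\<eta> t))^2"
      proof -
        have "\<eta> t \<bullet> \<Lambda> (Z t) \<le> cmod (\<Lambda> (Z t)) * cmod (\<eta> t)" using Cauchy_Schwarz_ineq2[of "\<eta> t" "\<Lambda> (Z t)"] by (simp add: mult.commute)
        then have "2 * (\<eta> t \<bullet> \<Lambda> (Z t)) \<le> 2 * (cmod (\<Lambda> (Z t)) * cmod (\<eta> t))" by simp
        also have "\<dots> \<le> l * (cmod (\<Lambda> (Z t)))^2 + 2^2 / (4 * l) * (cmod (\<eta> t))^2" by (rule weighted_amgm[OF l])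
        also have "l * (cmod (\<Lambda> (Z t)))^2 \<le> l * (C * e t)" using C(2)[OF t] l by (intro mult_left_mono) auto
        also have "l * (C * e t) = \<epsilon> * e t" using C(1) by (simp add: l_def)
        finally show ?thesis by simp
      qed
      show ?thesis using 1 2 3 unfolding q_def by linarith
    qed
    show "\<exists>V V' q B. (\<forall>t\<ge>0. (V has_vector_derivative V' t) (at t within {0..})) \<and> continuous_on {0..} V' \<and>
      (\<forall>t\<ge>0. \<bar>V t\<bar> \<le> B) \<and> negl q \<and> (\<forall>t\<ge>0. (cmod (a t))^2 \<le> V' t + \<epsilon> * e t + q t)"
    proof (intro exI conjI)
      show "\<forall>t\<ge>0. ((\<lambda>t. - V t) has_vector_derivative - V' t) (at t within {0..})"
        using dV has_vector_derivative_minus by blast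
      show "\<forall>t\<ge>0. \<bar>- V t\<bar> \<le> 2 * (C' * C)" using bV by simp
      show "\<forall>t\<ge>0. (cmod (a t))^2 \<le> - V' t + \<epsilon> * e t + q t" using le by blast
    qed (use cV nq in \<open>auto intro: continuous_intros\<close>)
  qed auto
qed (rule sig_conts)

end

section \<open>Displacement, slope and velocity terms, and the integral of the energy\<close>

context tower_traj
begin

lemma sq_sqrt_e: "t \<ge> 0 \<Longrightarrow> N (Z t) = sqrt (e t)"
  by (simp add: N_def e_def)

lemma fst_bound:
  obtains C where "C > 0" "\<And>t x. t \<ge> 0 \<Longrightarrow> x \<in> {0..1} \<Longrightarrow> cmod (fst (Z t) x) \<le> C * sqrt (e t)"
    "\<And>t x y. t \<ge> 0 \<Longrightarrow> x \<in> {0..1} \<Longrightarrow> y \<in> {0..1} \<Longrightarrow> cmod (fst (Z t) x - fst (Z t) y) \<le> C * sqrt (e t) * \<bar>x - y\<bar>"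
    "\<And>t. t \<ge> 0 \<Longrightarrow> sqrt (l2sq (D2 (fst (Z t)))) \<le> C * sqrt (e t)"
proof -
  obtain C where C: "C > 0" "\<And>z. z \<in> Xspace \<Longrightarrow> sqrt (l2sq (D2 (fst z))) \<le> C * N z"
    using comp_bounds by metis
  have H: "H2l (fst (Z t))" if "t \<ge> 0" for t using trD(1)[OF that] by (simp add: Xspace_iff)
  have 1: "sqrt (l2sq (D2 (fst (Z t)))) \<le> C * sqrt (e t)" if t: "t \<ge> 0" for t
    using C(2)[OF trD(1)[OF t]] by (simp add: sq_sqrt_e[OF t])
  show ?thesis
  proof (rule that[OF C(1) _ _ 1])
    show "cmod (fst (Z t) x) \<le> C * sqrt (e t)" if "t \<ge> 0" "x \<in> {0..1}" for t x
      using H2l_bound[OF H[OF that(1)] that(2)] 1[OF that(1)] by linarith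
    show "cmod (fst (Z t) x - fst (Z t) y) \<le> C * sqrt (e t) * \<bar>x - y\<bar>" if "t \<ge> 0" "x \<in> {0..1}" "y \<in> {0..1}" for t x y
      using H2l_lipschitz[OF H[OF that(1)] that(2,3)] mult_right_mono[OF 1[OF that(1)], of "\<bar>x - y\<bar>"] by linarith
  qed
qed

text \<open>\<open>\<kappa> n\<close> consists of the moment and the slope at the tip, both
  negligible by now; displacement and acceleration of the tip stay explicit.\<close>

lemma chain_exists:
  assumes c\<theta>: "continuous_on {0..1} \<theta>" and pos: "\<And>x. x \<in> {0..1} \<Longrightarrow> \<theta> x \<ge> 0" and k: "k \<ge> 0"
  shows "\<exists>\<kappa> \<gamma> G. moment_chain e (e 0) c \<xi> \<alpha> (\<lambda>n t. LINT x|I01. complex_of_real (th k \<theta> n x) * fst (Z t) x)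
    (\<lambda>n t. LINT x|I01. complex_of_real (th k \<theta> n x) * sg (Z t) x) (\<lambda>n t. LINT x|I01. complex_of_real (th k \<theta> n x) * sg (W' t) x)
    \<kappa> (\<lambda>n. Y1n k \<theta> n 1) (\<lambda>n. m * yn k \<theta> n 1) \<gamma> G"
proof -
  note cth = th_cont[OF c\<theta>]
  have sq: "sq_int (\<lambda>x. complex_of_real (th k \<theta> n x))" for n by (intro sq_int_cont continuous_intros cth)
  have L1: "linf (\<lambda>z. LINT x|I01. complex_of_real (th k \<theta> n x) * fst z x)" for n by (rule linf_basic(5)[OF sq])
  have L2: "linf (\<lambda>z. LINT x|I01. complex_of_real (th k \<theta> n x) * sg z x)" for n by (rule linf_basic(6)[OF sq])
  obtain K L where KL: "K \<ge> 0" "L \<ge> 0" "\<And>n x. x \<in> {0..1} \<Longrightarrow> th k \<theta> n x \<le> K * L^n / fact (4*(n-1))"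
    using th_bound[OF c\<theta> pos k] by blast
  obtain C where C: "C > 0" "\<And>t x. t \<ge> 0 \<Longrightarrow> x \<in> {0..1} \<Longrightarrow> cmod (fst (Z t) x) \<le> C * sqrt (e t)"
    using fst_bound by metis
  obtain G1 where G1: "G1 > 0" "\<And>t. t \<ge> 0 \<Longrightarrow> (cmod (\<xi> t))^2 \<le> G1 * e t" using sig_bound[OF linf_basic(1)] unfolding \<xi>_def by metis
  obtain G2 where G2: "G2 > 0" "\<And>t. t \<ge> 0 \<Longrightarrow> (cmod (c t))^2 \<le> G2 * e t"
    using sig_bound[OF linf_basic(3), of 1] unfolding c_def by (metis atLeastAtMost_iff order_refl zero_le_one)
  obtain G3 where G3: "G3 > 0" "\<And>t. t \<ge> 0 \<Longrightarrow> (cmod (LINT x|I01. complex_of_real (th k \<theta> 0 x) * sg (Z t) x))^2 \<le> G3 * e t"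
    using sig_bound[OF L2[of 0]] by metis
  define G where "G = G1 + G2 + G3"
  have Gle: "u \<le> G * e t" if "u \<le> g * e t" "g = G1 \<or> g = G2 \<or> g = G3" "t \<ge> 0" for u g t
  proof -
    have "g * e t \<le> G * e t" using that G1(1) G2(1) G3(1) e_nonneg[OF that(3)] by (intro mult_right_mono) (auto simp: G_def)
    then show ?thesis using that(1) by linarith
  qed
  define \<gamma> where "\<gamma> n = (K * C) * L^n / fact (4*(n-1))" for n
  define \<kappa> where "\<kappa> n t = complex_of_real (prim (\<lambda>x. Yn k \<theta> n x / EI x) 1) * M t + (- complex_of_real (Yn k \<theta> n 1)) * a t" for n t
  have "moment_chain e (e 0) c \<xi> \<alpha> (\<lambda>n t. LINT x|I01. complex_of_real (th k \<theta> n x) * fst (Z t) x)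
    (\<lambda>n t. LINT x|I01. complex_of_real (th k \<theta> n x) * sg (Z t) x) (\<lambda>n t. LINT x|I01. complex_of_real (th k \<theta> n x) * sg (W' t) x)
    \<kappa> (\<lambda>n. Y1n k \<theta> n 1) (\<lambda>n. m * yn k \<theta> n 1) \<gamma> G"
  proof (intro moment_chain.intro energy_weight_axioms moment_chain_axioms.intro)
    fix n and t :: real assume t: "t \<ge> 0"
    note A = trD(3)[OF t]
    show "((\<lambda>t. LINT x|I01. complex_of_real (th k \<theta> n x) * fst (Z t) x) has_vector_derivative (LINT x|I01. complex_of_real (th k \<theta> n x) * sg (Z t) x)) (at t within {0..})"
      using linf_traj[OF L1[of n] tr t] unfolding Arel_simple(3)[OF A] .
    show "((\<lambda>t. LINT x|I01. complex_of_real (th k \<theta> n x) * sg (Z t) x) has_vector_derivative (LINT x|I01. complex_of_real (th k \<theta> n x) * sg (W' t) x)) (at t within {0..})"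
      by (rule linf_traj[OF L2[of n] tr t])
    show "(LINT x|I01. complex_of_real (th k \<theta> n x) * fst (Z t) x) + (LINT x|I01. complex_of_real (th k \<theta> (Suc n) x) * sg (W' t) x) =
       \<kappa> n t + complex_of_real (Y1n k \<theta> n 1) * c t - complex_of_real (m * yn k \<theta> n 1) * \<alpha> t"
      using th_identity[OF A c\<theta>, of k n] unfolding \<kappa>_def M_def a_def c_def \<alpha>_def by simp
    show "(cmod (LINT x|I01. complex_of_real (th k \<theta> n x) * fst (Z t) x))^2 \<le> (\<gamma> n)^2 * e t"
    proof -
      define B where "B = K * L^n / fact (4*(n-1))"
      have B0: "B \<ge> 0" using KL by (simp add: B_def)
      have cf: "continuous_on {0..1} (fst (Z t))" using trD(1)[OF t] by (auto simp: Xspace_iff intro: H2l_cont)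
      have "l2sq (\<lambda>x. complex_of_real (th k \<theta> n x)) \<le> B^2"
        using KL(3) th_nonneg(1)[OF c\<theta> pos k] by (intro l2sq_le_const sq_int_meas sq) (auto simp: B_def)
      then have 1: "sqrt (l2sq (\<lambda>x. complex_of_real (th k \<theta> n x))) \<le> B" using B0 by (simp add: real_le_lsqrt)
      have "l2sq (fst (Z t)) \<le> (C * sqrt (e t))^2" by (intro l2sq_le_const measurable_I01_cont cf C t)
      then have 2: "sqrt (l2sq (fst (Z t))) \<le> C * sqrt (e t)" using C(1) e_nonneg[OF t] by (simp add: real_le_lsqrt)
      have "cmod (LINT x|I01. complex_of_real (th k \<theta> n x) * fst (Z t) x) \<le> sqrt (l2sq (\<lambda>x. complex_of_real (th k \<theta> n x))) * sqrt (l2sq (fst (Z t)))"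
        by (rule LINT_mult_bound[OF sq sq_int_cont[OF cf]])
      also have "\<dots> \<le> B * (C * sqrt (e t))" using B0 by (intro mult_mono 1 2) auto
      also have "\<dots> = \<gamma> n * sqrt (e t)" by (simp add: \<gamma>_def B_def)
      finally have "(cmod (LINT x|I01. complex_of_real (th k \<theta> n x) * fst (Z t) x))^2 \<le> (\<gamma> n * sqrt (e t))^2"
        by (rule power_mono) simp
      then show ?thesis using e_nonneg[OF t] by (simp add: power_mult_distrib)
    qed
  next
    show "Negl (\<kappa> n)" for n unfolding \<kappa>_def[abs_def] by (intro Negl_add Negl_cmult Negl_M Negl_a)
    show "(\<lambda>n. (x * real n)^(2*n) * \<gamma> n) \<longlonglongrightarrow> 0" for x unfolding \<gamma>_def by (rule exp_ratio_decay[OF KL(2)])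
    show "continuous_on {0..} (\<lambda>t. LINT x|I01. complex_of_real (th k \<theta> n x) * sg (W' t) x)" for n by (rule sig_cont(2)[OF L2])
    show "G \<ge> 0" using G1 G2 G3 by (simp add: G_def)
  next
    fix t :: real assume t: "t \<ge> 0"
    show "(cmod (\<xi> t))^2 \<le> G * e t" "(cmod (c t))^2 \<le> G * e t" "(cmod (LINT x|I01. complex_of_real (th k \<theta> 0 x) * sg (Z t) x))^2 \<le> G * e t"
      by (rule Gle[OF G1(2)[OF t] _ t], simp, rule Gle[OF G2(2)[OF t] _ t], simp, rule Gle[OF G3(2)[OF t] _ t], simp)
  qed (intro sig_derivs sig_conts | assumption)+
  then show ?thesis by blast
qed

text \<open>With \<theta> = 0 the zeroth moment vanishes identically, and k = 1 is what brings c
  into the first relation.\<close>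

lemma Negl_c: "Negl c"
proof -
  have c0: "continuous_on {0..1} (\<lambda>_. 0::real)" by (intro continuous_intros)
  from chain_exists[OF c0, of 1] obtain \<kappa> \<gamma> G where ch: "moment_chain e (e 0) c \<xi> \<alpha> (\<lambda>n t. LINT x|I01. complex_of_real (th 1 (\<lambda>_. 0) n x) * fst (Z t) x)
    (\<lambda>n t. LINT x|I01. complex_of_real (th 1 (\<lambda>_. 0) n x) * sg (Z t) x) (\<lambda>n t. LINT x|I01. complex_of_real (th 1 (\<lambda>_. 0) n x) * sg (W' t) x)
    \<kappa> (\<lambda>n. Y1n 1 (\<lambda>_. 0) n 1) (\<lambda>n. m * yn 1 (\<lambda>_. 0) n 1) \<gamma> G" by auto
  show ?thesis
  proof (rule moment_chain.observed_negl[OF ch])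
    show "Y1n 1 (\<lambda>_. 0) 0 1 = 1" by (simp add: Y1n_def prim_def)
    show "Y1n 1 (\<lambda>_. 0) n 1 \<ge> 0" "m * yn 1 (\<lambda>_. 0) n 1 \<ge> 0" for n
      using th_nonneg(2,4)[OF c0, of 1 1 n] m_pos by auto
  qed simp
qed

lemma Negl_moment:
  assumes c\<theta>: "continuous_on {0..1} \<theta>" and pos: "\<And>x. x \<in> {0..1} \<Longrightarrow> \<theta> x \<ge> 0"
  shows "Negl (\<lambda>t. LINT x|I01. complex_of_real (\<theta> x) * fst (Z t) x)"
proof -
  from chain_exists[OF c\<theta> pos, of 0] obtain \<kappa> \<gamma> G where ch: "moment_chain e (e 0) c \<xi> \<alpha> (\<lambda>n t. LINT x|I01. complex_of_real (th 0 \<theta> n x) * fst (Z t) x)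
    (\<lambda>n t. LINT x|I01. complex_of_real (th 0 \<theta> n x) * sg (Z t) x) (\<lambda>n t. LINT x|I01. complex_of_real (th 0 \<theta> n x) * sg (W' t) x)
    \<kappa> (\<lambda>n. Y1n 0 \<theta> n 1) (\<lambda>n. m * yn 0 \<theta> n 1) \<gamma> G" by auto
  from moment_chain.moment_negl[OF ch Negl_c] show ?thesis by simp
qed

text \<open>A narrow continuous bump recovers the point value up to an error controlled by the Lipschitz bound.\<close>

lemma negl_point:
  assumes x0: "x0 \<in> {0..1}"
  shows "negl (\<lambda>t. (cmod (fst (Z t) x0))^2)"
proof (rule negl_approx)
  have L: "linf (\<lambda>z. fst z x0)" by (rule linf_basic(3)[OF x0])
  show "continuous_on {0..} (\<lambda>t. (cmod (fst (Z t) x0))^2)" by (rule sq_cont[OF sig_cont(1)[OF L]])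
  obtain C where C: "C > 0" "\<And>t x. t \<ge> 0 \<Longrightarrow> x \<in> {0..1} \<Longrightarrow> cmod (fst (Z t) x) \<le> C * sqrt (e t)"
    "\<And>t x y. t \<ge> 0 \<Longrightarrow> x \<in> {0..1} \<Longrightarrow> y \<in> {0..1} \<Longrightarrow> cmod (fst (Z t) x - fst (Z t) y) \<le> C * sqrt (e t) * \<bar>x - y\<bar>"
    using fst_bound by metis
  fix \<epsilon> :: real assume e: "\<epsilon> > 0"
  \<comment> \<open>On the support of the bump w varies by at most
    \<open>C * d * sqrt (e t)\<close>; squared and doubled, this is
    \<open>\<epsilon> * e t\<close>.\<close>
  define d where "d = sqrt (\<epsilon> / 2) / C"
  have d: "d > 0" "2 * (C * d)^2 = \<epsilon>" using e C(1) by (auto simp: d_def)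
  define \<theta> where "\<theta> x = max 0 (d - \<bar>x - x0\<bar>)" for x
  have c\<theta>: "continuous_on {0..1} \<theta>" unfolding \<theta>_def[abs_def] by (intro continuous_intros)
  have pos: "\<theta> x \<ge> 0" for x by (simp add: \<theta>_def)
  define I where "I = (LINT x|I01. \<theta> x)"
  have i\<theta>: "integrable I01 \<theta>" by (rule integrable_I01_cont[OF c\<theta>])
  have I: "I > 0"
  proof (rule ccontr)
    assume "\<not> I > 0"
    moreover have "I \<ge> 0" unfolding I_def by (rule integral_nonneg_AE) (simp add: pos)
    ultimately have "integral {0..1} \<theta> = 0" using integral_01_LINT[OF i\<theta>] by (simp add: I_def)
    moreover have "(\<theta> has_integral integral {0..1} \<theta>) {0..1}"
      by (intro integrable_integral integrable_continuous_real c\<theta>)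
    ultimately have "(\<theta> has_integral 0) (cbox 0 1)" by simp
    then have "\<theta> x0 = 0" using has_integral_0_cbox_imp_0[of 0 1 \<theta> x0] c\<theta> pos x0 by (auto simp: box_real)
    then show False using d by (simp add: \<theta>_def)
  qed
  define r where "r t = (LINT x|I01. complex_of_real (\<theta> x) * fst (Z t) x)" for t
  define q where "q t = 2 / I^2 * (cmod (r t))^2" for t
  have "negl q" unfolding q_def[abs_def] r_def[abs_def] by (intro negl_scale Negl_negl Negl_moment c\<theta> pos) simp
  moreover have "(cmod (fst (Z t) x0))^2 \<le> \<epsilon> * e t + q t" if t: "t \<ge> 0" for t
  proof -
    define B where "B = C * sqrt (e t) * d"
    have B0: "B \<ge> 0" using C(1) d e_nonneg[OF t] by (simp add: B_def)
    have cf: "continuous_on {0..1} (fst (Z t))" using trD(1)[OF t] by (auto simp: Xspace_iff intro: H2l_cont)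
    have ii: "integrable I01 (\<lambda>x. complex_of_real (\<theta> x) * fst (Z t) x)" "integrable I01 (\<lambda>x. complex_of_real (\<theta> x) * fst (Z t) x0)"
      by (intro integrable_I01_cont continuous_intros cf c\<theta>)+
    have "complex_of_real I * fst (Z t) x0 - r t = (LINT x|I01. complex_of_real (\<theta> x) * fst (Z t) x0 - complex_of_real (\<theta> x) * fst (Z t) x)"
      using ii i\<theta> by (simp add: r_def I_def)
    also have "cmod \<dots> \<le> (LINT x|I01. \<theta> x * B)"
    proof (rule Bochner_Integration.integral_norm_bound_integral)
      show "norm (complex_of_real (\<theta> x) * fst (Z t) x0 - complex_of_real (\<theta> x) * fst (Z t) x) \<le> \<theta> x * B" if "x \<in> space I01" for x
      proof (cases "\<bar>x - x0\<bar> \<le> d")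
        case True
        have "norm (complex_of_real (\<theta> x) * fst (Z t) x0 - complex_of_real (\<theta> x) * fst (Z t) x) = \<theta> x * cmod (fst (Z t) x0 - fst (Z t) x)"
          using pos[of x] by (simp add: norm_mult flip: right_diff_distrib)
        also have "\<dots> \<le> \<theta> x * B"
        proof (intro mult_left_mono pos)
          have "cmod (fst (Z t) x0 - fst (Z t) x) \<le> C * sqrt (e t) * \<bar>x0 - x\<bar>" using that by (intro C t x0) auto
          also have "\<dots> \<le> B" unfolding B_def using True C(1) e_nonneg[OF t] by (intro mult_left_mono) auto
          finally show "cmod (fst (Z t) x0 - fst (Z t) x) \<le> B" .
        qed
        finally show ?thesis .
      next
        case False
        then show ?thesis by (simp add: \<theta>_def)
      qed
    qed (use ii i\<theta> in auto)
    also have "\<dots> = I * B" by (simp add: I_def)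
    finally have 1: "cmod (complex_of_real I * fst (Z t) x0 - r t) \<le> I * B" .
    have "I * cmod (fst (Z t) x0) = cmod (complex_of_real I * fst (Z t) x0)" using I by (simp add: norm_mult)
    also have "\<dots> \<le> I * B + cmod (r t)" using norm_triangle_ineq[of "complex_of_real I * fst (Z t) x0 - r t" "r t"] 1 by simp
    finally have "cmod (fst (Z t) x0) \<le> B + cmod (r t) / I" using I by (simp add: field_simps)
    then have "(cmod (fst (Z t) x0))^2 \<le> (B + cmod (r t) / I)^2" by (intro power_mono) auto
    also have "\<dots> \<le> 2 * B^2 + 2 * (cmod (r t) / I)^2"
      using sum_squares_bound[of B "cmod (r t) / I"] by (simp add: power2_sum)
    also have "2 * B^2 = \<epsilon> * e t" using e_nonneg[OF t] d(2) by (simp add: B_def power_mult_distrib)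
    also have "2 * (cmod (r t) / I)^2 = q t" by (simp add: q_def power_divide)
    finally show ?thesis .
  qed
  ultimately show "\<exists>q. negl q \<and> (\<forall>t\<ge>0. (cmod (fst (Z t) x0))^2 \<le> \<epsilon> * e t + q t)" by blast
qed simp

lemma negl_sum: "finite A \<Longrightarrow> (\<And>i. i \<in> A \<Longrightarrow> negl (p i)) \<Longrightarrow> negl (\<lambda>t. \<Sum>i\<in>A. p i t)"
proof (induction A rule: finite_induct)
  case empty
  show ?case by (auto intro!: negl_bounded_integral[where C=0])
next
  case (insert x F)
  then show ?case using negl_add[of "p x" "\<lambda>t. \<Sum>i\<in>F. p i t"] by simp
qed

text \<open>\<open>D1_l2_bound\<close> asks for the uniform size of w. Its values on a grid of n + 1
  points are negligible, and between the points the Lipschitz bound costs C sqrt(e) / n: a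
  quantitative substitute for compactness.\<close>

lemma slope_dominated:
  assumes e: "\<epsilon> > 0"
  obtains q where "negl q" "\<And>t. t \<ge> 0 \<Longrightarrow> l2sq (D1 (fst (Z t))) \<le> \<epsilon> * e t + q t"
proof -
  obtain C where C: "C > 0" "\<And>t x. t \<ge> 0 \<Longrightarrow> x \<in> {0..1} \<Longrightarrow> cmod (fst (Z t) x) \<le> C * sqrt (e t)"
    "\<And>t x y. t \<ge> 0 \<Longrightarrow> x \<in> {0..1} \<Longrightarrow> y \<in> {0..1} \<Longrightarrow> cmod (fst (Z t) x - fst (Z t) y) \<le> C * sqrt (e t) * \<bar>x - y\<bar>"
    "\<And>t. t \<ge> 0 \<Longrightarrow> sqrt (l2sq (D2 (fst (Z t)))) \<le> C * sqrt (e t)"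
    using fst_bound by blast
  \<comment> \<open>Makes the interpolation error C^2 / n at most \<epsilon>/2; the other half of
    \<epsilon> is the weight l in Young's inequality.\<close>
  obtain n0 :: nat where n0: "2 * C^2 / \<epsilon> < real n0" using reals_Archimedean2 by blast
  define n where "n = Suc n0"
  have n: "n > 0" "C^2 / real n \<le> \<epsilon> / 2" using n0 e by (auto simp: n_def field_simps)
  define F where "F t = (\<Sum>i\<in>{0..n}. cmod (fst (Z t) (real i / real n)))" for t
  define l where "l = \<epsilon> / 2"
  have l: "l > 0" using e by (simp add: l_def)
  define q where "q t = ((cmod (a t))^2 + (cmod (c t))^2) + C^2 / (4 * l) * (real (card {0..n}) * (\<Sum>i\<in>{0..n}. (cmod (fst (Z t) (real i / real n)))^2))" for t
  have "negl q" unfolding q_def[abs_def]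
    using l n by (intro negl_add negl_scale negl_sum Negl_negl Negl_a Negl_c negl_point) (auto simp: divide_le_eq)
  moreover have "l2sq (D1 (fst (Z t))) \<le> \<epsilon> * e t + q t" if t: "t \<ge> 0" for t
  proof -
    have H: "H2l (fst (Z t))" using trD(1)[OF t] by (simp add: Xspace_iff)
    define se where "se = sqrt (e t)"
    have se: "se \<ge> 0" "se^2 = e t" using e_nonneg[OF t] by (auto simp: se_def)
    define B where "B = F t + C * se / real n"
    have B: "cmod (fst (Z t) x) \<le> B" if x: "x \<in> {0..1}" for x
    proof -
      define i where "i = nat \<lfloor>x * real n\<rfloor>"
      have i: "real i \<le> x * real n" "x * real n \<le> real i + 1" "i \<le> n"
      proof -
        have "x * real n \<ge> 0" using x by simp
        moreover have "x * real n \<le> 1 * real n" using x by (intro mult_right_mono) auto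
        ultimately show "real i \<le> x * real n" "x * real n \<le> real i + 1" "i \<le> n" unfolding i_def by linarith+
      qed
      have "x - real i / real n = (x * real n - real i) / real n" using n(1) by (simp add: field_simps)
      moreover have "0 \<le> (x * real n - real i) / real n" "(x * real n - real i) / real n \<le> 1 / real n"
        using i n(1) by (auto intro!: divide_right_mono)
      ultimately have xi: "real i / real n \<in> {0..1}" "\<bar>x - real i / real n\<bar> \<le> 1 / real n"
        using i(3) n(1) by auto
      have "cmod (fst (Z t) x) \<le> cmod (fst (Z t) (real i / real n)) + cmod (fst (Z t) x - fst (Z t) (real i / real n))"
        using norm_triangle_ineq[of "fst (Z t) (real i / real n)" "fst (Z t) x - fst (Z t) (real i / real n)"] by simp
      also have "cmod (fst (Z t) (real i / real n)) \<le> F t" unfolding F_def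
        using i(3) by (intro member_le_sum) auto
      also have "cmod (fst (Z t) x - fst (Z t) (real i / real n)) \<le> C * se * \<bar>x - real i / real n\<bar>"
        unfolding se_def by (rule C(3)[OF t x xi(1)])
      also have "\<dots> \<le> C * se * (1 / real n)" using C(1) se by (intro mult_left_mono xi) auto
      finally show ?thesis by (simp add: B_def)
    qed
    have F2: "(F t)^2 \<le> real (card {0..n}) * (\<Sum>i\<in>{0..n}. (cmod (fst (Z t) (real i / real n)))^2)"
      unfolding F_def by (subst mult.commute) (rule sum_squared_le_sum_of_squares)
    have B0: "B \<ge> 0" using order_trans[OF norm_ge_zero B[of 0]] by simp
    have "l2sq (D1 (fst (Z t))) \<le> cmod (a t) * cmod (c t) + sqrt (l2sq (D2 (fst (Z t)))) * B"
      using D1_l2_bound[OF H B] by (simp add: a_def c_def)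
    also have "cmod (a t) * cmod (c t) \<le> (cmod (a t))^2 + (cmod (c t))^2"
      using sum_squares_bound[of "cmod (a t)" "cmod (c t)"] mult_nonneg_nonneg[OF norm_ge_zero norm_ge_zero, of "a t" "c t"] by linarith
    also have "sqrt (l2sq (D2 (fst (Z t)))) * B \<le> (C * se) * B"
      unfolding se_def by (intro mult_right_mono C t B0)
    also have "(C * se) * B = C * (se * F t) + C^2 / real n * se^2" by (simp add: B_def power2_eq_square algebra_simps)
    also have "C * (se * F t) \<le> l * se^2 + C^2 / (4 * l) * (F t)^2" by (rule weighted_amgm[OF l])
    also have "C^2 / (4 * l) * (F t)^2 \<le> C^2 / (4 * l) * (real (card {0..n}) * (\<Sum>i\<in>{0..n}. (cmod (fst (Z t) (real i / real n)))^2))"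
      using l by (intro mult_left_mono F2) auto
    also have "C^2 / real n * se^2 \<le> \<epsilon> / 2 * se^2" by (intro mult_right_mono n) auto
    finally show ?thesis unfolding q_def se(2) l_def by (simp add: algebra_simps)
  qed
  ultimately show ?thesis using that by blast
qed

text \<open>The functional from \<open>tip_test\<close> is close to m \<xi>, so its product with c
  has a derivative close to m |\<xi>|^2 plus c times \<Lambda> (W' t). The latter is controlled by M
  and the energy norm, against a negligible c.\<close>

lemma Negl_xi: "Negl \<xi>"
  unfolding Negl_iff
proof
  show "negl (\<lambda>t. (cmod (\<xi> t))^2)"
  proof (rule negl_lyapunov[OF sq_cont[OF sig_conts(2)]])
    fix \<epsilon> :: real assume e: "\<epsilon> > 0"
    obtain Cx where Cx: "Cx > 0" "\<And>t. t \<ge> 0 \<Longrightarrow> (cmod (\<xi> t))^2 \<le> Cx * e t" using sig_bound[OF linf_basic(1)] unfolding \<xi>_def by metis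
    \<comment> \<open>Balances the constant in the bound of |\<xi>| by the energy norm, so that
      replacing the functional by m \<xi> costs half of \<epsilon> m e.\<close>
    define d where "d = \<epsilon> * m / (2 * sqrt Cx)"
    have d: "d > 0" using e m_pos Cx by (simp add: d_def)
    obtain \<Lambda> K where L: "linf \<Lambda>" and K: "K > 0"
      and sm: "\<And>z. z \<in> Xspace \<Longrightarrow> cmod (\<Lambda> z - complex_of_real m * s\<xi> z) \<le> d * N z"
      and W: "\<And>z w. Arel \<rho> EI m J b z w \<Longrightarrow> cmod (\<Lambda> w) \<le> K * (cmod (Mom z w) + N z)"
      using tip_test[OF d] by blast
    obtain C where C: "C > 0" "\<And>t. t \<ge> 0 \<Longrightarrow> cmod (\<Lambda> (Z t)) \<le> C" using sig_bound[OF L] by metis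
    obtain C' where C': "C' > 0" "\<And>t. t \<ge> 0 \<Longrightarrow> cmod (c t) \<le> C'"
      using sig_bound[OF linf_basic(3), of 1] unfolding c_def by (metis atLeastAtMost_iff order_refl zero_le_one)
    define V where "V t = 1/m * (c t \<bullet> \<Lambda> (Z t))" for t
    define V' where "V' t = 1/m * (c t \<bullet> \<Lambda> (W' t) + \<xi> t \<bullet> \<Lambda> (Z t))" for t
    have dV: "(V has_vector_derivative V' t) (at t within {0..})" if t: "t \<ge> 0" for t
      unfolding V_def[abs_def] V'_def
      using bounded_bilinear.has_vector_derivative[OF bounded_bilinear_inner sig_derivs(1)[OF t] linf_traj[OF L(1) tr t]]
      by (intro has_vector_derivative_mult_right) auto
    have cV: "continuous_on {0..} V'" unfolding V'_def[abs_def] by (intro continuous_intros sig_conts sig_cont L)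
    have bV: "\<bar>V t\<bar> \<le> 1/m * (C' * C)" if t: "t \<ge> 0" for t
    proof -
      have "\<bar>c t \<bullet> \<Lambda> (Z t)\<bar> \<le> cmod (c t) * cmod (\<Lambda> (Z t))" by (rule Cauchy_Schwarz_ineq2)
      also have "\<dots> \<le> C' * C" using C' C t by (intro mult_mono) auto
      finally show ?thesis using m_pos by (simp add: V_def abs_mult divide_right_mono)
    qed
    define l where "l = \<epsilon> * m / 2"
    have l: "l > 0" using e m_pos by (simp add: l_def)
    define q where "q t = 1/m * (K^2 / (4 * l) * (cmod (c t))^2 + K * ((cmod (c t))^2 + (cmod (M t))^2))" for t
    have nq: "negl q" unfolding q_def[abs_def]
      using l K m_pos by (intro negl_scale negl_add Negl_negl Negl_c Negl_M) auto
    have le: "(cmod (\<xi> t))^2 \<le> V' t + \<epsilon> * e t + q t" if t: "t \<ge> 0" for t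
    proof -
      define R where "R = \<Lambda> (Z t) - complex_of_real m * \<xi> t"
      define se where "se = sqrt (e t)"
      have se: "se \<ge> 0" "se^2 = e t" using e_nonneg[OF t] by (auto simp: se_def)
      have R: "cmod R \<le> d * se" unfolding R_def \<xi>_def se_def using sm[OF trD(1)[OF t]] sq_sqrt_e[OF t] by simp
      have x1: "cmod (\<xi> t) \<le> sqrt Cx * se"
      proof -
        have "(cmod (\<xi> t))^2 \<le> Cx * se^2" using Cx(2)[OF t] se by simp
        then have "cmod (\<xi> t) \<le> sqrt (Cx * se^2)" by (rule real_le_rsqrt)
        then show ?thesis by (simp only: real_sqrt_mult real_sqrt_abs abs_of_nonneg[OF se(1)])
      qed
      have "\<xi> t \<bullet> \<Lambda> (Z t) = m * (cmod (\<xi> t))^2 + \<xi> t \<bullet> R"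
        using inner_mult_left[of m "\<xi> t" "\<xi> t"] by (simp add: R_def inner_diff_right inner_commute power2_norm_eq_inner)
      then have 1: "m * V' t = c t \<bullet> \<Lambda> (W' t) + m * (cmod (\<xi> t))^2 + \<xi> t \<bullet> R"
        using m_pos by (simp add: V'_def)
      have 2: "- (\<xi> t \<bullet> R) \<le> l * se^2"
      proof -
        have "- (\<xi> t \<bullet> R) \<le> cmod (\<xi> t) * cmod R" using Cauchy_Schwarz_ineq2[of "\<xi> t" R] by (simp add: abs_le_iff)
        also have "\<dots> \<le> (sqrt Cx * se) * (d * se)" using x1 R se Cx by (intro mult_mono) auto
        also have "\<dots> = l * se^2" using Cx(1) by (simp add: d_def l_def power2_eq_square)
        finally show ?thesis .
      qed
      have 3: "- (c t \<bullet> \<Lambda> (W' t)) \<le> l * se^2 + m * q t"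
      proof -
        have "- (c t \<bullet> \<Lambda> (W' t)) \<le> cmod (c t) * cmod (\<Lambda> (W' t))" using Cauchy_Schwarz_ineq2[of "c t" "\<Lambda> (W' t)"] by (simp add: abs_le_iff)
        also have "\<dots> \<le> cmod (c t) * (K * (cmod (M t) + se))"
          using W[OF trD(3)[OF t]] unfolding M_def se_def sq_sqrt_e[OF t] by (intro mult_left_mono) auto
        also have "\<dots> = K * (se * cmod (c t)) + K * (cmod (c t) * cmod (M t))" by (simp add: algebra_simps)
        also have "K * (se * cmod (c t)) \<le> l * se^2 + K^2 / (4 * l) * (cmod (c t))^2" by (rule weighted_amgm[OF l])
        also have "K * (cmod (c t) * cmod (M t)) \<le> K * ((cmod (c t))^2 + (cmod (M t))^2)"
          using sum_squares_bound[of "cmod (c t)" "cmod (M t)"] mult_nonneg_nonneg[OF norm_ge_zero norm_ge_zero, of "c t" "M t"] K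
          by (intro mult_left_mono) linarith+
        finally show ?thesis using m_pos by (simp add: q_def)
      qed
      have "m * (cmod (\<xi> t))^2 \<le> m * (V' t + \<epsilon> * e t + q t)"
        using 1 2 3 unfolding l_def se(2) by (simp add: algebra_simps)
      then show ?thesis using m_pos by simp
    qed
    show "\<exists>V V' q B. (\<forall>t\<ge>0. (V has_vector_derivative V' t) (at t within {0..})) \<and> continuous_on {0..} V' \<and>
      (\<forall>t\<ge>0. \<bar>V t\<bar> \<le> B) \<and> negl q \<and> (\<forall>t\<ge>0. (cmod (\<xi> t))^2 \<le> V' t + \<epsilon> * e t + q t)"
      using dV cV bV nq le by blast
  qed auto
qed (rule sig_conts)

text \<open>The coercivity c' is spent in parts: one half on the slope integral and one quarter on
  the negligible terms. Since Ie T is finite for each T, these can be moved to the left, and the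
  remaining quarter is bounded independently of T.\<close>

lemma energy_integral_bounded:
  obtains C where "\<And>T. T \<ge> 0 \<Longrightarrow> integral {0..T} e \<le> C"
proof -
  obtain B c' C where B: "bform B" and c': "c' > 0" and C: "C > 0"
    and ineq: "\<And>z w. Arel \<rho> EI m J b z w \<Longrightarrow> B w z + B z w \<le> - c' * N2 z
      + C * ((cmod (s\<xi> z))^2 + (cmod (s\<eta> z))^2 + (cmod (D1 (fst z) 1))^2 + (cmod (Mom z w))^2 + l2sq (D1 (fst z)))"
    using multiplier_inequality by blast
  have e1: "c' / (2 * C) > 0" using c' C by simp
  obtain q where q: "negl q" "\<And>t. t \<ge> 0 \<Longrightarrow> l2sq (D1 (fst (Z t))) \<le> c' / (2 * C) * e t + q t" using slope_dominated[OF e1] by blast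
  define Q where "Q t = C * ((cmod (\<xi> t))^2 + (cmod (\<eta> t))^2 + (cmod (a t))^2 + (cmod (M t))^2 + q t)" for t
  have nQ: "negl Q" unfolding Q_def[abs_def] using C by (intro negl_scale negl_add Negl_negl Negl_xi Negl_eta Negl_a Negl_M q) auto
  have cQ: "continuous_on {0..} Q" using nQ by (simp add: negl_def)
  define V where "V t = B (Z t) (Z t)" for t
  define V' where "V' t = B (W' t) (Z t) + B (Z t) (W' t)" for t
  have dV: "(V has_vector_derivative V' t) (at t within {0..})" if "t \<ge> 0" for t
    unfolding V_def[abs_def] V'_def by (rule bform_traj[OF B tr that])
  have cV: "continuous_on {0..} V'" unfolding V'_def[abs_def]
    by (intro continuous_intros bform_contX[OF B] traj_contX[OF tr])
  have le: "c' / 2 * e t \<le> - V' t + Q t" if t: "t \<ge> 0" for t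
  proof -
    have "V' t \<le> - c' * e t + C * ((cmod (\<xi> t))^2 + (cmod (\<eta> t))^2 + (cmod (a t))^2 + (cmod (M t))^2 + l2sq (D1 (fst (Z t))))"
      using ineq[OF trD(3)[OF t]] unfolding V'_def e_def \<xi>_def \<eta>_def a_def M_def .
    also have "\<dots> \<le> - c' * e t + C * ((cmod (\<xi> t))^2 + (cmod (\<eta> t))^2 + (cmod (a t))^2 + (cmod (M t))^2 + (c' / (2 * C) * e t + q t))"
      using q(2)[OF t] C by (intro add_left_mono mult_left_mono) auto
    also have "\<dots> = - (c' / 2 * e t) + Q t" using C by (simp add: Q_def algebra_simps)
    finally show ?thesis by simp
  qed
  have e2: "c' / 4 > 0" using c' by simp
  obtain CQ where CQ: "\<And>T. T \<ge> 0 \<Longrightarrow> integral {0..T} Q \<le> c' / 4 * Ie T + CQ" using neglD[OF nQ e2] by blast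
  obtain CB where CB: "CB > 0" "\<And>z w. z \<in> Xspace \<Longrightarrow> w \<in> Xspace \<Longrightarrow> \<bar>B z w\<bar> \<le> CB * (N z * N w)" using bform_bound[OF B] by blast
  have bV: "\<bar>V t\<bar> \<le> CB * e 0" if t: "t \<ge> 0" for t
  proof -
    have "\<bar>V t\<bar> \<le> CB * (N (Z t) * N (Z t))" unfolding V_def by (rule CB(2)[OF trD(1)[OF t] trD(1)[OF t]])
    also have "N (Z t) * N (Z t) = e t" using N_sq[OF trD(1)[OF t]] by (simp add: power2_eq_square e_def)
    also have "CB * e t \<le> CB * e 0" using CB(1) e_le[OF t] by (intro mult_left_mono) auto
    finally show ?thesis .
  qed
  have "Ie T \<le> 4 / c' * (2 * (CB * e 0) + CQ)" if T: "T \<ge> 0" for T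
  proof -
    have "integral {0..T} (\<lambda>t. c' / 2 * e t) \<le> integral {0..T} (\<lambda>t. - V' t + Q t)"
      by (intro integral_mono_half continuous_intros e_cont cV cQ le) auto
    also have "\<dots> = integral {0..T} (\<lambda>t. - V' t) + integral {0..T} Q"
      by (intro Henstock_Kurzweil_Integration.integral_add half_integrable continuous_intros cV cQ) auto
    also have "integral {0..T} (\<lambda>t. - V' t) = - (V T - V 0)"
      using FTC_half[OF dV, of 0 T] T by simp
    finally have "c' / 2 * Ie T \<le> - (V T - V 0) + (c' / 4 * Ie T + CQ)"
      using CQ[OF T] unfolding Ie_def by (simp only: integral_mult_right)
    then have "c' / 4 * Ie T \<le> 2 * (CB * e 0) + CQ"
      using bV[OF T] bV[of 0] by (simp add: abs_le_iff)
    then show ?thesis using c' by (simp add: field_simps)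
  qed
  then show ?thesis using that unfolding Ie_def by blast
qed

end

section \<open>Density of the domain\<close>

lemma reflected_power_l2sq: "l2sq (\<lambda>x. complex_of_real ((1 - x)^k)) = 1 / (2 * real k + 1)"
proof -
  have "((\<lambda>x::real. (1 - x)^(2*k)) has_integral (- ((1 - 1)^Suc (2*k)) / real (Suc (2*k)) - - ((1 - 0)^Suc (2*k)) / real (Suc (2*k)))) {0..1}"
  proof (rule fundamental_theorem_of_calculus)
    fix y :: real
    have "((\<lambda>x. (1 - x)^Suc (2*k)) has_real_derivative (real (Suc (2*k)) * (1 - y)^(2*k) * (-1))) (at y within {0..1})"
      by (rule derivative_eq_intros refl | simp)+
    from DERIV_cdivide[OF DERIV_minus[OF this], of "real (Suc (2*k))"]
    have "((\<lambda>x. - ((1 - x)^Suc (2*k)) / real (Suc (2*k))) has_real_derivative (real (Suc (2*k)) * (1 - y)^(2*k) / real (Suc (2*k)))) (at y within {0..1})"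
      by simp
    also have "real (Suc (2*k)) * (1 - y)^(2*k) / real (Suc (2*k)) = (1 - y)^(2*k)" by (simp del: of_nat_Suc)
    finally show "((\<lambda>x. - ((1 - x)^Suc (2*k)) / real (Suc (2*k))) has_vector_derivative (1 - y)^(2*k)) (at y within {0..1})"
      by (simp add: has_real_derivative_iff_has_vector_derivative)
  qed simp
  then have "integral {0..1} (\<lambda>x::real. (1 - x)^(2*k)) = 1 / (2 * real k + 1)" by (simp add: integral_unique add.commute)
  moreover have "(cmod (complex_of_real ((1 - x)^k)))^2 = (1 - x)^(2*k)" for x :: real
    unfolding norm_of_real power2_abs by (simp add: power_mult[symmetric] mult.commute)
  moreover have "sq_int (\<lambda>x. complex_of_real ((1 - x)^k))" by (intro sq_int_cont continuous_intros)
  ultimately show ?thesis by (simp only: l2sq_HK)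
qed

text \<open>The bump is a combination of \<open>s^n\<close> and \<open>s^(2n)\<close> with \<open>n\<close> large.\<close>

lemma endpoint_bump:
  fixes s :: "real \<Rightarrow> real" and p q :: complex
  assumes s: "\<And>x. (s has_real_derivative \<sigma>) (at x)" and \<sigma>: "\<sigma>^2 = 1" and ends: "s x1 = 1" "s x0 = 0"
    and l2: "\<And>k. l2sq (\<lambda>x. complex_of_real (s x ^ k)) = 1 / (2 * real k + 1)" and e: "\<epsilon> > 0"
  obtains u u1 u2 where "\<forall>x\<in>{0..1}. (u has_vector_derivative u1 x) (at x within {0..1})"
    "\<forall>x\<in>{0..1}. (u1 has_vector_derivative u2 x) (at x within {0..1})" "continuous_on {0..1} u2"
    "u x1 = p" "u1 x1 = q" "u x0 = 0" "u1 x0 = 0" "l2sq u < \<epsilon>"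
proof -
  \<comment> \<open>Bounds both coefficients \<open>c1\<close> and \<open>c2\<close>; the square
    integral of u is then at most 4 R^2 / n.\<close>
  define R where "R = 2 * cmod p + cmod q"
  obtain k :: nat where k: "real k > 4 * R^2 / \<epsilon>" using reals_Archimedean2 by blast
  define n where "n = k + 2"
  have n: "real n \<ge> 1" "n - 1 = Suc k" "n - 1 - 1 = k" "2 * n - 1 = Suc (2 * k + 2)" "2 * n - 1 - 1 = 2 * k + 2" by (auto simp: n_def)
  \<comment> \<open>The coefficients solve c1 + c2 = p and c1 + 2 c2 = \<sigma> q / n; as \<sigma>^2
    = 1, these prescribe the value and the slope at x1.\<close>
  define c2 where "c2 = complex_of_real (\<sigma> / real n) * q - p"
  define c1 where "c1 = p - c2"
  have cs: "continuous_on {0..1} s"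
    by (rule has_real_derivative_imp_continuous_on[where f' = "\<lambda>_. \<sigma>"]) (rule has_field_derivative_at_within[OF s])
  have pow: "((\<lambda>x. complex_of_real (s x ^ j)) has_vector_derivative complex_of_real (real j * \<sigma> * s x ^ (j - 1))) (at x within {0..1})" for j x
  proof -
    have "((\<lambda>x. s x ^ j) has_real_derivative (real j * \<sigma> * s x ^ (j - 1))) (at x within {0..1})"
      by (rule derivative_eq_intros has_field_derivative_at_within[OF s] refl | simp)+
    then show ?thesis
      unfolding has_real_derivative_iff_has_vector_derivative by (rule bounded_linear.has_vector_derivative[OF bounded_linear_of_real])
  qed
  define u where "u x = c1 * complex_of_real (s x ^ n) + c2 * complex_of_real (s x ^ (2 * n))" for x
  define u1 where "u1 x = c1 * complex_of_real (real n * \<sigma> * s x ^ (n - 1)) + c2 * complex_of_real (real (2 * n) * \<sigma> * s x ^ (2 * n - 1))" for x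
  define u2 where "u2 x = c1 * complex_of_real (real n * \<sigma>) * complex_of_real (real (n - 1) * \<sigma> * s x ^ (n - 1 - 1))
    + c2 * complex_of_real (real (2 * n) * \<sigma>) * complex_of_real (real (2 * n - 1) * \<sigma> * s x ^ (2 * n - 1 - 1))" for x
  have d1: "(u has_vector_derivative u1 x) (at x within {0..1})" for x
    unfolding u_def[abs_def] u1_def
    by (intro has_vector_derivative_add has_vector_derivative_mult_right pow)
  have "u1 = (\<lambda>x. c1 * complex_of_real (real n * \<sigma>) * complex_of_real (s x ^ (n - 1)) + c2 * complex_of_real (real (2 * n) * \<sigma>) * complex_of_real (s x ^ (2 * n - 1)))"
    by (simp add: u1_def fun_eq_iff mult.assoc)
  then have d2: "(u1 has_vector_derivative u2 x) (at x within {0..1})" for x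
    unfolding u2_def by (simp only:) (intro has_vector_derivative_add has_vector_derivative_mult_right pow)
  have cu: "continuous_on {0..1} u2" unfolding u2_def[abs_def] by (intro continuous_intros cs)
  have sq: "sq_int (\<lambda>x. complex_of_real (s x ^ j))" for j by (intro sq_int_cont continuous_intros cs)
  have ss: "\<sigma> * \<sigma> = 1" "\<bar>\<sigma>\<bar> = 1" using \<sigma> using abs_square_eq_1[of \<sigma>] by (auto simp: power2_eq_square)
  have v1: "u x1 = p" by (simp add: u_def ends c1_def)
  have "u1 x1 = complex_of_real (real n * \<sigma>) * (c1 + 2 * c2)" by (simp add: u1_def ends algebra_simps)
  also have "c1 + 2 * c2 = complex_of_real (\<sigma> / real n) * q" by (simp add: c1_def c2_def)
  also have "complex_of_real (real n * \<sigma>) * (complex_of_real (\<sigma> / real n) * q) = complex_of_real (real n * \<sigma> * (\<sigma> / real n)) * q"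
    by (simp only: of_real_mult mult.assoc)
  also have "real n * \<sigma> * (\<sigma> / real n) = 1" using n(1) ss by (simp add: field_simps)
  finally have v2: "u1 x1 = q" by simp
  have v3: "u x0 = 0" "u1 x0 = 0" by (auto simp: u_def u1_def ends n)  (auto simp: n_def)
  have b: "cmod (complex_of_real (\<sigma> / real n) * q) \<le> cmod q"
  proof -
    have "cmod (complex_of_real (\<sigma> / real n) * q) = (1 / real n) * cmod q" using ss by (simp add: norm_mult norm_divide)
    also have "\<dots> \<le> 1 * cmod q" using n(1) by (intro mult_right_mono) auto
    finally show ?thesis by simp
  qed
  have b2: "cmod c2 \<le> R" unfolding c2_def R_def using norm_triangle_ineq4[of "complex_of_real (\<sigma> / real n) * q" p] b by (smt (verit) norm_ge_zero)
  have "c1 = 2 * p - complex_of_real (\<sigma> / real n) * q" by (simp add: c1_def c2_def)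
  then have b1: "cmod c1 \<le> R" unfolding R_def using norm_triangle_ineq4[of "2 * p" "complex_of_real (\<sigma> / real n) * q"] b by (simp add: norm_mult)
  have "l2sq u \<le> 2 * ((cmod c1)^2 * (1 / (2 * real n + 1))) + 2 * ((cmod c2)^2 * (1 / (2 * real (2 * n) + 1)))"
    using l2sq_add_le2[OF sq_int_cmult[OF sq] sq_int_cmult[OF sq], of c1 n c2 "2 * n"] unfolding u_def[abs_def] l2sq_scale l2 .
  also have "(cmod c1)^2 * (1 / (2 * real n + 1)) \<le> R^2 * (1 / real n)"
    using b1 n(1) by (intro mult_mono power_mono) (auto simp: frac_le)
  also have "(cmod c2)^2 * (1 / (2 * real (2 * n) + 1)) \<le> R^2 * (1 / real n)"
    using b2 n(1) by (intro mult_mono power_mono) (auto simp: frac_le)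
  also have "2 * (R^2 * (1 / real n)) + 2 * (R^2 * (1 / real n)) = 4 * R^2 / real n" by simp
  also have "\<dots> < \<epsilon>"
  proof -
    have "real n > 4 * R^2 / \<epsilon>" using k by (simp add: n_def)
    then show ?thesis using e n(1) by (simp add: field_simps)
  qed
  finally have "l2sq u < \<epsilon>" by simp
  with d1 d2 cu v1 v2 v3 show ?thesis by (intro that[of u u1 u2]) auto
qed

context tower
begin

text \<open>The L2 norm does not see values and slopes at the endpoints, so a polynomial
  approximation can be corrected by a thin bump at each end. In this way the coupling \<xi> = g(1),
  \<eta> = g'(1) of the domain is met exactly.\<close>

lemma sq_int_C1_endpoint_dense:
  assumes g: "sq_int g" and e: "\<epsilon> > 0"
  obtains h h1 h2 where "H2chain h h1 h2" "h 0 = 0" "h1 0 = 0" "h 1 = \<xi>" "h1 1 = \<eta>" "l2sq (\<lambda>x. g x - h x) < \<epsilon>"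
proof -
  \<comment> \<open>The three errors add up to less than 2/16 + 2 (2/16 + 2/16) = 5/8 of
    \<epsilon>.\<close>
  have e16: "\<epsilon> / 16 > 0" using e by simp
  obtain q where q: "polynomial_function q" "l2sq (\<lambda>x. g x - q x) < \<epsilon> / 16" using poly_dense[OF g e16] by blast
  obtain q1 where q1: "polynomial_function q1" "\<And>x. (q has_vector_derivative q1 x) (at x)"
    using has_vector_derivative_polynomial_function[OF q(1)] by blast
  obtain q2 where q2: "polynomial_function q2" "\<And>x. (q1 has_vector_derivative q2 x) (at x)"
    using has_vector_derivative_polynomial_function[OF q1(1)] by blast
  obtain u u1 u2 where u: "\<forall>x\<in>{0..1}. (u has_vector_derivative u1 x) (at x within {0..1})"
    "\<forall>x\<in>{0..1}. (u1 has_vector_derivative u2 x) (at x within {0..1})" "continuous_on {0..1} u2"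
    "u 1 = \<xi> - q 1" "u1 1 = \<eta> - q1 1" "u 0 = 0" "u1 0 = 0" "l2sq u < \<epsilon> / 16"
    by (rule endpoint_bump[of "\<lambda>x. x" 1 1 0 "\<epsilon> / 16" "\<xi> - q 1" "\<eta> - q1 1"])
      (use e power_l2sq in \<open>auto intro!: derivative_eq_intros\<close>)
  obtain v v1 v2 where v: "\<forall>x\<in>{0..1}. (v has_vector_derivative v1 x) (at x within {0..1})"
    "\<forall>x\<in>{0..1}. (v1 has_vector_derivative v2 x) (at x within {0..1})" "continuous_on {0..1} v2"
    "v 0 = - q 0" "v1 0 = - q1 0" "v 1 = 0" "v1 1 = 0" "l2sq v < \<epsilon> / 16"
    by (rule endpoint_bump[of "\<lambda>x. 1 - x" "-1" 0 1 "\<epsilon> / 16" "- q 0" "- q1 0"])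
      (use e reflected_power_l2sq in \<open>auto intro!: derivative_eq_intros\<close>)
  define h where "h x = q x + (u x + v x)" for x
  have H: "H2chain h (\<lambda>x. q1 x + (u1 x + v1 x)) (\<lambda>x. q2 x + (u2 x + v2 x))"
    unfolding h_def[abs_def]
  proof (rule H2chainI)
    show "((\<lambda>x. q x + (u x + v x)) has_vector_derivative (q1 x + (u1 x + v1 x))) (at x within {0..1})" if "x \<in> {0..1}" for x
      using u(1) v(1) that by (intro has_vector_derivative_add has_vector_derivative_at_within[OF q1(2)]) auto
    show "((\<lambda>x. q1 x + (u1 x + v1 x)) has_vector_derivative (q2 x + (u2 x + v2 x))) (at x within {0..1})" if "x \<in> {0..1}" for x
      using u(2) v(2) that by (intro has_vector_derivative_add has_vector_derivative_at_within[OF q2(2)]) auto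
    show "continuous_on {0..1} (\<lambda>x. q2 x + (u2 x + v2 x))"
      by (intro continuous_intros u v continuous_poly_function q2)
  qed
  have su: "sq_int u" "sq_int v" using u(1) v(1) has_vector_derivative_continuous_on01 sq_int_cont by blast+
  have "l2sq (\<lambda>x. - (u x + v x)) \<le> 2 * l2sq u + 2 * l2sq v"
    unfolding l2sq_uminus by (rule l2sq_add_le2[OF su])
  moreover have "l2sq (\<lambda>x. (g x - q x) + - (u x + v x)) \<le> 2 * l2sq (\<lambda>x. g x - q x) + 2 * l2sq (\<lambda>x. - (u x + v x))"
    by (intro l2sq_add_le2 sq_int_diff sq_int_uminus sq_int_add g su sq_int_poly q)
  moreover have "(\<lambda>x. (g x - q x) + - (u x + v x)) = (\<lambda>x. g x - h x)" by (simp add: h_def fun_eq_iff)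
  ultimately have "l2sq (\<lambda>x. g x - h x) < \<epsilon>" using q(2) u(8) v(8) e by (simp only:)
  then show ?thesis using u v by (intro that[OF H]) (auto simp: h_def)
qed

text \<open>A polynomial approximates the second derivative and is integrated twice from 0; its
  product with EI is twice continuously differentiable because EI is.\<close>

lemma H4_dense:
  assumes f: "H2l f" and e: "\<epsilon> > 0"
  obtains f' f1 f2 f3 f4 h1 h2 where "H4chain f' f1 f2 f3 f4" "f' 0 = 0" "f1 0 = 0"
    "H2chain (\<lambda>x. complex_of_real (EI x) * f2 x) h1 h2" "continuous_on {0..1} h2" "l2sq (\<lambda>x. D2 f x - f2 x) < \<epsilon>"
proof -
  obtain p where p: "polynomial_function p" "l2sq (\<lambda>x. D2 f x - p x) < \<epsilon>" using poly_dense[OF H2l_sq[OF f] e] by blast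
  obtain p1 where p1: "polynomial_function p1" "\<And>x. (p has_vector_derivative p1 x) (at x)"
    using has_vector_derivative_polynomial_function[OF p(1)] by blast
  obtain p2 where p2: "polynomial_function p2" "\<And>x. (p1 has_vector_derivative p2 x) (at x)"
    using has_vector_derivative_polynomial_function[OF p1(1)] by blast
  note cp = continuous_poly_function[OF p(1)] continuous_poly_function[OF p1(1)] continuous_poly_function[OF p2(1)]
  note dp = has_vector_derivative_at_within[OF p1(2)] has_vector_derivative_at_within[OF p2(2)]
  have "H2chain p p1 p2" by (rule H2chainI) (rule dp cp)+
  then have P: "sq_int p2" "\<And>x. x \<in> {0..1} \<Longrightarrow> p1 x = p1 0 + integral {0..x} p2" "\<And>x. x \<in> {0..1} \<Longrightarrow> p x = p 0 + integral {0..x} p1"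
    unfolding H2chain_def by blast+
  have H4: "H4chain (\<lambda>x. integral {0..x} (\<lambda>y. integral {0..y} p)) (\<lambda>y. integral {0..y} p) p p1 p2"
    unfolding H4chain_def by (intro conjI ballI P) simp_all
  obtain E1 E2 where E: "\<And>x. x \<in> {0..1} \<Longrightarrow> (EI has_real_derivative E1 x) (at x within {0..1})"
    "\<And>x. x \<in> {0..1} \<Longrightarrow> (E1 has_real_derivative E2 x) (at x within {0..1})" "continuous_on {0..1} E1" "continuous_on {0..1} E2"
    using Ck_on_4_derivs[OF EI_C4] by blast
  have dE: "((\<lambda>x. complex_of_real (EI x)) has_vector_derivative complex_of_real (E1 x)) (at x within {0..1})"
    "((\<lambda>x. complex_of_real (E1 x)) has_vector_derivative complex_of_real (E2 x)) (at x within {0..1})" if "x \<in> {0..1}" for x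
    using E(1,2)[OF that] unfolding has_real_derivative_iff_has_vector_derivative by (auto intro: bounded_linear.has_vector_derivative[OF bounded_linear_of_real])
  let ?h2 = "\<lambda>x. (complex_of_real (EI x) * p2 x + complex_of_real (E1 x) * p1 x) + (complex_of_real (E1 x) * p1 x + complex_of_real (E2 x) * p x)"
  have c2: "continuous_on {0..1} ?h2" by (intro continuous_intros E cp)
  have H2: "H2chain (\<lambda>x. complex_of_real (EI x) * p x) (\<lambda>x. complex_of_real (EI x) * p1 x + complex_of_real (E1 x) * p x) ?h2"
  proof (rule H2chainI[OF _ _ c2])
    show "((\<lambda>x. complex_of_real (EI x) * p x) has_vector_derivative (complex_of_real (EI x) * p1 x + complex_of_real (E1 x) * p x)) (at x within {0..1})"
      if "x \<in> {0..1}" for x by (rule has_vector_derivative_mult[OF dE(1)[OF that] dp(1)])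
    show "((\<lambda>x. complex_of_real (EI x) * p1 x + complex_of_real (E1 x) * p x) has_vector_derivative ?h2 x) (at x within {0..1})"
      if "x \<in> {0..1}" for x
      by (rule has_vector_derivative_add[OF has_vector_derivative_mult[OF dE(1)[OF that] dp(2)] has_vector_derivative_mult[OF dE(2)[OF that] dp(1)]])
  qed
  show ?thesis by (rule that[OF H4 _ _ H2 c2 p(2)]) auto
qed

lemma DA_dense:
  assumes z: "z \<in> Xspace" and e: "\<epsilon> > 0"
  obtains z' w where "Arel \<rho> EI m J b z' w" "N (z - z') < \<epsilon>"
proof -
  obtain f g \<xi> \<eta> where zeq: "z = (f, g, \<xi>, \<eta>)" by (cases z) auto
  have f: "H2l f" and g: "sq_int g" using z by (auto simp: Xspace_iff zeq)
  obtain K where K: "K > 0" "\<And>z. z \<in> Xspace \<Longrightarrow> N2 z \<le> K * (l2sq (D2 (fst z)) + l2sq (sg z) + (cmod (s\<xi> z))^2 + (cmod (s\<eta> z))^2)"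
    using N2_upper by blast
  \<comment> \<open>The components \<xi> and \<eta> are kept, so only the two L2 errors have to be
    paid for.\<close>
  define d where "d = \<epsilon>^2 / (2 * K)"
  have d: "d > 0" using e K by (simp add: d_def)
  obtain f' f1 f2 f3 f4 h1 h2 where F: "H4chain f' f1 f2 f3 f4" "f' 0 = 0" "f1 0 = 0"
    "H2chain (\<lambda>x. complex_of_real (EI x) * f2 x) h1 h2" "continuous_on {0..1} h2" "l2sq (\<lambda>x. D2 f x - f2 x) < d"
    using H4_dense[OF f d] by blast
  obtain g' g1 g2 where G: "H2chain g' g1 g2" "g' 0 = 0" "g1 0 = 0" "g' 1 = \<xi>" "g1 1 = \<eta>" "l2sq (\<lambda>x. g x - g' x) < d"
    using sq_int_C1_endpoint_dense[OF g d] by blast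
  define z' where "z' = (f', g', \<xi>, \<eta>)"
  define w where "w = (g', (\<lambda>x. - h2 x / complex_of_real (\<rho> x)), h1 1 / complex_of_real m,
    (- (complex_of_real (EI 1) * f2 1) - complex_of_real b * \<eta>) / complex_of_real J)"
  have A: "Arel \<rho> EI m J b z' w"
    unfolding Arel_def z'_def w_def prod.case
    by (rule exI[of _ f1], rule exI[of _ f2], rule exI[of _ f3], rule exI[of _ f4], rule exI[of _ g1],
      rule exI[of _ g2], rule exI[of _ h1], rule exI[of _ h2], intro conjI ballI F G refl) (rule G(4,5)[symmetric])+
  have X: "z - z' \<in> Xspace" using X_diff[OF z Arel_X(1)[OF A]] .
  have zd: "z - z' = ((\<lambda>x. f x + (-1) * f' x), (\<lambda>x. g x - g' x), 0, 0)" by (simp add: zeq z'_def fun_eq_iff zero_prod_def)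
  have Hd: "H2chain (\<lambda>x. f x + (-1) * f' x) (\<lambda>x. D1 f x + (-1) * f1 x) (\<lambda>x. D2 f x + (-1) * f2 x)"
    by (intro H2chain_add H2chain_scale H2l_D(1)[OF f] H4chain_props(1)[OF F(1)])
  have "l2sq (D2 (\<lambda>x. f x + (-1) * f' x)) = l2sq (\<lambda>x. D2 f x + (-1) * f2 x)"
    by (rule l2sq_cong_AE[OF D2_AE(2)[OF Hd] D2_AE(1)[OF Hd] H2chain_props(1)[OF Hd]])
  then have "l2sq (D2 (fst (z - z'))) < d" using F(6) by (simp add: zd)
  moreover have "l2sq (sg (z - z')) < d" using G(6) by (simp add: zd)
  moreover have "s\<xi> (z - z') = 0" "s\<eta> (z - z') = 0" by (auto simp: zd)
  ultimately have "l2sq (D2 (fst (z - z'))) + l2sq (sg (z - z')) + (cmod (s\<xi> (z - z')))^2 + (cmod (s\<eta> (z - z')))^2 < 2 * d" by simp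
  then have "N2 (z - z') < K * (2 * d)" using K(2)[OF X] mult_strict_left_mono[OF _ K(1)] by (meson le_less_trans)
  also have "K * (2 * d) = \<epsilon>^2" using K(1) by (simp add: d_def)
  finally have "N (z - z') < \<epsilon>" unfolding N_def using e by (metis less_imp_le real_sqrt_abs real_sqrt_less_mono abs_of_pos)
  with A show ?thesis using that by blast
qed

end

section \<open>Decay of the energy\<close>

text \<open>By monotonicity (t/2) e(t) is at most the integral of e over [t/2, t], and such windows
  carry arbitrarily little of a convergent integral.\<close>

lemma antimono_integrable_decay:
  fixes e :: "real \<Rightarrow> real"
  assumes c: "continuous_on {0..} e" and nonneg: "\<And>t. t \<ge> 0 \<Longrightarrow> e t \<ge> 0"
    and anti: "\<And>s t. 0 \<le> s \<Longrightarrow> s \<le> t \<Longrightarrow> e t \<le> e s"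
    and bdd: "\<And>T. T \<ge> 0 \<Longrightarrow> integral {0..T} e \<le> C"
  shows "((\<lambda>t. t * e t) \<longlongrightarrow> 0) at_top"
proof (rule tendstoI)
  fix \<epsilon> :: real assume e: "\<epsilon> > 0"
  define I where "I t = integral {0..t} e" for t
  have bd: "bdd_above (I ` {0..})" unfolding I_def using bdd by (auto intro!: bdd_aboveI[of _ C])
  obtain S where S: "S \<ge> 0" "I S > (SUP t\<in>{0..}. I t) - \<epsilon> / 2"
  proof -
    have "(SUP t\<in>{0..}. I t) - \<epsilon> / 2 < (SUP t\<in>{0..}. I t)" using e by simp
    then show ?thesis using that less_cSUP_iff[OF _ bd] by auto
  qed
  have "\<bar>t * e t\<bar> < \<epsilon>" if t: "t \<ge> 2 * S" for t
  proof -
    have t0: "t \<ge> 0" "S \<le> t / 2" using S t by auto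
    have "integral {t/2..t} (\<lambda>_. e t) \<le> integral {t/2..t} e"
      by (rule integral_le) (use t0 anti half_integrable[OF c] in auto)
    then have "t / 2 * e t \<le> I t - I (t / 2)"
      using integral_split_half[OF c, of 0 "t/2" t] t0 by (simp add: I_def)
    moreover have "I S \<le> I (t / 2)" unfolding I_def by (rule integral_mono_upper[OF c nonneg S(1) t0(2)])
    moreover have "I t \<le> (SUP t\<in>{0..}. I t)" by (rule cSUP_upper[OF _ bd]) (use t0 in simp)
    ultimately have "t * e t < \<epsilon>" using S(2) by linarith
    then show ?thesis using nonneg t0 by simp
  qed
  then show "\<forall>\<^sub>F t in at_top. dist (t * e t) 0 < \<epsilon>"
    unfolding eventually_at_top_linorder by (intro exI[of _ "2 * S"]) (simp add: dist_real_def)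
qed

section \<open>Contractivity, the observation bound and the decay of all orbits\<close>

context tower_semigroup
begin

lemma solution_exists:
  assumes A: "Arel \<rho> EI m J b z w"
  obtains Z W where "tower_solution \<rho> EI m J b Z W"
    "\<forall>t\<ge>0. N2 (Z t) = N2 (T t z) \<and> s\<eta> (Z t) = s\<eta> (T t z) \<and> s\<eta> (W t) = s\<eta> (T t w)"
proof -
  obtain Z W where tr: "traj Z W" and Z: "\<And>t. t \<ge> 0 \<Longrightarrow> N (T t z - Z t) = 0" and W: "\<And>t. t \<ge> 0 \<Longrightarrow> N (T t w - W t) = 0"
    using trajectory_exists[OF A] by blast
  interpret S: tower_solution \<rho> EI m J b Z W by unfold_locales (rule tr)
  have TX: "T t z \<in> Xspace" "T t w \<in> Xspace" if "t \<ge> 0" for t using T_X[OF that] Arel_X[OF A] by auto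
  show ?thesis
  proof (rule that[OF S.tower_solution_axioms], intro allI impI conjI)
    fix t :: real assume t: "t \<ge> 0"
    show "N2 (Z t) = N2 (T t z)"
      using N_eqv(1)[OF TX(1)[OF t] S.trD(1)[OF t] Z[OF t]] N_sq[OF TX(1)[OF t]] N_sq[OF S.trD(1)[OF t]] by simp
    show "s\<eta> (Z t) = s\<eta> (T t z)" using linf_eqv[OF linf_basic(2) TX(1)[OF t] S.trD(1)[OF t] Z[OF t]] by simp
    show "s\<eta> (W t) = s\<eta> (T t w)" using linf_eqv[OF linf_basic(2) TX(2)[OF t] S.trD(2)[OF t] W[OF t]] by simp
  qed
qed

lemma DA_energy:
  assumes A: "Arel \<rho> EI m J b z w"
  shows "0 \<le> s \<Longrightarrow> s \<le> t \<Longrightarrow> N2 (T t z) \<le> N2 (T s z)"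
    "0 \<le> t \<Longrightarrow> N2 (T t z) \<le> N2 z"
    "0 \<le> t \<Longrightarrow> 2 * b * integral {0..t} (\<lambda>t. (cmod (s\<eta> (T t z)))^2) \<le> N2 z"
proof -
  obtain Z W where S0: "tower_solution \<rho> EI m J b Z W"
    "\<forall>t\<ge>0. N2 (Z t) = N2 (T t z) \<and> s\<eta> (Z t) = s\<eta> (T t z) \<and> s\<eta> (W t) = s\<eta> (T t w)"
    by (rule solution_exists[OF A])
  then have S: "N2 (Z t) = N2 (T t z)" "s\<eta> (Z t) = s\<eta> (T t z)" if "t \<ge> 0" for t using that by auto
  interpret S: tower_solution \<rho> EI m J b Z W by (rule S0(1))
  have zX: "z \<in> Xspace" by (rule Arel_X[OF A])
  have TX: "T t z \<in> Xspace" if "t \<ge> 0" for t using T_X[OF that zX] .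
  have 0: "N2 (T 0 z) = N2 z" using N_eqv(1)[OF TX zX T_0[OF zX]] N_sq[OF TX[of 0]] N_sq[OF zX] by simp
  show 1: "N2 (T t z) \<le> N2 (T s z)" if "0 \<le> s" "s \<le> t" for s t
    using S.e_antimono[OF that] S(1) that by (simp add: S.e_def)
  show "N2 (T t z) \<le> N2 z" if "0 \<le> t" using 1[OF order_refl that] 0 by simp
  show "2 * b * integral {0..t} (\<lambda>t. (cmod (s\<eta> (T t z)))^2) \<le> N2 z" if t: "0 \<le> t"
  proof -
    have "integral {0..t} (\<lambda>t. (cmod (s\<eta> (T t z)))^2) = integral {0..t} (\<lambda>t. (cmod (s\<eta> (Z t)))^2)"
      using S(2) by (intro integral_cong) simp
    moreover have "N2 (T t z) \<ge> 0" using N2_nonneg TX t by blast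
    ultimately show ?thesis using S.eta_integral[OF t] S(1) t 0 by (simp add: S.e_def)
  qed
qed

text \<open>Dissipation gives the inequality on the dense domain; the bound on T t, for this fixed
  t, carries it over to X.\<close>

lemma contraction:
  assumes t: "t \<ge> 0" and z: "z \<in> Xspace"
  shows "N (T t z) \<le> N z"
proof (rule field_le_epsilon)
  fix \<epsilon> :: real assume e: "\<epsilon> > 0"
  obtain C where C: "C > 0" "\<And>z. z \<in> Xspace \<Longrightarrow> N (T t z) \<le> C * N z" using T_bdd[OF t] by blast
  have "\<epsilon> / (C + 1) > 0" using e C by simp
  from DA_dense[OF z this] obtain z' w where A: "Arel \<rho> EI m J b z' w" and d: "N (z - z') < \<epsilon> / (C + 1)" by blast
  have z': "z' \<in> Xspace" by (rule Arel_X[OF A])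
  have "N (T t z) \<le> N (T t z') + N (T t z - T t z')" using N_diff_ge[OF T_X[OF t z] T_X[OF t z']] by linarith
  also have "N (T t z - T t z') = N (T t (z - z'))" by (rule N_T_diff[OF t z z'])
  also have "\<dots> \<le> C * N (z - z')" by (rule C(2)[OF X_diff[OF z z']])
  also have "N (T t z') \<le> N z'" unfolding N_def using DA_energy(2)[OF A t] by simp
  also have "N z' \<le> N z + N (z - z')" using N_diff_ge[OF z z'] by linarith
  finally have "N (T t z) \<le> N z + (C + 1) * N (z - z')" by (simp add: algebra_simps)
  also have "(C + 1) * N (z - z') \<le> \<epsilon>" using d C(1) by (simp add: field_simps)
  finally show "N (T t z) \<le> N z + \<epsilon>" by simp
qed

text \<open>The error made on \<open>{0..S}\<close> by replacing the initial state grows with \<open>S\<close>; hence the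
  approximation is chosen depending on \<open>S\<close>, while the final bound does not.\<close>

lemma observation_bounded:
  assumes z: "z \<in> Xspace"
  shows "\<exists>C. \<forall>S\<ge>0. integral {0..S} (\<lambda>t. (cmod (s\<eta> (T t z)))^2) \<le> C"
proof -
  obtain C where C: "C > 0" "\<And>z. z \<in> Xspace \<Longrightarrow> cmod (s\<eta> z) \<le> C * N z" using comp_bounds by metis
  have c: "continuous_on {0..} (\<lambda>t. s\<eta> (T t z))" if "z \<in> Xspace" for z
    by (rule linf_contX[OF linf_basic(2) T_contX[OF that]])
  have "integral {0..S} (\<lambda>t. (cmod (s\<eta> (T t z)))^2) \<le> (N z + 1)^2 / b + 2 * C^2" if S: "S \<ge> 0" for S
  proof -
    \<comment> \<open>The approximation error contributes at most 2 S (C d)^2 on [0, S], which this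
      d keeps below 2 C^2.\<close>
    define d where "d = 1 / (1 + S)"
    have d: "d > 0" "d \<le> 1" "S * d \<le> 1" using S by (auto simp: d_def field_simps)
    obtain z' w where A: "Arel \<rho> EI m J b z' w" and zd: "N (z - z') < d" using DA_dense[OF z d(1)] by blast
    have z': "z' \<in> Xspace" by (rule Arel_X[OF A])
    have N0: "N (z - z') \<ge> 0" using X_diff[OF z z'] by simp
    have pt: "(cmod (s\<eta> (T t z)))^2 \<le> 2 * (cmod (s\<eta> (T t z')))^2 + 2 * (C * d)^2" if t: "t \<ge> 0" for t
    proof -
      have X: "T t z - T t z' \<in> Xspace" by (rule X_diff[OF T_X[OF t z] T_X[OF t z']])
      have "cmod (s\<eta> (T t z - T t z')) \<le> C * N (T t z - T t z')" by (rule C(2)[OF X])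
      also have "N (T t z - T t z') = N (T t (z - z'))" by (rule N_T_diff[OF t z z'])
      also have "\<dots> \<le> N (z - z')" by (rule contraction[OF t X_diff[OF z z']])
      finally have 1: "cmod (s\<eta> (T t z - T t z')) \<le> C * d" using zd C(1) by (smt (verit) mult_left_mono)
      have "(cmod (s\<eta> (T t z') + s\<eta> (T t z - T t z')))^2 \<le> (1 + 1) * (cmod (s\<eta> (T t z')))^2 + (1 + 1/1) * (cmod (s\<eta> (T t z - T t z')))^2"
        by (rule sq_add_weighted) simp
      moreover have "(cmod (s\<eta> (T t z - T t z')))^2 \<le> (C * d)^2" using 1 by (intro power_mono) auto
      moreover have "s\<eta> (T t z') + s\<eta> (T t z - T t z') = s\<eta> (T t z)" by simp
      ultimately show ?thesis by simp
    qed
    have "integral {0..S} (\<lambda>t. (cmod (s\<eta> (T t z)))^2) \<le> integral {0..S} (\<lambda>t. 2 * (cmod (s\<eta> (T t z')))^2 + 2 * (C * d)^2)"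
      by (rule integral_mono_half[OF _ _ order_refl pt]) (intro continuous_intros c z z')+
    also have "\<dots> = 2 * integral {0..S} (\<lambda>t. (cmod (s\<eta> (T t z')))^2) + 2 * (C * d)^2 * S"
      using S by (subst integral_add) (auto intro!: half_integrable continuous_intros c z')
    also have "integral {0..S} (\<lambda>t. (cmod (s\<eta> (T t z')))^2) \<le> N2 z' / (2 * b)"
      using DA_energy(3)[OF A S] b_pos by (simp add: field_simps)
    also have "2 * (C * d)^2 * S \<le> 2 * C^2"
    proof -
      have "d * (S * d) \<le> 1 * 1" using d S by (intro mult_mono) auto
      then have "C^2 * (d * (S * d)) \<le> C^2 * 1" by (intro mult_left_mono) auto
      then show ?thesis by (simp add: power2_eq_square algebra_simps)
    qed
    also have "2 * (N2 z' / (2 * b)) \<le> (N z + 1)^2 / b"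
    proof -
      have "N z' \<le> N z + 1" using N_diff_ge[OF z z'] zd d(2) by linarith
      then have "(N z')^2 \<le> (N z + 1)^2" using N_nonneg[OF z'] by (intro power_mono) auto
      then show ?thesis using b_pos N_sq[OF z'] by (simp add: divide_right_mono)
    qed
    finally show ?thesis by simp
  qed
  then show ?thesis by blast
qed

text \<open>The moment at the tip involves the last component of T t w with w = A z. This w need not
  lie in D(A), so the square integrability is taken from the bound valid on all of X.\<close>

lemma classical_decay:
  assumes A: "Arel \<rho> EI m J b z w"
  shows "((\<lambda>t. t * N2 (T t z)) \<longlongrightarrow> 0) at_top"
proof -
  obtain Z W where S0: "tower_solution \<rho> EI m J b Z W"
    "\<forall>t\<ge>0. N2 (Z t) = N2 (T t z) \<and> s\<eta> (Z t) = s\<eta> (T t z) \<and> s\<eta> (W t) = s\<eta> (T t w)"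
    by (rule solution_exists[OF A])
  then have S: "N2 (Z t) = N2 (T t z)" "s\<eta> (W t) = s\<eta> (T t w)" if "t \<ge> 0" for t using that by auto
  interpret S: tower_solution \<rho> EI m J b Z W by (rule S0(1))
  obtain C where C: "\<And>s. s \<ge> 0 \<Longrightarrow> integral {0..s} (\<lambda>t. (cmod (s\<eta> (T t w)))^2) \<le> C"
    using observation_bounded[OF Arel_X(2)[OF A]] by blast
  have "integral {0..s} (\<lambda>t. (cmod (s\<eta> (W t)))^2) = integral {0..s} (\<lambda>t. (cmod (s\<eta> (T t w)))^2)" for s
    using S(2) by (intro integral_cong) simp
  then interpret D: tower_traj \<rho> EI m J b Z W by unfold_locales (use C in auto)
  obtain K where K: "\<And>t. t \<ge> 0 \<Longrightarrow> integral {0..t} S.e \<le> K" using D.energy_integral_bounded by blast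
  have ec: "continuous_on {0..} S.e" by (rule derivative_imp_continuous_half[OF S.e_deriv])
  have en: "S.e t \<ge> 0" if "t \<ge> 0" for t using N2_nonneg[OF S.trD(1)[OF that]] by (simp add: S.e_def)
  have "((\<lambda>t. t * S.e t) \<longlongrightarrow> 0) at_top"
    by (rule antimono_integrable_decay[OF ec en S.e_antimono K])
  moreover have "\<forall>\<^sub>F t in at_top. t * S.e t = t * N2 (T t z)"
    using eventually_ge_at_top[of 0] by eventually_elim (simp add: S.e_def S(1))
  ultimately show ?thesis by (simp add: tendsto_cong)
qed

lemma classical_energy_smallo:
  assumes A: "Arel \<rho> EI m J b z w"
  shows "energy \<rho> EI m J T z \<in> o[at_top](\<lambda>t. 1 / t)"
proof (rule smalloI_tendsto)
  have "((\<lambda>t. t * N2 (T t z) / 2) \<longlongrightarrow> 0 / 2) at_top" by (intro tendsto_intros classical_decay[OF A]) simp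
  then show "((\<lambda>t. energy \<rho> EI m J T z t / (1 / t)) \<longlongrightarrow> 0) at_top" by (simp add: energy_def mult.commute)
  show "\<forall>\<^sub>F t in at_top. 1 / t \<noteq> (0::real)" using eventually_gt_at_top[of 0] by eventually_elim simp
qed

lemma energy_tendsto_0:
  assumes z: "z \<in> Xspace"
  shows "(energy \<rho> EI m J T z \<longlongrightarrow> 0) at_top"
proof -
  have "((\<lambda>t. N (T t z)) \<longlongrightarrow> 0) at_top"
  proof (rule tendstoI)
    fix \<epsilon> :: real assume e: "\<epsilon> > 0"
    then have "\<epsilon> / 2 > 0" by simp
    from DA_dense[OF z this] obtain z' w where A: "Arel \<rho> EI m J b z' w" and d: "N (z - z') < \<epsilon> / 2" by blast
    have z': "z' \<in> Xspace" by (rule Arel_X[OF A])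
    have "(\<epsilon> / 2)^2 > 0" using e by simp
    from order_tendstoD(2)[OF classical_decay[OF A] this]
    show "\<forall>\<^sub>F t in at_top. dist (N (T t z)) 0 < \<epsilon>"
      using eventually_ge_at_top[of 1]
    proof eventually_elim
      case (elim t)
      then have t: "t \<ge> 0" by simp
      \<comment> \<open>For t at least 1 the decay of t N2 also bounds N2 itself.\<close>
      have "1 * N2 (T t z') \<le> t * N2 (T t z')" using elim N2_nonneg[OF T_X[OF t z']] by (intro mult_right_mono)
      then have "N (T t z') < \<epsilon> / 2" unfolding N_def
        using elim(1) e real_sqrt_less_mono[of "N2 (T t z')" "(\<epsilon> / 2)^2"] by simp
      moreover have "N (T t z - T t z') \<le> N (z - z')"
        using N_T_diff[OF t z z'] contraction[OF t X_diff[OF z z']] by simp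
      moreover have "N (T t z) \<le> N (T t z') + N (T t z - T t z')" using N_diff_ge[OF T_X[OF t z] T_X[OF t z']] by linarith
      moreover have "N (T t z) \<ge> 0" by (simp add: T_X t z)
      ultimately show ?case using d by (simp add: dist_real_def)
    qed
  qed
  then have "((\<lambda>t. (N (T t z))^2 / 2) \<longlongrightarrow> 0^2 / 2) at_top" by (intro tendsto_intros) auto
  moreover have "\<forall>\<^sub>F t in at_top. (N (T t z))^2 / 2 = energy \<rho> EI m J T z t"
    using eventually_ge_at_top[of 0] by eventually_elim (simp add: energy_def N_sq T_X z)
  ultimately show ?thesis by (simp add: tendsto_cong)
qed

end

theorem theorem3p3:
  fixes \<rho> EI :: "real \<Rightarrow> real" and m J b :: real
    and T :: "real \<Rightarrow> state \<Rightarrow> state"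
  assumes "Ck_on 4 {0..1} \<rho>" and "Ck_on 4 {0..1} EI"
    and "\<forall>x\<in>{0..1}. \<rho> x > 0" and "\<forall>x\<in>{0..1}. EI x > 0"
    and "m > 0" and "J > 0" and "b > 0"
    and "generated_by_A \<rho> EI m J b T"
  shows "(\<forall>z0\<in>Xspace. (energy \<rho> EI m J T z0 \<longlongrightarrow> 0) at_top) \<and>
         (\<forall>z0\<in>DA \<rho> EI m J b. energy \<rho> EI m J T z0 \<in> o[at_top](\<lambda>t. 1 / t))"
proof -
  interpret tower_semigroup \<rho> EI m J b T by unfold_locales (use assms in auto)
  show ?thesis using energy_tendsto_0 classical_energy_smallo by (auto simp: DA_def)
qed

end
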